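(* Let $G_n(z):=G_{n,2}(z)$ be the Taylor coefficients at $s=0$ of the doubly-completed weight-$2$ Eisenstein series, $\widehat{\widehat E}_2(z,s)=\sum_{n\ge0}G_n(z)s^n$. Then $G_0\equiv 0$, and for every integer $m\ge 0$ one has $V_2^{m}(0)=V_2^{m+1/2}(0)$, the space $V_2^m(0)$ is $m$-dimensional, and (for $m\ge1$) $\{G_1(z),\dots,G_m(z)\}$ is a basis of $V_2^m(0)$.
   Context: Write $z=x+iy\in\mathbb H$ (upper half-plane). For $k\in 2\mathbb Z$ the weight-$k$ hyperbolic Laplacian is $\Delta_k=y^2(\partial_x^2+\partial_y^2)-iky(\partial_x+i\partial_y)$. A weight-$k$ modular form here means a smooth $f:\mathbb H\to\mathbb C$ with $f(\frac{az+b}{cz+d})=(cz+d)^kf(z)$ for all $\begin{pmatrix}a&b\\c&d\end{pmatrix}\in SL_2(\mathbb Z)$; it has moderate growth if there is $\alpha\in\mathbb R$ with $f(x+iy)=O(y^\alpha)$ as $y\to\infty$ uniformly in $x$. For an integer $m\ge0$, $V_k^m(0)$ is the complex vector space of weight-$k$ modular forms of moderate growth with $\Delta_k^m f=0$ (so $V_k^0(0)=\{0\}$), and $V_k^{m+1/2}(0)$ is the space of weight-$k$ modular forms of moderate growth such that $\Delta_k^m f$ is a holomorphic function on $\mathbb H$ (so $V_k^{1/2}(0)=M_k$, the space of holomorphic weight-$k$ modular forms of moderate growth). Eisenstein series: for $k\in2\mathbb Z$, $E_k(z,s)=\frac12\sum_{(m,n)\in\mathbb Z^2\setminus\{(0,0)\}}\frac{y^s}{(mz+n)^k|mz+n|^{2s}}$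 for $\mathrm{Re}(2s+k)>2$, meromorphically continued in $s$; $\widehat E_k(z,s)=\pi^{-(s+k/2)}\Gamma(s+\frac k2+\frac{|k|}2)E_k(z,s)$; and $\widehat{\widehat E}_k(z,s)=(s+\frac k2)(s+\frac k2-1)\widehat E_k(z,s)$, which is entire in $s$. Its Taylor coefficients at $s=0$ are denoted $F_{n,k}(z)$ for $k\le0$ and $G_{n,k}(z)$ for $k\ge2$: $\widehat{\widehat E}_k(z,s)=\sum_{n\ge0}F_{n,k}(z)s^n$ ($k\le 0$), $=\sum_{n\ge0}G_{n,k}(z)s^n$ ($k\ge2$). *)

theory Defs
  imports "HOL-Analysis.Analysis" "HOL-Library.Function_Algebras"
begin

definition UHP :: "complex set" where
  "UHP = {z. Im z > 0}"

definition pdx :: "(complex \<Rightarrow> complex) \<Rightarrow> complex \<Rightarrow> complex" where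
  "pdx f z = vector_derivative (\<lambda>t::real. f (z + of_real t)) (at 0)"

definition pdy :: "(complex \<Rightarrow> complex) \<Rightarrow> complex \<Rightarrow> complex" where
  "pdy f z = vector_derivative (\<lambda>t::real. f (z + \<i> * of_real t)) (at 0)"

fun iter_pd :: "bool list \<Rightarrow> (complex \<Rightarrow> complex) \<Rightarrow> complex \<Rightarrow> complex" where
  "iter_pd [] f = f"
| "iter_pd (b # bs) f = (if b then pdx else pdy) (iter_pd bs f)"

definition smooth_UHP :: "(complex \<Rightarrow> complex) \<Rightarrow> bool" where
  "smooth_UHP f \<longleftrightarrow> (\<forall>bs. iter_pd bs f differentiable_on UHP)"

definition hyp_lap :: "int \<Rightarrow> (complex \<Rightarrow> complex) \<Rightarrow> complex \<Rightarrow> complex" where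
  "hyp_lap k f z =
     (of_real (Im z))^2 * (pdx (pdx f) z + pdy (pdy f) z)
     - \<i> * of_int k * of_real (Im z) * (pdx f z + \<i> * pdy f z)"

definition modular_weight :: "int \<Rightarrow> (complex \<Rightarrow> complex) \<Rightarrow> bool" where
  "modular_weight k f \<longleftrightarrow>
     (\<forall>a b c d :: int. a * d - b * c = 1 \<longrightarrow>
        (\<forall>z\<in>UHP. f ((of_int a * z + of_int b) / (of_int c * z + of_int d))
                  = (of_int c * z + of_int d) powi k * f z))"

definition moderate_growth :: "(complex \<Rightarrow> complex) \<Rightarrow> bool" where
  "moderate_growth f \<longleftrightarrow>
     (\<exists>\<alpha> C Y :: real. \<forall>x y. y \<ge> Y \<and> y > 0 \<longrightarrow> cmod (f (Complex x y)) \<le> C * y powr \<alpha>)"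

text \<open>Functions are taken to vanish off the upper half-plane (they are only defined on it).\<close>
definition base_forms :: "int \<Rightarrow> (complex \<Rightarrow> complex) set" where
  "base_forms k = {f. (\<forall>z. z \<notin> UHP \<longrightarrow> f z = 0) \<and> smooth_UHP f \<and>
                      modular_weight k f \<and> moderate_growth f}"

definition V_int :: "int \<Rightarrow> nat \<Rightarrow> (complex \<Rightarrow> complex) set" where
  "V_int k m = {f \<in> base_forms k. \<forall>z\<in>UHP. (hyp_lap k ^^ m) f z = 0}"

definition V_half :: "int \<Rightarrow> nat \<Rightarrow> (complex \<Rightarrow> complex) set" where
  "V_half k m = {f \<in> base_forms k. (hyp_lap k ^^ m) f holomorphic_on UHP}"

text \<open>Weight-k Eisenstein series for Re(2s+k) > 2 (absolutely convergent lattice sum).\<close>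
definition eis :: "int \<Rightarrow> complex \<Rightarrow> complex \<Rightarrow> complex" where
  "eis k z s = (1/2) * infsum (\<lambda>(m,n). of_real (Im z) powr s /
        ((of_int m * z + of_int n) powi k * of_real (cmod (of_int m * z + of_int n)) powr (2 * s)))
      (UNIV - {(0::int, 0::int)})"

definition eis_hat :: "int \<Rightarrow> complex \<Rightarrow> complex \<Rightarrow> complex" where
  "eis_hat k z s = of_real pi powr (-(s + of_int k / 2)) *
      Gamma (s + of_int k / 2 + of_int \<bar>k\<bar> / 2) * eis k z s"

definition eis_hh_conv :: "int \<Rightarrow> complex \<Rightarrow> complex \<Rightarrow> complex" where
  "eis_hh_conv k z s = (s + of_int k / 2) * (s + of_int k / 2 - 1) * eis_hat k z s"

text \<open>Its entire continuation in s (unique by the identity theorem).\<close>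
definition eis_hh :: "int \<Rightarrow> complex \<Rightarrow> complex \<Rightarrow> complex" where
  "eis_hh k z = (THE F. F holomorphic_on UNIV \<and>
        (\<forall>s. Re (2 * s + of_int k) > 2 \<longrightarrow> F s = eis_hh_conv k z s))"

definition taylor_coeff_eis :: "int \<Rightarrow> nat \<Rightarrow> complex \<Rightarrow> complex" where
  "taylor_coeff_eis k n z =
     (if z \<in> UHP then (deriv ^^ n) (eis_hh k z) 0 / of_nat (fact n) else 0)"

definition G2 :: "nat \<Rightarrow> complex \<Rightarrow> complex" where
  "G2 n = taylor_coeff_eis 2 n"

abbreviation fscale :: "complex \<Rightarrow> (complex \<Rightarrow> complex) \<Rightarrow> (complex \<Rightarrow> complex)" where
  "fscale c f \<equiv> (\<lambda>z. c * f z)"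

end

theory Submission
  imports Defs "HOL-Complex_Analysis.Complex_Analysis" "HOL-Probability.Probability"
begin

text \<open>Write \<open>v = y / |mz+n|^2\<close>. For \<open>Re s > 0\<close>, splitting the Mellin integral of the weight 2
theta series \<open>\<theta>2\<close> at \<open>t = 1\<close> and using \<open>\<theta>2(1/t) = t^3 \<theta>2(t)\<close> turns the completed Eisenstein series
into \<open>\<pi>/2\<close> times the sum of \<open>(mz+n)^(-2) h(s,v)\<close> over the lattice, where
\<open>h(s,v) = v^(-2) (K(s+1, \<pi>/v) + K(-s, \<pi>/v))\<close> and \<open>K(a,q)\<close> is the integral of \<open>t^a exp(-qt)\<close> over \<open>t \<ge> 1\<close>.
This sum is entire in \<open>s\<close>, so \<open>G_n\<close> is the lattice sum attached to the \<open>n\<close>-th Taylor coefficient of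
\<open>s(s+1)h(s,v)\<close>. Differentiating under the sum gives \<open>\<Delta> G_n = G_(n-1) + G_(n-2)\<close> and
\<open>y^2 d/dzbar G_1 = \<i>/4\<close>; the boundary terms at \<open>t = 1\<close> cancel by the theta functional equation.

In the other direction, \<open>\<Delta> = 4 d/dz (y^2 d/dzbar)\<close>. If \<open>\<Delta> h = 0\<close>, then \<open>y^2 dh/dzbar\<close> is antiholomorphic of
weight 0, hence constant, so \<open>h - c G_1\<close> is holomorphic of weight 2 for some \<open>c\<close>, and such a form vanishes.
Apply this to \<open>h = \<Delta>^m f\<close> and subtract \<open>c G_(m+1)\<close> from \<open>f\<close> to descend from \<open>m+1\<close> to \<open>m\<close>.\<close>

section \<open>Fourier coefficients and Poisson summation for Gaussians\<close>

text \<open>At s = 0 the series of (mz+n)^(-2) does not converge absolutely. The tails K decay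
  exponentially in |mz+n|^2 / y, so all sums over the kernel converge absolutely and can be
  differentiated term by term. The coefficients of the weight 2 theta series are conj(mz+n)^2 / y^2,
  so the lattice point 0 contributes nothing. Its functional equation therefore has no correction
  terms, and the completed series has no poles. The factor s (s + 1) only shifts Taylor
  coefficients: G_0 = 0, and G_n adds the coefficients of index n-1 and n-2. The completed series is
  an eigenfunction of the Laplacian with eigenvalue s (s + 1), which is where the recursion with two
  terms comes from. G_1 is pi/6 times the classical E_2 - 3 / (pi y) with E_2 = 1 - 24 q - .... Up
  to a factor it accounts for every constant value of y^2 d/dzbar, so each further Laplacian adds
  exactly one dimension.\<close>

definition fcoeff :: "(real \<Rightarrow> complex) \<Rightarrow> int \<Rightarrow> complex" where
  "fcoeff D n = integral {0..1} (\<lambda>x. D x * cis (-(2 * pi * of_int n * x)))"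

lemma continuous_on_cis_mult [continuous_intros]:
  "continuous_on S f \<Longrightarrow> continuous_on S (\<lambda>x. cis (f x))"
  unfolding cis_conv_exp by (intro continuous_intros)

text \<open>By Stone--Weierstrass this class, closed under sums and products, is dense in the continuous functions
on the circle; applied to an approximation of \<open>cnj u\<close> it shows that \<open>u\<close> with zero coefficients vanishes.\<close>
definition preserves_null :: "(real \<Rightarrow> complex) \<Rightarrow> bool" where
  "preserves_null t \<longleftrightarrow> continuous_on UNIV t \<and>
     (\<forall>u. continuous_on UNIV u \<longrightarrow> (\<forall>n. fcoeff u n = 0) \<longrightarrow> (\<forall>n. fcoeff (\<lambda>x. t x * u x) n = 0))"

lemma integrable_fcoeff:
  fixes u :: "real \<Rightarrow> complex"
  assumes "continuous_on UNIV u"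
  shows "(\<lambda>x. u x * cis (-(2 * pi * of_int n * x))) integrable_on {0..1}"
  by (intro integrable_continuous_real continuous_intros continuous_on_subset[OF assms]) auto

lemma fcoeff_add:
  assumes "continuous_on UNIV u" "continuous_on UNIV v"
  shows "fcoeff (\<lambda>x. u x + v x) n = fcoeff u n + fcoeff v n"
  unfolding fcoeff_def distrib_right
  by (rule integral_add) (use assms integrable_fcoeff in auto)

lemma fcoeff_mult: "fcoeff (\<lambda>x. c * u x) n = c * fcoeff u n"
  unfolding fcoeff_def by (simp add: mult.assoc)

lemma preserves_null_const: "preserves_null (\<lambda>x. c)"
  by (auto simp: preserves_null_def fcoeff_mult)

lemma preserves_null_add:
  assumes "preserves_null s" "preserves_null t"
  shows "preserves_null (\<lambda>x. s x + t x)"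
  using assms unfolding preserves_null_def distrib_right
  by (auto intro!: continuous_intros simp: fcoeff_add[OF continuous_on_mult continuous_on_mult])

lemma preserves_null_mult:
  assumes "preserves_null s" "preserves_null t"
  shows "preserves_null (\<lambda>x. s x * t x)"
  using assms unfolding preserves_null_def mult.assoc
  by (auto intro!: continuous_intros)

text \<open>Multiplication by a character only shifts the index of the Fourier coefficients.\<close>

lemma preserves_null_cis: "preserves_null (\<lambda>x. cis (2 * pi * of_int k * x))"
proof -
  have "fcoeff (\<lambda>x. cis (2 * pi * of_int k * x) * u x) n = fcoeff u (n - k)" for u n
  proof -
    have "cis (2 * pi * of_int k * x) * u x * cis (-(2 * pi * of_int n * x))
        = u x * cis (-(2 * pi * of_int (n - k) * x))" for x
    proof -
      have "cis (2 * pi * of_int k * x) * cis (-(2 * pi * of_int n * x)) = cis (-(2 * pi * of_int (n - k) * x))"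
        unfolding cis_mult by (rule arg_cong[of _ _ cis]) (simp add: algebra_simps)
      thus ?thesis by (metis mult.assoc mult.commute)
    qed
    thus ?thesis unfolding fcoeff_def by presburger
  qed
  thus ?thesis unfolding preserves_null_def by (auto intro!: continuous_intros)
qed

text \<open>A real-linear functional of \<open>cis x\<close> is a combination of cos x and sin x,
  hence by Euler's formulas of the characters of frequency 1 and -1. The closure properties carry
  this through sums and products.\<close>

lemma preserves_null_polynomial:
  assumes "real_polynomial_function p"
  shows "preserves_null (\<lambda>x. of_real (p (cis (2 * pi * x))))"
  using assms
proof induction
  case (linear h)
  then interpret h: bounded_linear h .
  have e: "of_real (h (cis (2 * pi * x)))
      = (of_real (h 1) / 2 + of_real (h \<i>) / (2 * \<i>)) * cis (2 * pi * of_int 1 * x)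
      + (of_real (h 1) / 2 - of_real (h \<i>) / (2 * \<i>)) * cis (2 * pi * of_int (-1) * x)" for x
  proof -
    have "h (cis (2 * pi * x)) = h (cos (2 * pi * x) *\<^sub>R 1 + sin (2 * pi * x) *\<^sub>R \<i>)"
      by (rule arg_cong[of _ _ h]) (simp add: complex_eq_iff)
    also have "\<dots> = cos (2 * pi * x) * h 1 + sin (2 * pi * x) * h \<i>"
      by (simp only: h.add h.scaleR real_scaleR_def)
    finally show ?thesis
      by (simp add: complex_eq_iff field_simps)
  qed
  show ?case unfolding e
    by (intro preserves_null_add preserves_null_mult preserves_null_cis preserves_null_const)
qed (auto intro: preserves_null_const preserves_null_add preserves_null_mult)

text \<open>The function \<open>Arg2pi\<close> jumps across the positive real axis, and
  \<open>D 1 = D 0\<close> repairs the jump. Continuity is read off the passage from loops to circle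
  maps, applied to the constant homotopy of \<open>D\<close>.\<close>

lemma periodic_continuous_on_circle:
  fixes D :: "real \<Rightarrow> complex"
  assumes "continuous_on UNIV D" "\<And>x. D (x + 1) = D x"
  shows "continuous_on (sphere 0 1) (D \<circ> (\<lambda>z. Arg2pi z / (2 * pi)))"
proof -
  have "D 1 = D 0" using assms(2)[of 0] by simp
  hence "homotopic_loops UNIV D D"
    using assms by (auto simp: homotopic_loops_refl path_def pathfinish_def pathstart_def intro: continuous_on_subset)
  from homotopic_loops_imp_homotopic_circlemaps[OF this]
  show ?thesis by (auto dest: homotopic_with_imp_continuous)
qed

lemma fourier_coeffs_zero_imp_zero:
  fixes D :: "real \<Rightarrow> complex"
  assumes cont: "continuous_on UNIV D" and per: "\<And>x. D (x + 1) = D x"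
    and null: "\<And>n. fcoeff D n = 0"
  shows "D x = 0"
proof -
  define g where "g = D \<circ> (\<lambda>z. Arg2pi z / (2 * pi))"
  have g: "g (cis (2 * pi * x)) = D x" if "0 \<le> x" "x < 1" for x
    using that by (auto simp: g_def cis_conv_exp mult.commute Arg2pi_exp)
  have contg: "continuous_on (sphere 0 1) (\<lambda>z. cnj (g z))"
    unfolding g_def by (intro continuous_on_cnj periodic_continuous_on_circle cont per)
  have cont01: "continuous_on {0..1} D" by (rule continuous_on_subset[OF cont]) auto
  define I where "I = integral {0..1} (\<lambda>x. (norm (D x))\<^sup>2)"
  define B where "B = integral {0..1} (\<lambda>x. norm (D x))"
  have "B \<ge> 0" unfolding B_def
  proof (rule integral_nonneg)
    show "(\<lambda>x. norm (D x)) integrable_on {0..1}"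
      by (intro integrable_continuous_real continuous_intros cont01)
  qed simp
  \<comment> \<open>With q within e of the conjugate of D, the integral of |D|^2 equals that of (cnj
    D - q) D, because q D has mean zero.\<close>
  have small: "I \<le> e * B" if e: "e > 0" for e
  proof -
    obtain p where p: "polynomial_function p" "\<And>z. z \<in> sphere 0 1 \<Longrightarrow> norm (cnj (g z) - p z) < e"
      using Stone_Weierstrass_polynomial_function[OF _ contg e] by auto
    define q where "q x = p (cis (2 * pi * x))" for x :: real
    have qc: "q = (\<lambda>x. of_real (Re (p (cis (2*pi*x)))) + \<i> * of_real (Im (p (cis (2*pi*x)))))"
      by (auto simp: q_def complex_eq_iff)
    have rp: "real_polynomial_function (\<lambda>z. Re (p z))" "real_polynomial_function (\<lambda>z. Im (p z))"
      using p(1) bounded_linear_Re bounded_linear_Im by (auto simp: polynomial_function_def o_def)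
    have pq: "preserves_null q" unfolding qc
      by (intro preserves_null_add preserves_null_mult preserves_null_const preserves_null_polynomial rp)
    have cq: "continuous_on UNIV q" using pq by (simp add: preserves_null_def)
    have "fcoeff (\<lambda>x. q x * D x) 0 = 0" using pq cont null unfolding preserves_null_def by blast
    hence z: "integral {0..1} (\<lambda>x. q x * D x) = 0" by (simp add: fcoeff_def)
    \<comment> \<open>\<open>g\<close> represents D on the half-open interval only, so the end point
      1 is reduced to 0 by periodicity.\<close>
    have close: "norm (cnj (D x) - q x) \<le> e" if "x \<in> {0..1}" for x
    proof -
      have *: "norm (cnj (D y) - q y) \<le> e" if "0 \<le> y" "y < 1" for y
        using p(2)[of "cis (2*pi*y)"] g[OF that] by (auto simp: q_def intro: less_imp_le)
      show ?thesis
      proof (cases "x = 1")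
        case True
        have "D 1 = D 0" "q 1 = q 0" using per[of 0] by (auto simp: q_def)
        thus ?thesis using True *[of 0] by auto
      qed (use that * in auto)
    qed
    have ci: "continuous_on {0..1} (\<lambda>x. (cnj (D x) - q x) * D x)"
      by (intro continuous_intros cont01 continuous_on_subset[OF cq]) auto
    have "complex_of_real I = integral {0..1} (\<lambda>x. cnj (D x) * D x)"
    proof -
      have "(\<lambda>x. (norm (D x))\<^sup>2) integrable_on {0..1}"
        by (intro integrable_continuous_real continuous_intros cont01)
      hence "((\<lambda>x. complex_of_real ((norm (D x))\<^sup>2)) has_integral complex_of_real I) {0..1}"
        unfolding I_def by (intro has_integral_of_real integrable_integral)
      moreover have "complex_of_real ((norm (D x))\<^sup>2) = cnj (D x) * D x" for x
        by (simp add: complex_norm_square mult.commute del: of_real_power)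
      ultimately show ?thesis by (auto intro: integral_unique[symmetric])
    qed
    also have "\<dots> = integral {0..1} (\<lambda>x. (cnj (D x) - q x) * D x + q x * D x)"
      by (simp add: algebra_simps)
    also have "\<dots> = integral {0..1} (\<lambda>x. (cnj (D x) - q x) * D x) + integral {0..1} (\<lambda>x. q x * D x)"
      by (intro integral_add integrable_continuous_real ci continuous_intros cont01 continuous_on_subset[OF cq]) auto
    finally have "complex_of_real I = integral {0..1} (\<lambda>x. (cnj (D x) - q x) * D x)" using z by simp
    moreover have "norm (integral {0..1} (\<lambda>x. (cnj (D x) - q x) * D x)) \<le> integral {0..1} (\<lambda>x. e * norm (D x))"
    proof (rule integral_norm_bound_integral)
      fix x :: real assume "x \<in> {0..1}"
      thus "norm ((cnj (D x) - q x) * D x) \<le> e * norm (D x)"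
        using close by (simp add: norm_mult mult_right_mono)
    next
      show "(\<lambda>x. (cnj (D x) - q x) * D x) integrable_on {0..1}" by (rule integrable_continuous_real[OF ci])
    next
      show "(\<lambda>x. e * norm (D x)) integrable_on {0..1}"
        by (intro integrable_continuous_real continuous_intros cont01)
    qed
    ultimately have "norm (complex_of_real I) \<le> integral {0..1} (\<lambda>x. e * norm (D x))"
      by (rule ord_eq_le_trans[OF arg_cong[of _ _ norm]])
    moreover have "integral {0..1} (\<lambda>x. e * norm (D x)) = e * B"
      unfolding B_def by (rule integral_mult_right)
    ultimately have "\<bar>I\<bar> \<le> e * B" by (metis norm_of_real)
    thus ?thesis by (rule abs_le_D1)
  qed
  have "I \<le> 0"
  proof (rule ccontr)
    assume "\<not> I \<le> 0"
    \<comment> \<open>This e makes e B at most I / 2; the summand 1 keeps the denominator positive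
      when B = 0.\<close>
    hence "I \<le> I / (2 * (B + 1)) * B" using \<open>B \<ge> 0\<close> by (intro small) auto
    also have "\<dots> \<le> I / 2" using \<open>B \<ge> 0\<close> \<open>\<not> I \<le> 0\<close> by (simp add: field_simps)
    finally show False using \<open>\<not> I \<le> 0\<close> by simp
  qed
  moreover have "I \<ge> 0" unfolding I_def
  proof (rule integral_nonneg)
    show "(\<lambda>x. (norm (D x))\<^sup>2) integrable_on {0..1}"
      by (intro integrable_continuous_real continuous_intros cont01)
  qed simp
  ultimately have "I = 0" by simp
  have zero: "D x = 0" if "x \<in> {0..1}" for x
  proof -
    have "continuous_on {0..1} (\<lambda>x. (norm (D x))\<^sup>2)" by (intro continuous_intros cont01)
    from integral_eq_0_iff[OF this] \<open>I = 0\<close> that show ?thesis by (simp add: I_def)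
  qed
  have shiftn: "D (x + of_nat n) = D x" for x n
  proof (induction n)
    case (Suc n)
    have "D (x + of_nat (Suc n)) = D ((x + of_nat n) + 1)" by (simp add: algebra_simps)
    thus ?case using Suc by (simp only: per)
  qed simp
  have shift: "D (x + of_int k) = D x" for x k
    using shiftn[of x "nat k"] shiftn[of "x + of_int k" "nat (-k)"] by (cases "k \<ge> 0") auto
  have "D x = D (frac x)" using shift[of "frac x" "\<lfloor>x\<rfloor>"] by (simp add: frac_def)
  also have "\<dots> = 0" by (rule zero) (auto simp: frac_lt_1 less_imp_le)
  finally show ?thesis .
qed

section \<open>Decay estimates and termwise Fourier coefficients\<close>

text \<open>A single term of the exponential series is at most its sum. With a suitable N this
  supplies most of the decay estimates below.\<close>

lemma exp_minus_le: "x > 0 \<Longrightarrow> exp (-x) \<le> fact N / x ^ N" for x :: real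
proof -
  assume x: "x > 0"
  have "x ^ N / fact N = (\<Sum>k\<in>{N}. x ^ k /\<^sub>R fact k)" by (simp add: field_simps)
  also have "\<dots> \<le> exp x" unfolding exp_def
    by (rule sum_le_suminf) (use x summable_exp_generic[of x] in auto)
  finally show ?thesis using x by (simp add: exp_minus field_simps)
qed

text \<open>The cut-off at 1 keeps the term at n = 0 equal to 1, where \<open>0 powr (-p)\<close>
  would be 0; the comparisons below need a positive majorant there.\<close>

lemma summable_on_int_powr:
  assumes p: "p > (1::real)"
  shows "(\<lambda>n::int. max 1 \<bar>real_of_int n\<bar> powr (-p)) summable_on UNIV"
proof -
  have "summable (\<lambda>n. real n powr (-p))" using p by (simp add: summable_real_powr_iff)
  hence "summable (\<lambda>n. real (Suc n) powr (-p))" by (subst summable_Suc_iff)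
  hence s: "(\<lambda>n. real (Suc n) powr (-p)) summable_on UNIV"
    by (intro norm_summable_imp_summable_on) simp
  have "(\<lambda>n::int. max 1 \<bar>real_of_int n\<bar> powr (-p)) summable_on (range (\<lambda>n. int (Suc n)))"
    by (subst summable_on_reindex) (use s in \<open>auto simp: o_def inj_on_def\<close>)
  moreover have "(\<lambda>n::int. max 1 \<bar>real_of_int n\<bar> powr (-p)) summable_on (range (\<lambda>n. - int (Suc n)))"
    by (subst summable_on_reindex) (use s in \<open>auto simp: o_def inj_on_def add.commute abs_if\<close>)
  moreover have "(\<lambda>n::int. max 1 \<bar>real_of_int n\<bar> powr (-p)) summable_on {0}" by simp
  ultimately have "(\<lambda>n::int. max 1 \<bar>real_of_int n\<bar> powr (-p)) summable_on
     (({0} \<union> range (\<lambda>n. int (Suc n))) \<union> range (\<lambda>n. - int (Suc n)))"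
    by (intro summable_on_Un_disjoint) auto
  moreover have "n \<in> ({0} \<union> range (\<lambda>n. int (Suc n))) \<union> range (\<lambda>n. - int (Suc n))" for n :: int
  proof (cases n "0::int" rule: linorder_cases)
    case less
    hence "n = - int (Suc (nat (-n - 1)))" by auto
    thus ?thesis by blast
  next
    case greater
    hence "n = int (Suc (nat (n - 1)))" by auto
    thus ?thesis by blast
  qed auto
  hence "({0} \<union> range (\<lambda>n. int (Suc n))) \<union> range (\<lambda>n. - int (Suc n)) = UNIV" by blast
  ultimately show ?thesis by metis
qed

lemma gaussian_summable_on_int:
  assumes c: "c > (0::real)"
  shows "(\<lambda>n::int. exp (- (c * (of_int n)\<^sup>2))) summable_on UNIV"
proof (rule summable_on_comparison_test[where f = "\<lambda>n::int. max 1 (1/c) * max 1 \<bar>real_of_int n\<bar> powr (-2)"])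
  show "(\<lambda>n::int. max 1 (1/c) * max 1 \<bar>real_of_int n\<bar> powr (-2)) summable_on UNIV"
    by (intro summable_on_cmult_right summable_on_int_powr) simp
  fix n :: int
  show "exp (- (c * (of_int n)\<^sup>2)) \<le> max 1 (1/c) * max 1 \<bar>real_of_int n\<bar> powr (-2)"
  proof (cases "n = 0")
    case False
    hence n1: "\<bar>real_of_int n\<bar> \<ge> 1" by linarith
    have "exp (- (c * (of_int n)\<^sup>2)) \<le> fact 1 / (c * (of_int n)\<^sup>2) ^ 1"
      by (rule exp_minus_le) (use c False in auto)
    also have "\<dots> = (1/c) * (1 / (of_int n)\<^sup>2)" by simp
    also have "\<dots> \<le> max 1 (1/c) * (1 / (of_int n)\<^sup>2)" by (intro mult_right_mono) auto
    also have "1 / (real_of_int n)\<^sup>2 = max 1 \<bar>real_of_int n\<bar> powr (-2)"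
      using n1 by (simp add: max_def powr_minus field_simps)
    finally show ?thesis .
  qed auto
qed auto

lemma fcoeff_infsum:
  assumes cont: "\<And>i. i \<in> I \<Longrightarrow> continuous_on {0..1} (f i)"
    and bound: "\<And>i x. i \<in> I \<Longrightarrow> x \<in> {0..1} \<Longrightarrow> norm (f i x) \<le> M i"
    and M: "M summable_on I"
  shows "((\<lambda>i. fcoeff (f i) n) has_sum fcoeff (\<lambda>x. \<Sum>\<^sub>\<infinity>i\<in>I. f i x) n) I"
proof -
  define e where "e x = cis (-(2 * pi * of_int n * x))" for x
  \<comment> \<open>Off I the family is set to 0, because the integral of the partial sum must exist
    for every X, including those not contained in I.\<close>
  define f' where "f' i = (if i \<in> I then f i else (\<lambda>_. 0))" for i
  have f': "i \<in> I \<Longrightarrow> f' i = f i" for i by (auto simp: f'_def)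
  have cf': "continuous_on {0..1} (f' i)" for i by (auto simp: f'_def cont)
  have ce: "continuous_on {0..1} e" unfolding e_def by (intro continuous_intros)
  have ul: "uniform_limit (cbox 0 1) (\<lambda>X x. \<Sum>i\<in>X. f' i x * e x) (\<lambda>x. \<Sum>\<^sub>\<infinity>i\<in>I. f' i x * e x) (finite_subsets_at_top I)"
    by (rule Weierstrass_m_test_general[OF _ M]) (use bound in \<open>auto simp: f' norm_mult e_def\<close>)
  obtain J K where J: "\<And>X. ((\<lambda>x. \<Sum>i\<in>X. f' i x * e x) has_integral J X) (cbox 0 1)"
    and K: "((\<lambda>x. \<Sum>\<^sub>\<infinity>i\<in>I. f' i x * e x) has_integral K) (cbox 0 1)" and lim: "(J \<longlongrightarrow> K) (finite_subsets_at_top I)"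
    by (rule uniform_limit_integral_cbox[OF ul]) (auto intro!: continuous_on_sum continuous_on_mult cf' ce)
  have "K = integral {0..1} (\<lambda>x. \<Sum>\<^sub>\<infinity>i\<in>I. f' i x * e x)" using K by (simp add: integral_unique)
  also have "\<dots> = fcoeff (\<lambda>x. \<Sum>\<^sub>\<infinity>i\<in>I. f i x) n"
    unfolding fcoeff_def e_def[symmetric]
    by (intro integral_cong) (simp add: infsum_cmult_left' f' cong: infsum_cong)
  finally have Keq: "K = fcoeff (\<lambda>x. \<Sum>\<^sub>\<infinity>i\<in>I. f i x) n" .
  have "J X = (\<Sum>i\<in>X. fcoeff (f i) n)" if "finite X" "X \<subseteq> I" for X
  proof -
    have "J X = integral {0..1} (\<lambda>x. \<Sum>i\<in>X. f' i x * e x)" using J[of X] by (simp add: integral_unique)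
    also have "\<dots> = (\<Sum>i\<in>X. integral {0..1} (\<lambda>x. f' i x * e x))"
      by (rule integral_sum) (use that in \<open>auto intro!: integrable_continuous_real continuous_on_mult cf' ce\<close>)
    finally show ?thesis using that by (auto simp: fcoeff_def e_def f' intro!: sum.cong)
  qed
  hence "\<forall>\<^sub>F X in finite_subsets_at_top I. J X = (\<Sum>i\<in>X. fcoeff (f i) n)"
    by (intro eventually_finite_subsets_at_top_weakI) auto
  with lim have "((\<lambda>X. \<Sum>i\<in>X. fcoeff (f i) n) \<longlongrightarrow> K) (finite_subsets_at_top I)"
    using tendsto_cong by fast
  thus ?thesis by (simp add: has_sum_def Keq)
qed

lemma continuous_on_infsum_local:
  fixes f :: "'i \<Rightarrow> 'a::t2_space \<Rightarrow> complex"
  assumes cont: "\<And>i. i \<in> I \<Longrightarrow> continuous_on S (f i)" and S: "open S"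
    and bound: "\<And>x. x \<in> S \<Longrightarrow> \<exists>U M. open U \<and> x \<in> U \<and> M summable_on I \<and> (\<forall>i\<in>I. \<forall>y\<in>U \<inter> S. norm (f i y) \<le> M i)"
  shows "continuous_on S (\<lambda>x. \<Sum>\<^sub>\<infinity>i\<in>I. f i x)"
proof (subst continuous_on_eq_continuous_at[OF S], intro ballI)
  fix x assume x: "x \<in> S"
  then obtain U M where U: "open U" "x \<in> U" "M summable_on I" "\<And>i y. i \<in> I \<Longrightarrow> y \<in> U \<inter> S \<Longrightarrow> norm (f i y) \<le> M i"
    using bound[OF x] by blast
  have ul: "uniform_limit (U \<inter> S) (\<lambda>X x. \<Sum>i\<in>X. f i x) (\<lambda>x. \<Sum>\<^sub>\<infinity>i\<in>I. f i x) (finite_subsets_at_top I)"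
    by (rule Weierstrass_m_test_general[OF _ U(3)]) (use U(4) in auto)
  have "continuous_on (U \<inter> S) (\<lambda>x. \<Sum>\<^sub>\<infinity>i\<in>I. f i x)"
  proof (rule uniform_limit_theorem[OF _ ul])
    show "\<forall>\<^sub>F X in finite_subsets_at_top I. continuous_on (U \<inter> S) (\<lambda>x. \<Sum>i\<in>X. f i x)"
      by (intro eventually_finite_subsets_at_top_weakI continuous_on_sum continuous_on_subset[OF cont]) auto
  qed auto
  thus "isCont (\<lambda>x. \<Sum>\<^sub>\<infinity>i\<in>I. f i x) x"
    using U(1,2) x S by (subst (asm) continuous_on_eq_continuous_at) auto
qed

text \<open>This is the characteristic function of the standard normal distribution after the
  substitution x = s u; s normalises the exponent and t produces the required phase.\<close>

lemma gaussian_fourier: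
  fixes c k :: real
  assumes c: "c > 0"
  shows "integrable lborel (\<lambda>u. of_real (exp (-(pi * c * u\<^sup>2))) * cis (-(2 * pi * k * u)))"
    and "(LBINT u. of_real (exp (-(pi * c * u\<^sup>2))) * cis (-(2 * pi * k * u)))
           = complex_of_real (exp (-(pi * k\<^sup>2 / c)) / sqrt c)"
proof -
  define s where "s = sqrt (2 * pi * c)"
  have s: "s > 0" "s\<^sup>2 = 2 * pi * c" using c by (auto simp: s_def)
  define t where "t = -(2 * pi * k / s)"
  have base: "has_bochner_integral lborel (\<lambda>x. std_normal_density x *\<^sub>R cis (t * x)) (complex_of_real (exp (- (t^2) / 2)))"
  proof -
    have "integrable std_normal_distribution (\<lambda>x. cis (t * x))"
    proof -
      interpret prob_space std_normal_distribution by (rule prob_space_normal_density) simp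
      have "(\<lambda>x. iexp (t * x)) \<in> borel_measurable std_normal_distribution" by measurable
      hence "integrable std_normal_distribution (\<lambda>x. iexp (t * x))" by (intro integrable_const_bound[where B = 1]) auto
      thus ?thesis by (simp add: cis_conv_exp)
    qed
    hence "integrable lborel (\<lambda>x. std_normal_density x *\<^sub>R cis (t * x))"
      by (subst (asm) integrable_density) (auto simp: cis_conv_exp)
    moreover have "(LBINT x. std_normal_density x *\<^sub>R cis (t * x)) = complex_of_real (exp (- (t^2) / 2))"
      using fun_cong[OF char_std_normal_distribution, of t] unfolding char_def cis_conv_exp
      by (subst (asm) integral_density) (auto simp: mult_ac)
    ultimately show ?thesis by (simp add: has_bochner_integral_iff)
  qed
  have eq: "of_real (exp (-(pi * c * u\<^sup>2))) * cis (-(2 * pi * k * u))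
      = sqrt (2 * pi) *\<^sub>R (std_normal_density (0 + s * u) *\<^sub>R cis (t * (0 + s * u)))" for u
    using s by (simp add: normal_density_def t_def power_mult_distrib scaleR_conv_of_real mult.assoc)
  have "has_bochner_integral lborel (\<lambda>u. std_normal_density (0 + s * u) *\<^sub>R cis (t * (0 + s * u)))
       (complex_of_real (exp (- (t^2) / 2)) /\<^sub>R \<bar>s\<bar>)"
    using base s by (subst (asm) lborel_has_bochner_integral_real_affine_iff[of s _ _ 0]) auto
  hence "has_bochner_integral lborel (\<lambda>u. sqrt (2 * pi) *\<^sub>R (std_normal_density (0 + s * u) *\<^sub>R cis (t * (0 + s * u))))
       (sqrt (2 * pi) *\<^sub>R (complex_of_real (exp (- (t^2) / 2)) /\<^sub>R \<bar>s\<bar>))"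
    by (intro has_bochner_integral_scaleR_right) auto
  moreover have "sqrt (2 * pi) *\<^sub>R (complex_of_real (exp (- (t^2) / 2)) /\<^sub>R \<bar>s\<bar>)
      = complex_of_real (exp (-(pi * k\<^sup>2 / c)) / sqrt c)"
  proof -
    have "t\<^sup>2 / 2 = pi * k\<^sup>2 / c"
    proof -
      have "t\<^sup>2 = 4 * pi\<^sup>2 * k\<^sup>2 / s\<^sup>2" by (simp add: t_def power_divide power_mult_distrib)
      also have "\<dots> = 2 * (pi * k\<^sup>2 / c)" unfolding s(2) using c by (simp add: power2_eq_square)
      finally show ?thesis by simp
    qed
    thus ?thesis using c by (simp add: s_def real_sqrt_mult scaleR_conv_of_real field_simps)
  qed
  ultimately have "has_bochner_integral lborel (\<lambda>u. of_real (exp (-(pi * c * u\<^sup>2))) * cis (-(2 * pi * k * u)))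
     (complex_of_real (exp (-(pi * k\<^sup>2 / c)) / sqrt c))"
    unfolding eq by simp
  thus "integrable lborel (\<lambda>u. of_real (exp (-(pi * c * u\<^sup>2))) * cis (-(2 * pi * k * u)))"
    and "(LBINT u. of_real (exp (-(pi * c * u\<^sup>2))) * cis (-(2 * pi * k * u)))
           = complex_of_real (exp (-(pi * k\<^sup>2 / c)) / sqrt c)"
    by (auto simp: has_bochner_integral_iff)
qed

lemma fcoeff_cis: "fcoeff (\<lambda>x. cis (2 * pi * of_int n * x)) k = (if n = k then 1 else 0)"
proof -
  have "fcoeff (\<lambda>x. cis (2 * pi * of_int n * x)) k = integral {0..1} (\<lambda>x. cis (2 * pi * of_int (n - k) * x))"
    unfolding fcoeff_def cis_mult by (simp add: algebra_simps)
  also have "\<dots> = (if n = k then 1 else 0)"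
  proof (cases "n = k")
    case False
    define w where "w = 2 * pi * of_int (n - k)"
    have w: "w \<noteq> 0" using False by (simp add: w_def)
    have "((\<lambda>x. cis (w * x)) has_integral (cis (w * 1) / (\<i> * w) - cis (w * 0) / (\<i> * w))) {0..1}"
    proof (rule fundamental_theorem_of_calculus)
      fix x :: real
      have "((\<lambda>z. exp (\<i> * of_real w * z) / (\<i> * of_real w)) has_field_derivative exp (\<i> * of_real w * of_real x)) (at (of_real x))"
        using w by (auto intro!: derivative_eq_intros)
      from has_vector_derivative_real_field[OF this]
      show "((\<lambda>x. cis (w * x) / (\<i> * w)) has_vector_derivative cis (w * x)) (at x within {0..1})"
        by (simp add: cis_conv_exp mult.assoc)
    qed auto
    moreover have "cis w = 1" unfolding w_def by (rule cis_multiple_2pi) auto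
    ultimately show ?thesis using False by (auto simp: w_def dest: integral_unique)
  qed simp
  finally show ?thesis .
qed

lemma sum_shifted_integrals:
  fixes g :: "real \<Rightarrow> complex"
  assumes "continuous_on UNIV g"
  shows "(\<Sum>n\<in>{- int N..<int N}. integral {of_int n..of_int n + 1} g) = integral {- real N..real N} g"
proof (induction N)
  case (Suc N)
  have int: "g integrable_on {a..b}" for a b
    by (rule integrable_continuous_real[OF continuous_on_subset[OF assms]]) auto
  have "{- int (Suc N)..<int (Suc N)} = insert (- int (Suc N)) (insert (int N) {- int N..<int N})"
    by auto
  hence "(\<Sum>n\<in>{- int (Suc N)..<int (Suc N)}. integral {of_int n..of_int n + 1} g)
     = integral {- real (Suc N)..- real (Suc N) + 1} g + (integral {real N..real N + 1} g + integral {- real N..real N} g)"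
    using Suc by simp
  also have "- real (Suc N) + 1 = - real N" by simp
  also have "integral {real N..real N + 1} g + integral {- real N..real N} g = integral {- real N..real N + 1} g"
    by (subst add.commute, rule Henstock_Kurzweil_Integration.integral_combine) (auto intro: int)
  also have "integral {- real (Suc N)..- real N} g + integral {- real N..real N + 1} g = integral {- real (Suc N)..real N + 1} g"
    by (rule Henstock_Kurzweil_Integration.integral_combine) (auto intro: int)
  finally show ?case by (simp add: add.commute)
qed auto

lemma integral_symmetric_tendsto:
  fixes g :: "real \<Rightarrow> complex"
  assumes g: "integrable lborel g" "continuous_on UNIV g"
  shows "(\<lambda>N. integral {- real N..real N} g) \<longlonglongrightarrow> integral\<^sup>L lborel g"
proof -
  have "(\<lambda>N. LBINT x. indicator {- real N..real N} x *\<^sub>R g x) \<longlonglongrightarrow> integral\<^sup>L lborel g"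
  proof (rule integral_dominated_convergence[where w = "\<lambda>x. norm (g x)"])
    show "AE x in lborel. (\<lambda>N. indicator {- real N..real N} x *\<^sub>R g x) \<longlonglongrightarrow> g x"
    proof (rule AE_I2)
      fix x
      have "eventually (\<lambda>N. indicator {- real N..real N} x *\<^sub>R g x = g x) sequentially"
        using eventually_ge_at_top[of "nat \<lceil>\<bar>x\<bar>\<rceil>"]
        by eventually_elim (auto simp: indicator_def abs_le_iff nat_le_iff ceiling_le_iff; linarith)
      thus "(\<lambda>N. indicator {- real N..real N} x *\<^sub>R g x) \<longlonglongrightarrow> g x" by (rule tendsto_eventually)
    qed
    show "AE x in lborel. norm (indicator {- real N..real N} x *\<^sub>R g x) \<le> norm (g x)" for N
      by (rule AE_I2) (auto simp: indicator_def)
  qed (use g in auto)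
  moreover have "(LBINT x. indicator {- real N..real N} x *\<^sub>R g x) = integral {- real N..real N} g" for N
  proof -
    have "set_integrable lborel {- real N..real N} g"
      by (rule borel_integrable_atLeastAtMost') (rule continuous_on_subset[OF g(2)], auto)
    thus ?thesis using set_borel_integral_eq_integral(2) by (auto simp: set_lebesgue_integral_def)
  qed
  ultimately show ?thesis by simp
qed

text \<open>From (n + 2a)^2 \<ge> 0 follows n^2 / 2 \<le> (n + a)^2 + a^2. The right-hand side no
  longer depends on a, so it serves as a Weierstrass majorant on bounded sets of shifts.\<close>

lemma gaussian_shift_le:
  fixes c a R :: real
  assumes "c > 0" "\<bar>a\<bar> \<le> R"
  shows "exp (-(pi * c * (of_int n + a)\<^sup>2)) \<le> exp (pi * c * R\<^sup>2) * exp (- (pi * c / 2 * (of_int n)\<^sup>2))"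
proof -
  have "a\<^sup>2 \<le> R\<^sup>2" using assms(2) by (metis abs_ge_zero order.trans power2_abs power_mono)
  moreover have "(of_int n)\<^sup>2 / 2 \<le> (of_int n + a)\<^sup>2 + a\<^sup>2"
  proof -
    have "(of_int n + 2 * a)\<^sup>2 \<ge> 0" by simp
    thus ?thesis by (simp add: power2_eq_square algebra_simps)
  qed
  ultimately have "(of_int n)\<^sup>2 / 2 - R\<^sup>2 \<le> (of_int n + a)\<^sup>2" by linarith
  hence "pi * c * ((of_int n)\<^sup>2 / 2 - R\<^sup>2) \<le> pi * c * (of_int n + a)\<^sup>2"
    using assms by (intro mult_left_mono) auto
  thus ?thesis unfolding exp_add[symmetric] exp_le_cancel_iff by (simp add: algebra_simps)
qed

text \<open>Both sides are continuous and 1-periodic in a with the same Fourier coefficients, so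
  their difference vanishes by \<open>fourier_coeffs_zero_imp_zero\<close>.\<close>

lemma poisson_gaussian:
  fixes c a :: real
  assumes c: "c > 0"
  shows "(\<Sum>\<^sub>\<infinity>n::int. complex_of_real (exp (-(pi * c * (of_int n + a)\<^sup>2))))
       = (\<Sum>\<^sub>\<infinity>n::int. complex_of_real (exp (-(pi * (of_int n)\<^sup>2 / c)) / sqrt c) * cis (2 * pi * of_int n * a))"
proof -
  define f where "f n a = complex_of_real (exp (-(pi * c * (of_int n + a)\<^sup>2)))" for n :: int and a :: real
  define b where "b n = exp (-(pi * (of_int n)\<^sup>2 / c)) / sqrt c" for n :: int
  define g where "g n a = complex_of_real (b n) * cis (2 * pi * of_int n * a)" for n :: int and a :: real
  define L where "L a = (\<Sum>\<^sub>\<infinity>n. f n a)" for a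
  define R where "R a = (\<Sum>\<^sub>\<infinity>n. g n a)" for a
  have M1: "(\<lambda>n::int. exp (pi * c * r\<^sup>2) * exp (- (pi * c / 2 * (of_int n)\<^sup>2))) summable_on UNIV" for r
    using gaussian_summable_on_int[of "pi * c / 2"] c by (intro summable_on_cmult_right) auto
  have M2: "b summable_on UNIV"
    using summable_on_cmult_left[OF gaussian_summable_on_int[of "pi / c"], of "1 / sqrt c"] c
    by (auto simp: b_def[abs_def])
  have b0: "b n \<ge> 0" for n using c by (auto simp: b_def)
  have ng: "norm (g n a) = b n" for n a using b0[of n] by (simp add: g_def norm_mult)
  have cf: "continuous_on S (f n)" for n S unfolding f_def by (intro continuous_intros)
  have cg: "continuous_on S (g n)" for n S unfolding g_def by (intro continuous_intros)
  have contL: "continuous_on UNIV L" unfolding L_def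
  proof (rule continuous_on_infsum_local)
    fix x :: real
    define M where "M = (\<lambda>n::int. exp (pi * c * (\<bar>x\<bar>+1)\<^sup>2) * exp (- (pi * c / 2 * (of_int n)\<^sup>2)))"
    have "norm (f n y) \<le> M n" if "y \<in> {x-1<..<x+1}" for n y
      using gaussian_shift_le[OF c, of y "\<bar>x\<bar> + 1" n] that by (auto simp: f_def M_def)
    moreover have "M summable_on UNIV" unfolding M_def by (rule M1)
    ultimately show "\<exists>U M. open U \<and> x \<in> U \<and> M summable_on UNIV \<and> (\<forall>i\<in>UNIV. \<forall>y\<in>U \<inter> UNIV. cmod (f i y) \<le> M i)"
      by (intro exI[of _ "{x-1<..<x+1}"] exI[of _ M]) auto
  qed (auto intro: cf)
  have contR: "continuous_on UNIV R" unfolding R_def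
  proof (rule continuous_on_infsum_local)
    fix x :: real
    have "norm (g n y) \<le> b n" for n y by (simp add: ng)
    with M2 show "\<exists>U M. open U \<and> x \<in> U \<and> M summable_on UNIV \<and> (\<forall>i\<in>UNIV. \<forall>y\<in>U \<inter> UNIV. cmod (g i y) \<le> M i)"
      by (intro exI[of _ UNIV] exI[of _ b]) simp
  qed (rule cg, rule open_UNIV)
  have perL: "L (x + 1) = L x" for x
  proof -
    have "L (x + 1) = (\<Sum>\<^sub>\<infinity>n. f (n + 1) x)" by (simp add: L_def f_def algebra_simps)
    also have "\<dots> = L x" unfolding L_def
      by (rule infsum_reindex_bij_witness[of _ "\<lambda>n. n - 1" "\<lambda>n. n + 1"]) auto
    finally show ?thesis .
  qed
  have perR: "R (x + 1) = R x" for x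
  proof -
    have "cis (2 * pi * of_int n * (x + 1)) = cis (2 * pi * of_int n * x)" for n :: int
      by (simp add: distrib_left cis_mult[symmetric] cis_multiple_2pi)
    thus ?thesis unfolding R_def g_def by presburger
  qed
  \<comment> \<open>Unfolding: the coefficient of the n-th shifted Gaussian is an integral over
    [n, n+1], and these intervals tile the line.\<close>
  have fcL: "fcoeff L k = complex_of_real (b k)" for k
  proof -
    define h where "h u = complex_of_real (exp (-(pi * c * u\<^sup>2))) * cis (-(2 * pi * of_int k * u))" for u
    have ch: "continuous_on S h" for S unfolding h_def by (intro continuous_intros)
    have "((\<lambda>n. fcoeff (f n) k) has_sum fcoeff L k) UNIV" unfolding L_def
    proof (rule fcoeff_infsum[OF _ _ M1[of 1]])
      fix i :: int and x :: real assume "x \<in> {0..1}"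
      thus "norm (f i x) \<le> exp (pi * c * 1\<^sup>2) * exp (- (pi * c / 2 * (of_int i)\<^sup>2))"
        using gaussian_shift_le[OF c, of x 1 i] by (auto simp: f_def)
    qed (rule cf)
    moreover have "fcoeff (f n) k = integral {of_int n..of_int n + 1} h" for n
    proof -
      have "fcoeff (f n) k = integral {0..1} (\<lambda>x. h (x + of_int n))"
        unfolding fcoeff_def f_def h_def
      proof (intro integral_cong arg_cong2[of _ _ _ _ "(*)"])
        fix x :: real
        have "cis (- (2 * pi * of_int k * (x + of_int n))) = cis (- (2 * pi * of_int k * x)) * cis (2 * pi * of_int (- k * n))"
          unfolding cis_mult by (rule arg_cong[of _ _ cis]) (simp add: algebra_simps)
        thus "cis (- (2 * pi * of_int k * x)) = cis (- (2 * pi * of_int k * (x + of_int n)))"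
          by (simp only: cis_multiple_2pi[OF Ints_of_int]) simp
      qed (simp add: add.commute)
      also have "((\<lambda>x. h (x + of_int n)) has_integral integral {of_int n..of_int n + 1} h) {0..1}"
      proof -
        have "(h has_integral integral {of_int n..of_int n + 1} h) {of_int n..of_int n + 1}"
          by (intro integrable_integral integrable_continuous_real ch)
        from has_integral_shift_real_ivl[OF this, of "of_int n"] show ?thesis by simp
      qed
      hence "integral {0..1} (\<lambda>x. h (x + of_int n)) = integral {of_int n..of_int n + 1} h"
        by (rule integral_unique)
      finally show ?thesis .
    qed
    ultimately have hs: "((\<lambda>n. integral {of_int n..of_int n + 1} h) has_sum fcoeff L k) UNIV" by simp
    \<comment> \<open>Evaluating the unordered sum along these blocks turns it into integrals over
      [-N, N].\<close>
    have "filterlim (\<lambda>N. {- int N..<int N}) (finite_subsets_at_top UNIV) sequentially"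
      unfolding filterlim_finite_subsets_at_top
    proof safe
      fix X :: "int set" assume X: "finite X"
      have "eventually (\<lambda>N. \<forall>x\<in>X. N > nat \<bar>x\<bar>) sequentially"
        using X by (intro eventually_ball_finite ballI eventually_gt_at_top) auto
      thus "\<forall>\<^sub>F N in sequentially. finite {- int N..<int N} \<and> X \<subseteq> {- int N..<int N} \<and> {- int N..<int N} \<subseteq> UNIV"
        by eventually_elim force
    qed
    from filterlim_compose[OF hs[unfolded has_sum_def] this]
    have "(\<lambda>N. integral {- real N..real N} h) \<longlonglongrightarrow> fcoeff L k"
      by (simp add: sum_shifted_integrals ch)
    moreover have "(\<lambda>N. integral {- real N..real N} h) \<longlonglongrightarrow> complex_of_real (b k)"
      using integral_symmetric_tendsto[OF _ ch] gaussian_fourier[OF c, of "of_int k"]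
      unfolding h_def[symmetric] b_def by simp
    ultimately show ?thesis by (rule LIMSEQ_unique)
  qed
  have fcR: "fcoeff R k = complex_of_real (b k)" for k
  proof -
    have "((\<lambda>n. fcoeff (g n) k) has_sum fcoeff R k) UNIV" unfolding R_def
      by (rule fcoeff_infsum[OF _ _ M2]) (auto intro!: cg simp: ng)
    moreover have "((\<lambda>n. fcoeff (g n) k) has_sum complex_of_real (b k)) UNIV"
    proof -
      have "fcoeff (g n) k = (if n = k then complex_of_real (b k) else 0)" for n
        unfolding g_def[abs_def] by (simp add: fcoeff_mult fcoeff_cis)
      thus ?thesis
        by (subst has_sum_cong_neutral[where T = "{k}" and g = "\<lambda>_. complex_of_real (b k)"])
           (auto intro: has_sum_finiteI)
    qed
    ultimately show ?thesis by (rule has_sum_unique)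
  qed
  have "L a - R a = 0"
  proof (rule fourier_coeffs_zero_imp_zero)
    show "continuous_on UNIV (\<lambda>a. L a - R a)" by (intro continuous_intros contL contR)
    fix n
    have "fcoeff (\<lambda>a. L a + (-1) * R a) n = 0"
      by (subst fcoeff_add[OF contL continuous_on_mult[OF continuous_on_const contR]], subst fcoeff_mult) (simp add: fcL fcR)
    thus "fcoeff (\<lambda>a. L a - R a) n = 0" by simp
  qed (simp add: perL perR)
  thus ?thesis by (simp add: L_def R_def f_def g_def b_def)
qed

section \<open>Wirtinger derivatives and smooth functions on the upper half-plane\<close>

text \<open>The real derivative at z, split into its complex linear and its conjugate linear
  part.\<close>

definition has_wirtinger :: "(complex \<Rightarrow> complex) \<Rightarrow> complex \<Rightarrow> complex \<Rightarrow> complex \<Rightarrow> bool" where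
  "has_wirtinger f a b z \<longleftrightarrow> (f has_derivative (\<lambda>h. a * h + b * cnj h)) (at z)"

definition dz :: "(complex \<Rightarrow> complex) \<Rightarrow> complex \<Rightarrow> complex" where
  "dz f z = (pdx f z - \<i> * pdy f z) / 2"

definition dzb :: "(complex \<Rightarrow> complex) \<Rightarrow> complex \<Rightarrow> complex" where
  "dzb f z = (pdx f z + \<i> * pdy f z) / 2"

lemma open_UHP [simp]: "open UHP"
  unfolding UHP_def by (rule open_halfspace_Im_gt)

lemma convex_UHP: "convex UHP"
  unfolding UHP_def by (rule convex_halfspace_Im_gt)

lemma pd_of_has_derivative:
  assumes "(f has_derivative D) (at z)"
  shows "((\<lambda>t::real. f (z + of_real t)) has_vector_derivative D 1) (at 0)"
    and "((\<lambda>t::real. f (z + \<i> * of_real t)) has_vector_derivative D \<i>) (at 0)"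
    and "pdx f z = D 1" and "pdy f z = D \<i>"
proof -
  interpret D: bounded_linear D using assms by (rule has_derivative_bounded_linear)
  have 1: "((\<lambda>t::real. z + of_real t) has_derivative (\<lambda>t. of_real t)) (at 0)"
    and 2: "((\<lambda>t::real. z + \<i> * of_real t) has_derivative (\<lambda>t. \<i> * of_real t)) (at 0)"
    by (auto intro!: derivative_eq_intros)
  show a: "((\<lambda>t::real. f (z + of_real t)) has_vector_derivative D 1) (at 0)"
    using diff_chain_at[OF 1, of f D] assms D.scaleR[of _ 1]
    by (simp add: has_vector_derivative_def o_def scaleR_conv_of_real)
  show b: "((\<lambda>t::real. f (z + \<i> * of_real t)) has_vector_derivative D \<i>) (at 0)"
    using diff_chain_at[OF 2, of f D] assms D.scaleR[of _ \<i>]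
    by (simp add: has_vector_derivative_def o_def scaleR_conv_of_real mult.commute)
  show "pdx f z = D 1" "pdy f z = D \<i>"
    unfolding pdx_def pdy_def by (rule vector_derivative_at[OF a], rule vector_derivative_at[OF b])
qed

lemma differentiable_wirtinger:
  assumes "f differentiable (at z)"
  shows "has_wirtinger f (dz f z) (dzb f z) z"
proof -
  from assms obtain D where D: "(f has_derivative D) (at z)" by (auto simp: differentiable_def)
  interpret D: bounded_linear D using D by (rule has_derivative_bounded_linear)
  have "D h = dz f z * h + dzb f z * cnj h" for h
  proof -
    have "D h = D (Re h *\<^sub>R 1 + Im h *\<^sub>R \<i>)" by (rule arg_cong[of _ _ D]) (simp add: complex_eq_iff)
    also have "\<dots> = Re h *\<^sub>R pdx f z + Im h *\<^sub>R pdy f z"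
      using pd_of_has_derivative[OF D] by (simp add: D.add D.scaleR)
    also have "\<dots> = dz f z * h + dzb f z * cnj h"
      by (simp add: dz_def dzb_def complex_eq_iff field_simps)
    finally show ?thesis .
  qed
  hence "D = (\<lambda>h. dz f z * h + dzb f z * cnj h)" by (rule ext)
  thus ?thesis using D by (simp add: has_wirtinger_def)
qed

lemma has_wirtinger_imp:
  assumes "has_wirtinger f a b z"
  shows "f differentiable (at z)" "dz f z = a" "dzb f z = b" "pdx f z = a + b" "pdy f z = \<i> * (a - b)"
proof -
  have D: "(f has_derivative (\<lambda>h. a * h + b * cnj h)) (at z)" using assms by (simp add: has_wirtinger_def)
  thus "f differentiable (at z)" by (auto simp: differentiable_def)
  show 1: "pdx f z = a + b" and 2: "pdy f z = \<i> * (a - b)"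
    using pd_of_has_derivative(3,4)[OF D] by (auto simp: algebra_simps)
  show "dz f z = a" "dzb f z = b" unfolding dz_def dzb_def 1 2 by (auto simp: field_simps)
qed

lemma has_wirtinger_add:
  "has_wirtinger f a b z \<Longrightarrow> has_wirtinger g c d z \<Longrightarrow> has_wirtinger (\<lambda>z. f z + g z) (a + c) (b + d) z"
  unfolding has_wirtinger_def by (drule (1) has_derivative_add) (simp add: algebra_simps)

lemma has_wirtinger_cmult:
  "has_wirtinger f a b z \<Longrightarrow> has_wirtinger (\<lambda>z. c * f z) (c * a) (c * b) z"
  unfolding has_wirtinger_def by (drule has_derivative_mult_right[where g' = "\<lambda>h. a * h + b * cnj h" and x = c]) (simp add: algebra_simps)

lemma has_wirtinger_mult:
  "has_wirtinger f a b z \<Longrightarrow> has_wirtinger g c d z \<Longrightarrow>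
    has_wirtinger (\<lambda>z. f z * g z) (f z * c + a * g z) (f z * d + b * g z) z"
  unfolding has_wirtinger_def by (drule (1) has_derivative_mult) (simp add: algebra_simps)

lemma has_wirtinger_field:
  "(f has_field_derivative a) (at z) \<Longrightarrow> has_wirtinger f a 0 z"
  unfolding has_wirtinger_def has_field_derivative_def by simp

lemma has_wirtinger_field_iff:
  "has_wirtinger f a 0 z \<longleftrightarrow> (f has_field_derivative a) (at z)"
  unfolding has_wirtinger_def has_field_derivative_def by simp

lemma has_wirtinger_cnj:
  assumes "has_wirtinger f a b z"
  shows "has_wirtinger (\<lambda>z. cnj (f z)) (cnj b) (cnj a) z"
  using has_derivative_cnj[OF assms[unfolded has_wirtinger_def]]
  by (simp add: has_wirtinger_def add.commute)

lemma has_wirtinger_compose: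
  assumes "has_wirtinger f a b (\<phi> z)" "(\<phi> has_field_derivative c) (at z)"
  shows "has_wirtinger (\<lambda>z. f (\<phi> z)) (a * c) (b * cnj c) z"
  using diff_chain_at[OF assms(2)[unfolded has_field_derivative_def] assms(1)[unfolded has_wirtinger_def]]
  by (simp add: has_wirtinger_def o_def mult_ac)

lemma has_wirtinger_transform:
  assumes "has_wirtinger f a b z" "open S" "z \<in> S" "\<And>w. w \<in> S \<Longrightarrow> f w = g w"
  shows "has_wirtinger g a b z"
  using assms has_derivative_transform_within_open unfolding has_wirtinger_def by blast

lemma has_wirtinger_Im: "has_wirtinger (\<lambda>z. of_real (Im z)) (1 / (2 * \<i>)) (- (1 / (2 * \<i>))) z"
proof -
  have "((\<lambda>z. complex_of_real (Im z)) has_derivative (\<lambda>h. of_real (Im h))) (at z)"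
    by (auto intro!: derivative_eq_intros)
  moreover have "(\<lambda>h. complex_of_real (Im h)) = (\<lambda>h. 1 / (2 * \<i>) * h + - (1 / (2 * \<i>)) * cnj h)"
    by (auto simp: complex_eq_iff)
  ultimately show ?thesis by (simp add: has_wirtinger_def)
qed

lemma pd_cong:
  assumes "\<And>z. z \<in> UHP \<Longrightarrow> f z = g z" "z \<in> UHP"
  shows "pdx f z = pdx g z" "pdy f z = pdy g z"
proof -
  have t: "((\<lambda>t::real. z + of_real t) \<longlongrightarrow> z + of_real 0) (nhds 0)"
       "((\<lambda>t::real. z + \<i> * of_real t) \<longlongrightarrow> z + \<i> * of_real 0) (nhds 0)"
    by (intro tendsto_intros filterlim_ident)+
  have "eventually (\<lambda>t::real. z + of_real t \<in> UHP) (nhds 0)"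
    by (rule topological_tendstoD[OF t(1) open_UHP]) (use assms(2) in simp)
  hence 1: "eventually (\<lambda>t::real. f (z + of_real t) = g (z + of_real t)) (nhds 0)"
    by (rule eventually_mono) (rule assms(1))
  have "eventually (\<lambda>t::real. z + \<i> * of_real t \<in> UHP) (nhds 0)"
    by (rule topological_tendstoD[OF t(2) open_UHP]) (use assms(2) in simp)
  hence 2: "eventually (\<lambda>t::real. f (z + \<i> * of_real t) = g (z + \<i> * of_real t)) (nhds 0)"
    by (rule eventually_mono) (rule assms(1))
  show "pdx f z = pdx g z" "pdy f z = pdy g z"
    unfolding pdx_def pdy_def using 1 2 by (auto intro!: vector_derivative_cong_eq)
qed

section \<open>Smoothness on the upper half-plane\<close>

text \<open>The induction on words of partial derivatives is done here once. Later it is enough to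
  exhibit a class of functions that is closed under \<open>pdx\<close> and
  \<open>pdy\<close>.\<close>

lemma smooth_coinduct:
  assumes "P f" and "\<And>f z. P f \<Longrightarrow> z \<in> UHP \<Longrightarrow> f differentiable (at z)"
    and "\<And>f. P f \<Longrightarrow> P (pdx f)" and "\<And>f. P f \<Longrightarrow> P (pdy f)"
  shows "smooth_UHP f"
proof -
  have "P (iter_pd bs f)" for bs
    by (induction bs) (simp_all add: assms(1,3,4))
  hence "iter_pd bs f differentiable (at z within UHP)" if "z \<in> UHP" for bs z
    by (rule differentiable_at_withinI[OF assms(2)[OF _ that]])
  thus ?thesis by (simp add: smooth_UHP_def differentiable_on_def)
qed

lemma smooth_differentiable:
  assumes "smooth_UHP f" "z \<in> UHP" shows "f differentiable (at z)"
  using assms(1)[unfolded smooth_UHP_def, rule_format, of "[]"] assms(2)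
  by (auto simp: differentiable_on_def at_within_open[OF _ open_UHP])

lemma smooth_pd:
  assumes "smooth_UHP f" shows "smooth_UHP (pdx f)" "smooth_UHP (pdy f)"
proof -
  have "iter_pd bs (pdx f) = iter_pd (bs @ [True]) f" "iter_pd bs (pdy f) = iter_pd (bs @ [False]) f" for bs
    by (induction bs) auto
  thus "smooth_UHP (pdx f)" "smooth_UHP (pdy f)" using assms by (auto simp: smooth_UHP_def)
qed

lemma differentiable_transform_UHP:
  assumes "f differentiable (at z)" "z \<in> UHP" "\<And>z. z \<in> UHP \<Longrightarrow> f z = g z"
  shows "g differentiable (at z)"
  using assms has_derivative_transform_within_open[OF _ open_UHP] unfolding differentiable_def by blast

lemma smooth_cong:
  assumes "smooth_UHP f" "\<And>z. z \<in> UHP \<Longrightarrow> f z = g z" shows "smooth_UHP g"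
proof (rule smooth_coinduct[where P = "\<lambda>g. \<exists>f. smooth_UHP f \<and> (\<forall>z\<in>UHP. f z = g z)"])
  fix g z assume "\<exists>f. smooth_UHP f \<and> (\<forall>z\<in>UHP. f z = g z)" "z \<in> UHP"
  thus "g differentiable (at z)" using differentiable_transform_UHP smooth_differentiable by metis
next
  fix g assume "\<exists>f. smooth_UHP f \<and> (\<forall>z\<in>UHP. f z = g z)"
  then obtain f where f: "smooth_UHP f" "\<And>z. z \<in> UHP \<Longrightarrow> f z = g z" by blast
  show "\<exists>f. smooth_UHP f \<and> (\<forall>z\<in>UHP. f z = pdx g z)"
    by (rule exI[of _ "pdx f"]) (use smooth_pd(1)[OF f(1)] pd_cong(1)[of f g, OF f(2)] in simp)
  show "\<exists>f. smooth_UHP f \<and> (\<forall>z\<in>UHP. f z = pdy g z)"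
    by (rule exI[of _ "pdy f"]) (use smooth_pd(2)[OF f(1)] pd_cong(2)[of f g, OF f(2)] in simp)
qed (use assms in blast)

lemma smooth_wirtinger:
  "smooth_UHP f \<Longrightarrow> z \<in> UHP \<Longrightarrow> has_wirtinger f (dz f z) (dzb f z) z"
  by (intro differentiable_wirtinger smooth_differentiable)

lemma pd_add:
  assumes "f differentiable (at z)" "g differentiable (at z)"
  shows "pdx (\<lambda>z. f z + g z) z = pdx f z + pdx g z" "pdy (\<lambda>z. f z + g z) z = pdy f z + pdy g z"
  unfolding has_wirtinger_imp(4,5)[OF has_wirtinger_add[OF assms[THEN differentiable_wirtinger]]]
  by (simp_all add: dz_def dzb_def field_simps)

lemma pd_cmult:
  assumes "f differentiable (at z)"
  shows "pdx (\<lambda>z. c * f z) z = c * pdx f z" "pdy (\<lambda>z. c * f z) z = c * pdy f z"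
  unfolding has_wirtinger_imp(4,5)[OF has_wirtinger_cmult[OF assms[THEN differentiable_wirtinger]], of c]
  by (simp_all add: dz_def dzb_def field_simps)

lemma pd_Im_mult:
  assumes "f differentiable (at z)"
  shows "pdx (\<lambda>z. of_real (Im z) * f z) z = of_real (Im z) * pdx f z"
    "pdy (\<lambda>z. of_real (Im z) * f z) z = of_real (Im z) * pdy f z + f z"
    "(\<lambda>z. of_real (Im z) * f z) differentiable (at z)"
  unfolding has_wirtinger_imp(4,5)[OF has_wirtinger_mult[OF has_wirtinger_Im assms[THEN differentiable_wirtinger]]]
  using has_wirtinger_imp(1)[OF has_wirtinger_mult[OF has_wirtinger_Im assms[THEN differentiable_wirtinger]]]
  by (simp_all add: dz_def dzb_def field_simps)

lemma smooth_add:
  assumes "smooth_UHP f" "smooth_UHP g" shows "smooth_UHP (\<lambda>z. f z + g z)"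
proof -
  \<comment> \<open>Agreement is asked on the half-plane only, since outside it the partial
    derivatives of a sum need not add up.\<close>
  define P where "P = (\<lambda>h::complex \<Rightarrow> complex. \<exists>f g. smooth_UHP f \<and> smooth_UHP g \<and> (\<forall>z\<in>UHP. f z + g z = h z))"
  show ?thesis
  proof (rule smooth_coinduct[where P = P])
    show "P (\<lambda>z. f z + g z)" unfolding P_def using assms by blast
    fix h assume "P h"
    then obtain f g where fg: "smooth_UHP f" "smooth_UHP g" "\<And>z. z \<in> UHP \<Longrightarrow> f z + g z = h z"
      by (auto simp: P_def)
    note d = smooth_differentiable[OF fg(1)] smooth_differentiable[OF fg(2)]
    show "h differentiable (at z)" if "z \<in> UHP" for z
      by (rule differentiable_transform_UHP[OF _ that fg(3)]) (auto intro!: differentiable_add d that)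
    have "pdx f z + pdx g z = pdx h z" "pdy f z + pdy g z = pdy h z" if "z \<in> UHP" for z
      using pd_cong[of "\<lambda>z. f z + g z" h z, OF fg(3) that] pd_add[OF d(1)[OF that] d(2)[OF that]] by auto
    thus "P (pdx h)" "P (pdy h)" unfolding P_def
      using smooth_pd[OF fg(1)] smooth_pd[OF fg(2)]
      by blast+
  qed
qed

lemma smooth_cmult:
  assumes "smooth_UHP f" shows "smooth_UHP (\<lambda>z. c * f z)"
proof -
  define P where "P = (\<lambda>h::complex \<Rightarrow> complex. \<exists>f. smooth_UHP f \<and> (\<forall>z\<in>UHP. c * f z = h z))"
  show ?thesis
  proof (rule smooth_coinduct[where P = P])
    show "P (\<lambda>z. c * f z)" unfolding P_def using assms by blast
    fix h assume "P h"
    then obtain f where f: "smooth_UHP f" "\<And>z. z \<in> UHP \<Longrightarrow> c * f z = h z"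
      by (auto simp: P_def)
    note d = smooth_differentiable[OF f(1)]
    show "h differentiable (at z)" if "z \<in> UHP" for z
      by (rule differentiable_transform_UHP[OF _ that f(2)]) (auto intro!: differentiable_mult d that)
    have "c * pdx f z = pdx h z" "c * pdy f z = pdy h z" if "z \<in> UHP" for z
      using pd_cong[of "\<lambda>z. c * f z" h z, OF f(2) that] pd_cmult[OF d[OF that]] by auto
    thus "P (pdx h)" "P (pdy h)" unfolding P_def using smooth_pd[OF f(1)] by auto
  qed
qed

lemma smooth_Im_mult:
  assumes "smooth_UHP f" shows "smooth_UHP (\<lambda>z. of_real (Im z) * f z)"
proof -
  \<comment> \<open>The summand g absorbs the extra term f that d/dy produces from the factor
    \<open>Im z\<close>, which makes the class closed.\<close>
  define P where "P = (\<lambda>h::complex \<Rightarrow> complex. \<exists>f g. smooth_UHP f \<and> smooth_UHP g \<and> (\<forall>z\<in>UHP. of_real (Im z) * f z + g z = h z))"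
  show ?thesis
  proof (rule smooth_coinduct[where P = P])
    have "smooth_UHP (\<lambda>z. 0 * f z)" by (rule smooth_cmult[OF assms])
    thus "P (\<lambda>z. of_real (Im z) * f z)" unfolding P_def using assms by (intro exI[of _ f] exI[of _ "\<lambda>z. 0 * f z"]) simp
    fix h assume "P h"
    then obtain f g where fg: "smooth_UHP f" "smooth_UHP g" "\<And>z. z \<in> UHP \<Longrightarrow> of_real (Im z) * f z + g z = h z"
      by (auto simp: P_def)
    note d = smooth_differentiable[OF fg(1)] smooth_differentiable[OF fg(2)]
    show "h differentiable (at z)" if "z \<in> UHP" for z
      by (rule differentiable_transform_UHP[OF _ that fg(3)])
         (intro differentiable_add pd_Im_mult(3) d that)
    have "of_real (Im z) * pdx f z + pdx g z = pdx h z" "of_real (Im z) * pdy f z + (f z + pdy g z) = pdy h z" if "z \<in> UHP" for z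
      using pd_cong[of "\<lambda>z. of_real (Im z) * f z + g z" h z, OF fg(3) that]
        pd_add[OF pd_Im_mult(3)[OF d(1)[OF that]] d(2)[OF that]] pd_Im_mult(1,2)[OF d(1)[OF that]]
      by (simp_all add: add.assoc)
    thus "P (pdx h)" "P (pdy h)" unfolding P_def
      using smooth_pd[OF fg(1)] smooth_pd[OF fg(2)] smooth_add[OF fg(1) smooth_pd(2)[OF fg(2)]]
      by blast+
  qed
qed

lemma smooth_continuous: "smooth_UHP f \<Longrightarrow> continuous_on UHP f"
  by (intro differentiable_imp_continuous_on) (auto simp: differentiable_on_def intro: differentiable_at_withinI smooth_differentiable)

lemma vline_derivative:
  assumes "f differentiable (at (Complex x y))"
  shows "((\<lambda>t. f (Complex x t)) has_vector_derivative pdy f (Complex x y)) (at y)"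
proof -
  obtain D where D: "(f has_derivative D) (at (Complex x y))" using assms by (auto simp: differentiable_def)
  have "((\<lambda>t. Complex x t) has_derivative (\<lambda>t. t *\<^sub>R \<i>)) (at y)"
    unfolding Complex_eq by (auto intro!: derivative_eq_intros simp: scaleR_conv_of_real mult.commute)
  from diff_chain_at[OF this D] pd_of_has_derivative(4)[OF D] linear_scale[OF has_derivative_linear[OF D]]
  show ?thesis by (simp add: has_vector_derivative_def o_def)
qed

lemma hline_derivative:
  assumes "f differentiable (at (Complex x y))"
  shows "((\<lambda>t. f (Complex t y)) has_vector_derivative pdx f (Complex x y)) (at x)"
proof -
  obtain D where D: "(f has_derivative D) (at (Complex x y))" using assms by (auto simp: differentiable_def)
  have "((\<lambda>t. Complex t y) has_derivative (\<lambda>t. t *\<^sub>R 1)) (at x)"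
    unfolding Complex_eq by (auto intro!: derivative_eq_intros simp: scaleR_conv_of_real mult.commute)
  from diff_chain_at[OF this D] pd_of_has_derivative(3)[OF D] linear_scale[OF has_derivative_linear[OF D]]
  show ?thesis by (simp add: has_vector_derivative_def o_def)
qed

lemma continuous_on_Complex [continuous_intros]:
  "continuous_on S f \<Longrightarrow> continuous_on S g \<Longrightarrow> continuous_on S (\<lambda>x. Complex (f x) (g x))"
  unfolding Complex_eq by (intro continuous_intros)

text \<open>By the fundamental theorem f(x,y) - f(x0,y) is the integral of \<open>pdx f\<close>.
  Differentiating it in y under the integral sign, and then in x at x0, gives both orders. Only x
  \<ge> x0 occurs, so derivatives from the right are compared at the end.\<close>

lemma mixed_partials:
  assumes f: "smooth_UHP f" and z: "z \<in> UHP"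
  shows "pdx (pdy f) z = pdy (pdx f) z"
proof -
  define x0 where "x0 = Re z" define y0 where "y0 = Im z"
  have z0: "z = Complex x0 y0" by (simp add: x0_def y0_def)
  have y0: "y0 > 0" using z by (simp add: UHP_def y0_def)
  have inU: "Complex x y \<in> UHP \<longleftrightarrow> y > 0" for x y by (simp add: UHP_def)
  note sd = smooth_differentiable
  note px = smooth_pd(1)[OF f] note py = smooth_pd(2)[OF f]
  note pyx = smooth_pd(2)[OF px]
  have cont: "continuous_on ({0<..} \<times> {a..b}) (\<lambda>(y, x). g (Complex x y))" if "smooth_UHP g" for g and a b :: real
    unfolding split_beta
    by (intro continuous_on_compose2[OF smooth_continuous[OF that]] continuous_intros) (auto simp: inU)
  have conth: "continuous_on {a..b} (\<lambda>x. g (Complex x y))" if "smooth_UHP g" "y > 0" for g y and a b :: real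
    by (intro continuous_on_compose2[OF smooth_continuous[OF that(1)]] continuous_intros) (auto simp: inU that)
  have A: "f (Complex x y) - f (Complex x0 y) = integral {x0..x} (\<lambda>u. pdx f (Complex u y))" if "x \<ge> x0" "y > 0" for x y
  proof -
    have hd: "((\<lambda>u. f (Complex u y)) has_vector_derivative pdx f (Complex u y)) (at u within {x0..x})" for u
      by (rule has_vector_derivative_at_within[OF hline_derivative[OF sd[OF f]]]) (simp add: inU that)
    show ?thesis
      using fundamental_theorem_of_calculus[OF \<open>x \<ge> x0\<close> hd] by (simp add: integral_unique)
  qed
  have B: "pdy f (Complex x y0) - pdy f (Complex x0 y0) = integral {x0..x} (\<lambda>u. pdy (pdx f) (Complex u y0))" if x: "x \<ge> x0" for x
  proof -
    have L1: "((\<lambda>y. pdx f (Complex t y)) has_vector_derivative pdy (pdx f) (Complex t y)) (at y within {0<..})"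
      if "y \<in> {0<..}" for t y
    proof (rule has_vector_derivative_at_within)
      have "Complex t y \<in> UHP" using that by (simp add: inU)
      from vline_derivative[OF sd[OF px this]]
      show "((\<lambda>y. pdx f (Complex t y)) has_vector_derivative pdy (pdx f) (Complex t y)) (at y)" .
    qed
    have L2: "(\<lambda>u. pdx f (Complex u y)) integrable_on cbox x0 x" if "y \<in> {0<..}" for y
      using that conth[OF px, of y x0 x] by (simp add: integrable_continuous_real)
    have L3: "continuous_on ({0<..} \<times> cbox x0 x) (\<lambda>(y, u). pdy (pdx f) (Complex u y))"
      unfolding cbox_interval by (rule cont[OF pyx])
    have "((\<lambda>y. integral (cbox x0 x) (\<lambda>u. pdx f (Complex u y))) has_vector_derivative
        integral (cbox x0 x) (\<lambda>u. pdy (pdx f) (Complex u y0))) (at y0 within {0<..})"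
      using leibniz_rule_vector_derivative[where f = "\<lambda>y u. pdx f (Complex u y)" and fx = "\<lambda>y u. pdy (pdx f) (Complex u y)", OF L1 L2 L3, of y0] y0
      by simp
    moreover have "((\<lambda>y. integral (cbox x0 x) (\<lambda>u. pdx f (Complex u y))) has_vector_derivative
       (pdy f (Complex x y0) - pdy f (Complex x0 y0))) (at y0 within {0<..})"
    proof -
      have vd: "((\<lambda>y. f (Complex x y)) has_vector_derivative pdy f (Complex x y0)) (at y0)" for x
        by (rule vline_derivative[OF sd[OF f]]) (simp add: inU y0)
      have "((\<lambda>y. f (Complex x y) - f (Complex x0 y)) has_vector_derivative (pdy f (Complex x y0) - pdy f (Complex x0 y0))) (at y0 within {0<..})"
        by (rule has_vector_derivative_at_within[OF has_vector_derivative_diff[OF vd vd]])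
      thus ?thesis
        by (rule has_vector_derivative_transform[rotated 2]) (use A x y0 in auto)
    qed
    moreover have "at y0 within {0<..} = at y0" using y0 by (intro at_within_open) auto
    ultimately have "pdy f (Complex x y0) - pdy f (Complex x0 y0) = integral (cbox x0 x) (\<lambda>u. pdy (pdx f) (Complex u y0))"
      by (simp only:) (erule (1) vector_derivative_unique_at[symmetric])
    thus ?thesis by simp
  qed
  have "((\<lambda>x. integral {x0..x} (\<lambda>u. pdy (pdx f) (Complex u y0))) has_vector_derivative pdy (pdx f) (Complex x0 y0)) (at x0 within {x0..x0+1})"
    by (rule integral_has_vector_derivative[OF conth[OF pyx y0]]) simp
  moreover have "((\<lambda>x. integral {x0..x} (\<lambda>u. pdy (pdx f) (Complex u y0))) has_vector_derivative pdx (pdy f) (Complex x0 y0)) (at x0 within {x0..x0+1})"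
  proof -
    have hd: "((\<lambda>x. pdy f (Complex x y0)) has_vector_derivative pdx (pdy f) (Complex x0 y0)) (at x0)"
      by (rule hline_derivative[OF sd[OF py]]) (simp add: inU y0)
    have "((\<lambda>x. pdy f (Complex x y0) - pdy f (Complex x0 y0)) has_vector_derivative (pdx (pdy f) (Complex x0 y0) - 0)) (at x0 within {x0..x0+1})"
      by (rule has_vector_derivative_at_within[OF has_vector_derivative_diff[OF hd has_vector_derivative_const]])
    hence "((\<lambda>x. pdy f (Complex x y0) - pdy f (Complex x0 y0)) has_vector_derivative pdx (pdy f) (Complex x0 y0)) (at x0 within {x0..x0+1})"
      by simp
    thus ?thesis
      by (rule has_vector_derivative_transform[rotated 2]) (use B in auto)
  qed
  ultimately have "pdx (pdy f) (Complex x0 y0) = pdy (pdx f) (Complex x0 y0)"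
    using vector_derivative_unique_within[where x = x0 and S = "{x0..x0+1}"] at_within_Icc_at_right[of x0 "x0+1"]
    by (metis less_add_one trivial_limit_at_right_real)
  thus ?thesis by (simp only: z0)
qed

text \<open>Up to a constant this is the Maass lowering operator, here from weight 2 to weight
  0.\<close>

definition lowering :: "(complex \<Rightarrow> complex) \<Rightarrow> complex \<Rightarrow> complex" where
  "lowering f z = (of_real (Im z))\<^sup>2 * dzb f z"

lemma smooth_const_mult_add: "smooth_UHP f \<Longrightarrow> smooth_UHP g \<Longrightarrow> smooth_UHP (\<lambda>z. a * f z + b * g z)"
  by (intro smooth_add smooth_cmult)

lemma smooth_dz: "smooth_UHP f \<Longrightarrow> smooth_UHP (dz f)"
  by (rule smooth_cong[OF smooth_const_mult_add[of "pdx f" "pdy f" "1/2" "-\<i>/2"]])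
     (auto intro: smooth_pd simp: dz_def field_simps)

lemma smooth_dzb: "smooth_UHP f \<Longrightarrow> smooth_UHP (dzb f)"
  by (rule smooth_cong[OF smooth_const_mult_add[of "pdx f" "pdy f" "1/2" "\<i>/2"]])
     (auto intro: smooth_pd simp: dzb_def field_simps)

lemma smooth_lowering: "smooth_UHP f \<Longrightarrow> smooth_UHP (lowering f)"
  by (rule smooth_cong[OF smooth_Im_mult[OF smooth_Im_mult[OF smooth_dzb]]])
     (auto simp: lowering_def power2_eq_square)

lemma wirtinger_lowering:
  assumes "smooth_UHP f" "z \<in> UHP"
  shows "has_wirtinger (lowering f) ((of_real (Im z))\<^sup>2 * dz (dzb f) z - \<i> * of_real (Im z) * dzb f z)
           ((of_real (Im z))\<^sup>2 * dzb (dzb f) z + \<i> * of_real (Im z) * dzb f z) z"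
proof -
  have l: "lowering f = (\<lambda>z. (of_real (Im z) * of_real (Im z)) * dzb f z)"
    by (auto simp: lowering_def power2_eq_square)
  show ?thesis
    using has_wirtinger_mult[OF has_wirtinger_mult[OF has_wirtinger_Im has_wirtinger_Im] smooth_wirtinger[OF smooth_dzb[OF assms(1)] assms(2)]]
    unfolding l by (simp add: power2_eq_square field_simps)
qed

text \<open>Since dy/dz = 1 / (2i), the derivative of y^2 contributes -i y, and 4 times this is the
  first-order term of the Laplacian precisely in weight 2. In the second-order part the mixed
  partials cancel.\<close>

lemma hyp_lap_eq:
  assumes f: "smooth_UHP f" and z: "z \<in> UHP"
  shows "hyp_lap 2 f z = 4 * dz (lowering f) z"
proof -
  have e: "dzb f = (\<lambda>z. (1/2) * pdx f z + (\<i>/2) * pdy f z)"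
    by (auto simp: dzb_def field_simps)
  have "has_wirtinger (dzb f) ((1/2) * dz (pdx f) z + (\<i>/2) * dz (pdy f) z) ((1/2) * dzb (pdx f) z + (\<i>/2) * dzb (pdy f) z) z"
    unfolding e by (intro has_wirtinger_add has_wirtinger_cmult smooth_wirtinger smooth_pd f z)
  hence d: "dz (dzb f) z = (1/2) * dz (pdx f) z + (\<i>/2) * dz (pdy f) z"
    by (rule has_wirtinger_imp)
  have l: "dz (lowering f) z = (of_real (Im z))\<^sup>2 * dz (dzb f) z - \<i> * of_real (Im z) * dzb f z"
    by (rule has_wirtinger_imp(2)[OF wirtinger_lowering[OF f z]])
  show ?thesis unfolding hyp_lap_def l d
    by (simp add: dz_def dzb_def mixed_partials[OF f z] field_simps)
qed

lemma smooth_hyp_lap: "smooth_UHP f \<Longrightarrow> smooth_UHP (hyp_lap 2 f)"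
  by (rule smooth_cong[OF smooth_cmult[OF smooth_dz[OF smooth_lowering]], of f 4]) (auto simp: hyp_lap_eq)

lemma dz_cong: "(\<And>z. z \<in> UHP \<Longrightarrow> f z = g z) \<Longrightarrow> z \<in> UHP \<Longrightarrow> dz f z = dz g z"
  and dzb_cong: "(\<And>z. z \<in> UHP \<Longrightarrow> f z = g z) \<Longrightarrow> z \<in> UHP \<Longrightarrow> dzb f z = dzb g z"
  using pd_cong[of f g z] by (auto simp: dz_def dzb_def)

lemma hyp_lap_cong:
  "(\<And>z. z \<in> UHP \<Longrightarrow> f z = g z) \<Longrightarrow> z \<in> UHP \<Longrightarrow> hyp_lap k f z = hyp_lap k g z"
  using pd_cong[of f g] pd_cong[of "pdx f" "pdx g"] pd_cong[of "pdy f" "pdy g"]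
  by (auto simp: hyp_lap_def)

lemma dzb_linear:
  assumes "smooth_UHP f" "smooth_UHP g" "z \<in> UHP"
  shows "dz (\<lambda>z. a * f z + b * g z) z = a * dz f z + b * dz g z"
    and "dzb (\<lambda>z. a * f z + b * g z) z = a * dzb f z + b * dzb g z"
  using has_wirtinger_imp(2,3)[OF has_wirtinger_add[OF has_wirtinger_cmult has_wirtinger_cmult, OF smooth_wirtinger smooth_wirtinger, OF assms(1,3) assms(2,3)]]
  by auto

lemma lowering_linear:
  assumes "smooth_UHP f" "smooth_UHP g" "z \<in> UHP"
  shows "lowering (\<lambda>z. a * f z + b * g z) z = a * lowering f z + b * lowering g z"
  unfolding lowering_def dzb_linear(2)[OF assms] by (simp add: algebra_simps)

lemma hyp_lap_linear:
  assumes "smooth_UHP f" "smooth_UHP g" "z \<in> UHP"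
  shows "hyp_lap 2 (\<lambda>z. a * f z + b * g z) z = a * hyp_lap 2 f z + b * hyp_lap 2 g z"
proof -
  have "hyp_lap 2 (\<lambda>z. a * f z + b * g z) z = 4 * dz (lowering (\<lambda>z. a * f z + b * g z)) z"
    by (intro hyp_lap_eq smooth_const_mult_add assms)
  also have "dz (lowering (\<lambda>z. a * f z + b * g z)) z = dz (\<lambda>z. a * lowering f z + b * lowering g z) z"
    by (intro dz_cong lowering_linear assms)
  also have "\<dots> = a * dz (lowering f) z + b * dz (lowering g) z"
    by (intro dzb_linear smooth_lowering assms)
  finally show ?thesis by (simp add: hyp_lap_eq[OF assms(1,3)] hyp_lap_eq[OF assms(2,3)] algebra_simps)
qed

section \<open>Invariance under the two generators of the modular group\<close>

definition inv_T :: "(complex \<Rightarrow> complex) \<Rightarrow> bool" where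
  "inv_T f \<longleftrightarrow> (\<forall>z\<in>UHP. f (z + 1) = f z)"

definition inv_S :: "nat \<Rightarrow> (complex \<Rightarrow> complex) \<Rightarrow> bool" where
  "inv_S k f \<longleftrightarrow> (\<forall>z\<in>UHP. f (- 1 / z) = z ^ k * f z)"

lemma UHP_shift [simp]: "z + 1 \<in> UHP \<longleftrightarrow> z \<in> UHP"
  by (simp add: UHP_def)

lemma UHP_nonzero: "z \<in> UHP \<Longrightarrow> z \<noteq> 0"
  by (auto simp: UHP_def)

lemma Im_inversion: "Im (- 1 / z) = Im z / (cmod z)\<^sup>2"
  by (simp add: Im_divide cmod_power2)

lemma UHP_inversion: "z \<in> UHP \<Longrightarrow> - 1 / z \<in> UHP"
  unfolding UHP_def mem_Collect_eq Im_inversion by (auto intro!: divide_pos_pos)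

lemma inv_T_derivs:
  assumes f: "smooth_UHP f" "inv_T f"
  shows "inv_T (dz f)" "inv_T (dzb f)" "inv_T (lowering f)"
proof -
  have *: "dz f (z + 1) = dz f z \<and> dzb f (z + 1) = dzb f z" if z: "z \<in> UHP" for z
  proof -
    have "has_wirtinger (\<lambda>z. f (z + 1)) (dz f (z + 1) * 1) (dzb f (z + 1) * cnj 1) z"
      by (rule has_wirtinger_compose[OF smooth_wirtinger[OF f(1)]]) (use z in \<open>auto intro!: derivative_eq_intros\<close>)
    from has_wirtinger_transform[OF this open_UHP z, of f] f(2)
    have "has_wirtinger f (dz f (z + 1) * 1) (dzb f (z + 1) * cnj 1) z"
      by (auto simp: inv_T_def)
    from has_wirtinger_imp(2,3)[OF this] show ?thesis by simp
  qed
  thus "inv_T (dz f)" "inv_T (dzb f)" "inv_T (lowering f)" by (auto simp: inv_T_def lowering_def)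
qed

text \<open>The chain rule differentiates f(-1/z); invariance replaces that function by z^k f(z)
  near z.\<close>

lemma inversion_derivs:
  assumes f: "smooth_UHP f" "inv_S k f" and z: "z \<in> UHP"
  shows "has_wirtinger (\<lambda>z. z ^ k * f z) (dz f (- 1 / z) / z\<^sup>2) (dzb f (- 1 / z) / (cnj z)\<^sup>2) z"
proof -
  have "has_wirtinger (\<lambda>z. f (- 1 / z)) (dz f (- 1 / z) * (1 / z\<^sup>2)) (dzb f (- 1 / z) * cnj (1 / z\<^sup>2)) z"
    by (rule has_wirtinger_compose[where \<phi> = "\<lambda>z. - 1 / z", OF smooth_wirtinger[OF f(1) UHP_inversion[OF z]]])
       (use UHP_nonzero[OF z] in \<open>auto intro!: derivative_eq_intros simp: power2_eq_square\<close>)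
  from has_wirtinger_transform[OF this open_UHP z, of "\<lambda>z. z ^ k * f z"] f(2)
  show ?thesis by (auto simp: inv_S_def)
qed

text \<open>The holomorphic factor z^2 passes through d/dzbar. The remaining |z|^4 = z^2 (cnj z)^2
  cancels against the square of Im(-1/z) = y / |z|^2.\<close>

lemma inv_S_lowering:
  assumes f: "smooth_UHP f" "inv_S 2 f"
  shows "inv_S 0 (lowering f)"
  unfolding inv_S_def
proof
  fix z assume z: "z \<in> UHP"
  note nz = UHP_nonzero[OF z]
  have "((\<lambda>z. z ^ 2) has_field_derivative 2 * z) (at z)" by (auto intro!: derivative_eq_intros)
  from has_wirtinger_mult[OF has_wirtinger_field[OF this] smooth_wirtinger[OF f(1) z]]
  have "dzb (\<lambda>z. z ^ 2 * f z) z = z\<^sup>2 * dzb f z"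
    by (auto dest: has_wirtinger_imp)
  hence e: "dzb f (- 1 / z) = z\<^sup>2 * (cnj z)\<^sup>2 * dzb f z"
    using has_wirtinger_imp(3)[OF inversion_derivs[OF f z]] nz by (simp add: field_simps)
  have "(complex_of_real ((cmod z)\<^sup>2))\<^sup>2 = z\<^sup>2 * (cnj z)\<^sup>2"
    by (simp only: complex_norm_square power_mult_distrib)
  hence "(complex_of_real (Im z / (cmod z)\<^sup>2))\<^sup>2 * (z\<^sup>2 * (cnj z)\<^sup>2) = (of_real (Im z))\<^sup>2"
    using nz by (simp add: power_divide field_simps)
  thus "lowering f (- 1 / z) = z ^ 0 * lowering f z"
    unfolding lowering_def Im_inversion e by (metis (no_types, lifting) mult.assoc mult_1 power_0)
qed

text \<open>In weight 0 there is no automorphy factor to differentiate, so d/dz raises the weight to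
  2.\<close>

lemma inv_S_dz:
  assumes f: "smooth_UHP f" "inv_S 0 f"
  shows "inv_S 2 (dz f)"
  unfolding inv_S_def
proof
  fix z assume z: "z \<in> UHP"
  have "dz f z = dz f (- 1 / z) / z\<^sup>2"
    using has_wirtinger_imp(2)[OF inversion_derivs[OF f z]] by simp
  thus "dz f (- 1 / z) = z\<^sup>2 * dz f z" using UHP_nonzero[OF z] by simp
qed

lemma hyp_lap_inv:
  assumes f: "smooth_UHP f"
  shows "inv_T f \<Longrightarrow> inv_T (hyp_lap 2 f)" "inv_S 2 f \<Longrightarrow> inv_S 2 (hyp_lap 2 f)"
proof -
  show "inv_T (hyp_lap 2 f)" if "inv_T f"
    using inv_T_derivs(1)[OF smooth_lowering[OF f] inv_T_derivs(3)[OF f that]]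
    by (simp add: inv_T_def hyp_lap_eq[OF f])
  show "inv_S 2 (hyp_lap 2 f)" if "inv_S 2 f"
    unfolding inv_S_def
  proof
    fix z assume z: "z \<in> UHP"
    show "hyp_lap 2 f (- 1 / z) = z\<^sup>2 * hyp_lap 2 f z"
      using inv_S_dz[OF smooth_lowering[OF f] inv_S_lowering[OF f that]] z
      unfolding hyp_lap_eq[OF f UHP_inversion[OF z]] hyp_lap_eq[OF f z] by (simp add: inv_S_def)
  qed
qed

lemma holomorphic_iff_dzb:
  assumes "smooth_UHP f"
  shows "f holomorphic_on UHP \<longleftrightarrow> (\<forall>z\<in>UHP. dzb f z = 0)"
proof
  assume "f holomorphic_on UHP"
  thus "\<forall>z\<in>UHP. dzb f z = 0"
    by (auto simp: holomorphic_on_open field_differentiable_def dest!: bspec has_wirtinger_field has_wirtinger_imp(3))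
next
  assume "\<forall>z\<in>UHP. dzb f z = 0"
  hence "(f has_field_derivative dz f z) (at z)" if "z \<in> UHP" for z
    using smooth_wirtinger[OF assms that] that by (simp add: has_wirtinger_field_iff)
  thus "f holomorphic_on UHP" by (auto simp: holomorphic_on_open)
qed

lemma holomorphic_cnj_of_dz:
  assumes "smooth_UHP f" "\<And>z. z \<in> UHP \<Longrightarrow> dz f z = 0"
  shows "(\<lambda>z. cnj (f z)) holomorphic_on UHP"
proof -
  have "((\<lambda>z. cnj (f z)) has_field_derivative cnj (dzb f z)) (at z)" if "z \<in> UHP" for z
    using has_wirtinger_cnj[OF smooth_wirtinger[OF assms(1) that]] assms(2)[OF that]
    by (simp add: has_wirtinger_field_iff)
  thus ?thesis by (auto simp: holomorphic_on_open)
qed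

section \<open>Forms of weak growth\<close>

text \<open>Moderate growth of \<open>f\<close> does not pass to its derivatives. What does pass is that each Fourier coefficient
is an iterated derivative of a polynomially bounded function, and this still excludes \<open>exp (\<mu> y)\<close> with \<open>\<mu> > 0\<close>.\<close>
definition weak_growth_order :: "nat \<Rightarrow> (real \<Rightarrow> complex) \<Rightarrow> bool" where
  "weak_growth_order N a \<longleftrightarrow> (\<exists>u C k Y. Y \<ge> 1 \<and> C \<ge> 0 \<and> (\<forall>i<N. \<forall>y>Y. (u i has_vector_derivative u (Suc i) y) (at y)) \<and>
     (\<forall>y>Y. u N y = a y) \<and> continuous_on {Y<..} (u 0) \<and> (\<forall>y>Y. norm (u 0 y) \<le> C * y ^ k))"

definition weak_growth :: "(real \<Rightarrow> complex) \<Rightarrow> bool" where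
  "weak_growth a \<longleftrightarrow> (\<exists>N. weak_growth_order N a)"

lemma weak_growth_orderI:
  assumes "Y \<ge> 1" "C \<ge> 0" "\<And>i y. i < N \<Longrightarrow> y > Y \<Longrightarrow> (u i has_vector_derivative u (Suc i) y) (at y)"
    "\<And>y. y > Y \<Longrightarrow> u N y = a y" "continuous_on {Y<..} (u 0)" "\<And>y. y > Y \<Longrightarrow> norm (u 0 y) \<le> C * y ^ k"
  shows "weak_growth_order N a"
  unfolding weak_growth_order_def using assms by blast

lemma weak_growth_orderE:
  assumes "weak_growth_order N a"
  obtains u C k Y where "Y \<ge> 1" "C \<ge> 0" "\<And>i y. i < N \<Longrightarrow> y > Y \<Longrightarrow> (u i has_vector_derivative u (Suc i) y) (at y)"
    "\<And>y. y > Y \<Longrightarrow> u N y = a y" "continuous_on {Y<..} (u 0)" "\<And>y. y > Y \<Longrightarrow> norm (u 0 y) \<le> C * y ^ k"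
  using assms unfolding weak_growth_order_def by blast

text \<open>The primitive starts at Y + 1, inside the open ray on which u is continuous. Integration
  costs one power of y.\<close>

lemma antiderivative_poly_growth:
  fixes u :: "real \<Rightarrow> complex"
  assumes Y: "Y \<ge> 1" and C: "C \<ge> 0" and cont: "continuous_on {Y<..} u" and bd: "\<And>y. y > Y \<Longrightarrow> norm (u y) \<le> C * y ^ k"
  obtains U where "\<And>y. y > Y + 1 \<Longrightarrow> (U has_vector_derivative u y) (at y)" "continuous_on {Y+1<..} U"
    "\<And>y. y > Y + 1 \<Longrightarrow> norm (U y) \<le> C * y ^ Suc k"
proof -
  define U where "U y = integral {Y + 1..y} u" for y
  have d: "(U has_vector_derivative u y) (at y)" if "y > Y + 1" for y
  proof -
    have "continuous_on {Y+1..y+1} u" by (rule continuous_on_subset[OF cont]) auto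
    from integral_has_vector_derivative[OF this, of y] that
    show ?thesis by (simp add: U_def[abs_def] at_within_Icc_at)
  qed
  have "norm (U y) \<le> C * y ^ Suc k" if y: "y > Y + 1" for y
  proof -
    have "norm (integral {Y+1..y} u) \<le> C * y ^ k * (y - (Y + 1))"
    proof (rule integral_bound)
      show "continuous_on {Y+1..y} u" by (rule continuous_on_subset[OF cont]) auto
      fix t assume t: "t \<in> {Y+1..y}"
      hence "norm (u t) \<le> C * t ^ k" by (intro bd) auto
      also have "\<dots> \<le> C * y ^ k" using t Y C by (intro mult_left_mono power_mono) auto
      finally show "norm (u t) \<le> C * y ^ k" .
    qed (use y in auto)
    also have "\<dots> \<le> C * y ^ k * y" using y Y C by (intro mult_left_mono) auto
    finally show ?thesis by (simp add: U_def mult_ac)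
  qed
  moreover have "continuous_on {Y+1<..} U"
    by (intro continuous_at_imp_continuous_on ballI has_vector_derivative_continuous[OF d]) auto
  ultimately show ?thesis using d that by blast
qed

text \<open>A primitive of \<open>u 0\<close> is put in front of the chain. In this way the orders
  of two functions can be equalised before the functions are added.\<close>

lemma weak_growth_order_Suc: "weak_growth_order N a \<Longrightarrow> weak_growth_order (Suc N) a"
proof (erule weak_growth_orderE)
  fix u C k Y
  assume Y: "Y \<ge> 1" "C \<ge> (0::real)" and d: "\<And>i y. i < N \<Longrightarrow> y > Y \<Longrightarrow> (u i has_vector_derivative u (Suc i) y) (at y)"
    and e: "\<And>y. y > Y \<Longrightarrow> u N y = a y" and c: "continuous_on {Y<..} (u 0)" and b: "\<And>y. y > Y \<Longrightarrow> norm (u 0 y) \<le> C * y ^ k"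
  obtain U where U: "\<And>y. y > Y + 1 \<Longrightarrow> (U has_vector_derivative u 0 y) (at y)" "continuous_on {Y+1<..} U"
    "\<And>y. y > Y + 1 \<Longrightarrow> norm (U y) \<le> C * y ^ Suc k"
    using antiderivative_poly_growth[OF Y c b] by blast
  show "weak_growth_order (Suc N) a"
  proof (rule weak_growth_orderI[where u = "\<lambda>i. case i of 0 \<Rightarrow> U | Suc j \<Rightarrow> u j" and Y = "Y + 1" and C = C and k = "Suc k"])
    fix i y assume "i < Suc N" "y > Y + 1"
    thus "((case i of 0 \<Rightarrow> U | Suc j \<Rightarrow> u j) has_vector_derivative (case Suc i of 0 \<Rightarrow> U | Suc j \<Rightarrow> u j) y) (at y)"
      using U(1) d by (cases i) auto
  qed (use Y e U in auto)
qed

lemma weak_growth_order_mono: "weak_growth_order N a \<Longrightarrow> N \<le> M \<Longrightarrow> weak_growth_order M a"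
  by (rule dec_induct[of N M "\<lambda>N. weak_growth_order N a"]) (auto intro: weak_growth_order_Suc)

lemma weak_growth_add: "weak_growth a \<Longrightarrow> weak_growth b \<Longrightarrow> weak_growth (\<lambda>y. a y + b y)"
proof -
  assume "weak_growth a" "weak_growth b"
  then obtain N M where "weak_growth_order N a" "weak_growth_order M b" by (auto simp: weak_growth_def)
  hence ab: "weak_growth_order (max N M) a" "weak_growth_order (max N M) b" by (auto intro: weak_growth_order_mono)
  define K where "K = max N M"
  from ab(1)[folded K_def] obtain u C k Y where u: "Y \<ge> 1" "C \<ge> 0" "\<And>i y. i < K \<Longrightarrow> y > Y \<Longrightarrow> (u i has_vector_derivative u (Suc i) y) (at y)"
    "\<And>y. y > Y \<Longrightarrow> u K y = a y" "continuous_on {Y<..} (u 0)" "\<And>y. y > Y \<Longrightarrow> norm (u 0 y) \<le> C * y ^ k"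
    by (rule weak_growth_orderE) blast
  from ab(2)[folded K_def] obtain v D l Z where v: "Z \<ge> 1" "D \<ge> 0" "\<And>i y. i < K \<Longrightarrow> y > Z \<Longrightarrow> (v i has_vector_derivative v (Suc i) y) (at y)"
    "\<And>y. y > Z \<Longrightarrow> v K y = b y" "continuous_on {Z<..} (v 0)" "\<And>y. y > Z \<Longrightarrow> norm (v 0 y) \<le> D * y ^ l"
    by (rule weak_growth_orderE) blast
  have "weak_growth_order K (\<lambda>y. a y + b y)"
  proof (rule weak_growth_orderI[where u = "\<lambda>i y. u i y + v i y" and Y = "max Y Z" and C = "C + D" and k = "max k l"])
    show "continuous_on {max Y Z<..} (\<lambda>y. u 0 y + v 0 y)"
      by (intro continuous_on_add continuous_on_subset[OF u(5)] continuous_on_subset[OF v(5)]) auto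
    fix y assume y: "y > max Y Z"
    have "norm (u 0 y + v 0 y) \<le> C * y ^ k + D * y ^ l"
      using u(6)[of y] v(6)[of y] y by (intro norm_triangle_mono) auto
    also have "\<dots> \<le> C * y ^ max k l + D * y ^ max k l"
      using u(1,2) v(1,2) y by (intro add_mono mult_left_mono power_increasing) auto
    finally show "norm (u 0 y + v 0 y) \<le> (C + D) * y ^ max k l" by (simp add: algebra_simps)
    fix i assume "i < K"
    thus "((\<lambda>y. u i y + v i y) has_vector_derivative u (Suc i) y + v (Suc i) y) (at y)"
      using y by (intro has_vector_derivative_add u v) auto
  qed (use u v in auto)
  thus ?thesis by (auto simp: weak_growth_def)
qed

lemma weak_growth_cmult: "weak_growth a \<Longrightarrow> weak_growth (\<lambda>y. c * a y)"
proof -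
  assume "weak_growth a"
  then obtain N where "weak_growth_order N a" by (auto simp: weak_growth_def)
  then obtain u C k Y where u: "Y \<ge> 1" "C \<ge> 0" "\<And>i y. i < N \<Longrightarrow> y > Y \<Longrightarrow> (u i has_vector_derivative u (Suc i) y) (at y)"
    "\<And>y. y > Y \<Longrightarrow> u N y = a y" "continuous_on {Y<..} (u 0)" "\<And>y. y > Y \<Longrightarrow> norm (u 0 y) \<le> C * y ^ k"
    by (rule weak_growth_orderE) blast
  have "weak_growth_order N (\<lambda>y. c * a y)"
  proof (rule weak_growth_orderI[where u = "\<lambda>i y. c * u i y" and Y = Y and C = "norm c * C" and k = k])
    show "continuous_on {Y<..} (\<lambda>y. c * u 0 y)" by (intro continuous_intros u)
    show "norm (c * u 0 y) \<le> norm c * C * y ^ k" if "y > Y" for y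
      using u(6)[OF that] by (simp add: norm_mult mult.assoc mult_left_mono)
    show "((\<lambda>y. c * u i y) has_vector_derivative c * u (Suc i) y) (at y)" if "i < N" "y > Y" for i y
      by (rule has_vector_derivative_mult_right[OF u(3)[OF that]])
  qed (use u in auto)
  thus ?thesis by (auto simp: weak_growth_def)
qed

lemma weak_growth_cong:
  assumes "weak_growth a" "\<And>y. y > R \<Longrightarrow> a y = b y" shows "weak_growth b"
proof -
  from assms(1) obtain N where "weak_growth_order N a" by (auto simp: weak_growth_def)
  then obtain u C k Y where u: "Y \<ge> 1" "C \<ge> 0" "\<And>i y. i < N \<Longrightarrow> y > Y \<Longrightarrow> (u i has_vector_derivative u (Suc i) y) (at y)"
    "\<And>y. y > Y \<Longrightarrow> u N y = a y" "continuous_on {Y<..} (u 0)" "\<And>y. y > Y \<Longrightarrow> norm (u 0 y) \<le> C * y ^ k"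
    by (rule weak_growth_orderE) blast
  have "weak_growth_order N b"
  proof (rule weak_growth_orderI[where u = u and Y = "max Y R" and C = C and k = k])
    show "continuous_on {max Y R<..} (u 0)" by (rule continuous_on_subset[OF u(5)]) auto
  qed (use u assms(2) in auto)
  thus ?thesis by (auto simp: weak_growth_def)
qed

lemma weak_growth_deriv:
  assumes "weak_growth a" "\<And>y. y > 0 \<Longrightarrow> (a has_vector_derivative b y) (at y)" shows "weak_growth b"
proof -
  from assms(1) obtain N where "weak_growth_order N a" by (auto simp: weak_growth_def)
  then obtain u C k Y where u: "Y \<ge> 1" "C \<ge> 0" "\<And>i y. i < N \<Longrightarrow> y > Y \<Longrightarrow> (u i has_vector_derivative u (Suc i) y) (at y)"
    "\<And>y. y > Y \<Longrightarrow> u N y = a y" "continuous_on {Y<..} (u 0)" "\<And>y. y > Y \<Longrightarrow> norm (u 0 y) \<le> C * y ^ k"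
    by (rule weak_growth_orderE) blast
  have "weak_growth_order (Suc N) b"
  proof (rule weak_growth_orderI[where u = "\<lambda>i. if i \<le> N then u i else b" and Y = Y and C = C and k = k])
    fix i y assume i: "i < Suc N" and y: "y > Y"
    have "(u N has_vector_derivative b y) (at y)"
      by (rule has_vector_derivative_transform_within_open[OF assms(2), of y "{Y<..}"]) (use y u in auto)
    thus "((if i \<le> N then u i else b) has_vector_derivative (if Suc i \<le> N then u (Suc i) else b) y) (at y)"
      using i u(3)[of i y] y by (cases "i = N") auto
  qed (use u in auto)
  thus ?thesis by (auto simp: weak_growth_def)
qed

text \<open>By Leibniz the N-th derivative of y u_0 is y u_N + N u_(N-1), and the second term,
  itself of weak growth, is subtracted again. The order is first raised to \<open>Suc M\<close>, so
  that u_(N-1) exists. At i = 0 the truncated index \<open>i - 1\<close> carries the factor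
  0.\<close>

lemma weak_growth_mult_y: "weak_growth a \<Longrightarrow> weak_growth (\<lambda>y. of_real y * a y)"
proof -
  assume "weak_growth a"
  then obtain M where "weak_growth_order M a" by (auto simp: weak_growth_def)
  define N where "N = Suc M"
  note N = N_def
  have "weak_growth_order N a" unfolding N_def by (rule weak_growth_order_Suc) fact
  then obtain u C k Y where u: "Y \<ge> 1" "C \<ge> 0" "\<And>i y. i < N \<Longrightarrow> y > Y \<Longrightarrow> (u i has_vector_derivative u (Suc i) y) (at y)"
    "\<And>y. y > Y \<Longrightarrow> u N y = a y" "continuous_on {Y<..} (u 0)" "\<And>y. y > Y \<Longrightarrow> norm (u 0 y) \<le> C * y ^ k"
    by (rule weak_growth_orderE) blast
  have 1: "weak_growth (u M)" unfolding weak_growth_def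
    by (rule exI[of _ M], rule weak_growth_orderI[where u = u and Y = Y and C = C and k = k]) (use u N in auto)
  have "weak_growth_order N (\<lambda>y. of_real y * u N y + of_nat N * u M y)"
  proof (rule weak_growth_orderI[where u = "\<lambda>i y. of_real y * u i y + of_nat i * u (i - 1) y" and Y = Y and C = C and k = "Suc k"])
    show "continuous_on {Y<..} (\<lambda>y. of_real y * u 0 y + of_nat 0 * u (0 - 1) y)"
      using u(5) by (auto intro!: continuous_intros)
    show "norm (of_real y * u 0 y + of_nat 0 * u (0 - 1) y) \<le> C * y ^ Suc k" if y: "y > Y" for y
      using mult_left_mono[OF u(6)[OF y], of y] u(1) y by (simp add: norm_mult mult_ac)
    fix i y assume i: "i < N" and y: "y > Y"
    have "((\<lambda>y. of_real y * u i y) has_vector_derivative of_real y * u (Suc i) y + of_real 1 * u i y) (at y)"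
      by (intro has_vector_derivative_mult has_vector_derivative_of_real u(3) i y) (auto intro!: derivative_eq_intros)
    moreover have "((\<lambda>y. of_nat i * u (i - 1) y) has_vector_derivative of_nat i * u i y) (at y)"
    proof (cases i)
      case (Suc j)
      thus ?thesis using u(3)[of j y] i y by (intro has_vector_derivative_mult_right) auto
    qed auto
    ultimately show "((\<lambda>y. of_real y * u i y + of_nat i * u (i - 1) y) has_vector_derivative
        of_real y * u (Suc i) y + of_nat (Suc i) * u (Suc i - 1) y) (at y)"
      by (drule_tac has_vector_derivative_add) (auto simp: algebra_simps)
  qed (use u N in auto)
  hence "weak_growth (\<lambda>y. of_real y * u N y + of_nat N * u M y)" by (auto simp: weak_growth_def)
  from weak_growth_add[OF this weak_growth_cmult[OF 1, of "- of_nat N"]]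
  have "weak_growth (\<lambda>y. of_real y * u N y)" by simp
  thus ?thesis by (rule weak_growth_cong[where R = Y]) (use u in auto)
qed

text \<open>Integrating i times turns c exp(\<mu> y) into c / \<mu>^i exp(\<mu> y) up to an error of
  polynomial size, by the mean value inequality. After N steps a polynomially bounded
  \<open>u 0\<close> is reached, which forces c = 0.\<close>

lemma weak_growth_exp_zero:
  fixes \<mu> :: real and c :: complex
  assumes w: "weak_growth (\<lambda>y. c * of_real (exp (\<mu> * y)))" and mu: "\<mu> > 0"
  shows "c = 0"
proof -
  from w obtain N where "weak_growth_order N (\<lambda>y. c * of_real (exp (\<mu> * y)))" by (auto simp: weak_growth_def)
  then obtain u C k Y where u: "Y \<ge> 1" "C \<ge> 0" "\<And>i y. i < N \<Longrightarrow> y > Y \<Longrightarrow> (u i has_vector_derivative u (Suc i) y) (at y)"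
    "\<And>y. y > Y \<Longrightarrow> u N y = c * of_real (exp (\<mu> * y))" "continuous_on {Y<..} (u 0)" "\<And>y. y > Y \<Longrightarrow> norm (u 0 y) \<le> C * y ^ k"
    by (rule weak_growth_orderE) blast
  have "\<exists>D\<ge>0. \<forall>y>Y+1. norm (u (N - i) y - c / of_real \<mu> ^ i * of_real (exp (\<mu> * y))) \<le> D * y ^ i" if "i \<le> N" for i
    using that
  proof (induction i)
    case 0
    thus ?case using u(4) by (intro exI[of _ 0]) auto
  next
    case (Suc i)
    then obtain D where D: "D \<ge> 0" "\<And>y. y > Y+1 \<Longrightarrow> norm (u (N - i) y - c / of_real \<mu> ^ i * of_real (exp (\<mu> * y))) \<le> D * y ^ i"
      by auto
    define p where "p y = u (N - Suc i) y - c / of_real \<mu> ^ Suc i * of_real (exp (\<mu> * y))" for y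
    have dp: "(p has_vector_derivative (u (N - i) y - c / of_real \<mu> ^ i * of_real (exp (\<mu> * y)))) (at y)" if y: "y > Y" for y
    proof -
      have "((\<lambda>y. exp (\<mu> * y)) has_real_derivative exp (\<mu> * y) * \<mu>) (at y)"
        by (auto intro!: derivative_eq_intros)
      from has_vector_derivative_mult_right[OF has_vector_derivative_of_real[OF this], of "c / of_real \<mu> ^ Suc i"]
      have 1: "((\<lambda>y. c / of_real \<mu> ^ Suc i * of_real (exp (\<mu> * y))) has_vector_derivative c / of_real \<mu> ^ i * of_real (exp (\<mu> * y))) (at y)"
        using mu by (simp add: field_simps)
      have "(u (N - Suc i) has_vector_derivative u (N - i) y) (at y)"
        using u(3)[of "N - Suc i" y] Suc.prems y by (simp add: Suc_diff_Suc)
      from has_vector_derivative_diff[OF this 1] show ?thesis by (simp add: p_def[abs_def])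
    qed
    have "norm (p y) \<le> (norm (p (Y+1)) + D) * y ^ Suc i" if y: "y > Y + 1" for y
    proof -
      have "\<exists>x\<in>{Y+1<..<y}. norm (p y - p (Y+1)) \<le> norm ((y - (Y+1)) *\<^sub>R (u (N - i) x - c / of_real \<mu> ^ i * of_real (exp (\<mu> * x))))"
      proof (rule mvt_general[OF y, where f = p and f' = "\<lambda>x h. h *\<^sub>R (u (N - i) x - c / of_real \<mu> ^ i * of_real (exp (\<mu> * x)))"])
        show "continuous_on {Y+1..y} p"
          by (intro continuous_at_imp_continuous_on ballI has_vector_derivative_continuous[OF dp]) auto
        show "(p has_derivative (\<lambda>h. h *\<^sub>R (u (N - i) x - c / of_real \<mu> ^ i * of_real (exp (\<mu> * x))))) (at x)" if "Y + 1 < x" for x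
          using dp[of x] that by (auto simp: has_vector_derivative_def)
      qed
      then obtain x where x: "Y + 1 < x" "x < y"
        and le: "norm (p y - p (Y+1)) \<le> norm ((y - (Y+1)) *\<^sub>R (u (N - i) x - c / of_real \<mu> ^ i * of_real (exp (\<mu> * x))))"
        by auto
      have "norm (u (N - i) x - c / of_real \<mu> ^ i * of_real (exp (\<mu> * x))) \<le> D * x ^ i" by (rule D(2)[OF x(1)])
      also have "\<dots> \<le> D * y ^ i" using D(1) x u(1) by (intro mult_left_mono power_mono) auto
      finally have "norm ((y - (Y+1)) *\<^sub>R (u (N - i) x - c / of_real \<mu> ^ i * of_real (exp (\<mu> * x)))) \<le> y * (D * y ^ i)"
        unfolding norm_scaleR using y u(1) by (intro mult_mono) auto
      with le have "norm (p y - p (Y+1)) \<le> D * y ^ Suc i" by (simp add: mult_ac)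
      moreover have "norm (p y) \<le> norm (p (Y+1)) + norm (p y - p (Y+1))" using norm_triangle_sub by blast
      moreover have "norm (p (Y+1)) * 1 \<le> norm (p (Y+1)) * y ^ Suc i" using y u(1) by (intro mult_left_mono one_le_power) auto
      ultimately show ?thesis by (simp add: algebra_simps)
    qed
    thus ?case using D(1) unfolding p_def by (intro exI[of _ "norm (p (Y+1)) + D"]) (auto simp: p_def)
  qed
  from this[of N] obtain D where D: "D \<ge> 0" "\<And>y. y > Y+1 \<Longrightarrow> norm (u 0 y - c / of_real \<mu> ^ N * of_real (exp (\<mu> * y))) \<le> D * y ^ N"
    by auto
  \<comment> \<open>One power more than the polynomial bounds contain, so that the quotient decays
    like K / y.\<close>
  define M where "M = Suc (max k N)"
  define K where "K = (C + D) * fact M / \<mu> ^ M"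
  have K0: "K \<ge> 0" using u(2) D(1) mu by (simp add: K_def)
  have main: "norm c / \<mu> ^ N \<le> K / y" if y: "y > Y + 1" for y
  proof -
    have y1: "y \<ge> 1" "y > 0" using y u(1) by auto
    have "norm (c / of_real \<mu> ^ N * of_real (exp (\<mu> * y))) \<le> norm (u 0 y) + norm (u 0 y - c / of_real \<mu> ^ N * of_real (exp (\<mu> * y)))"
      by (metis norm_minus_commute norm_triangle_sub)
    also have "\<dots> \<le> C * y ^ k + D * y ^ N" using u(6)[of y] D(2)[OF y] y by (intro add_mono) auto
    also have "\<dots> \<le> C * y ^ max k N + D * y ^ max k N"
      using u(2) D(1) y1 by (intro add_mono mult_left_mono power_increasing) auto
    finally have "norm c / \<mu> ^ N * exp (\<mu> * y) \<le> (C + D) * y ^ max k N"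
      using mu by (simp add: norm_mult norm_divide norm_power algebra_simps)
    hence "norm c / \<mu> ^ N \<le> (C + D) * y ^ max k N * exp (-(\<mu> * y))"
      by (simp add: exp_minus field_simps)
    also have "\<dots> \<le> (C + D) * y ^ max k N * (fact M / (\<mu> * y) ^ M)"
      using u(2) D(1) y1 mu by (intro mult_left_mono exp_minus_le) auto
    also have "\<dots> = K / y" using y1 mu by (simp add: K_def M_def power_mult_distrib field_simps)
    finally show ?thesis .
  qed
  show "c = 0"
  proof (rule ccontr)
    assume "c \<noteq> 0"
    define e where "e = norm c / \<mu> ^ N"
    have e: "e > 0" using \<open>c \<noteq> 0\<close> mu by (simp add: e_def)
    define y where "y = Y + 2 + K / e"
    have "K / e \<ge> 0" using K0 e by simp
    hence y: "y > Y + 1" "y > K / e" "y > 0" using u(1) by (auto simp: y_def)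
    have "e * y \<le> K" using main[OF y(1)] y(3) by (simp add: e_def[symmetric] field_simps)
    moreover have "e * y > K" using y(2) e by (simp add: field_simps)
    ultimately show False by simp
  qed
qed

section \<open>Fourier modes on horizontal lines\<close>

definition fourier_mode :: "int \<Rightarrow> (complex \<Rightarrow> complex) \<Rightarrow> real \<Rightarrow> complex" where
  "fourier_mode n f y = fcoeff (\<lambda>x. f (Complex x y)) n"

lemma UHP_Complex [simp]: "Complex x y \<in> UHP \<longleftrightarrow> y > 0"
  by (simp add: UHP_def)

lemma continuous_hline: "smooth_UHP f \<Longrightarrow> y > 0 \<Longrightarrow> continuous_on S (\<lambda>x. f (Complex x y))"
  by (rule continuous_on_compose2[OF smooth_continuous]) (auto intro!: continuous_on_Complex continuous_on_id continuous_on_const)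

lemma fourier_mode_linear:
  assumes "smooth_UHP f" "smooth_UHP g" "y > 0"
  shows "fourier_mode n (\<lambda>z. a * f z + b * g z) y = a * fourier_mode n f y + b * fourier_mode n g y"
  unfolding fourier_mode_def fcoeff_add[OF continuous_hline[OF smooth_cmult[OF assms(1)] assms(3)] continuous_hline[OF smooth_cmult[OF assms(2)] assms(3)]]
    fcoeff_mult ..

lemma fourier_mode_has_derivative:
  assumes f: "smooth_UHP f" and y: "y > 0"
  shows "(fourier_mode n f has_vector_derivative fourier_mode n (pdy f) y) (at y)"
proof -
  define e where "e u = cis (-(2 * pi * of_int n * u))" for u
  have ce: "continuous_on S e" for S unfolding e_def by (intro continuous_intros)
  have L1: "((\<lambda>y. f (Complex t y) * e t) has_vector_derivative pdy f (Complex t y) * e t) (at y within {0<..})"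
    if "y \<in> {0<..}" for t y
    using that by (intro has_vector_derivative_at_within[OF has_vector_derivative_mult_left[OF vline_derivative]] smooth_differentiable[OF f]) simp
  have L2: "(\<lambda>u. f (Complex u y) * e u) integrable_on cbox 0 1" if "y \<in> {0<..}" for y
    using integrable_continuous_real[OF continuous_on_mult[OF continuous_hline[OF f] ce], of y 0 1] that by simp
  have c1: "continuous_on ({0<..} \<times> cbox 0 1) (\<lambda>p. pdy f (Complex (snd p) (fst p)))"
    by (rule continuous_on_compose2[OF smooth_continuous[OF smooth_pd(2)[OF f]]],
        intro continuous_on_Complex continuous_on_fst continuous_on_snd continuous_on_id) auto
  have c2: "continuous_on ({0<..} \<times> cbox 0 1) (\<lambda>p. e (snd p))"
    by (rule continuous_on_compose2[OF ce[of UNIV] continuous_on_snd[OF continuous_on_id]]) simp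
  have L3: "continuous_on ({0<..} \<times> cbox 0 1) (\<lambda>(y, u). pdy f (Complex u y) * e u)"
    unfolding split_beta by (rule continuous_on_mult[OF c1 c2])
  have "((\<lambda>y. integral (cbox 0 1) (\<lambda>u. f (Complex u y) * e u)) has_vector_derivative
        integral (cbox 0 1) (\<lambda>u. pdy f (Complex u y) * e u)) (at y within {0<..})"
    using leibniz_rule_vector_derivative[where f = "\<lambda>y u. f (Complex u y) * e u" and fx = "\<lambda>y u. pdy f (Complex u y) * e u", OF L1 L2 L3, of y] y
    by simp
  moreover have "at y within {0<..} = at y" using y by (intro at_within_open) auto
  ultimately show ?thesis by (simp add: fourier_mode_def[abs_def] fcoeff_def e_def)
qed

text \<open>Integration by parts; the boundary terms cancel because f and the character are both
  1-periodic.\<close>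

lemma fourier_mode_pdx:
  assumes f: "smooth_UHP f" "inv_T f" and y: "y > 0"
  shows "fourier_mode n (pdx f) y = 2 * pi * \<i> * of_int n * fourier_mode n f y"
proof -
  define e where "e u = cis (-(2 * pi * of_int n * u))" for u
  define c where "c = 2 * pi * \<i> * of_int n"
  have de: "(e has_vector_derivative - c * e u) (at u)" for u
  proof -
    have "((\<lambda>z. exp (- c * z)) has_field_derivative - c * exp (- c * of_real u)) (at (of_real u))"
      by (auto intro!: derivative_eq_intros)
    from has_vector_derivative_real_field[OF this]
    show ?thesis by (simp add: e_def[abs_def] c_def cis_conv_exp mult_ac)
  qed
  have ce: "continuous_on S e" for S unfolding e_def by (intro continuous_intros)
  have d: "((\<lambda>u. f (Complex u y) * e u) has_vector_derivative f (Complex u y) * (- c * e u) + pdx f (Complex u y) * e u) (at u)" for u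
    by (intro has_vector_derivative_mult de hline_derivative smooth_differentiable[OF f(1)]) (use y in simp)
  have "((\<lambda>u. f (Complex u y) * (- c * e u) + pdx f (Complex u y) * e u) has_integral
      (f (Complex 1 y) * e 1 - f (Complex 0 y) * e 0)) {0..1}"
    by (rule fundamental_theorem_of_calculus) (simp, rule has_vector_derivative_at_within[OF d])
  moreover have "f (Complex 1 y) = f (Complex 0 y)"
  proof -
    have "Complex 0 y + 1 = Complex 1 y" by (simp add: complex_eq_iff)
    moreover have "f (Complex 0 y + 1) = f (Complex 0 y)" using f(2) y by (simp add: inv_T_def)
    ultimately show ?thesis by simp
  qed
  moreover have "e 1 = 1" unfolding e_def using cis_multiple_2pi[of "of_int (-n)"] by simp
  moreover have "e 0 = 1" by (simp add: e_def)
  ultimately have "integral {0..1} (\<lambda>u. f (Complex u y) * (- c * e u) + pdx f (Complex u y) * e u) = 0"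
    by (simp add: integral_unique)
  moreover have "integral {0..1} (\<lambda>u. f (Complex u y) * (- c * e u) + pdx f (Complex u y) * e u)
     = integral {0..1} (\<lambda>u. f (Complex u y) * (- c * e u)) + integral {0..1} (\<lambda>u. pdx f (Complex u y) * e u)"
    by (rule integral_add; rule integrable_continuous_real; rule continuous_on_mult)
       (rule continuous_hline[OF f(1) y] continuous_hline[OF smooth_pd(1)[OF f(1)] y] ce continuous_on_mult[OF continuous_on_const ce])+
  moreover have "integral {0..1} (\<lambda>u. f (Complex u y) * (- c * e u)) = - c * integral {0..1} (\<lambda>u. f (Complex u y) * e u)"
    by (subst integral_mult_right[symmetric]) (simp add: mult_ac)
  ultimately show ?thesis by (simp add: fourier_mode_def fcoeff_def e_def c_def)
qed

lemma fourier_mode_dz: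
  assumes f: "smooth_UHP f" "inv_T f" and y: "y > 0"
  shows "fourier_mode n (dz f) y = (1/2) * (2 * pi * \<i> * of_int n * fourier_mode n f y - \<i> * fourier_mode n (pdy f) y)"
    "fourier_mode n (dzb f) y = (1/2) * (2 * pi * \<i> * of_int n * fourier_mode n f y + \<i> * fourier_mode n (pdy f) y)"
proof -
  have "dz f = (\<lambda>z. (1/2) * pdx f z + (-\<i>/2) * pdy f z)" "dzb f = (\<lambda>z. (1/2) * pdx f z + (\<i>/2) * pdy f z)"
    by (auto simp: dz_def dzb_def field_simps)
  thus "fourier_mode n (dz f) y = (1/2) * (2 * pi * \<i> * of_int n * fourier_mode n f y - \<i> * fourier_mode n (pdy f) y)"
    "fourier_mode n (dzb f) y = (1/2) * (2 * pi * \<i> * of_int n * fourier_mode n f y + \<i> * fourier_mode n (pdy f) y)"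
    by (simp_all only: fourier_mode_linear[OF smooth_pd[OF f(1)] y] fourier_mode_pdx[OF f y]) (simp_all add: field_simps)
qed

lemma fourier_mode_lowering:
  assumes f: "smooth_UHP f" "inv_T f" and y: "y > 0"
  shows "fourier_mode n (lowering f) y = of_real y * (of_real y * fourier_mode n (dzb f) y)"
proof -
  have "lowering f (Complex x y) = of_real y ^ 2 * dzb f (Complex x y)" for x by (simp add: lowering_def)
  thus ?thesis by (simp add: fourier_mode_def fcoeff_mult power2_eq_square mult.assoc)
qed

text \<open>On the n-th mode d/dx is multiplication by 2 pi i n and d/dy is the derivative in y.
  Both preserve weak growth, and so does multiplication by y.\<close>

lemma weak_growth_dz_dzb_lowering:
  assumes f: "smooth_UHP f" "inv_T f" and w: "\<And>n. weak_growth (fourier_mode n f)"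
  shows "weak_growth (fourier_mode n (dz f))" "weak_growth (fourier_mode n (dzb f))" "weak_growth (fourier_mode n (lowering f))"
proof -
  have d: "weak_growth (fourier_mode n (pdy f))" by (rule weak_growth_deriv[OF w[of n]]) (rule fourier_mode_has_derivative[OF f(1)])
  have 1: "weak_growth (\<lambda>y. (pi * \<i> * of_int n) * fourier_mode n f y + (-\<i>/2) * fourier_mode n (pdy f) y)"
          "weak_growth (\<lambda>y. (pi * \<i> * of_int n) * fourier_mode n f y + (\<i>/2) * fourier_mode n (pdy f) y)"
    by (intro weak_growth_add weak_growth_cmult w d)+
  show "weak_growth (fourier_mode n (dz f))" by (rule weak_growth_cong[OF 1(1), where R = 0]) (simp add: fourier_mode_dz[OF f] field_simps)
  show 2: "weak_growth (fourier_mode n (dzb f))" by (rule weak_growth_cong[OF 1(2), where R = 0]) (simp add: fourier_mode_dz[OF f] field_simps)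
  show "weak_growth (fourier_mode n (lowering f))" by (rule weak_growth_cong[OF weak_growth_mult_y[OF weak_growth_mult_y[OF 2]], where R = 0]) (simp add: fourier_mode_lowering[OF f])
qed

text \<open>What survives of a form of moderate growth under repeated Laplacians: the growth
  condition is put on each Fourier mode instead of on f.\<close>

definition weak_form :: "(complex \<Rightarrow> complex) \<Rightarrow> bool" where
  "weak_form f \<longleftrightarrow> smooth_UHP f \<and> inv_T f \<and> inv_S 2 f \<and> (\<forall>n. weak_growth (fourier_mode n f))"

lemma weak_form_hyp_lap:
  assumes "weak_form f" shows "weak_form (hyp_lap 2 f)"
proof -
  have f: "smooth_UHP f" "inv_T f" "inv_S 2 f" "\<And>n. weak_growth (fourier_mode n f)" using assms by (auto simp: weak_form_def)
  note l = smooth_lowering[OF f(1)] inv_T_derivs(3)[OF f(1,2)] weak_growth_dz_dzb_lowering(3)[OF f(1,2,4)]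
  have "weak_growth (fourier_mode n (hyp_lap 2 f))" for n
  proof (rule weak_growth_cong[where R = 0, OF weak_growth_cmult[where c = 4, OF weak_growth_dz_dzb_lowering(1)[OF l]]])
    fix y :: real assume "y > 0"
    hence "hyp_lap 2 f (Complex x y) = 4 * dz (lowering f) (Complex x y)" for x by (intro hyp_lap_eq f) simp
    thus "4 * fourier_mode n (dz (lowering f)) y = fourier_mode n (hyp_lap 2 f) y" by (simp add: fourier_mode_def fcoeff_mult)
  qed
  thus ?thesis using smooth_hyp_lap hyp_lap_inv f by (auto simp: weak_form_def)
qed

lemma weak_form_iterate: "weak_form f \<Longrightarrow> weak_form ((hyp_lap 2 ^^ m) f)"
  by (induction m) (auto intro: weak_form_hyp_lap)

lemma weak_form_linear:
  assumes "weak_form f" "weak_form g"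
  shows "weak_form (\<lambda>z. a * f z + b * g z)"
proof -
  have f: "smooth_UHP f" "inv_T f" "inv_S 2 f" "\<And>n. weak_growth (fourier_mode n f)" using assms by (auto simp: weak_form_def)
  have g: "smooth_UHP g" "inv_T g" "inv_S 2 g" "\<And>n. weak_growth (fourier_mode n g)" using assms by (auto simp: weak_form_def)
  have "weak_growth (\<lambda>y. a * fourier_mode n f y + b * fourier_mode n g y)" for n by (intro weak_growth_add weak_growth_cmult f g)
  hence "weak_growth (fourier_mode n (\<lambda>z. a * f z + b * g z))" for n
    by (rule weak_growth_cong[where R = 0]) (simp add: fourier_mode_linear f g)
  thus ?thesis using f g by (auto simp: weak_form_def smooth_const_mult_add inv_T_def inv_S_def algebra_simps)
qed

lemma fourier_mode_bound:
  assumes "smooth_UHP f" "y > 0" "\<And>x. norm (f (Complex x y)) \<le> B"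
  shows "norm (fourier_mode n f y) \<le> B"
proof -
  have "norm (integral {0..1} (\<lambda>x. f (Complex x y) * cis (-(2 * pi * of_int n * x)))) \<le> B * (1 - 0)"
  proof (rule integral_bound)
    show "continuous_on {0..1} (\<lambda>x. f (Complex x y) * cis (-(2 * pi * of_int n * x)))"
      by (intro continuous_on_mult continuous_hline assms(1,2) continuous_on_cis_mult continuous_on_minus continuous_on_const continuous_on_id)
    show "norm (f (Complex x y) * cis (-(2 * pi * of_int n * x))) \<le> B" for x
      using assms(3)[of x] by (simp add: norm_mult)
  qed simp
  thus ?thesis by (simp add: fourier_mode_def fcoeff_def)
qed

lemma weak_form_base:
  assumes "f \<in> base_forms 2" shows "weak_form f"
proof -
  have f: "smooth_UHP f" "modular_weight 2 f" "moderate_growth f" using assms by (auto simp: base_forms_def)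
  have "f (z + 1) = f z" if "z \<in> UHP" for z
    using f(2)[unfolded modular_weight_def, rule_format, of 1 1 1 0 z] that by simp
  hence T: "inv_T f" by (simp add: inv_T_def)
  have "f (- 1 / z) = z\<^sup>2 * f z" if "z \<in> UHP" for z
    using f(2)[unfolded modular_weight_def, rule_format, of 0 0 "-1" 1 z] that by simp
  hence S: "inv_S 2 f" by (simp add: inv_S_def)
  obtain \<alpha> C Y where g: "\<And>x y. y \<ge> Y \<Longrightarrow> y > 0 \<Longrightarrow> norm (f (Complex x y)) \<le> C * y powr \<alpha>"
    using f(3) unfolding moderate_growth_def by blast
  have "weak_growth (fourier_mode n f)" for n unfolding weak_growth_def
  proof (rule exI[of _ 0], rule weak_growth_orderI[where u = "\<lambda>_. fourier_mode n f" and Y = "max 1 Y" and C = "\<bar>C\<bar>" and k = "nat \<lceil>\<alpha>\<rceil>"])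
    show "continuous_on {max 1 Y<..} (fourier_mode n f)"
      by (intro continuous_at_imp_continuous_on ballI has_vector_derivative_continuous[OF fourier_mode_has_derivative[OF f(1)]]) auto
    fix y assume y: "y > max 1 Y"
    have "norm (fourier_mode n f y) \<le> C * y powr \<alpha>" by (rule fourier_mode_bound[OF f(1)]) (use y g in auto)
    also have "\<dots> \<le> \<bar>C\<bar> * y powr (real (nat \<lceil>\<alpha>\<rceil>))"
      using y by (intro mult_mono powr_mono) (auto intro: real_nat_ceiling_ge)
    finally show "norm (fourier_mode n f y) \<le> \<bar>C\<bar> * y ^ nat \<lceil>\<alpha>\<rceil>" using y by (simp add: powr_realpow)
  qed auto
  thus ?thesis using f(1) T S by (simp add: weak_form_def)
qed

lemma holomorphic_pd:
  assumes "f holomorphic_on UHP" "z \<in> UHP"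
  shows "pdx f z = deriv f z" "pdy f z = \<i> * deriv f z" "f differentiable (at z)"
proof -
  have "(f has_field_derivative deriv f z) (at z)"
    using assms by (simp add: holomorphic_derivI)
  from has_wirtinger_imp[OF has_wirtinger_field[OF this]]
  show "pdx f z = deriv f z" "pdy f z = \<i> * deriv f z" "f differentiable (at z)" by simp_all
qed

lemma holomorphic_smooth:
  assumes "f holomorphic_on UHP" shows "smooth_UHP f"
proof (rule smooth_coinduct[where P = "\<lambda>f. f holomorphic_on UHP"])
  fix f assume f: "f holomorphic_on UHP"
  show "f differentiable (at z)" if "z \<in> UHP" for z by (rule holomorphic_pd(3)[OF f that])
  have d: "deriv f holomorphic_on UHP" by (rule holomorphic_deriv[OF f open_UHP])
  show "pdx f holomorphic_on UHP"
    by (rule holomorphic_transform[OF d]) (simp add: holomorphic_pd[OF f])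
  have "(\<lambda>z. \<i> * deriv f z) holomorphic_on UHP" by (intro holomorphic_on_mult holomorphic_on_const d)
  thus "pdy f holomorphic_on UHP"
    by (rule holomorphic_transform) (simp add: holomorphic_pd[OF f])
qed (rule assms)

text \<open>The Cauchy-Riemann equations turn d/dy into i d/dx, so the mode solves u' = -2 pi n u.
  The solution is normalised at y = 1.\<close>

lemma fourier_mode_holomorphic:
  assumes f: "f holomorphic_on UHP" "inv_T f" and y: "y > 0"
  shows "fourier_mode n f y = fourier_mode n f 1 * of_real (exp (2 * pi * of_int n)) * of_real (exp (-(2 * pi * of_int n) * y))"
proof -
  note sf = holomorphic_smooth[OF f(1)]
  define w where "w = 2 * pi * of_int n"
  define g where "g y = of_real (exp (w * y)) * fourier_mode n f y" for y
  have pdy: "fourier_mode n (pdy f) y = - w * fourier_mode n f y" if "y > 0" for y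
  proof -
    have "pdy f (Complex x y) = \<i> * pdx f (Complex x y)" for x
      using holomorphic_pd[OF f(1), of "Complex x y"] that by simp
    hence "fourier_mode n (pdy f) y = \<i> * fourier_mode n (pdx f) y" by (simp add: fourier_mode_def fcoeff_mult)
    also have "fourier_mode n (pdx f) y = 2 * pi * \<i> * of_int n * fourier_mode n f y" by (rule fourier_mode_pdx[OF sf f(2) that])
    also have "\<i> * (2 * pi * \<i> * of_int n * X) = complex_of_real (- w) * X" for X
      unfolding w_def by simp
    finally show ?thesis .
  qed
  have dg: "(g has_derivative (\<lambda>h. 0)) (at y within {0<..})" if "y \<in> {0<..}" for y
  proof -
    have "((\<lambda>y. exp (w * y)) has_real_derivative exp (w * y) * w) (at y)" by (auto intro!: derivative_eq_intros)
    hence 1: "((\<lambda>y. complex_of_real (exp (w * y))) has_vector_derivative of_real (exp (w * y) * w)) (at y)"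
      by (rule has_vector_derivative_of_real)
    have 2: "(fourier_mode n f has_vector_derivative - w * fourier_mode n f y) (at y)"
      using fourier_mode_has_derivative[OF sf, of y n] that by (simp add: pdy)
    have "((\<lambda>y. complex_of_real (exp (w * y)) * fourier_mode n f y) has_vector_derivative
        of_real (exp (w * y)) * (- w * fourier_mode n f y) + of_real (exp (w * y) * w) * fourier_mode n f y) (at y)"
      by (rule has_vector_derivative_mult[OF 1 2])
    moreover have "of_real (exp (w * y)) * (- w * fourier_mode n f y) + of_real (exp (w * y) * w) * fourier_mode n f y = 0"
      by (simp add: algebra_simps)
    ultimately have "(g has_vector_derivative 0) (at y)" unfolding g_def[abs_def] by (simp only:)
    hence "(g has_derivative (\<lambda>h. 0)) (at y)" by (simp add: has_vector_derivative_def)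
    thus ?thesis by (rule has_derivative_at_withinI)
  qed
  have "\<exists>k. \<forall>y\<in>{0<..}. g y = k"
    using has_derivative_zero_constant[OF convex_real_interval(3) dg] by blast
  then obtain k where k: "\<forall>y\<in>{0<..}. g y = k" ..
  have "g y = g 1" using k[rule_format, of y] k[rule_format, of 1] y by simp
  moreover have "fourier_mode n f y = g y * of_real (exp (- w * y))"
  proof -
    have "complex_of_real (exp (w * y)) * of_real (exp (- w * y)) = 1"
      by (simp add: of_real_mult[symmetric] exp_add[symmetric] del: of_real_mult)
    thus ?thesis unfolding g_def by (metis mult.assoc mult.commute mult.right_neutral)
  qed
  moreover have "g 1 = fourier_mode n f 1 * of_real (exp w)" by (simp add: g_def)
  ultimately have "fourier_mode n f y = fourier_mode n f 1 * of_real (exp w) * of_real (exp (- w * y))" by metis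
  thus ?thesis by (simp only: w_def)
qed

section \<open>Holomorphic forms of weight 0 and 2\<close>

text \<open>The modes give the coefficients of a power series in q. On every horizontal line it has
  the same Fourier coefficients as F, hence equals F there.\<close>

lemma holomorphic_q_expansion:
  assumes F: "F holomorphic_on UHP" "inv_T F" and neg: "\<And>n y. n < 0 \<Longrightarrow> y > 0 \<Longrightarrow> fourier_mode n F y = 0"
  obtains H where "H holomorphic_on ball 0 1" "\<And>z. z \<in> UHP \<Longrightarrow> F z = H (exp (2 * pi * \<i> * z))"
proof -
  note sF = holomorphic_smooth[OF F(1)]
  define c where "c n = fourier_mode (int n) F 1 * of_real (exp (2 * pi * n))" for n :: nat
  have fcn: "fourier_mode (int n) F y = c n * of_real (exp (-(2 * pi * n) * y))" if "y > 0" for n y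
    using fourier_mode_holomorphic[OF F that, of "int n"] by (simp add: c_def)
  have per: "F (Complex (x + 1) y) = F (Complex x y)" if "y > 0" for x y
  proof -
    have "Complex (x + 1) y = Complex x y + 1" by (simp add: complex_eq_iff)
    thus ?thesis using F(2) that by (simp add: inv_T_def)
  qed
  have bd: "\<exists>M\<ge>0. \<forall>n. norm (c n) * exp (-(2 * pi * y)) ^ n \<le> M" if y: "y > 0" for y
  proof -
    have "compact ((\<lambda>x. F (Complex x y)) ` {0..1})"
      by (intro compact_continuous_image continuous_hline sF y) auto
    hence "bounded ((\<lambda>x. F (Complex x y)) ` {0..1})" by (rule compact_imp_bounded)
    then obtain M where M0: "M > 0" "\<forall>w\<in>(\<lambda>x. F (Complex x y)) ` {0..1}. norm w \<le> M"
      unfolding bounded_pos by blast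
    hence M: "M > 0" "\<And>x. x \<in> {0..1} \<Longrightarrow> norm (F (Complex x y)) \<le> M" by auto
    have "norm (c n) * exp (-(2 * pi * y)) ^ n \<le> M" for n
    proof -
      have "norm (fourier_mode (int n) F y) \<le> M * (1 - 0)"
        unfolding fourier_mode_def fcoeff_def
      proof (rule integral_bound)
        show "continuous_on {0..1} (\<lambda>x. F (Complex x y) * cis (-(2 * pi * of_int (int n) * x)))"
          by (intro continuous_on_mult continuous_hline sF y continuous_on_cis_mult continuous_on_minus continuous_on_const continuous_on_id)
      qed (use M in \<open>auto simp: norm_mult\<close>)
      thus ?thesis using fcn[OF y, of n] by (simp add: norm_mult exp_of_nat_mult[symmetric] mult_ac)
    qed
    thus ?thesis using M(1) by (intro exI[of _ M]) auto
  qed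
  have summ: "summable (\<lambda>n. norm (c n) * r ^ n)" if r: "0 \<le> r" "r < 1" for r
  proof -
    \<comment> \<open>Any s strictly between r and 1 works: the coefficient bound on the line with
      |q| = s makes the series at r geometric of ratio r / s.\<close>
    define s where "s = (r + 1) / 2"
    have s: "r < s" "0 < s" "s < 1" using r by (auto simp: s_def)
    define y where "y = - ln s / (2 * pi)"
    have "y > 0" unfolding y_def using s ln_less_zero[of s] by (intro divide_pos_pos) auto
    from bd[OF this] obtain M where M: "M \<ge> 0" "\<And>n. norm (c n) * s ^ n \<le> M"
      using s by (auto simp: y_def)
    have "summable (\<lambda>n. M * (r / s) ^ n)" using s r by (intro summable_mult summable_geometric) auto
    thus ?thesis
    proof (rule summable_comparison_test'[where N = 0])
      fix n
      have "norm (c n) * r ^ n = (norm (c n) * s ^ n) * (r / s) ^ n" using s by (simp add: power_divide)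
      also have "\<dots> \<le> M * (r / s) ^ n" using s r by (intro mult_right_mono M) auto
      finally show "norm (norm (c n) * r ^ n) \<le> M * (r / s) ^ n" using r by simp
    qed
  qed
  define H where "H w = (\<Sum>n. c n * w ^ n)" for w
  have sums: "(\<lambda>n. c n * (w - 0) ^ n) sums H w" if "w \<in> ball 0 1" for w
  proof -
    have "summable (\<lambda>n. norm (c n * w ^ n))" using summ[of "norm w"] that by (simp add: norm_mult norm_power)
    thus ?thesis using summable_sums[OF summable_norm_cancel] by (simp add: H_def)
  qed
  have holH: "H holomorphic_on ball 0 1" by (rule power_series_holomorphic[OF sums])
  have eq: "F (Complex x y) = H (exp (2 * pi * \<i> * Complex x y))" if y: "y > 0" for x y
  proof -
    define r where "r = exp (-(2 * pi * y))"
    have r: "0 < r" "r < 1" using y by (auto simp: r_def)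
    define f where "f n x = c n * of_real (r ^ n) * cis (2 * pi * of_int (int n) * x)" for n x
    have E: "exp (2 * pi * \<i> * Complex x y) = of_real r * cis (2 * pi * x)" for x
      by (simp add: r_def cis_conv_exp exp_of_real[symmetric] exp_add[symmetric] Complex_eq algebra_simps)
    have fE: "c n * (of_real r * cis (2 * pi * x)) ^ n = f n x" for n x
    proof -
      have "cis (2 * pi * x) ^ n = cis (2 * pi * of_int (int n) * x)"
        using Complex.DeMoivre[of "2 * pi * x" n] by (simp add: mult_ac)
      thus ?thesis by (simp add: f_def power_mult_distrib)
    qed
    define M where "M n = norm (c n) * r ^ n" for n
    have fM: "norm (f n x) = M n" for n x using r by (simp add: f_def M_def norm_mult norm_power)
    have Msum: "M summable_on UNIV" unfolding M_def
      using summ[of r] r by (intro norm_summable_imp_summable_on) simp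
    have HR: "H (of_real r * cis (2 * pi * x)) = (\<Sum>\<^sub>\<infinity>n. f n x)" for x
    proof -
      have "f n x = c n * (of_real r * cis (2 * pi * x) - 0) ^ n" for n by (simp add: fE)
      hence "(\<lambda>n. f n x) sums H (of_real r * cis (2 * pi * x))"
        using sums[of "of_real r * cis (2 * pi * x)"] r by (simp add: norm_mult)
      moreover have "summable (\<lambda>n. norm (f n x))" unfolding fM M_def using summ[of r] r by simp
      ultimately have "((\<lambda>n. f n x) has_sum H (of_real r * cis (2 * pi * x))) UNIV"
        by (intro norm_summable_imp_has_sum)
      thus ?thesis by (simp add: infsumI)
    qed
    have cf: "continuous_on S (f n)" for S n unfolding f_def
      by (intro continuous_on_mult continuous_on_const continuous_on_cis_mult continuous_on_id)
    define D where "D x = F (Complex x y) + (-1) * H (of_real r * cis (2 * pi * x))" for x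
    have cH: "continuous_on UNIV (\<lambda>x. H (of_real r * cis (2 * pi * x)))"
      by (rule continuous_on_compose2[OF holomorphic_on_imp_continuous_on[OF holH]],
          intro continuous_on_mult continuous_on_const continuous_on_cis_mult continuous_on_id)
         (use r in \<open>auto simp: norm_mult\<close>)
    have "D x = 0"
    proof (rule fourier_coeffs_zero_imp_zero)
      show "continuous_on UNIV D" unfolding D_def
        by (intro continuous_on_add continuous_on_mult continuous_on_const continuous_hline sF y cH)
      show "D (x + 1) = D x" for x
        using per[OF y, of x] by (simp add: D_def distrib_left cis_mult[symmetric])
      fix n
      have "fcoeff (\<lambda>x. H (of_real r * cis (2 * pi * x))) n = fourier_mode n F y"
      proof (rule has_sum_unique)
        show "((\<lambda>j. fcoeff (f j) n) has_sum fcoeff (\<lambda>x. H (of_real r * cis (2 * pi * x))) n) UNIV"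
          unfolding HR by (rule fcoeff_infsum[OF cf _ Msum]) (simp add: fM)
        have fj: "fcoeff (f j) n = (if int j = n then c j * of_real (r ^ j) else 0)" for j
          unfolding f_def[abs_def] fcoeff_mult fcoeff_cis by simp
        show "((\<lambda>j. fcoeff (f j) n) has_sum fourier_mode n F y) UNIV"
        proof (cases "n < 0")
          case True
          hence "fcoeff (f j) n = 0" for j unfolding fj by auto
          thus ?thesis using neg[OF True y] by simp
        next
          case False
          then obtain k where k: "n = int k" by (metis nonneg_int_cases not_less)
          have "fourier_mode n F y = c k * of_real (r ^ k)"
            using fcn[OF y, of k] by (simp add: k r_def exp_of_nat_mult[symmetric] mult_ac)
          thus ?thesis unfolding fj
            by (subst has_sum_cong_neutral[where T = "{k}" and g = "\<lambda>_. fourier_mode n F y"]) (auto simp: k intro: has_sum_finiteI)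
        qed
      qed
      thus "fcoeff D n = 0"
        unfolding D_def
        by (subst fcoeff_add[OF continuous_hline[OF sF y] continuous_on_mult[OF continuous_on_const cH]])
           (simp only: fcoeff_mult, simp add: fourier_mode_def)
    qed
    thus ?thesis unfolding D_def E by simp
  qed
  show ?thesis
  proof (rule that[OF holH])
    fix z assume "z \<in> UHP"
    thus "F z = H (exp (2 * pi * \<i> * z))" using eq[of "Im z" "Re z"] by (simp add: UHP_def)
  qed
qed

text \<open>Crude reduction theory: every orbit meets the closed half-plane \<open>Im w \<ge> 1/2\<close>, which is enough for the maximum principle.\<close>
lemma reduce_Im:
  assumes F: "inv_T F" "inv_S 0 F" and z: "z \<in> UHP"
  shows "\<exists>w\<in>UHP. Im w \<ge> 1/2 \<and> F w = F z"
proof -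
  have shn: "F (w + of_nat n) = F w \<and> w + of_nat n \<in> UHP" if "w \<in> UHP" for w n
  proof (induction n)
    case (Suc n)
    have "w + of_nat (Suc n) = (w + of_nat n) + 1" by simp
    thus ?case using Suc F(1) unfolding inv_T_def by (metis UHP_shift)
  qed (use that in auto)
  have sh: "F (w + of_int k) = F w" "w + of_int k \<in> UHP" if w: "w \<in> UHP" for w k
  proof -
    show i: "w + of_int k \<in> UHP" using w by (simp add: UHP_def)
    show "F (w + of_int k) = F w"
      using shn[OF w, of "nat k"] shn[OF i, of "nat (-k)"] by (cases "k \<ge> 0") auto
  qed
  \<comment> \<open>Induction on the number of doublings still allowed: after centring, Im z < 1/2
    gives |z|^2 \<le> 1/2, and then z -> -1/z at least doubles the imaginary part.\<close>
  have main: "\<exists>w\<in>UHP. Im w \<ge> 1/2 \<and> F w = F z" if "z \<in> UHP" "Im z * 2 ^ n \<ge> 1/2" for n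
    using that
  proof (induction n arbitrary: z)
    case (Suc n)
    show ?case
    proof (cases "Im z \<ge> 1/2")
      case False
      define w where "w = z + of_int (- round (Re z))"
      have w: "w \<in> UHP" "F w = F z" "Im w = Im z" using sh[OF Suc.prems(1), of "- round (Re z)"] by (auto simp: w_def)
      have "\<bar>Re w\<bar> \<le> 1/2" using of_int_round_abs_le[of "Re z"] by (simp add: w_def abs_minus_commute)
      hence "(Re w)\<^sup>2 \<le> (1/2)\<^sup>2" by (metis abs_le_square_iff abs_numeral abs_one abs_divide)
      moreover have "(Im w)\<^sup>2 \<le> (1/2)\<^sup>2"
        using False Suc.prems(1) w(3) by (intro power_mono) (auto simp: UHP_def)
      ultimately have m: "(cmod w)\<^sup>2 \<le> 1/2" unfolding cmod_power2 by (simp add: power2_eq_square)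
      have wn: "(cmod w)\<^sup>2 > 0" using UHP_nonzero[OF w(1)] by simp
      have wp: "Im w > 0" using w(1) by (simp add: UHP_def)
      have "Im w * 2 \<le> Im (- 1 / w)"
        unfolding Im_inversion pos_le_divide_eq[OF wn]
      proof -
        have "Im w * 2 * (cmod w)\<^sup>2 \<le> Im w * 2 * (1/2)" by (intro mult_left_mono m) (use wp in simp)
        thus "Im w * 2 * (cmod w)\<^sup>2 \<le> Im w" by simp
      qed
      hence "Im (- 1 / w) * 2 ^ n \<ge> 1/2"
        using Suc.prems(2) w(3) mult_right_mono[of "Im w * 2" "Im (- 1 / w)" "2 ^ n"] by simp
      from Suc.IH[OF UHP_inversion[OF w(1)] this] F(2) w
      show ?thesis by (auto simp: inv_S_def)
    qed (use Suc.prems in auto)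
  qed auto
  obtain n where "1 / (2 * Im z) < 2 ^ n" using real_arch_pow[of 2 "1 / (2 * Im z)"] by auto
  hence "Im z * 2 ^ n \<ge> 1/2" using z by (simp add: UHP_def field_simps)
  thus ?thesis by (rule main[OF z])
qed

text \<open>By \<open>reduce_Im\<close> every value of F is taken where Im z \<ge> 1/2, that is, for
  |q| \<le> exp(-pi). Hence |H| attains its supremum over the unit disc at an interior
  point.\<close>

lemma modular_function_constant:
  assumes F: "F holomorphic_on UHP" "inv_T F" "inv_S 0 F" and neg: "\<And>n y. n < 0 \<Longrightarrow> y > 0 \<Longrightarrow> fourier_mode n F y = 0"
  shows "\<exists>c. \<forall>z\<in>UHP. F z = c"
proof -
  obtain H where H: "H holomorphic_on ball 0 1" "\<And>z. z \<in> UHP \<Longrightarrow> F z = H (exp (2 * pi * \<i> * z))"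
    using holomorphic_q_expansion[OF F(1,2) neg] by blast
  define r where "r = exp (- pi)"
  have r: "0 < r" "r < 1" by (auto simp: r_def)
  have ne: "norm (exp (2 * pi * \<i> * z)) = exp (-(2 * pi * Im z))" for z by simp
  have "continuous_on (cball 0 r) (\<lambda>w. norm (H w))"
    using r by (intro continuous_on_norm continuous_on_subset[OF holomorphic_on_imp_continuous_on[OF H(1)]]) auto
  from continuous_attains_sup[OF _ _ this] r
  obtain w0 where w0: "w0 \<in> cball 0 r" "\<And>w. w \<in> cball 0 r \<Longrightarrow> norm (H w) \<le> norm (H w0)" by auto
  have max: "norm (H w) \<le> norm (H w0)" if w: "w \<in> ball 0 1" for w
  proof (cases "w = 0")
    case False
    define z where "z = Ln w / (2 * pi * \<i>)"
    have ez: "exp (2 * pi * \<i> * z) = w" using False by (simp add: z_def)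
    have "exp (-(2 * pi * Im z)) < 1" using ne[of z] w unfolding ez by simp
    hence z: "z \<in> UHP" by (simp add: UHP_def zero_less_mult_iff)
    obtain z' where z': "z' \<in> UHP" "Im z' \<ge> 1/2" "F z' = F z" using reduce_Im[OF F(2,3) z] by blast
    have "H w = H (exp (2 * pi * \<i> * z'))" using H(2)[OF z] H(2)[OF z'(1)] z'(3) ez by simp
    moreover have "norm (exp (2 * pi * \<i> * z')) \<le> r"
      unfolding ne r_def exp_le_cancel_iff using z'(2) mult_left_mono[of "1/2" "Im z'" "2 * pi"] by simp
    ultimately show ?thesis using w0(2) by simp
  qed (use w0(2)[of 0] r in auto)
  have "H constant_on ball 0 1"
    by (rule maximum_modulus_principle[OF H(1) _ _ _ subset_refl _ max]) (use w0(1) r in auto)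
  then obtain c where c: "\<And>w. w \<in> ball 0 1 \<Longrightarrow> H w = c" by (auto simp: constant_on_def)
  have "F z = c" if z: "z \<in> UHP" for z
  proof -
    have "norm (exp (2 * pi * \<i> * z)) < 1" unfolding ne using z by (simp add: UHP_def)
    thus ?thesis using H(2)[OF z] c by simp
  qed
  thus ?thesis by blast
qed

text \<open>A primitive F of h is invariant up to additive constants, and these vanish by testing at
  elliptic points: i for the inversion, a cube root of unity for the translation. The second test
  also excludes a constant term of h, which would give F a linear part. So F is a modular function,
  hence constant.\<close>

lemma holomorphic_weight_2_zero:
  assumes h: "h holomorphic_on UHP" "inv_T h" "inv_S 2 h" and neg: "\<And>n y. n < 0 \<Longrightarrow> y > 0 \<Longrightarrow> fourier_mode n h y = 0"
    and z: "z \<in> UHP"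
  shows "h z = 0"
proof -
  obtain F where F: "\<And>z. z \<in> UHP \<Longrightarrow> (F has_field_derivative h z) (at z within UHP)"
    using holomorphic_convex_primitive'[OF convex_UHP open_UHP h(1)] by blast
  have dF: "(F has_field_derivative h z) (at z)" if "z \<in> UHP" for z
    using F[OF that] at_within_open[OF that open_UHP] by simp
  have holF: "F holomorphic_on UHP" using dF by (auto simp: holomorphic_on_open)
  have const: "\<exists>k. \<forall>z\<in>UHP. g z = k" if "\<And>z. z \<in> UHP \<Longrightarrow> (g has_field_derivative 0) (at z)" for g
    using has_field_derivative_zero_constant[OF convex_UHP has_field_derivative_at_within[OF that]] by blast
  have S: "F (- 1 / z) = F z" if z: "z \<in> UHP" for z
  proof -
    have "((\<lambda>z. F (- 1 / z) - F z) has_field_derivative 0) (at z)" if z: "z \<in> UHP" for z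
    proof -
      have "((\<lambda>z. - 1 / z) has_field_derivative 1 / z\<^sup>2) (at z)"
        using UHP_nonzero[OF z] by (auto intro!: derivative_eq_intros simp: power2_eq_square)
      from DERIV_chain2[OF dF[OF UHP_inversion[OF z]] this]
      have "((\<lambda>z. F (- 1 / z)) has_field_derivative h (- 1 / z) * (1 / z\<^sup>2)) (at z)" .
      moreover have "h (- 1 / z) * (1 / z\<^sup>2) = h z"
        using h(3) z UHP_nonzero[OF z] unfolding inv_S_def by simp
      ultimately have "((\<lambda>z. F (- 1 / z)) has_field_derivative h z) (at z)" by simp
      from DERIV_diff[OF this dF[OF z]] show ?thesis by simp
    qed
    from const[OF this] obtain k where k: "\<And>z. z \<in> UHP \<Longrightarrow> F (- 1 / z) - F z = k" by blast
    have "- 1 / \<i> = \<i>" by (simp add: field_simps)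
    hence "k = 0" using k[of \<i>] by (simp add: UHP_def)
    thus ?thesis using k[OF z] by simp
  qed
  have T: "F (z + 1) = F z" if z: "z \<in> UHP" for z
  proof -
    have "((\<lambda>z. F (z + 1) - F z) has_field_derivative 0) (at z)" if z: "z \<in> UHP" for z
    proof -
      have "((\<lambda>z. F (z + 1)) has_field_derivative h (z + 1) * 1) (at z)"
        by (rule DERIV_chain2[where g = "\<lambda>z. z + 1", OF dF]) (use z in \<open>auto intro!: derivative_eq_intros\<close>)
      hence "((\<lambda>z. F (z + 1)) has_field_derivative h z) (at z)" using z h(2) by (simp add: inv_T_def)
      from DERIV_diff[OF this dF[OF z]] show ?thesis by simp
    qed
    from const[OF this] obtain k where k: "\<And>z. z \<in> UHP \<Longrightarrow> F (z + 1) - F z = k" by blast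
    \<comment> \<open>The inversion maps \<rho> + 1 to \<rho>, so \<open>S\<close> already gives F
      \<rho> = F(\<rho> + 1).\<close>
    define \<rho> where "\<rho> = Complex (-1/2) (sqrt 3 / 2)"
    have rU: "\<rho> \<in> UHP" by (simp add: \<rho>_def)
    have "\<rho> * (\<rho> + 1) = -1" by (simp add: \<rho>_def complex_eq_iff)
    moreover have "\<rho> + 1 \<noteq> 0" by (simp add: \<rho>_def complex_eq_iff)
    ultimately have "- 1 / (\<rho> + 1) = \<rho>" by (simp add: field_simps)
    hence "F \<rho> = F (\<rho> + 1)" using S[of "\<rho> + 1"] rU by simp
    hence "k = 0" using k[OF rU] by simp
    thus ?thesis using k[OF z] by simp
  qed
  have TF: "inv_T F" and SF: "inv_S 0 F" using S T by (auto simp: inv_S_def inv_T_def)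
  have "fourier_mode n F y = 0" if "n < 0" "y > 0" for n y
  proof -
    have "pdx F (Complex x y) = h (Complex x y)" for x
      using has_wirtinger_imp(4)[OF has_wirtinger_field[OF dF]] that by simp
    hence "fourier_mode n (pdx F) y = fourier_mode n h y" by (simp add: fourier_mode_def)
    thus ?thesis using fourier_mode_pdx[OF holomorphic_smooth[OF holF] TF that(2), of n] neg[OF that] that(1) by simp
  qed
  from modular_function_constant[OF holF TF SF this] obtain c where c: "\<And>z. z \<in> UHP \<Longrightarrow> F z = c" by blast
  have "((\<lambda>_. c) has_field_derivative h z) (at z)"
    by (rule has_field_derivative_transform_within_open[OF dF[OF z] open_UHP z c])
  thus ?thesis using DERIV_const[of c "at z"] DERIV_unique by blast
qed

text \<open>For n < 0 the n-th mode of a holomorphic function is a multiple of exp(2 pi |n| y),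
  which weak growth excludes.\<close>

lemma weak_form_holomorphic_zero:
  assumes h: "weak_form h" "h holomorphic_on UHP" and z: "z \<in> UHP"
  shows "h z = 0"
proof (rule holomorphic_weight_2_zero[OF h(2) _ _ _ z])
  show T: "inv_T h" and "inv_S 2 h" using h(1) by (auto simp: weak_form_def)
  fix n :: int and y :: real assume n: "n < 0" and y: "y > 0"
  have w: "weak_growth (fourier_mode n h)" using h(1) by (simp add: weak_form_def)
  have "weak_growth (\<lambda>y. (fourier_mode n h 1 * of_real (exp (2 * pi * of_int n))) * of_real (exp (-(2 * pi * of_int n) * y)))"
    by (rule weak_growth_cong[where R = 0, OF w]) (rule fourier_mode_holomorphic[OF h(2) T])
  from weak_growth_exp_zero[OF this] n have "fourier_mode n h 1 * of_real (exp (2 * pi * of_int n)) = 0"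
    by (simp add: mult_pos_neg)
  thus "fourier_mode n h y = 0" using fourier_mode_holomorphic[OF h(2) T y, of n] by simp
qed

text \<open>Conjugation exchanges the modes n and -n. A negative mode of the holomorphic function
  \<open>F\<close> would be an exponentially growing mode of \<open>lowering h\<close>, whose modes
  have weak growth.\<close>

lemma weak_form_harmonic_lowering_constant:
  assumes h: "weak_form h" and harm: "\<And>z. z \<in> UHP \<Longrightarrow> hyp_lap 2 h z = 0"
  shows "\<exists>c. \<forall>z\<in>UHP. lowering h z = c"
proof -
  have hs: "smooth_UHP h" "inv_T h" "inv_S 2 h" "\<And>n. weak_growth (fourier_mode n h)" using h by (auto simp: weak_form_def)
  define F where "F z = cnj (lowering h z)" for z
  have holF: "F holomorphic_on UHP" unfolding F_def
    by (rule holomorphic_cnj_of_dz[OF smooth_lowering[OF hs(1)]]) (use harm hyp_lap_eq[OF hs(1)] in simp)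
  have TF: "inv_T F" and SF: "inv_S 0 F"
    using inv_T_derivs(3)[OF hs(1,2)] inv_S_lowering[OF hs(1,3)] by (auto simp: inv_T_def inv_S_def F_def)
  have fcF: "fourier_mode n F y = cnj (fourier_mode (- n) (lowering h) y)" for n y
    unfolding fourier_mode_def fcoeff_def F_def integral_cnj by (simp add: cis_cnj)
  have "fourier_mode n F y = 0" if n: "n < 0" and y: "y > 0" for n y
  proof -
    define c where "c = fourier_mode n F 1 * of_real (exp (2 * pi * of_int n))"
    have e: "fourier_mode (- n) (lowering h) y = cnj c * of_real (exp (-(2 * pi * of_int n) * y))" if "y > 0" for y
      using arg_cong[OF fourier_mode_holomorphic[OF holF TF that, of n], of cnj] fcF[of n y] by (simp add: c_def)
    have "weak_growth (\<lambda>y. cnj c * of_real (exp (-(2 * pi * of_int n) * y)))"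
      by (rule weak_growth_cong[where R = 0, OF weak_growth_dz_dzb_lowering(3)[OF hs(1,2,4), of "-n"]]) (rule e)
    from weak_growth_exp_zero[OF this] n have "c = 0" by (simp add: mult_pos_neg)
    thus ?thesis using fourier_mode_holomorphic[OF holF TF y, of n] by (simp add: c_def)
  qed
  from modular_function_constant[OF holF TF SF this] obtain c where "\<And>z. z \<in> UHP \<Longrightarrow> F z = c" by blast
  hence "lowering h z = cnj c" if "z \<in> UHP" for z using that by (metis F_def complex_cnj_cnj)
  thus ?thesis by blast
qed

section \<open>Functions holomorphic in two variables\<close>

text \<open>A real-analytic function of \<open>z\<close> is handled as the restriction of \<open>F z w\<close> to \<open>w = cnj z\<close>, so that
\<open>d/dz\<close> and \<open>d/dzbar\<close> become \<open>D1\<close> and \<open>D2\<close>.\<close>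
definition hol2 :: "complex set \<Rightarrow> complex set \<Rightarrow> (complex \<Rightarrow> complex \<Rightarrow> complex) \<Rightarrow> bool" where
  "hol2 S T F \<longleftrightarrow> continuous_on (S \<times> T) (\<lambda>p. F (fst p) (snd p)) \<and>
     (\<forall>w\<in>T. (\<lambda>z. F z w) holomorphic_on S) \<and> (\<forall>z\<in>S. F z holomorphic_on T)"

definition D1 :: "(complex \<Rightarrow> complex \<Rightarrow> complex) \<Rightarrow> complex \<Rightarrow> complex \<Rightarrow> complex" where
  "D1 F z w = deriv (\<lambda>\<zeta>. F \<zeta> w) z"

definition D2 :: "(complex \<Rightarrow> complex \<Rightarrow> complex) \<Rightarrow> complex \<Rightarrow> complex \<Rightarrow> complex" where
  "D2 F z w = deriv (F z) w"

text \<open>Facts about \<open>D2\<close> are obtained from those about \<open>D1\<close> by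
  exchanging the variables.\<close>

lemma hol2_swap: "hol2 S T F \<Longrightarrow> hol2 T S (\<lambda>w z. F z w)"
proof -
  assume F: "hol2 S T F"
  have "continuous_on (T \<times> S) (\<lambda>p. (\<lambda>p. F (fst p) (snd p)) (snd p, fst p))"
    by (rule continuous_on_compose2[of "S \<times> T"])
       (use F in \<open>auto simp: hol2_def intro!: continuous_on_Pair continuous_on_fst continuous_on_snd continuous_on_id\<close>)
  thus ?thesis using F by (simp add: hol2_def)
qed

lemma D2_eq: "D2 F z w = D1 (\<lambda>w z. F z w) w z"
  by (simp add: D1_def D2_def)

text \<open>Cauchy's formula on a circle that stays fixed while z moves inside it. As a parameter
  integral over [0,1] it gives continuity in both variables and differentiability in w.\<close>

lemma D1_cauchy:
  assumes F: "hol2 S T F" and r: "r > 0" "cball z0 r \<subseteq> S" and z: "z \<in> ball z0 r" and w: "w \<in> T"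
  shows "D1 F z w = integral (cbox 0 1) (\<lambda>t. F (circlepath z0 r t) w / (circlepath z0 r t - z)\<^sup>2 * (of_real r * exp (2 * of_real pi * \<i> * of_real t)))"
proof -
  have hol: "(\<lambda>z. F z w) holomorphic_on S" using F w by (simp add: hol2_def)
  have 1: "continuous_on (cball z0 r) (\<lambda>z. F z w)"
    by (rule holomorphic_on_imp_continuous_on[OF holomorphic_on_subset[OF hol r(2)]])
  have 2: "(\<lambda>z. F z w) holomorphic_on ball z0 r"
    by (rule holomorphic_on_subset[OF hol]) (use r(2) ball_subset_cball in blast)
  have "((\<lambda>z. F z w) has_field_derivative (1 / (2 * of_real pi * \<i>) * contour_integral (circlepath z0 r) (\<lambda>u. F u w / (u - z)\<^sup>2))) (at z)"
    by (rule Cauchy_derivative_integral_circlepath(2)[OF 1 2 z])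
  hence "D1 F z w = 1 / (2 * of_real pi * \<i>) * contour_integral (circlepath z0 r) (\<lambda>u. F u w / (u - z)\<^sup>2)"
    unfolding D1_def by (rule DERIV_imp_deriv)
  also have "contour_integral (circlepath z0 r) (\<lambda>u. F u w / (u - z)\<^sup>2)
     = integral (cbox 0 1) (\<lambda>t. (2 * of_real pi * \<i>) * (F (circlepath z0 r t) w / (circlepath z0 r t - z)\<^sup>2 * (of_real r * exp (2 * of_real pi * \<i> * of_real t))))"
    unfolding contour_integral_integral cbox_interval
    by (intro integral_cong) (simp add: vector_derivative_circlepath mult_ac)
  finally show ?thesis unfolding integral_mult_right by simp
qed

lemma circlepath_ne:
  assumes "z \<in> ball z0 r" shows "circlepath z0 r t - z \<noteq> 0"
proof
  assume "circlepath z0 r t - z = 0"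
  hence "z - z0 = r * exp (2 * of_real pi * \<i> * t)" by (simp add: circlepath algebra_simps)
  hence "norm (z - z0) = \<bar>r\<bar>" by (simp add: norm_mult)
  thus False using assms by (simp add: dist_norm norm_minus_commute)
qed

lemma cauchy_kernel_continuous:
  fixes F :: "complex \<Rightarrow> complex \<Rightarrow> complex"
  assumes F: "continuous_on (S \<times> T) (\<lambda>p. F (fst p) (snd p))" and r: "r > 0" "cball z0 r \<subseteq> S"
  shows "continuous_on ((ball z0 r \<times> T) \<times> cbox 0 1)
     (\<lambda>p. F (circlepath z0 r (snd p)) (snd (fst p)) / (circlepath z0 r (snd p) - fst (fst p))\<^sup>2 * (of_real r * exp (2 * of_real pi * \<i> * of_real (snd p))))"
proof -
  have c: "continuous_on A (\<lambda>p. circlepath z0 r (snd p))" for A :: "((complex \<times> complex) \<times> real) set"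
    unfolding circlepath by (intro continuous_intros)
  have m: "circlepath z0 r t \<in> S" for t
    using r by (auto intro!: subsetD[OF r(2)] simp: circlepath dist_norm norm_mult)
  have "continuous_on ((ball z0 r \<times> T) \<times> cbox 0 1) (\<lambda>p. (\<lambda>p. F (fst p) (snd p)) (circlepath z0 r (snd p), snd (fst p)))"
    by (rule continuous_on_compose2[OF F], intro continuous_on_Pair c continuous_on_snd continuous_on_fst continuous_on_id)
       (use m in auto)
  hence 1: "continuous_on ((ball z0 r \<times> T) \<times> cbox 0 1) (\<lambda>p. F (circlepath z0 r (snd p)) (snd (fst p)))" by simp
  have 2: "continuous_on ((ball z0 r \<times> T) \<times> cbox 0 1) (\<lambda>p. (circlepath z0 r (snd p) - fst (fst p))\<^sup>2)"
    by (intro continuous_on_power continuous_on_diff c continuous_on_fst continuous_on_id)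
  have 3: "continuous_on ((ball z0 r \<times> T) \<times> cbox 0 1) (\<lambda>p. of_real r * exp (2 * of_real pi * \<i> * of_real (snd p)))"
    by (intro continuous_intros)
  show ?thesis
    by (rule continuous_on_mult[OF continuous_on_divide[OF 1 2] 3]) (use circlepath_ne[of _ z0 r] in auto)
qed

lemma D1_continuous:
  assumes F: "hol2 S T F" and S: "open S" and T: "open T"
  shows "continuous_on (S \<times> T) (\<lambda>p. D1 F (fst p) (snd p))"
proof (rule continuous_at_imp_continuous_on, rule ballI)
  fix p assume p: "p \<in> S \<times> T"
  obtain r where r: "r > 0" "cball (fst p) r \<subseteq> S" using S p open_contains_cball[of S] by (auto simp: mem_Times_iff)
  have cF: "continuous_on (S \<times> T) (\<lambda>p. F (fst p) (snd p))" using F by (simp add: hol2_def)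
  have "continuous_on (ball (fst p) r \<times> T) (\<lambda>q. integral (cbox 0 1) (\<lambda>t. F (circlepath (fst p) r t) (snd q) / (circlepath (fst p) r t - fst q)\<^sup>2 * (of_real r * exp (2 * of_real pi * \<i> * of_real t))))"
    by (rule integral_continuous_on_param) (use cauchy_kernel_continuous[OF cF r] in \<open>simp add: split_beta\<close>)
  hence "continuous_on (ball (fst p) r \<times> T) (\<lambda>p. D1 F (fst p) (snd p))"
    by (rule continuous_on_eq) (use D1_cauchy[OF F r] in \<open>simp add: mem_Times_iff\<close>)
  moreover have "p \<in> ball (fst p) r \<times> T" using p r by (auto simp: mem_Times_iff)
  ultimately show "isCont (\<lambda>p. D1 F (fst p) (snd p)) p"
    using continuous_on_eq_continuous_at[OF open_Times[OF open_ball T]] by blast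
qed

lemma D2_continuous:
  assumes F: "hol2 S T F" and S: "open S" and T: "open T"
  shows "continuous_on (S \<times> T) (\<lambda>p. D2 F (fst p) (snd p))"
proof -
  have "continuous_on (S \<times> T) (\<lambda>p. (\<lambda>p. D1 (\<lambda>w z. F z w) (fst p) (snd p)) (snd p, fst p))"
    by (rule continuous_on_compose2[OF D1_continuous[OF hol2_swap[OF F] T S]])
       (auto intro!: continuous_on_Pair continuous_on_fst continuous_on_snd continuous_on_id)
  thus ?thesis by (simp add: D2_eq)
qed

text \<open>Differentiation under the Cauchy integral in w. The result is the Cauchy integral of
  \<open>D2 F\<close>, which yields both holomorphy in w and \<open>D1_D2_commute\<close>.\<close>

lemma D1_has_derivative_w:
  assumes F: "hol2 S T F" and S: "open S" and T: "open T" and r: "r > 0" "cball z0 r \<subseteq> S" and z: "z \<in> ball z0 r" and w: "w \<in> T"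
  shows "((\<lambda>w. D1 F z w) has_field_derivative
     integral (cbox 0 1) (\<lambda>t. D2 F (circlepath z0 r t) w / (circlepath z0 r t - z)\<^sup>2 * (of_real r * exp (2 * of_real pi * \<i> * of_real t)))) (at w)"
proof -
  obtain e where e: "e > 0" "ball w e \<subseteq> T" using T w openE by blast
  have m: "circlepath z0 r t \<in> S" for t
    using r by (auto intro!: subsetD[OF r(2)] simp: circlepath dist_norm norm_mult)
  define k where "k t = of_real r * exp (2 * of_real pi * \<i> * of_real t) / (circlepath z0 r t - z)\<^sup>2" for t
  have k: "F (circlepath z0 r t) w / (circlepath z0 r t - z)\<^sup>2 * (of_real r * exp (2 * of_real pi * \<i> * of_real t)) = F (circlepath z0 r t) w * k t"
     "D2 F (circlepath z0 r t) w / (circlepath z0 r t - z)\<^sup>2 * (of_real r * exp (2 * of_real pi * \<i> * of_real t)) = D2 F (circlepath z0 r t) w * k t" for t w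
    by (simp_all add: k_def)
  have L1: "((\<lambda>w. F (circlepath z0 r t) w * k t) has_field_derivative D2 F (circlepath z0 r t) w' * k t) (at w' within ball w e)"
    if "w' \<in> ball w e" for w' t
  proof -
    have "F (circlepath z0 r t) holomorphic_on T" using F m by (simp add: hol2_def)
    from holomorphic_derivI[OF this T, of w'] that e
    have "(F (circlepath z0 r t) has_field_derivative D2 F (circlepath z0 r t) w') (at w')" by (auto simp: D2_def)
    thus ?thesis by (rule has_field_derivative_at_within[OF DERIV_cmult_right])
  qed
  have kc: "continuous_on (ball w e \<times> cbox 0 1) (\<lambda>p. G (circlepath z0 r (snd p)) (fst p) * k (snd p))"
    if G: "continuous_on (S \<times> T) (\<lambda>p. G (fst p) (snd p))" for G
  proof -
    have "continuous_on (ball w e \<times> cbox (0::real) 1) (\<lambda>p. ((z, fst p), snd p))"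
      by (intro continuous_on_Pair continuous_on_const continuous_on_fst continuous_on_snd continuous_on_id)
    moreover have "(\<lambda>p. ((z, fst p), snd p)) ` (ball w e \<times> cbox (0::real) 1) \<subseteq> (ball z0 r \<times> T) \<times> cbox 0 1"
      using z e by auto
    ultimately show ?thesis
      using continuous_on_compose2[OF cauchy_kernel_continuous[OF G r], of "ball w e \<times> cbox 0 1" "\<lambda>p. ((z, fst p), snd p)"]
      by (simp add: k_def)
  qed
  have cF: "continuous_on (S \<times> T) (\<lambda>p. F (fst p) (snd p))" using F by (simp add: hol2_def)
  have L2: "(\<lambda>t. F (circlepath z0 r t) w' * k t) integrable_on cbox 0 1" if "w' \<in> ball w e" for w'
  proof (rule integrable_continuous)
    have "continuous_on (cbox (0::real) 1) (\<lambda>t. (w', t))" by (intro continuous_on_Pair continuous_on_const continuous_on_id)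
    moreover have "(\<lambda>t. (w', t)) ` cbox (0::real) 1 \<subseteq> ball w e \<times> cbox 0 1" using that by auto
    ultimately show "continuous_on (cbox 0 1) (\<lambda>t. F (circlepath z0 r t) w' * k t)"
      using continuous_on_compose2[OF kc[OF cF], of "cbox 0 1" "\<lambda>t. (w', t)"] by simp
  qed
  have L3: "continuous_on (ball w e \<times> cbox 0 1) (\<lambda>(w, t). D2 F (circlepath z0 r t) w * k t)"
    unfolding split_beta by (rule kc[OF D2_continuous[OF F S T]])
  have "((\<lambda>w. integral (cbox 0 1) (\<lambda>t. F (circlepath z0 r t) w * k t)) has_field_derivative
      integral (cbox 0 1) (\<lambda>t. D2 F (circlepath z0 r t) w * k t)) (at w within ball w e)"
    using leibniz_rule_field_derivative[where f = "\<lambda>w t. F (circlepath z0 r t) w * k t" and fx = "\<lambda>w t. D2 F (circlepath z0 r t) w * k t", OF L1 L2 L3, of w] e(1)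
    by (simp add: convex_ball)
  hence "((\<lambda>w. integral (cbox 0 1) (\<lambda>t. F (circlepath z0 r t) w * k t)) has_field_derivative
      integral (cbox 0 1) (\<lambda>t. D2 F (circlepath z0 r t) w * k t)) (at w)"
    by (simp only: at_within_open[OF centre_in_ball[THEN iffD2, OF e(1)] open_ball])
  hence "((\<lambda>w. D1 F z w) has_field_derivative
      integral (cbox 0 1) (\<lambda>t. D2 F (circlepath z0 r t) w * k t)) (at w)"
  proof (rule has_field_derivative_transform_within_open[OF _ T w])
    fix w' assume "w' \<in> T"
    from D1_cauchy[OF F r z this]
    show "integral (cbox 0 1) (\<lambda>t. F (circlepath z0 r t) w' * k t) = D1 F z w'" by (simp only: k)
  qed
  thus ?thesis by (simp only: k)
qed

lemma hol2_D1:
  assumes F: "hol2 S T F" and S: "open S" and T: "open T"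
  shows "hol2 S T (D1 F)"
  unfolding hol2_def
proof (intro conjI ballI)
  show "continuous_on (S \<times> T) (\<lambda>p. D1 F (fst p) (snd p))" by (rule D1_continuous[OF F S T])
  fix w assume "w \<in> T"
  thus "(\<lambda>z. D1 F z w) holomorphic_on S" using F S unfolding D1_def hol2_def by (intro holomorphic_deriv) auto
next
  fix z assume z: "z \<in> S"
  obtain r where r: "r > 0" "cball z r \<subseteq> S" using S z open_contains_cball[of S] by auto
  have "z \<in> ball z r" using r by simp
  from D1_has_derivative_w[OF F S T r this]
  show "D1 F z holomorphic_on T" using T by (auto simp: holomorphic_on_open)
qed

lemma hol2_D2:
  assumes F: "hol2 S T F" and S: "open S" and T: "open T"
  shows "hol2 S T (D2 F)"
  using hol2_swap[OF hol2_D1[OF hol2_swap[OF F] T S]] unfolding D2_eq[abs_def] .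

lemma D1_D2_commute:
  assumes F: "hol2 S T F" and S: "open S" and T: "open T" and z: "z \<in> S" and w: "w \<in> T"
  shows "D2 (D1 F) z w = D1 (D2 F) z w"
proof -
  obtain r where r: "r > 0" "cball z r \<subseteq> S" using S z open_contains_cball[of S] by auto
  have zb: "z \<in> ball z r" using r by simp
  have "D2 (D1 F) z w = integral (cbox 0 1) (\<lambda>t. D2 F (circlepath z r t) w / (circlepath z r t - z)\<^sup>2 * (of_real r * exp (2 * of_real pi * \<i> * of_real t)))"
    unfolding D2_def[of "D1 F"] by (rule DERIV_imp_deriv[OF D1_has_derivative_w[OF F S T r zb w]])
  thus ?thesis using D1_cauchy[OF hol2_D2[OF F S T] r zb w] by simp
qed

lemma hol2_derivs:
  assumes "hol2 S T F" "open S" "open T" "z \<in> S" "w \<in> T"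
  shows "((\<lambda>\<zeta>. F \<zeta> w) has_field_derivative D1 F z w) (at z)" "(F z has_field_derivative D2 F z w) (at w)"
  using assms unfolding D1_def D2_def hol2_def by (auto intro!: holomorphic_derivI)

lemma hol2_add: "hol2 S T F \<Longrightarrow> hol2 S T G \<Longrightarrow> hol2 S T (\<lambda>z w. F z w + G z w)"
  unfolding hol2_def by (auto intro!: continuous_on_add holomorphic_on_add)

lemma hol2_cmult: "hol2 S T F \<Longrightarrow> hol2 S T (\<lambda>z w. c * F z w)"
  unfolding hol2_def by (auto intro!: continuous_on_mult_left holomorphic_on_mult holomorphic_on_const)

lemma hol2_mult: "hol2 S T F \<Longrightarrow> hol2 S T G \<Longrightarrow> hol2 S T (\<lambda>z w. F z w * G z w)"
  unfolding hol2_def by (auto intro!: continuous_on_mult holomorphic_on_mult)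

lemma hol2_compose:
  assumes "hol2 S T V" "g holomorphic_on A" "\<And>z w. z \<in> S \<Longrightarrow> w \<in> T \<Longrightarrow> V z w \<in> A"
  shows "hol2 S T (\<lambda>z w. g (V z w))"
  unfolding hol2_def
proof (intro conjI ballI)
  show "continuous_on (S \<times> T) (\<lambda>p. g (V (fst p) (snd p)))"
    by (rule continuous_on_compose2[OF holomorphic_on_imp_continuous_on[OF assms(2)]])
       (use assms in \<open>auto simp: hol2_def\<close>)
  show "(\<lambda>z. g (V z w)) holomorphic_on S" if "w \<in> T" for w
    using holomorphic_on_compose_gen[of "\<lambda>z. V z w" S g A] assms that by (auto simp: hol2_def o_def)
  show "(\<lambda>w. g (V z w)) holomorphic_on T" if "z \<in> S" for z
    using holomorphic_on_compose_gen[of "V z" T g A] assms that by (auto simp: hol2_def o_def)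
qed

section \<open>Restriction to the diagonal w = cnj z\<close>

definition LHP :: "complex set" where "LHP = {w. Im w < 0}"

lemma open_LHP [simp]: "open LHP" unfolding LHP_def by (rule open_halfspace_Im_lt)
lemma convex_LHP: "convex LHP" unfolding LHP_def by (rule convex_halfspace_Im_lt)
lemma cnj_LHP [simp]: "cnj z \<in> LHP \<longleftrightarrow> z \<in> UHP" by (simp add: LHP_def UHP_def)

text \<open>A partial derivative in z together with a continuous one in w gives total
  differentiability on the product. Composition with z -> (z, cnj z) then separates the two
  Wirtinger derivatives.\<close>

lemma diagonal_wirtinger:
  assumes F: "hol2 UHP LHP F" and f: "\<And>z. z \<in> UHP \<Longrightarrow> f z = F z (cnj z)" and z: "z \<in> UHP"
  shows "has_wirtinger f (D1 F z (cnj z)) (D2 F z (cnj z)) z"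
proof -
  define w where "w = cnj z"
  have w: "w \<in> LHP" using z by (simp add: w_def)
  have d: "((\<lambda>(x, y). F x y) has_derivative (\<lambda>(tx, ty). (\<lambda>h. D1 F z w * h) tx + blinfun_mult_right (D2 F z w) ty)) (at (z, w) within UHP \<times> LHP)"
  proof (rule has_derivative_partialsI)
    show "((\<lambda>x. F x w) has_derivative (\<lambda>h. D1 F z w * h)) (at z within UHP)"
      using has_field_derivative_at_within[OF hol2_derivs(1)[OF F open_UHP open_LHP z w]] by (simp add: has_field_derivative_def)
    show "((\<lambda>y. F x y) has_derivative blinfun_apply (blinfun_mult_right (D2 F x y))) (at y within LHP)" if "x \<in> UHP" "y \<in> LHP" for x y
      using has_field_derivative_at_within[OF hol2_derivs(2)[OF F open_UHP open_LHP that]] by (simp add: has_field_derivative_def)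
    have "continuous_on (UHP \<times> LHP) (\<lambda>p. blinfun_mult_right (D2 F (fst p) (snd p)))"
      by (intro bounded_linear.continuous_on[OF bounded_linear_blinfun_mult_right] D2_continuous[OF F] open_UHP open_LHP)
    hence "continuous (at (z, w) within UHP \<times> LHP) (\<lambda>p. blinfun_mult_right (D2 F (fst p) (snd p)))"
      using z w by (simp add: continuous_on_eq_continuous_within)
    thus "continuous (at (z, w) within UHP \<times> LHP) (\<lambda>(x, y). blinfun_mult_right (D2 F x y))"
      unfolding case_prod_unfold .
  qed (use w convex_LHP in auto)
  have "at (z, w) within UHP \<times> LHP = at (z, w)" using z w by (intro at_within_open open_Times) auto
  with d have d': "((\<lambda>p. F (fst p) (snd p)) has_derivative (\<lambda>t. D1 F z w * fst t + D2 F z w * snd t)) (at (z, cnj z))"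
    by (simp add: case_prod_unfold w_def)
  have "((\<lambda>z. (z, cnj z)) has_derivative (\<lambda>h. (h, cnj h))) (at z)"
    by (intro has_derivative_Pair has_derivative_ident has_derivative_cnj)
  from diff_chain_at[OF this d']
  have "has_wirtinger (\<lambda>z. F z (cnj z)) (D1 F z w) (D2 F z w) z"
    by (simp add: has_wirtinger_def o_def)
  thus ?thesis unfolding w_def
    by (rule has_wirtinger_transform[OF _ open_UHP z]) (simp add: f)
qed

text \<open>Diagonals of functions holomorphic in two variables form a class closed under the
  partial derivatives, which act as D1 + D2 and i (D1 - D2).\<close>

lemma diagonal_smooth:
  assumes F: "hol2 UHP LHP F" and f: "\<And>z. z \<in> UHP \<Longrightarrow> f z = F z (cnj z)"
  shows "smooth_UHP f"
proof -
  define P where "P = (\<lambda>f. \<exists>F. hol2 UHP LHP F \<and> (\<forall>z\<in>UHP. f z = F z (cnj z)))"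
  show ?thesis
  proof (rule smooth_coinduct[where P = P])
    show "P f" using F f by (auto simp: P_def)
    fix f assume "P f"
    then obtain F where F: "hol2 UHP LHP F" and f: "\<And>z. z \<in> UHP \<Longrightarrow> f z = F z (cnj z)" by (auto simp: P_def)
    note W = has_wirtinger_imp[OF diagonal_wirtinger[OF F f]]
    show "f differentiable (at z)" if "z \<in> UHP" for z using W(1) that by blast
    note D = hol2_D1[OF F open_UHP open_LHP] hol2_D2[OF F open_UHP open_LHP]
    have "hol2 UHP LHP (\<lambda>z w. D1 F z w + D2 F z w)" by (intro hol2_add D)
    moreover have "pdx f z = D1 F z (cnj z) + D2 F z (cnj z)" if "z \<in> UHP" for z by (rule W(4)[OF _ that])
    ultimately show "P (pdx f)" unfolding P_def by (intro exI[of _ "\<lambda>z w. D1 F z w + D2 F z w"]) simp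
    have "hol2 UHP LHP (\<lambda>z w. \<i> * D1 F z w + (-\<i>) * D2 F z w)" by (intro hol2_add hol2_cmult D)
    moreover have "pdy f z = \<i> * D1 F z (cnj z) + (-\<i>) * D2 F z (cnj z)" if "z \<in> UHP" for z
      by (rule trans[OF W(5)[OF _ that]]) (simp_all add: algebra_simps)
    ultimately show "P (pdy f)" unfolding P_def by (intro exI[of _ "\<lambda>z w. \<i> * D1 F z w + (-\<i>) * D2 F z w"]) simp
  qed
qed

section \<open>Locally uniform sums of holomorphic functions\<close>

lemma higher_deriv_finite_sum:
  assumes "finite X" "\<And>i. i \<in> X \<Longrightarrow> f i holomorphic_on S" "open S" "z \<in> S"
  shows "(deriv ^^ m) (\<lambda>x. \<Sum>i\<in>X. f i x) z = (\<Sum>i\<in>X. (deriv ^^ m) (f i) z)"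
  using assms(1,2)
proof (induction X rule: finite_induct)
  case empty
  have "(deriv ^^ m) (\<lambda>x. 0 :: complex) = (\<lambda>x. 0)" by (induction m) auto
  thus ?case by simp
next
  case (insert i X)
  have "(deriv ^^ m) (\<lambda>x. f i x + (\<Sum>i\<in>X. f i x)) z = (deriv ^^ m) (f i) z + (deriv ^^ m) (\<lambda>x. \<Sum>i\<in>X. f i x) z"
    by (intro higher_deriv_add[where S = S] holomorphic_on_sum insert assms) auto
  thus ?case using insert by simp
qed

text \<open>Weierstrass's theorem along the filter of finite index sets. The case m = 0 gives the
  sum itself, m = 1 the partial derivatives of lattice sums, and general m their Taylor coefficients
  in s.\<close>

lemma holomorphic_infsum_local:
  fixes f :: "'i \<Rightarrow> complex \<Rightarrow> complex"
  assumes hol: "\<And>i. i \<in> I \<Longrightarrow> f i holomorphic_on S" and S: "open S"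
    and bound: "\<And>x. x \<in> S \<Longrightarrow> \<exists>U M. open U \<and> x \<in> U \<and> M summable_on I \<and> (\<forall>i\<in>I. \<forall>y\<in>U \<inter> S. norm (f i y) \<le> M i)"
  shows "(\<lambda>x. \<Sum>\<^sub>\<infinity>i\<in>I. f i x) holomorphic_on S"
    and "x \<in> S \<Longrightarrow> ((\<lambda>i. (deriv ^^ m) (f i) x) has_sum (deriv ^^ m) (\<lambda>x. \<Sum>\<^sub>\<infinity>i\<in>I. f i x) x) I"
proof -
  have *: "\<exists>r>0. cball x r \<subseteq> S \<and> uniform_limit (cball x r) (\<lambda>X x. \<Sum>i\<in>X. f i x) (\<lambda>x. \<Sum>\<^sub>\<infinity>i\<in>I. f i x) (finite_subsets_at_top I)"
    if x: "x \<in> S" for x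
  proof -
    from bound[OF x] obtain U M where U: "open U" "x \<in> U" "M summable_on I" "\<And>i y. i \<in> I \<Longrightarrow> y \<in> U \<inter> S \<Longrightarrow> norm (f i y) \<le> M i"
      by blast
    have "open (U \<inter> S)" "x \<in> U \<inter> S" using U S x by auto
    then obtain r where r: "r > 0" "cball x r \<subseteq> U \<inter> S" using open_contains_cball by blast
    have "norm (f i y) \<le> M i" if "i \<in> I" "y \<in> cball x r" for i y
      using U(4) r(2) that by blast
    from Weierstrass_m_test_general[of I "cball x r", OF this U(3)]
    show ?thesis using r by (intro exI[of _ r]) simp
  qed
  have fin: "\<forall>\<^sub>F X in finite_subsets_at_top I. (\<lambda>x. \<Sum>i\<in>X. f i x) holomorphic_on S"
    by (intro eventually_finite_subsets_at_top_weakI holomorphic_on_sum hol) auto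
  show "(\<lambda>x. \<Sum>\<^sub>\<infinity>i\<in>I. f i x) holomorphic_on S"
    unfolding holomorphic_on_open[OF S]
  proof
    fix x assume "x \<in> S"
    from *[OF this] obtain r where r: "r > 0" "cball x r \<subseteq> S"
      and ul: "uniform_limit (cball x r) (\<lambda>X x. \<Sum>i\<in>X. f i x) (\<lambda>x. \<Sum>\<^sub>\<infinity>i\<in>I. f i x) (finite_subsets_at_top I)" by blast
    have "\<forall>\<^sub>F X in finite_subsets_at_top I. continuous_on (cball x r) (\<lambda>x. \<Sum>i\<in>X. f i x) \<and> (\<lambda>x. \<Sum>i\<in>X. f i x) holomorphic_on ball x r"
      using fin
    proof eventually_elim
      case (elim X)
      have "ball x r \<subseteq> S" using r(2) ball_subset_cball by blast
      thus ?case using holomorphic_on_subset[OF elim] r(2) holomorphic_on_imp_continuous_on by blast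
    qed
    from holomorphic_uniform_limit[OF this ul] have "(\<lambda>x. \<Sum>\<^sub>\<infinity>i\<in>I. f i x) holomorphic_on ball x r" by auto
    thus "\<exists>f'. ((\<lambda>x. \<Sum>\<^sub>\<infinity>i\<in>I. f i x) has_field_derivative f') (at x)"
      using r(1) by (auto simp: holomorphic_on_open)
  qed
  assume x: "x \<in> S"
  from *[OF this] obtain r where r: "r > 0" "cball x r \<subseteq> S"
      and ul: "uniform_limit (cball x r) (\<lambda>X x. \<Sum>i\<in>X. f i x) (\<lambda>x. \<Sum>\<^sub>\<infinity>i\<in>I. f i x) (finite_subsets_at_top I)" by blast
  have ul': "uniform_limit (ball x r) (\<lambda>X x. \<Sum>i\<in>X. f i x) (\<lambda>x. \<Sum>\<^sub>\<infinity>i\<in>I. f i x) (finite_subsets_at_top I)"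
    by (rule uniform_limit_on_subset[OF ul ball_subset_cball])
  have bs: "ball x r \<subseteq> S" using r(2) ball_subset_cball by blast
  have "\<forall>\<^sub>F X in finite_subsets_at_top I. (\<lambda>x. \<Sum>i\<in>X. f i x) holomorphic_on ball x r"
    using fin by eventually_elim (rule holomorphic_on_subset[OF _ bs])
  from higher_deriv_complex_uniform_limit[OF ul' this _ open_ball, of x m] r(1)
  have lim: "((\<lambda>X. (deriv ^^ m) (\<lambda>x. \<Sum>i\<in>X. f i x) x) \<longlongrightarrow> (deriv ^^ m) (\<lambda>x. \<Sum>\<^sub>\<infinity>i\<in>I. f i x) x) (finite_subsets_at_top I)"
    by simp
  have "(deriv ^^ m) (\<lambda>x. \<Sum>i\<in>X. f i x) x = (\<Sum>i\<in>X. (deriv ^^ m) (f i) x)" if "finite X" "X \<subseteq> I" for X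
    by (rule higher_deriv_finite_sum[OF _ _ S x]) (use hol that in auto)
  hence "\<forall>\<^sub>F X in finite_subsets_at_top I. (deriv ^^ m) (\<lambda>x. \<Sum>i\<in>X. f i x) x = (\<Sum>i\<in>X. (deriv ^^ m) (f i) x)"
    by (intro eventually_finite_subsets_at_top_weakI) auto
  from tendsto_cong[OF this] lim
  show "((\<lambda>i. (deriv ^^ m) (f i) x) has_sum (deriv ^^ m) (\<lambda>x. \<Sum>\<^sub>\<infinity>i\<in>I. f i x) x) I"
    by (simp add: has_sum_def)
qed

lemma hol2_infsum:
  fixes F :: "'i \<Rightarrow> complex \<Rightarrow> complex \<Rightarrow> complex"
  assumes hol: "\<And>i. i \<in> I \<Longrightarrow> hol2 S T (F i)" and S: "open S" and T: "open T"
    and bound: "\<And>z w. z \<in> S \<Longrightarrow> w \<in> T \<Longrightarrow> \<exists>U V M. open U \<and> open V \<and> z \<in> U \<and> w \<in> V \<and> M summable_on I \<and>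
       (\<forall>i\<in>I. \<forall>z'\<in>U \<inter> S. \<forall>w'\<in>V \<inter> T. norm (F i z' w') \<le> M i)"
  shows "hol2 S T (\<lambda>z w. \<Sum>\<^sub>\<infinity>i\<in>I. F i z w)"
    and "z \<in> S \<Longrightarrow> w \<in> T \<Longrightarrow> ((\<lambda>i. D1 (F i) z w) has_sum D1 (\<lambda>z w. \<Sum>\<^sub>\<infinity>i\<in>I. F i z w) z w) I"
    and "z \<in> S \<Longrightarrow> w \<in> T \<Longrightarrow> ((\<lambda>i. D2 (F i) z w) has_sum D2 (\<lambda>z w. \<Sum>\<^sub>\<infinity>i\<in>I. F i z w) z w) I"
proof -
  have b1: "\<exists>U M. open U \<and> z \<in> U \<and> M summable_on I \<and> (\<forall>i\<in>I. \<forall>y\<in>U \<inter> S. norm (F i y w) \<le> M i)" if zw: "z \<in> S" "w \<in> T" for z w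
  proof -
    from bound[OF zw] obtain U V M where UV: "open U" "z \<in> U" "w \<in> V" "M summable_on I"
       "\<forall>i\<in>I. \<forall>z'\<in>U \<inter> S. \<forall>w'\<in>V \<inter> T. norm (F i z' w') \<le> M i" by blast
    have "\<forall>i\<in>I. \<forall>y\<in>U \<inter> S. norm (F i y w) \<le> M i" using UV(3,5) zw(2) by blast
    with UV(1,2,4) show ?thesis by blast
  qed
  have b2: "\<exists>U M. open U \<and> w \<in> U \<and> M summable_on I \<and> (\<forall>i\<in>I. \<forall>y\<in>U \<inter> T. norm (F i z y) \<le> M i)" if zw: "z \<in> S" "w \<in> T" for z w
  proof -
    from bound[OF zw] obtain U V M where UV: "open V" "z \<in> U" "w \<in> V" "M summable_on I"
       "\<forall>i\<in>I. \<forall>z'\<in>U \<inter> S. \<forall>w'\<in>V \<inter> T. norm (F i z' w') \<le> M i" by blast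
    have "\<forall>i\<in>I. \<forall>y\<in>V \<inter> T. norm (F i z y) \<le> M i" using UV(2,5) zw(1) by blast
    with UV(1,3,4) show ?thesis by blast
  qed
  have h1: "(\<lambda>z. F i z w) holomorphic_on S" if "i \<in> I" "w \<in> T" for i w using hol that by (simp add: hol2_def)
  have h2: "F i z holomorphic_on T" if "i \<in> I" "z \<in> S" for i z using hol that by (simp add: hol2_def)
  have "continuous_on (S \<times> T) (\<lambda>p. \<Sum>\<^sub>\<infinity>i\<in>I. F i (fst p) (snd p))"
  proof (rule continuous_on_infsum_local)
    show "continuous_on (S \<times> T) (\<lambda>p. F i (fst p) (snd p))" if "i \<in> I" for i using hol[OF that] by (simp add: hol2_def)
    fix p assume p: "p \<in> S \<times> T"
    then obtain U V M where UV: "open U" "open V" "fst p \<in> U" "snd p \<in> V" "M summable_on I"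
       "\<And>i z' w'. i \<in> I \<Longrightarrow> z' \<in> U \<inter> S \<Longrightarrow> w' \<in> V \<inter> T \<Longrightarrow> norm (F i z' w') \<le> M i"
      using bound[of "fst p" "snd p"] by (auto simp: mem_Times_iff)
    show "\<exists>U M. open U \<and> p \<in> U \<and> M summable_on I \<and> (\<forall>i\<in>I. \<forall>y\<in>U \<inter> S \<times> T. norm (F i (fst y) (snd y)) \<le> M i)"
      by (rule exI[of _ "U \<times> V"], rule exI[of _ M]) (use UV open_Times in \<open>auto simp: mem_Times_iff\<close>)
  qed (use open_Times[OF S T] in auto)
  thus "hol2 S T (\<lambda>z w. \<Sum>\<^sub>\<infinity>i\<in>I. F i z w)"
    using holomorphic_infsum_local(1)[OF h1 S b1] holomorphic_infsum_local(1)[OF h2 T b2] by (simp add: hol2_def)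
  assume zw: "z \<in> S" "w \<in> T"
  show "((\<lambda>i. D1 (F i) z w) has_sum D1 (\<lambda>z w. \<Sum>\<^sub>\<infinity>i\<in>I. F i z w) z w) I"
    using holomorphic_infsum_local(2)[where m = 1, OF h1[OF _ zw(2)] S b1[OF _ zw(2)] zw(1)] by (simp add: D1_def)
  show "((\<lambda>i. D2 (F i) z w) has_sum D2 (\<lambda>z w. \<Sum>\<^sub>\<infinity>i\<in>I. F i z w) z w) I"
    using holomorphic_infsum_local(2)[where m = 1, OF h2[OF _ zw(1)] T b2[OF zw(1)] zw(2)] by (simp add: D2_def)
qed

section \<open>Lattice sums\<close>

abbreviation lat :: "(int \<times> int) set" where "lat \<equiv> UNIV - {(0, 0)}"

definition lin :: "int \<times> int \<Rightarrow> complex \<Rightarrow> complex" where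
  "lin p z = of_int (fst p) * z + of_int (snd p)"

text \<open>The polarization of \<open>Im z / |mz+n|^2\<close>, to which it reduces for \<open>w = cnj z\<close>.\<close>
definition polar_height :: "int \<times> int \<Rightarrow> complex \<Rightarrow> complex \<Rightarrow> complex" where
  "polar_height p z w = (z - w) / (2 * \<i> * lin p z * lin p w)"

definition latnorm :: "int \<times> int \<Rightarrow> real" where
  "latnorm p = max \<bar>of_int (fst p)\<bar> \<bar>of_int (snd p)\<bar>"

lemma latnorm_ge_1: "p \<in> lat \<Longrightarrow> latnorm p \<ge> 1"
  by (cases p) (auto simp: latnorm_def max_def)

text \<open>The imaginary part controls |m|, and n differs from mz + n by at most |m| R. Only |Im z|
  enters, so the bound serves both half-planes, and it is uniform on compact sets.\<close>

lemma lin_lower: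
  assumes a: "a > 0" "a \<le> \<bar>Im z\<bar>" and R: "norm z \<le> R"
  shows "a / (1 + 2 * R) * latnorm p \<le> norm (lin p z)"
proof -
  define m n where "m = (of_int (fst p) :: real)" and "n = (of_int (snd p) :: real)"
  have l: "lin p z = of_real m * z + of_real n" by (simp add: lin_def m_def n_def)
  have R0: "R \<ge> a" "R > 0" using R a abs_Im_le_cmod[of z] by linarith+
  have "\<bar>m\<bar> * \<bar>Im z\<bar> = \<bar>Im (lin p z)\<bar>" by (simp add: l abs_mult)
  also have "\<dots> \<le> norm (lin p z)" by (rule abs_Im_le_cmod)
  finally have 1: "\<bar>m\<bar> * \<bar>Im z\<bar> \<le> norm (lin p z)" .
  hence m: "\<bar>m\<bar> * a \<le> norm (lin p z)" using a by (smt (verit) mult_left_mono abs_ge_zero)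
  have "\<bar>n\<bar> = norm (lin p z - of_real m * z)" by (simp add: l)
  also have "\<dots> \<le> norm (lin p z) + \<bar>m\<bar> * norm z" by (metis norm_triangle_ineq4 norm_mult norm_of_real)
  also have "\<bar>m\<bar> * norm z \<le> \<bar>m\<bar> * R" using R by (intro mult_left_mono) auto
  finally have "\<bar>n\<bar> * a \<le> (norm (lin p z) + \<bar>m\<bar> * R) * a" using a by (intro mult_right_mono) auto
  also have "\<dots> = norm (lin p z) * a + (\<bar>m\<bar> * a) * R" by (simp add: algebra_simps)
  also have "\<dots> \<le> norm (lin p z) * R + norm (lin p z) * R"
    using m R0 by (intro add_mono mult_left_mono mult_right_mono) auto
  finally have n: "\<bar>n\<bar> * a \<le> norm (lin p z) * (2 * R)" by (simp add: mult_ac)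
  have "latnorm p * a \<le> norm (lin p z) * (1 + 2 * R)"
  proof (cases "\<bar>m\<bar> \<le> \<bar>n\<bar>")
    case True
    hence "latnorm p = \<bar>n\<bar>" by (simp add: latnorm_def m_def n_def)
    thus ?thesis using n by (simp add: algebra_simps) (use norm_ge_zero[of "lin p z"] in linarith)
  next
    case False
    hence "latnorm p = \<bar>m\<bar>" by (simp add: latnorm_def m_def n_def)
    moreover have "norm (lin p z) * 1 \<le> norm (lin p z) * (1 + 2 * R)" using R0 by (intro mult_left_mono) auto
    ultimately show ?thesis using m by simp
  qed
  thus ?thesis using R0 by (simp add: field_simps)
qed

lemma lin_nonzero: "p \<in> lat \<Longrightarrow> Im z \<noteq> 0 \<Longrightarrow> lin p z \<noteq> 0"
proof
  assume p: "p \<in> lat" "Im z \<noteq> 0" "lin p z = 0"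
  have "\<bar>Im z\<bar> / (1 + 2 * norm z) * latnorm p \<le> norm (lin p z)" by (rule lin_lower) (use p in auto)
  moreover have "\<bar>Im z\<bar> / (1 + 2 * norm z) * latnorm p > 0"
    using p latnorm_ge_1[OF p(1)] by (intro mult_pos_pos divide_pos_pos add_pos_nonneg) auto
  ultimately show False using p(3) by simp
qed

text \<open>The square of max(|m|,|n|) dominates max(1,|m|) max(1,|n|), so the sum is majorised by a
  product of two sums over the integers with exponent q/2 > 1.\<close>

lemma summable_latnorm:
  assumes q: "q > (2::real)"
  shows "(\<lambda>p. latnorm p powr (-q)) summable_on lat"
proof -
  define g where "g n = max 1 \<bar>real_of_int n\<bar> powr (-(q/2))" for n
  have g: "g summable_on UNIV" unfolding g_def using q by (intro summable_on_int_powr) simp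
  have g0: "g n \<ge> 0" for n by (simp add: g_def)
  have "(\<lambda>p. norm (g (fst p) * g (snd p))) summable_on (UNIV \<times> UNIV)"
  proof (rule Infinite_Sum.abs_summable_on_Sigma_iff[THEN iffD2], rule conjI)
    show "\<forall>x\<in>UNIV. (\<lambda>y. norm (g (fst (x, y)) * g (snd (x, y)))) summable_on UNIV"
      using g g0 by (auto intro!: summable_on_cmult_right)
    have e: "(\<Sum>\<^sub>\<infinity>y\<in>UNIV. norm (g (fst (x, y)) * g (snd (x, y)))) = g x * infsum g UNIV" for x
      using g0 g by (simp add: infsum_cmult_right)
    moreover have "infsum g UNIV \<ge> 0" using g0 by (rule infsum_nonneg)
    ultimately show "(\<lambda>x. norm (\<Sum>\<^sub>\<infinity>y\<in>UNIV. norm (g (fst (x, y)) * g (snd (x, y))))) summable_on UNIV"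
      unfolding e using g g0 by (simp add: summable_on_cmult_left)
  qed
  hence "(\<lambda>p. g (fst p) * g (snd p)) summable_on UNIV" using g0 by (simp add: abs_mult)
  hence s: "(\<lambda>p. g (fst p) * g (snd p)) summable_on lat" by (rule summable_on_subset_banach) auto
  show ?thesis
  proof (rule summable_on_comparison_test[OF s])
    fix p assume p: "p \<in> lat"
    define N where "N = latnorm p"
    have N: "N \<ge> 1" using latnorm_ge_1[OF p] by (simp add: N_def)
    have "max 1 \<bar>of_int (fst p)\<bar> * max 1 \<bar>of_int (snd p)\<bar> \<le> N * N"
      using N by (intro mult_mono) (auto simp: N_def latnorm_def)
    hence "(N * N) powr (-(q/2)) \<le> (max 1 \<bar>of_int (fst p)\<bar> * max 1 \<bar>of_int (snd p)\<bar>) powr (-(q/2))"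
      using q by (intro powr_mono2') (auto intro!: mult_pos_pos add_pos_pos)
    also have "\<dots> = g (fst p) * g (snd p)" unfolding g_def by (rule powr_mult)
    also have "(N * N) powr (-(q/2)) = N powr (-q)"
      using N by (simp add: powr_mult powr_add[symmetric])
    finally show "latnorm p powr (-q) \<le> g (fst p) * g (snd p)" by (simp add: N_def)
  qed auto
qed

text \<open>For m different from 0, partial fractions write (z - w) / (l(z) l(w)) as (1/l(w) -
  1/l(z)) / m, whose imaginary part splits into a term in z and a term in w. For m = 0 the linear
  forms are constant.\<close>

lemma Re_polar_height:
  assumes z: "z \<in> UHP" and w: "w \<in> LHP" and p: "p \<in> lat"
  shows "Re (polar_height p z w) = (Im z / (norm (lin p z))\<^sup>2 + (- Im w) / (norm (lin p w))\<^sup>2) / 2"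
proof -
  have nz: "lin p z \<noteq> 0" "lin p w \<noteq> 0" using lin_nonzero[OF p] z w by (auto simp: UHP_def LHP_def)
  define m n where "m = (of_int (fst p) :: real)" and "n = (of_int (snd p) :: real)"
  have l: "lin p z = of_real m * z + of_real n" for z by (simp add: lin_def m_def n_def)
  have R: "Re (x / (2 * \<i>)) = Im x / 2" for x by (simp add: Re_divide power2_eq_square)
  have I: "Im (1 / u) = - Im u / (norm u)\<^sup>2" for u by (simp add: Im_divide cmod_power2)
  have v: "polar_height p z w = ((z - w) / (lin p z * lin p w)) / (2 * \<i>)"
    unfolding polar_height_def divide_divide_eq_left by (simp only: mult_ac)
  show ?thesis
  proof (cases "m = 0")
    case True
    hence "n \<noteq> 0" using p by (cases p) (auto simp: m_def n_def)
    have ln: "lin p z = of_real n" "lin p w = of_real n" using True by (simp_all add: l)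
    have "(z - w) / (lin p z * lin p w) = (z - w) / of_real (n\<^sup>2)" unfolding ln by (simp add: power2_eq_square)
    hence "Im ((z - w) / (lin p z * lin p w)) = (Im z - Im w) / n\<^sup>2" by (simp only: Im_divide_of_real) simp
    moreover have "norm (lin p z) ^ 2 = n\<^sup>2" "norm (lin p w) ^ 2 = n\<^sup>2" unfolding ln by auto
    ultimately show ?thesis unfolding v R by (simp add: diff_divide_distrib)
  next
    case False
    have "(z - w) / (lin p z * lin p w) = (1 / lin p w - 1 / lin p z) / of_real m"
      using False nz by (simp add: field_simps) (simp add: l algebra_simps)
    hence "Im ((z - w) / (lin p z * lin p w)) = (Im (1 / lin p w) - Im (1 / lin p z)) / m"
      by (simp only: Im_divide_of_real minus_complex.sel)
    also have "\<dots> = (Im (lin p z) / (norm (lin p z))\<^sup>2 - Im (lin p w) / (norm (lin p w))\<^sup>2) / m"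
      unfolding I by simp
    also have "\<dots> = Im z / (norm (lin p z))\<^sup>2 + (- Im w) / (norm (lin p w))\<^sup>2"
      using False nz by (simp add: l field_simps)
    finally show ?thesis unfolding v R by simp
  qed
qed

lemma Re_polar_height_pos:
  assumes z: "z \<in> UHP" and w: "w \<in> LHP" and p: "p \<in> lat"
  shows "Re (polar_height p z w) > 0"
proof -
  have I: "Im z > 0" "- Im w > 0" using z w by (auto simp: UHP_def LHP_def)
  have "lin p z \<noteq> 0" "lin p w \<noteq> 0" using lin_nonzero[OF p] I by auto
  hence "Im z / (norm (lin p z))\<^sup>2 > 0" "(- Im w) / (norm (lin p w))\<^sup>2 > 0"
    using I by (intro divide_pos_pos; simp)+
  thus ?thesis unfolding Re_polar_height[OF assms] by simp
qed

text \<open>The inequality 2AB \<le> A^2 + B^2, applied to the two summands of the real part. For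
  fixed z and w all values over the lattice lie in one sector; on the diagonal the constant is
  1.\<close>

lemma polar_height_sector:
  assumes z: "z \<in> UHP" and w: "w \<in> LHP" and p: "p \<in> lat"
  shows "2 * sqrt (Im z * (- Im w)) / norm (z - w) * norm (polar_height p z w) \<le> Re (polar_height p z w)"
proof -
  have I: "Im z > 0" "- Im w > 0" using z w by (auto simp: UHP_def LHP_def)
  have nz: "lin p z \<noteq> 0" "lin p w \<noteq> 0" using lin_nonzero[OF p] I by auto
  have "z \<noteq> w" using I by auto
  define A where "A = sqrt (Im z) / norm (lin p z)"
  define B where "B = sqrt (- Im w) / norm (lin p w)"
  have "2 * sqrt (Im z * (- Im w)) / norm (z - w) * norm (polar_height p z w) = A * B"
    using \<open>z \<noteq> w\<close> nz unfolding A_def B_def polar_height_def real_sqrt_mult by (simp add: norm_divide norm_mult)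
  also have "\<dots> \<le> (A\<^sup>2 + B\<^sup>2) / 2" using sum_squares_bound[of A B] by simp
  also have "\<dots> = Re (polar_height p z w)" unfolding Re_polar_height[OF assms] A_def B_def using I by (simp add: power_divide)
  finally show ?thesis .
qed

text \<open>The identity l(z) - m (z - w) = l(w) cancels the other variable: d/dz depends on z alone
  and d/dw on w alone. This is what lets derivatives pass between weight 2 and weight 0
  sums.\<close>

lemma polar_height_derivs:
  assumes z: "z \<in> UHP" and w: "w \<in> LHP" and p: "p \<in> lat"
  shows "((\<lambda>z. polar_height p z w) has_field_derivative 1 / (2 * \<i> * (lin p z)\<^sup>2)) (at z)"
    "((\<lambda>w. polar_height p z w) has_field_derivative - 1 / (2 * \<i> * (lin p w)\<^sup>2)) (at w)"
proof -
  have I: "Im z > 0" "- Im w > 0" using z w by (auto simp: UHP_def LHP_def)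
  have nz: "lin p z \<noteq> 0" "lin p w \<noteq> 0" using lin_nonzero[OF p] I by auto
  have d: "(lin p has_field_derivative of_int (fst p)) (at u)" for u
    unfolding lin_def[abs_def] by (auto intro!: derivative_eq_intros)
  have "((\<lambda>z. polar_height p z w) has_field_derivative
     (1 * (2 * \<i> * lin p z * lin p w) - (z - w) * (2 * \<i> * of_int (fst p) * lin p w)) / ((2 * \<i> * lin p z * lin p w) * (2 * \<i> * lin p z * lin p w))) (at z)"
    unfolding polar_height_def using nz by (auto intro!: derivative_eq_intros d)
  also have "(1 * (2 * \<i> * lin p z * lin p w) - (z - w) * (2 * \<i> * of_int (fst p) * lin p w)) = 2 * \<i> * lin p w * (lin p z - (z - w) * of_int (fst p))"
    by (simp add: algebra_simps)
  also have "lin p z - (z - w) * of_int (fst p) = lin p w" by (simp add: lin_def algebra_simps)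
  also have "2 * \<i> * lin p w * lin p w / ((2 * \<i> * lin p z * lin p w) * (2 * \<i> * lin p z * lin p w)) = 1 / (2 * \<i> * (lin p z)\<^sup>2)"
    using nz by (simp add: power2_eq_square)
  finally show "((\<lambda>z. polar_height p z w) has_field_derivative 1 / (2 * \<i> * (lin p z)\<^sup>2)) (at z)" .
  have "((\<lambda>w. polar_height p z w) has_field_derivative
     (- 1 * (2 * \<i> * lin p z * lin p w) - (z - w) * (2 * \<i> * lin p z * of_int (fst p))) / ((2 * \<i> * lin p z * lin p w) * (2 * \<i> * lin p z * lin p w))) (at w)"
    unfolding polar_height_def using nz by (auto intro!: derivative_eq_intros d)
  also have "(- 1 * (2 * \<i> * lin p z * lin p w) - (z - w) * (2 * \<i> * lin p z * of_int (fst p))) = - 2 * \<i> * lin p z * (lin p w + (z - w) * of_int (fst p))"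
    by (simp add: algebra_simps)
  also have "lin p w + (z - w) * of_int (fst p) = lin p z" by (simp add: lin_def algebra_simps)
  also have "- 2 * \<i> * lin p z * lin p z / ((2 * \<i> * lin p z * lin p w) * (2 * \<i> * lin p z * lin p w)) = - 1 / (2 * \<i> * (lin p w)\<^sup>2)"
    using nz by (simp add: power2_eq_square)
  finally show "((\<lambda>w. polar_height p z w) has_field_derivative - 1 / (2 * \<i> * (lin p w)\<^sup>2)) (at w)" .
qed

section \<open>Lattice sums over profiles on the right half-plane\<close>

definition RHP :: "complex set" where "RHP = {v. Re v > 0}"

lemma open_RHP [simp]: "open RHP" unfolding RHP_def by (rule open_halfspace_Re_gt)

lemma polar_height_RHP: "z \<in> UHP \<Longrightarrow> w \<in> LHP \<Longrightarrow> p \<in> lat \<Longrightarrow> polar_height p z w \<in> RHP"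
  using Re_polar_height_pos by (simp add: RHP_def)

lemma hol2_lin: "p \<in> lat \<Longrightarrow> hol2 UHP LHP (\<lambda>z w. 1 / (lin p z)\<^sup>2)"
  unfolding hol2_def using lin_nonzero[of p]
  by (auto simp: lin_def UHP_def intro!: continuous_intros holomorphic_intros)

lemma hol2_polar_height: "p \<in> lat \<Longrightarrow> hol2 UHP LHP (polar_height p)"
proof -
  assume p: "p \<in> lat"
  have nz: "lin p z \<noteq> 0" "lin p w \<noteq> 0" if "z \<in> UHP" "w \<in> LHP" for z w
    using lin_nonzero[OF p] that by (auto simp: UHP_def LHP_def)
  have c: "continuous_on (UHP \<times> LHP) (\<lambda>q. (fst q - snd q) / (2 * \<i> * lin p (fst q) * lin p (snd q)))"
    by (intro continuous_on_divide) (auto simp: lin_def nz[unfolded lin_def] intro!: continuous_intros)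
  have "((\<lambda>z. polar_height p z w) holomorphic_on UHP)" if "w \<in> LHP" for w
    using polar_height_derivs(1)[OF _ that p] by (auto simp: holomorphic_on_open)
  moreover have "(polar_height p z holomorphic_on LHP)" if "z \<in> UHP" for z
    using polar_height_derivs(2)[OF that _ p] by (auto simp: holomorphic_on_open)
  ultimately show ?thesis using c by (simp add: hol2_def polar_height_def[symmetric])
qed

text \<open>A quadratic bound on every sector. Locally uniformly \<open>polar_height p\<close> is of
  order |p|^(-2) and stays in a sector, so the lattice sums are majorised by |p|^(-4).\<close>

definition flat :: "(complex \<Rightarrow> complex) \<Rightarrow> bool" where
  "flat \<phi> \<longleftrightarrow> \<phi> holomorphic_on RHP \<and>
     (\<forall>\<kappa>>0. \<exists>C. \<forall>v\<in>RHP. \<kappa> * norm v \<le> Re v \<longrightarrow> norm (\<phi> v) \<le> C * (norm v)\<^sup>2)"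

lemma flat_bound:
  assumes \<phi>: "flat \<phi>" and a: "a > 0"
  obtains C where "C \<ge> 0" "\<And>p z w. p \<in> lat \<Longrightarrow> Im z \<ge> a \<Longrightarrow> Im w \<le> -a \<Longrightarrow> norm z \<le> R \<Longrightarrow> norm w \<le> R \<Longrightarrow>
      norm (\<phi> (polar_height p z w)) \<le> C * latnorm p powr (-4) \<and>
      norm (\<phi> (polar_height p z w) * (1 / (lin p z)\<^sup>2)) \<le> C * latnorm p powr (-4)"
proof (cases "R > 0")
  case R: True
  \<comment> \<open>The constant in \<open>polar_height_sector\<close> is at least 2a / (2R), as the
    root is at least a and |z - w| \<le> 2R.\<close>
  define \<kappa> where "\<kappa> = a / R"
  have k: "\<kappa> > 0" using a R by (simp add: \<kappa>_def)
  obtain C0 where "\<And>v. v \<in> RHP \<Longrightarrow> \<kappa> * norm v \<le> Re v \<Longrightarrow> norm (\<phi> v) \<le> C0 * (norm v)\<^sup>2"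
    using \<phi> k unfolding flat_def by blast
  hence C0: "norm (\<phi> v) \<le> \<bar>C0\<bar> * (norm v)\<^sup>2" if "v \<in> RHP" "\<kappa> * norm v \<le> Re v" for v
    using that by (smt (verit) mult_right_mono zero_le_power2)
  define \<delta> where "\<delta> = a / (1 + 2 * R)"
  have d: "\<delta> > 0" using a R by (simp add: \<delta>_def)
  define C where "C = \<bar>C0\<bar> * (R / \<delta>\<^sup>2)\<^sup>2"
  have main: "norm (\<phi> (polar_height p z w)) \<le> C * latnorm p powr (-4) \<and>
      norm (\<phi> (polar_height p z w) * (1 / (lin p z)\<^sup>2)) \<le> max C (C / \<delta>\<^sup>2) * latnorm p powr (-4)"
    if p: "p \<in> lat" and zw: "Im z \<ge> a" "Im w \<le> -a" "norm z \<le> R" "norm w \<le> R" for p z w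
  proof -
    have z: "z \<in> UHP" and w: "w \<in> LHP" using zw a by (auto simp: UHP_def LHP_def)
    define N where "N = latnorm p"
    have N: "N \<ge> 1" using latnorm_ge_1[OF p] by (simp add: N_def)
    have lz: "\<delta> * N \<le> norm (lin p z)" unfolding \<delta>_def N_def by (rule lin_lower) (use a zw in auto)
    have lw: "\<delta> * N \<le> norm (lin p w)" unfolding \<delta>_def N_def by (rule lin_lower) (use a zw in auto)
    have dN: "\<delta> * N > 0" using d N by simp
    have zw2: "norm (z - w) \<le> 2 * R" using norm_triangle_ineq4[of z w] zw by simp
    have "z \<noteq> w" using zw a by auto
    have "sqrt (a * a) \<le> sqrt (Im z * (- Im w))" using zw a by (intro real_sqrt_le_mono mult_mono) auto
    hence "a \<le> sqrt (Im z * (- Im w))" using a by simp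
    hence "2 * a / (2 * R) \<le> 2 * sqrt (Im z * (- Im w)) / norm (z - w)"
      using zw2 a R \<open>z \<noteq> w\<close> mult_nonneg_nonpos[of "Im z" "Im w"] zw by (intro frac_le) auto
    hence "\<kappa> * norm (polar_height p z w) \<le> 2 * sqrt (Im z * (- Im w)) / norm (z - w) * norm (polar_height p z w)"
      by (intro mult_right_mono) (auto simp: \<kappa>_def)
    also have "\<dots> \<le> Re (polar_height p z w)" by (rule polar_height_sector[OF z w p])
    finally have sec: "\<kappa> * norm (polar_height p z w) \<le> Re (polar_height p z w)" .
    have "norm (polar_height p z w) = norm (z - w) / (2 * (norm (lin p z) * norm (lin p w)))"
      by (simp add: polar_height_def norm_divide norm_mult)
    also have "\<dots> \<le> (2 * R) / (2 * ((\<delta> * N) * (\<delta> * N)))"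
      using zw2 lz lw dN R d N by (intro frac_le mult_left_mono mult_mono mult_pos_pos) auto
    also have "\<dots> = (R / \<delta>\<^sup>2) * (1 / N\<^sup>2)" by (simp add: power2_eq_square)
    finally have "(norm (polar_height p z w))\<^sup>2 \<le> ((R / \<delta>\<^sup>2) * (1 / N\<^sup>2))\<^sup>2" by (intro power_mono) auto
    also have "\<dots> = (R / \<delta>\<^sup>2)\<^sup>2 * (1 / N ^ 4)" by (simp add: power_mult_distrib power_divide power_mult[symmetric])
    also have "1 / N ^ 4 = N powr (-4)" using N by (simp add: powr_minus_divide)
    finally have "(norm (polar_height p z w))\<^sup>2 \<le> (R / \<delta>\<^sup>2)\<^sup>2 * N powr (-4)" .
    hence "\<bar>C0\<bar> * (norm (polar_height p z w))\<^sup>2 \<le> \<bar>C0\<bar> * ((R / \<delta>\<^sup>2)\<^sup>2 * N powr (-4))" by (intro mult_left_mono) auto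
    with C0[OF polar_height_RHP[OF z w p] sec] have 1: "norm (\<phi> (polar_height p z w)) \<le> C * N powr (-4)"
      by (simp add: C_def mult.assoc)
    have "norm (1 / (lin p z)\<^sup>2) \<le> 1 / \<delta>\<^sup>2"
    proof -
      have "\<delta> * 1 \<le> \<delta> * N" using d N by (intro mult_left_mono) auto
      hence "\<delta> \<le> norm (lin p z)" using lz by linarith
      hence "\<delta>\<^sup>2 \<le> (norm (lin p z))\<^sup>2" using d by (intro power_mono) auto
      thus ?thesis using d by (simp add: norm_divide norm_power frac_le)
    qed
    with 1 have "norm (\<phi> (polar_height p z w)) * norm (1 / (lin p z)\<^sup>2) \<le> (C * N powr (-4)) * (1 / \<delta>\<^sup>2)"
      by (intro mult_mono) (auto intro: order_trans[OF norm_ge_zero])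
    also have "\<dots> = C / \<delta>\<^sup>2 * N powr (-4)" by simp
    also have "\<dots> \<le> max C (C / \<delta>\<^sup>2) * N powr (-4)" by (intro mult_right_mono) auto
    finally have 2: "norm (\<phi> (polar_height p z w)) * norm (1 / (lin p z)\<^sup>2) \<le> max C (C / \<delta>\<^sup>2) * N powr (-4)" .
    show ?thesis using 1 2 unfolding norm_mult N_def by (rule conjI)
  qed
  have le: "C * latnorm p powr (-4) \<le> max C (C / \<delta>\<^sup>2) * latnorm p powr (-4)" for p by (intro mult_right_mono) auto
  show ?thesis
  proof (rule that[of "max C (C / \<delta>\<^sup>2)"])
    show "max C (C / \<delta>\<^sup>2) \<ge> 0" by (simp add: C_def le_max_iff_disj)
    fix p z w assume "p \<in> lat" "Im z \<ge> a" "Im w \<le> -a" "norm z \<le> R" "norm w \<le> R"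
    note m = main[OF this]
    show "norm (\<phi> (polar_height p z w)) \<le> max C (C / \<delta>\<^sup>2) * latnorm p powr (-4) \<and>
      norm (\<phi> (polar_height p z w) * (1 / (lin p z)\<^sup>2)) \<le> max C (C / \<delta>\<^sup>2) * latnorm p powr (-4)"
      by (rule conjI[OF order_trans[OF conjunct1[OF m] le] conjunct2[OF m]])
  qed
next
  \<comment> \<open>If R \<le> 0, no z satisfies Im z \<ge> a > 0 and norm z \<le> R, so any
    constant serves.\<close>
  case False
  show ?thesis
  proof (rule that[of 0])
    fix p z w assume "Im z \<ge> a" "norm z \<le> R"
    thus "norm (\<phi> (polar_height p z w)) \<le> 0 * latnorm p powr (-4) \<and> norm (\<phi> (polar_height p z w) * (1 / (lin p z)\<^sup>2)) \<le> 0 * latnorm p powr (-4)"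
      using False a abs_Im_le_cmod[of z] by linarith
  qed auto
qed

text \<open>The digit in \<open>LS2\<close> and \<open>LS0\<close> is the weight on the diagonal,
  where \<open>polar_height\<close> is invariant and the factor (mz+n)^(-2) carries weight
  2.\<close>

definition LS2 :: "(complex \<Rightarrow> complex) \<Rightarrow> complex \<Rightarrow> complex \<Rightarrow> complex" where
  "LS2 \<phi> z w = (\<Sum>\<^sub>\<infinity>p\<in>lat. \<phi> (polar_height p z w) * (1 / (lin p z)\<^sup>2))"

definition LS0 :: "(complex \<Rightarrow> complex) \<Rightarrow> complex \<Rightarrow> complex \<Rightarrow> complex" where
  "LS0 \<phi> z w = (\<Sum>\<^sub>\<infinity>p\<in>lat. \<phi> (polar_height p z w))"

lemma flat_local_bound:
  assumes \<phi>: "flat \<phi>" and z: "z \<in> UHP" and w: "w \<in> LHP"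
  shows "\<exists>U V M. open U \<and> open V \<and> z \<in> U \<and> w \<in> V \<and> M summable_on lat \<and>
     (\<forall>p\<in>lat. \<forall>z'\<in>U \<inter> UHP. \<forall>w'\<in>V \<inter> LHP. norm (\<phi> (polar_height p z' w')) \<le> M p \<and> norm (\<phi> (polar_height p z' w') * (1 / (lin p z')\<^sup>2)) \<le> M p)"
proof -
  define a where "a = min (Im z) (- Im w) / 2"
  define R where "R = norm z + norm w + 1"
  have a: "a > 0" using z w by (auto simp: a_def UHP_def LHP_def)
  obtain C where C: "\<And>p z w. p \<in> lat \<Longrightarrow> Im z \<ge> a \<Longrightarrow> Im w \<le> -a \<Longrightarrow> norm z \<le> R \<Longrightarrow> norm w \<le> R \<Longrightarrow>
      norm (\<phi> (polar_height p z w)) \<le> C * latnorm p powr (-4) \<and>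
      norm (\<phi> (polar_height p z w) * (1 / (lin p z)\<^sup>2)) \<le> C * latnorm p powr (-4)"
    using flat_bound[OF \<phi> a, of R] by metis
  define U where "U = {z'. Im z' > a} \<inter> ball 0 R"
  define V where "V = {w'. Im w' < -a} \<inter> ball 0 R"
  have "open U" "open V" unfolding U_def V_def
    by (intro open_Int open_halfspace_Im_gt open_halfspace_Im_lt open_ball)+
  moreover have "z \<in> U" "w \<in> V" using z w by (auto simp: U_def V_def a_def R_def UHP_def LHP_def min_def intro: add_nonneg_pos)
  moreover have "(\<lambda>p. C * latnorm p powr (-4)) summable_on lat"
    by (intro summable_on_cmult_right summable_latnorm) simp
  moreover have "\<forall>p\<in>lat. \<forall>z'\<in>U \<inter> UHP. \<forall>w'\<in>V \<inter> LHP. norm (\<phi> (polar_height p z' w')) \<le> C * latnorm p powr (-4) \<and>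
      norm (\<phi> (polar_height p z' w') * (1 / (lin p z')\<^sup>2)) \<le> C * latnorm p powr (-4)"
    by (intro ballI C) (auto simp: U_def V_def)
  ultimately show ?thesis by blast
qed

lemma LS_hol2:
  assumes \<phi>: "flat \<phi>"
  shows "hol2 UHP LHP (LS2 \<phi>)" "hol2 UHP LHP (LS0 \<phi>)"
    and "z \<in> UHP \<Longrightarrow> w \<in> LHP \<Longrightarrow> ((\<lambda>p. - 1 / (2 * \<i>) * (deriv \<phi> (polar_height p z w) / ((lin p z)\<^sup>2 * (lin p w)\<^sup>2))) has_sum D2 (LS2 \<phi>) z w) lat"
    and "z \<in> UHP \<Longrightarrow> w \<in> LHP \<Longrightarrow> ((\<lambda>p. 1 / (2 * \<i>) * (deriv \<phi> (polar_height p z w) * (1 / (lin p z)\<^sup>2))) has_sum D1 (LS0 \<phi>) z w) lat"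
    and "z \<in> UHP \<Longrightarrow> w \<in> LHP \<Longrightarrow> ((\<lambda>p. \<phi> (polar_height p z w) * (1 / (lin p z)\<^sup>2)) has_sum LS2 \<phi> z w) lat"
    and "z \<in> UHP \<Longrightarrow> w \<in> LHP \<Longrightarrow> ((\<lambda>p. \<phi> (polar_height p z w)) has_sum LS0 \<phi> z w) lat"
proof -
  have h0: "hol2 UHP LHP (\<lambda>z w. \<phi> (polar_height p z w))" if "p \<in> lat" for p
    by (rule hol2_compose[OF hol2_polar_height[OF that]]) (use \<phi> polar_height_RHP[OF _ _ that] in \<open>auto simp: flat_def\<close>)
  have h2: "hol2 UHP LHP (\<lambda>z w. \<phi> (polar_height p z w) * (1 / (lin p z)\<^sup>2))" if "p \<in> lat" for p
    by (rule hol2_mult[OF h0[OF that] hol2_lin[OF that]])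
  have b0: "\<exists>U V M. open U \<and> open V \<and> z \<in> U \<and> w \<in> V \<and> M summable_on lat \<and>
     (\<forall>p\<in>lat. \<forall>z'\<in>U \<inter> UHP. \<forall>w'\<in>V \<inter> LHP. norm (\<phi> (polar_height p z' w')) \<le> M p)" if "z \<in> UHP" "w \<in> LHP" for z w
    using flat_local_bound[OF \<phi> that] by (elim exE conjE) (intro exI conjI, assumption+, blast)
  have b2: "\<exists>U V M. open U \<and> open V \<and> z \<in> U \<and> w \<in> V \<and> M summable_on lat \<and>
     (\<forall>p\<in>lat. \<forall>z'\<in>U \<inter> UHP. \<forall>w'\<in>V \<inter> LHP. norm (\<phi> (polar_height p z' w') * (1 / (lin p z')\<^sup>2)) \<le> M p)" if "z \<in> UHP" "w \<in> LHP" for z w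
    using flat_local_bound[OF \<phi> that] by (elim exE conjE) (intro exI conjI, assumption+, blast)
  note H2 = hol2_infsum[where F = "\<lambda>p z w. \<phi> (polar_height p z w) * (1 / (lin p z)\<^sup>2)", OF h2 open_UHP open_LHP b2]
  note H0 = hol2_infsum[where F = "\<lambda>p z w. \<phi> (polar_height p z w)", OF h0 open_UHP open_LHP b0]
  show "hol2 UHP LHP (LS2 \<phi>)" "hol2 UHP LHP (LS0 \<phi>)"
    using H2(1) H0(1) by (simp_all add: LS2_def[abs_def] LS0_def[abs_def])
  assume z: "z \<in> UHP" and w: "w \<in> LHP"
  have d\<phi>: "(\<phi> has_field_derivative deriv \<phi> (polar_height p z w)) (at (polar_height p z w))" if "p \<in> lat" for p
    using \<phi> polar_height_RHP[OF z w that] by (auto simp: flat_def intro!: holomorphic_derivI)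
  have "D2 (\<lambda>z w. \<phi> (polar_height p z w) * (1 / (lin p z)\<^sup>2)) z w = - 1 / (2 * \<i>) * (deriv \<phi> (polar_height p z w) / ((lin p z)\<^sup>2 * (lin p w)\<^sup>2))"
    if p: "p \<in> lat" for p
  proof -
    have "((\<lambda>w. \<phi> (polar_height p z w) * (1 / (lin p z)\<^sup>2)) has_field_derivative deriv \<phi> (polar_height p z w) * (- 1 / (2 * \<i> * (lin p w)\<^sup>2)) * (1 / (lin p z)\<^sup>2)) (at w)"
      by (intro DERIV_cmult_right DERIV_chain2[OF d\<phi>[OF p] polar_height_derivs(2)[OF z w p]])
    hence "D2 (\<lambda>z w. \<phi> (polar_height p z w) * (1 / (lin p z)\<^sup>2)) z w = deriv \<phi> (polar_height p z w) * (- 1 / (2 * \<i> * (lin p w)\<^sup>2)) * (1 / (lin p z)\<^sup>2)"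
      unfolding D2_def by (rule DERIV_imp_deriv)
    also have "x * (- 1 / (c * b)) * (1 / a) = - 1 / c * (x / (a * b))" for x a b c :: complex
      by (simp add: divide_inverse mult_ac)
    finally show ?thesis .
  qed
  moreover have "((\<lambda>p. D2 (\<lambda>z w. \<phi> (polar_height p z w) * (1 / (lin p z)\<^sup>2)) z w) has_sum D2 (LS2 \<phi>) z w) lat"
    unfolding LS2_def[abs_def] by (rule H2(3)) (use z w in auto)
  ultimately show "((\<lambda>p. - 1 / (2 * \<i>) * (deriv \<phi> (polar_height p z w) / ((lin p z)\<^sup>2 * (lin p w)\<^sup>2))) has_sum D2 (LS2 \<phi>) z w) lat"
    by (rule has_sum_cong[THEN iffD1])
  have "D1 (\<lambda>z w. \<phi> (polar_height p z w)) z w = 1 / (2 * \<i>) * (deriv \<phi> (polar_height p z w) * (1 / (lin p z)\<^sup>2))"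
    if p: "p \<in> lat" for p
  proof -
    have "((\<lambda>z. \<phi> (polar_height p z w)) has_field_derivative deriv \<phi> (polar_height p z w) * (1 / (2 * \<i> * (lin p z)\<^sup>2))) (at z)"
      by (rule DERIV_chain2[OF d\<phi>[OF p] polar_height_derivs(1)[OF z w p]])
    hence "D1 (\<lambda>z w. \<phi> (polar_height p z w)) z w = deriv \<phi> (polar_height p z w) * (1 / (2 * \<i> * (lin p z)\<^sup>2))"
      unfolding D1_def by (rule DERIV_imp_deriv)
    also have "x * (1 / (c * a)) = 1 / c * (x * (1 / a))" for x a c :: complex
      by (simp add: divide_inverse mult_ac)
    finally show ?thesis .
  qed
  moreover have "((\<lambda>p. D1 (\<lambda>z w. \<phi> (polar_height p z w)) z w) has_sum D1 (LS0 \<phi>) z w) lat"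
    unfolding LS0_def[abs_def] by (rule H0(2)) (use z w in auto)
  ultimately show "((\<lambda>p. 1 / (2 * \<i>) * (deriv \<phi> (polar_height p z w) * (1 / (lin p z)\<^sup>2))) has_sum D1 (LS0 \<phi>) z w) lat"
    by (rule has_sum_cong[THEN iffD1])
  obtain U V M where UV: "z \<in> U" "w \<in> V" "M summable_on lat"
     "\<forall>p\<in>lat. \<forall>z'\<in>U \<inter> UHP. \<forall>w'\<in>V \<inter> LHP. norm (\<phi> (polar_height p z' w')) \<le> M p \<and> norm (\<phi> (polar_height p z' w') * (1 / (lin p z')\<^sup>2)) \<le> M p"
    using flat_local_bound[OF \<phi> z w] by blast
  have "(\<lambda>p. \<phi> (polar_height p z w) * (1 / (lin p z)\<^sup>2)) summable_on lat" "(\<lambda>p. \<phi> (polar_height p z w)) summable_on lat"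
    by (rule abs_summable_summable[OF Infinite_Sum.abs_summable_on_comparison_test'[OF UV(3)]], use UV z w in blast)+
  thus "((\<lambda>p. \<phi> (polar_height p z w) * (1 / (lin p z)\<^sup>2)) has_sum LS2 \<phi> z w) lat" "((\<lambda>p. \<phi> (polar_height p z w)) has_sum LS0 \<phi> z w) lat"
    by (simp_all add: LS2_def LS0_def)
qed

section \<open>Modular forms built from profiles\<close>

definition latform :: "(complex \<Rightarrow> complex) \<Rightarrow> complex \<Rightarrow> complex" where
  "latform \<phi> z = (if z \<in> UHP then LS2 \<phi> z (cnj z) else 0)"

lemma lin_cnj: "lin p (cnj z) = cnj (lin p z)"
  by (simp add: lin_def)

lemma polar_height_diagonal: "polar_height p z (cnj z) = of_real (Im z / (norm (lin p z))\<^sup>2)"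
proof -
  have "z - cnj z = 2 * \<i> * of_real (Im z)" by (simp add: complex_eq_iff)
  hence "polar_height p z (cnj z) = (2 * \<i> * of_real (Im z)) / (2 * \<i> * (lin p z * cnj (lin p z)))"
    by (simp add: polar_height_def lin_cnj mult.assoc)
  also have "\<dots> = of_real (Im z) / (lin p z * cnj (lin p z))" by simp
  also have "lin p z * cnj (lin p z) = of_real ((norm (lin p z))\<^sup>2)" by (simp only: complex_norm_square)
  finally show ?thesis by simp
qed

lemma latform_wirtinger:
  assumes "flat \<phi>" "z \<in> UHP"
  shows "has_wirtinger (latform \<phi>) (D1 (LS2 \<phi>) z (cnj z)) (D2 (LS2 \<phi>) z (cnj z)) z"
  by (rule diagonal_wirtinger[OF LS_hol2(1)[OF assms(1)]]) (auto simp: latform_def assms)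

lemma latform_smooth: "flat \<phi> \<Longrightarrow> smooth_UHP (latform \<phi>)"
  by (rule diagonal_smooth[OF LS_hol2(1)]) (auto simp: latform_def)

text \<open>On the diagonal y^2 / (l^2 (cnj l)^2) is the square of v, so y^2 times the termwise d/dw
  of the weight 2 sum is a weight 0 sum with profile v^2 \<phi>'.\<close>

lemma lowering_latform:
  assumes \<phi>: "flat \<phi>" and z: "z \<in> UHP"
  shows "lowering (latform \<phi>) z = (\<i> / 2) * LS0 (\<lambda>v. v\<^sup>2 * deriv \<phi> v) z (cnj z)"
proof -
  have w: "cnj z \<in> LHP" using z by simp
  have "dzb (latform \<phi>) z = D2 (LS2 \<phi>) z (cnj z)"
    by (rule has_wirtinger_imp(3)[OF latform_wirtinger[OF \<phi> z]])
  hence "lowering (latform \<phi>) z = (of_real (Im z))\<^sup>2 * D2 (LS2 \<phi>) z (cnj z)" by (simp add: lowering_def)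
  also have "D2 (LS2 \<phi>) z (cnj z) = (\<Sum>\<^sub>\<infinity>p\<in>lat. - 1 / (2 * \<i>) * (deriv \<phi> (polar_height p z (cnj z)) / ((lin p z)\<^sup>2 * (lin p (cnj z))\<^sup>2)))"
    by (rule infsumI[symmetric, OF LS_hol2(3)[OF \<phi> z w]])
  also have "(of_real (Im z))\<^sup>2 * \<dots> = (\<Sum>\<^sub>\<infinity>p\<in>lat. (of_real (Im z))\<^sup>2 * (- 1 / (2 * \<i>) * (deriv \<phi> (polar_height p z (cnj z)) / ((lin p z)\<^sup>2 * (lin p (cnj z))\<^sup>2))))"
    by (rule infsum_cmult_right'[symmetric])
  also have "\<dots> = (\<Sum>\<^sub>\<infinity>p\<in>lat. (\<i> / 2) * ((polar_height p z (cnj z))\<^sup>2 * deriv \<phi> (polar_height p z (cnj z))))"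
  proof (rule infsum_cong)
    fix p
    define a where "a = lin p z"
    have "polar_height p z (cnj z) = of_real (Im z) / of_real ((norm a)\<^sup>2)" by (simp add: polar_height_diagonal a_def)
    also have "of_real ((norm a)\<^sup>2) = a * cnj a" by (simp only: complex_norm_square)
    finally have v: "(polar_height p z (cnj z))\<^sup>2 = (of_real (Im z))\<^sup>2 / (a\<^sup>2 * (cnj a)\<^sup>2)"
      by (simp add: power_divide power_mult_distrib)
    show "(of_real (Im z))\<^sup>2 * (- 1 / (2 * \<i>) * (deriv \<phi> (polar_height p z (cnj z)) / ((lin p z)\<^sup>2 * (lin p (cnj z))\<^sup>2))) = (\<i> / 2) * ((polar_height p z (cnj z))\<^sup>2 * deriv \<phi> (polar_height p z (cnj z)))"
    proof -
      have c: "- 1 / (2 * \<i>) = \<i> / 2" by (simp add: complex_eq_iff)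
      have "Y * (c * (D / Q)) = c * (Y / Q * D)" for Y c D Q :: complex by simp
      thus ?thesis unfolding v lin_cnj a_def c .
    qed
  qed
  also have "\<dots> = (\<i> / 2) * LS0 (\<lambda>v. v\<^sup>2 * deriv \<phi> v) z (cnj z)" unfolding LS0_def by (rule infsum_cmult_right')
  finally show ?thesis .
qed

text \<open>On profiles the Laplacian is d/dv v^2 d/dv: the constants i/2 from the lowering, 1/(2i)
  from d/dz and 4 from \<open>hyp_lap_eq\<close> multiply to 1.\<close>

lemma hyp_lap_latform:
  assumes \<phi>: "flat \<phi>" and \<psi>: "flat (\<lambda>v. v\<^sup>2 * deriv \<phi> v)" and z: "z \<in> UHP"
  shows "hyp_lap 2 (latform \<phi>) z = LS2 (deriv (\<lambda>v. v\<^sup>2 * deriv \<phi> v)) z (cnj z)"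
proof -
  define \<omega> where "\<omega> v = v\<^sup>2 * deriv \<phi> v" for v
  have \<omega>: "flat \<omega>" using \<psi> by (simp add: \<omega>_def[abs_def])
  have w: "cnj z \<in> LHP" using z by simp
  have "dz (lowering (latform \<phi>)) z = dz (\<lambda>z. (\<i> / 2) * LS0 \<omega> z (cnj z)) z"
    by (rule dz_cong[OF _ z]) (simp add: lowering_latform[OF \<phi>] \<omega>_def[abs_def])
  also have "\<dots> = (\<i> / 2) * D1 (LS0 \<omega>) z (cnj z)"
    by (rule has_wirtinger_imp(2)[OF has_wirtinger_cmult[OF diagonal_wirtinger[OF LS_hol2(2)[OF \<omega>] refl z]]])
  also have "D1 (LS0 \<omega>) z (cnj z) = (\<Sum>\<^sub>\<infinity>p\<in>lat. 1 / (2 * \<i>) * (deriv \<omega> (polar_height p z (cnj z)) * (1 / (lin p z)\<^sup>2)))"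
    by (rule infsumI[symmetric, OF LS_hol2(4)[OF \<omega> z w]])
  also have "\<dots> = 1 / (2 * \<i>) * LS2 (deriv \<omega>) z (cnj z)" unfolding LS2_def by (rule infsum_cmult_right')
  finally have "dz (lowering (latform \<phi>)) z = (1/4) * LS2 (deriv \<omega>) z (cnj z)" by simp
  thus ?thesis unfolding hyp_lap_eq[OF latform_smooth[OF \<phi>] z] by (simp add: \<omega>_def[abs_def] mult.commute)
qed

text \<open>The matrix permutes the row vectors (m, n). \<open>polar_height\<close> is invariant
  because the automorphy factors of z - w and of the two linear forms cancel, and (mz+n)^(-2) leaves
  the factor (cz+d)^2.\<close>

lemma latform_modular: "modular_weight 2 (latform \<phi>)"
  unfolding modular_weight_def
proof (intro allI impI ballI)
  fix a b c d :: int and z assume det: "a * d - b * c = 1" and z: "z \<in> UHP"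
  define \<gamma> where "\<gamma> u = (of_int a * u + of_int b) / (of_int c * u + of_int d)" for u :: complex
  define j where "j u = of_int c * u + of_int d" for u :: complex
  have detr: "complex_of_int a * of_int d - of_int b * of_int c = 1"
    using arg_cong[OF det, of complex_of_int] by simp
  have jnz: "j z \<noteq> 0"
  proof -
    have "(c, d) \<in> lat" using det by auto
    from lin_nonzero[OF this, of z] z show ?thesis by (simp add: lin_def j_def UHP_def)
  qed
  have jc: "j (cnj z) = cnj (j z)" by (simp add: j_def)
  have jcnz: "j (cnj z) \<noteq> 0" using jnz by (simp add: jc)
  have gc: "\<gamma> (cnj z) = cnj (\<gamma> z)" by (simp add: \<gamma>_def)
  have diff: "\<gamma> z - \<gamma> w = (z - w) / (j z * j w)" if "j w \<noteq> 0" for w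
  proof -
    have "\<gamma> z - \<gamma> w = ((of_int a * z + of_int b) * j w - (of_int a * w + of_int b) * j z) / (j z * j w)"
      using jnz that by (simp add: \<gamma>_def j_def[symmetric] diff_frac_eq)
    also have "(of_int a * z + of_int b) * j w - (of_int a * w + of_int b) * j z = (complex_of_int a * of_int d - of_int b * of_int c) * (z - w)"
      by (simp add: j_def algebra_simps)
    finally show ?thesis by (simp add: detr)
  qed
  have gU: "\<gamma> z \<in> UHP"
  proof -
    have "\<gamma> z - cnj (\<gamma> z) = (z - cnj z) / (j z * cnj (j z))" using diff[OF jcnz] by (simp add: gc jc)
    also have "j z * cnj (j z) = of_real ((norm (j z))\<^sup>2)" by (simp only: complex_norm_square)
    finally have "Im (\<gamma> z - cnj (\<gamma> z)) = Im (z - cnj z) / (norm (j z))\<^sup>2" by (simp only: Im_divide_of_real)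
    hence "Im (\<gamma> z) = Im z / (norm (j z))\<^sup>2" by simp
    thus ?thesis using z jnz by (simp add: UHP_def)
  qed
  \<comment> \<open>\<sigma> multiplies the row vector p by the matrix, \<tau> by its
    inverse.\<close>
  define \<sigma> where "\<sigma> p = (fst p * a + snd p * c, fst p * b + snd p * d)" for p :: "int \<times> int"
  define \<tau> where "\<tau> p = (fst p * d - snd p * c, snd p * a - fst p * b)" for p :: "int \<times> int"
  have st: "\<sigma> (\<tau> p) = p" for p
  proof -
    have "fst (\<sigma> (\<tau> p)) = fst p * (a * d - b * c)" "snd (\<sigma> (\<tau> p)) = snd p * (a * d - b * c)"
      by (simp_all add: \<sigma>_def \<tau>_def algebra_simps)
    thus ?thesis by (simp add: det prod_eq_iff)
  qed
  have ts: "\<tau> (\<sigma> p) = p" for p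
  proof -
    have "fst (\<tau> (\<sigma> p)) = fst p * (a * d - b * c)" "snd (\<tau> (\<sigma> p)) = snd p * (a * d - b * c)"
      by (simp_all add: \<sigma>_def \<tau>_def algebra_simps)
    thus ?thesis by (simp add: det prod_eq_iff)
  qed
  have s0: "\<sigma> (0, 0) = (0, 0)" "\<tau> (0, 0) = (0, 0)" by (simp_all add: \<sigma>_def \<tau>_def)
  have slat: "\<sigma> p \<in> lat" if "p \<in> lat" for p
  proof -
    have "\<sigma> p \<noteq> (0, 0)"
    proof
      assume "\<sigma> p = (0, 0)"
      hence "p = (0, 0)" using ts[of p] s0 by simp
      thus False using that by simp
    qed
    thus ?thesis by simp
  qed
  have tlat: "\<tau> p \<in> lat" if "p \<in> lat" for p
  proof -
    have "\<tau> p \<noteq> (0, 0)"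
    proof
      assume "\<tau> p = (0, 0)"
      hence "p = (0, 0)" using st[of p] s0 by simp
      thus False using that by simp
    qed
    thus ?thesis by simp
  qed
  have ling: "lin p (\<gamma> u) = lin (\<sigma> p) u / j u" if "j u \<noteq> 0" for p u
    using that by (simp add: lin_def \<gamma>_def \<sigma>_def j_def field_simps)
  have vg: "polar_height p (\<gamma> z) (\<gamma> (cnj z)) = polar_height (\<sigma> p) z (cnj z)" for p
  proof -
    have "polar_height p (\<gamma> z) (\<gamma> (cnj z)) = ((z - cnj z) / (j z * j (cnj z))) / (2 * \<i> * (lin (\<sigma> p) z / j z) * (lin (\<sigma> p) (cnj z) / j (cnj z)))"
      unfolding polar_height_def diff[OF jcnz] ling[OF jnz] ling[OF jcnz] ..
    also have "\<dots> = polar_height (\<sigma> p) z (cnj z)" using jnz jcnz by (simp add: polar_height_def)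
    finally show ?thesis .
  qed
  have "latform \<phi> (\<gamma> z) = (\<Sum>\<^sub>\<infinity>p\<in>lat. \<phi> (polar_height (\<sigma> p) z (cnj z)) * (1 / (lin (\<sigma> p) z / j z)\<^sup>2))"
    using gU by (simp add: latform_def LS2_def gc[symmetric] vg ling[OF jnz])
  also have "\<dots> = (\<Sum>\<^sub>\<infinity>p\<in>lat. (j z)\<^sup>2 * (\<phi> (polar_height (\<sigma> p) z (cnj z)) * (1 / (lin (\<sigma> p) z)\<^sup>2)))"
    by (rule infsum_cong) (simp add: power_divide)
  also have "\<dots> = (j z)\<^sup>2 * (\<Sum>\<^sub>\<infinity>p\<in>lat. \<phi> (polar_height (\<sigma> p) z (cnj z)) * (1 / (lin (\<sigma> p) z)\<^sup>2))"
    by (rule infsum_cmult_right')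
  also have "(\<Sum>\<^sub>\<infinity>p\<in>lat. \<phi> (polar_height (\<sigma> p) z (cnj z)) * (1 / (lin (\<sigma> p) z)\<^sup>2)) = LS2 \<phi> z (cnj z)"
    unfolding LS2_def
    by (rule infsum_reindex_bij_witness[where i = \<tau> and j = \<sigma>]) (simp_all only: st ts slat tlat)
  finally show "latform \<phi> ((of_int a * z + of_int b) / (of_int c * z + of_int d)) = (of_int c * z + of_int d) powi 2 * latform \<phi> z"
    using z by (simp add: latform_def \<gamma>_def j_def power_int_def)
qed

text \<open>In the strip 0 \<le> x \<le> 1, y \<ge> 1 the constant of \<open>lin_lower\<close> is at
  least 1/5, whatever y. Since |v| = y / l^2 with l = |mz+n|, each term is O(y^2 / l^6). Translation
  by the floor of x reduces every point to the strip.\<close>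

lemma latform_growth:
  assumes \<phi>: "flat \<phi>"
  shows "moderate_growth (latform \<phi>)"
proof -
  obtain C0 where "\<And>v. v \<in> RHP \<Longrightarrow> 1 * norm v \<le> Re v \<Longrightarrow> norm (\<phi> v) \<le> C0 * (norm v)\<^sup>2"
    using \<phi> zero_less_one unfolding flat_def by blast
  hence C0: "norm (\<phi> v) \<le> \<bar>C0\<bar> * (norm v)\<^sup>2" if "v \<in> RHP" "norm v \<le> Re v" for v
    using that by (smt (verit) mult_right_mono zero_le_power2)
  have ls: "(\<lambda>p. \<bar>C0\<bar> * 5 ^ 6 * latnorm p powr (-6)) summable_on lat"
    by (intro summable_on_cmult_right summable_latnorm) simp
  define S where "S = (\<Sum>\<^sub>\<infinity>p\<in>lat. \<bar>C0\<bar> * 5 ^ 6 * latnorm p powr (-6))"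
  have strip: "norm (latform \<phi> (Complex x y)) \<le> S * y\<^sup>2" if y: "y \<ge> 1" and x: "0 \<le> x" "x \<le> 1" for x y
  proof -
    define z where "z = Complex x y"
    have z: "z \<in> UHP" using y by (simp add: z_def)
    have nz: "norm z \<le> 1 + y" using cmod_le[of z] x y by (simp add: z_def)
    have b: "norm (\<phi> (polar_height p z (cnj z)) * (1 / (lin p z)\<^sup>2)) \<le> (\<bar>C0\<bar> * 5 ^ 6 * latnorm p powr (-6)) * y\<^sup>2" if p: "p \<in> lat" for p
    proof -
      define N where "N = latnorm p"
      define l where "l = norm (lin p z)"
      have N: "N \<ge> 1" using latnorm_ge_1[OF p] by (simp add: N_def)
      have "y / (1 + 2 * (1 + y)) * N \<le> l" unfolding N_def l_def
        by (rule lin_lower) (use y nz in \<open>auto simp: z_def\<close>)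
      moreover have "1 / 5 \<le> y / (1 + 2 * (1 + y))" using y by (simp add: field_simps)
      hence "1 / 5 * N \<le> y / (1 + 2 * (1 + y)) * N" using N by (intro mult_right_mono) auto
      ultimately have l: "N / 5 \<le> l" by linarith
      have l0: "l > 0" using l N by linarith
      have v: "polar_height p z (cnj z) = of_real (y / l\<^sup>2)" by (simp add: polar_height_diagonal z_def l_def)
      have "norm (polar_height p z (cnj z)) = y / l\<^sup>2" "Re (polar_height p z (cnj z)) = y / l\<^sup>2" "polar_height p z (cnj z) \<in> RHP"
        using y l0 by (simp_all add: v RHP_def del: of_real_divide)
      hence "norm (\<phi> (polar_height p z (cnj z))) \<le> \<bar>C0\<bar> * (y / l\<^sup>2)\<^sup>2" using C0[of "polar_height p z (cnj z)"] by simp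
      hence "norm (\<phi> (polar_height p z (cnj z))) * (1 / l\<^sup>2) \<le> \<bar>C0\<bar> * (y / l\<^sup>2)\<^sup>2 * (1 / l\<^sup>2)" by (intro mult_right_mono) auto
      also have "\<dots> = \<bar>C0\<bar> * y\<^sup>2 * (1 / l ^ 6)" using l0 by (simp add: field_simps power_divide eval_nat_numeral)
      also have "\<dots> \<le> \<bar>C0\<bar> * y\<^sup>2 * (1 / (N / 5) ^ 6)"
        using l N l0 by (intro mult_left_mono divide_left_mono power_mono mult_pos_pos zero_less_power) auto
      also have "1 / (N / 5) ^ 6 = 5 ^ 6 * N powr (-6)" using N by (simp add: power_divide powr_minus_divide)
      finally show ?thesis by (simp add: norm_mult norm_divide norm_power l_def N_def mult_ac)
    qed
    have "norm (LS2 \<phi> z (cnj z)) \<le> S * y\<^sup>2"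
    proof (rule norm_infsum_le[OF LS_hol2(5)[OF \<phi> z] _ b])
      show "((\<lambda>p. (\<bar>C0\<bar> * 5 ^ 6 * latnorm p powr (-6)) * y\<^sup>2) has_sum S * y\<^sup>2) lat"
        unfolding S_def by (intro has_sum_cmult_left has_sum_infsum ls)
    qed (use z in auto)
    thus ?thesis using z by (simp add: latform_def z_def)
  qed
  have "norm (latform \<phi> (Complex x y)) \<le> S * y powr 2" if y: "y \<ge> 1" for x y
  proof -
    define z where "z = Complex (frac x) y"
    have z: "z \<in> UHP" using y by (simp add: z_def)
    have "Complex x y = (of_int 1 * z + of_int \<lfloor>x\<rfloor>) / (of_int 0 * z + of_int 1)"
      by (simp add: z_def complex_eq_iff frac_def)
    also have "latform \<phi> \<dots> = (of_int 0 * z + of_int 1) powi 2 * latform \<phi> z"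
      using latform_modular[of \<phi>, unfolded modular_weight_def, rule_format, of 1 1 "\<lfloor>x\<rfloor>" 0 z] z by simp
    finally have "latform \<phi> (Complex x y) = latform \<phi> (Complex (frac x) y)" by (simp add: z_def)
    thus ?thesis using strip[OF y, of "frac x"] y frac_lt_1[of x] by (simp add: powr_numeral less_imp_le)
  qed
  thus ?thesis unfolding moderate_growth_def by blast
qed

lemma latform_base: "flat \<phi> \<Longrightarrow> latform \<phi> \<in> base_forms 2"
  unfolding base_forms_def using latform_smooth latform_modular latform_growth by (auto simp: latform_def)

section \<open>The kernel of the completed Eisenstein series\<close>

text \<open>The power of t is spelled out through ln t, so that the kernel is visibly entire in
  a.\<close>

definition mellin_kernel :: "complex \<Rightarrow> complex \<Rightarrow> real \<Rightarrow> complex" where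
  "mellin_kernel a q t = exp (a * of_real (ln t)) * exp (- q * of_real t)"

text \<open>The integral of \<open>t^a exp(-qt)\<close> over \<open>t \<ge> 1\<close>, cut into unit pieces so that holomorphy in \<open>a\<close> and \<open>q\<close>
follows from that of locally uniform sums.\<close>
definition mellin_tail :: "complex \<Rightarrow> complex \<Rightarrow> complex" where
  "mellin_tail a q = (\<Sum>\<^sub>\<infinity>n::nat. integral (cbox 0 1) (\<lambda>t. mellin_kernel a q (real n + 1 + t)))"

lemma norm_mellin_kernel: "t > 0 \<Longrightarrow> norm (mellin_kernel a q t) = t powr Re a * exp (- (Re q * t))"
  by (simp add: mellin_kernel_def norm_mult powr_def)

lemma norm_mellin_kernel_le:
  assumes t: "t \<ge> 1" and a: "Re a \<le> A" and q: "Re q \<ge> c" "c > 0"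
  shows "norm (mellin_kernel a q t) \<le> fact N / c ^ N * t powr (A - real N)"
proof -
  have "norm (mellin_kernel a q t) = t powr Re a * exp (- (Re q * t))" using t by (simp add: norm_mellin_kernel)
  also have "\<dots> \<le> t powr A * exp (- (c * t))" using t a q by (intro mult_mono powr_mono) auto
  also have "\<dots> \<le> t powr A * (fact N / (c * t) ^ N)" using t q by (intro mult_left_mono exp_minus_le) auto
  also have "\<dots> = fact N / c ^ N * t powr (A - real N)"
    using t by (simp add: powr_diff powr_realpow power_mult_distrib)
  finally show ?thesis .
qed

lemma mellin_kernel_continuous:
  "continuous_on ((UNIV \<times> UNIV) \<times> {0..}) (\<lambda>p. mellin_kernel (fst (fst p)) (snd (fst p)) (real n + 1 + snd p))"
  unfolding mellin_kernel_def by (intro continuous_intros) auto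

lemma mellin_kernel_piece_continuous: "continuous_on (cbox 0 1) (\<lambda>t. mellin_kernel a q (real n + 1 + t))"
  unfolding mellin_kernel_def by (intro continuous_intros) auto

lemma mellin_kernel_derivs:
  shows "((\<lambda>a. mellin_kernel a q t) has_field_derivative of_real (ln t) * mellin_kernel a q t) (at a within A)"
    and "t > 0 \<Longrightarrow> ((\<lambda>q. mellin_kernel a q t) has_field_derivative - mellin_kernel (a + 1) q t) (at q within B)"
proof -
  show "((\<lambda>a. mellin_kernel a q t) has_field_derivative of_real (ln t) * mellin_kernel a q t) (at a within A)"
    unfolding mellin_kernel_def by (auto intro!: derivative_eq_intros)
  assume t: "t > 0"
  have "exp (complex_of_real (ln t)) = of_real t" using t by (simp add: exp_of_real)
  hence "exp ((a + 1) * of_real (ln t)) = of_real t * exp (a * of_real (ln t))" by (simp add: distrib_right exp_add mult.commute)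
  thus "((\<lambda>q. mellin_kernel a q t) has_field_derivative - mellin_kernel (a + 1) q t) (at q within B)"
    unfolding mellin_kernel_def by (auto intro!: derivative_eq_intros)
qed

lemma mellin_tail_piece_hol2: "hol2 UNIV RHP (\<lambda>a q. integral (cbox 0 1) (\<lambda>t. mellin_kernel a q (real n + 1 + t)))"
  and mellin_tail_piece_D2: "D2 (\<lambda>a q. integral (cbox 0 1) (\<lambda>t. mellin_kernel a q (real n + 1 + t))) a q = - integral (cbox 0 1) (\<lambda>t. mellin_kernel (a + 1) q (real n + 1 + t))"
proof -
  have int: "(\<lambda>t. mellin_kernel a q (real n + 1 + t)) integrable_on cbox 0 1" for a q
    by (rule integrable_continuous[OF mellin_kernel_piece_continuous])
  have d1: "((\<lambda>a. integral (cbox 0 1) (\<lambda>t. mellin_kernel a q (real n + 1 + t))) has_field_derivative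
      integral (cbox 0 1) (\<lambda>t. of_real (ln (real n + 1 + t)) * mellin_kernel a q (real n + 1 + t))) (at a within UNIV)" for a q
  proof (rule leibniz_rule_field_derivative[where f = "\<lambda>a t. mellin_kernel a q (real n + 1 + t)" and fx = "\<lambda>a t. of_real (ln (real n + 1 + t)) * mellin_kernel a q (real n + 1 + t)"])
    show "continuous_on (UNIV \<times> cbox 0 1) (\<lambda>(a, t). of_real (ln (real n + 1 + t)) * mellin_kernel a q (real n + 1 + t))"
      unfolding mellin_kernel_def split_beta by (intro continuous_intros) auto
  qed (use int mellin_kernel_derivs(1) in auto)
  have d2: "((\<lambda>q. integral (cbox 0 1) (\<lambda>t. mellin_kernel a q (real n + 1 + t))) has_field_derivative
      integral (cbox 0 1) (\<lambda>t. - mellin_kernel (a + 1) q (real n + 1 + t))) (at q within UNIV)" for a q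
  proof (rule leibniz_rule_field_derivative[where f = "\<lambda>q t. mellin_kernel a q (real n + 1 + t)" and fx = "\<lambda>q t. - mellin_kernel (a + 1) q (real n + 1 + t)"])
    show "((\<lambda>q. mellin_kernel a q (real n + 1 + t)) has_field_derivative - mellin_kernel (a + 1) q (real n + 1 + t)) (at q within UNIV)"
      if "t \<in> cbox 0 1" for q t using that by (intro mellin_kernel_derivs(2)) auto
    show "continuous_on (UNIV \<times> cbox 0 1) (\<lambda>(q, t). - mellin_kernel (a + 1) q (real n + 1 + t))"
      unfolding mellin_kernel_def split_beta by (intro continuous_intros) auto
  qed (use int in auto)
  show "hol2 UNIV RHP (\<lambda>a q. integral (cbox 0 1) (\<lambda>t. mellin_kernel a q (real n + 1 + t)))"
    unfolding hol2_def
  proof (intro conjI ballI)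
    have "continuous_on ((UNIV \<times> RHP) \<times> cbox 0 1) (\<lambda>(p, t). mellin_kernel (fst p) (snd p) (real n + 1 + t))"
      unfolding split_beta by (rule continuous_on_subset[OF mellin_kernel_continuous]) auto
    thus "continuous_on (UNIV \<times> RHP) (\<lambda>p. integral (cbox 0 1) (\<lambda>t. mellin_kernel (fst p) (snd p) (real n + 1 + t)))"
      by (rule integral_continuous_on_param)
    show "(\<lambda>a. integral (cbox 0 1) (\<lambda>t. mellin_kernel a q (real n + 1 + t))) holomorphic_on UNIV" for q
      using d1 by (auto simp: holomorphic_on_open)
    show "(\<lambda>q. integral (cbox 0 1) (\<lambda>t. mellin_kernel a q (real n + 1 + t))) holomorphic_on RHP" for a
      using d2 by (auto simp: holomorphic_on_open)
  qed
  show "D2 (\<lambda>a q. integral (cbox 0 1) (\<lambda>t. mellin_kernel a q (real n + 1 + t))) a q = - integral (cbox 0 1) (\<lambda>t. mellin_kernel (a + 1) q (real n + 1 + t))"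
    unfolding D2_def using DERIV_imp_deriv[OF d2[of a q]] by simp
qed

lemma mellin_tail_piece_bound:
  assumes a: "Re a \<le> A" and q: "Re q \<ge> c" "c > 0" and N: "A \<le> real N"
  shows "norm (integral (cbox 0 1) (\<lambda>t. mellin_kernel a q (real n + 1 + t))) \<le> fact N / c ^ N * (real n + 1) powr (A - real N)"
proof -
  have "norm (integral {0..1} (\<lambda>t. mellin_kernel a q (real n + 1 + t))) \<le> (fact N / c ^ N * (real n + 1) powr (A - real N)) * (1 - 0)"
  proof (rule integral_bound)
    show "continuous_on {0..1} (\<lambda>t. mellin_kernel a q (real n + 1 + t))" using mellin_kernel_piece_continuous[of a q n] by simp
    fix t :: real assume t: "t \<in> {0..1}"
    have "norm (mellin_kernel a q (real n + 1 + t)) \<le> fact N / c ^ N * (real n + 1 + t) powr (A - real N)"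
      by (rule norm_mellin_kernel_le[OF _ a q]) (use t in auto)
    also have "\<dots> \<le> fact N / c ^ N * (real n + 1) powr (A - real N)"
      using t q N by (intro mult_left_mono powr_mono2') auto
    finally show "norm (mellin_kernel a q (real n + 1 + t)) \<le> fact N / c ^ N * (real n + 1) powr (A - real N)" .
  qed auto
  thus ?thesis by simp
qed

lemma summable_Suc_powr: "p > 1 \<Longrightarrow> (\<lambda>n::nat. C * (real n + 1) powr (-p)) summable_on UNIV"
proof -
  assume p: "p > (1::real)"
  have "summable (\<lambda>n. real n powr (-p))" using p by (simp add: summable_real_powr_iff)
  hence "summable (\<lambda>n. real (Suc n) powr (-p))" by (subst summable_Suc_iff)
  hence "(\<lambda>n. real (Suc n) powr (-p)) summable_on UNIV" by (intro norm_summable_imp_summable_on) simp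
  thus ?thesis by (intro summable_on_cmult_right) (simp add: add.commute)
qed

lemma mellin_tail_local_bound:
  assumes "q \<in> RHP"
  shows "\<exists>U V M. open U \<and> open V \<and> a \<in> U \<and> q \<in> V \<and> M summable_on UNIV \<and>
    (\<forall>n\<in>(UNIV :: nat set). \<forall>a'\<in>U \<inter> UNIV. \<forall>q'\<in>V \<inter> RHP. norm (integral (cbox 0 1) (\<lambda>t. mellin_kernel a' q' (real n + 1 + t))) \<le> M n)"
proof -
  define A where "A = \<bar>Re a\<bar> + 1"
  define c where "c = Re q / 2"
  have c: "c > 0" using assms by (simp add: c_def RHP_def)
  \<comment> \<open>N exceeds A by at least 2, so the bounds on the pieces decay at least like (n +
    1)^(-2).\<close>
  define N where "N = nat \<lceil>A\<rceil> + 2"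
  have N: "A + 2 \<le> real N" unfolding N_def by linarith
  define M where "M = (\<lambda>n::nat. fact N / c ^ N * (real n + 1) powr (-(real N - A)))"
  have "open {a. Re a < A}" "open {q. Re q > c}" by (rule open_halfspace_Re_lt, rule open_halfspace_Re_gt)
  moreover have "M summable_on UNIV" unfolding M_def by (rule summable_Suc_powr) (use N in simp)
  moreover have "norm (integral (cbox 0 1) (\<lambda>t. mellin_kernel a' q' (real n + 1 + t))) \<le> M n" if "Re a' < A" "Re q' > c" for n a' q'
    using mellin_tail_piece_bound[of a' A c q' N n] that c N by (simp add: M_def)
  moreover have "a \<in> {a. Re a < A}" "q \<in> {q. Re q > c}" using assms by (auto simp: A_def c_def RHP_def)
  ultimately show ?thesis by (intro exI[of _ "{a. Re a < A}"] exI[of _ "{q. Re q > c}"] exI[of _ M]) auto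
qed

lemma mellin_tail_hol2: "hol2 UNIV RHP mellin_tail"
  and mellin_tail_D2: "q \<in> RHP \<Longrightarrow> D2 mellin_tail a q = - mellin_tail (a + 1) q"
  and mellin_tail_has_sum: "q \<in> RHP \<Longrightarrow> ((\<lambda>n::nat. integral (cbox 0 1) (\<lambda>t. mellin_kernel a q (real n + 1 + t))) has_sum mellin_tail a q) UNIV"
proof -
  note H = hol2_infsum[where I = "UNIV :: nat set" and F = "\<lambda>n a q. integral (cbox 0 1) (\<lambda>t. mellin_kernel a q (real n + 1 + t))" and S = UNIV and T = RHP,
     OF mellin_tail_piece_hol2 open_UNIV open_RHP mellin_tail_local_bound]
  show "hol2 UNIV RHP mellin_tail" using H(1) by (simp add: mellin_tail_def[abs_def])
  assume q: "q \<in> RHP"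
  show hs: "((\<lambda>n::nat. integral (cbox 0 1) (\<lambda>t. mellin_kernel a q (real n + 1 + t))) has_sum mellin_tail a q) UNIV" for a
  proof -
    from mellin_tail_local_bound[OF q, of a] obtain M where M: "M summable_on UNIV" "\<And>n::nat. norm (integral (cbox 0 1) (\<lambda>t. mellin_kernel a q (real n + 1 + t))) \<le> M n"
      using q by (elim exE conjE) (metis IntI UNIV_I)
    hence "(\<lambda>n. integral (cbox 0 1) (\<lambda>t. mellin_kernel a q (real n + 1 + t))) summable_on UNIV"
      by (intro abs_summable_summable[OF Infinite_Sum.abs_summable_on_comparison_test'[OF M(1)]]) auto
    thus ?thesis by (simp add: mellin_tail_def)
  qed
  have "((\<lambda>n. D2 (\<lambda>a q. integral (cbox 0 1) (\<lambda>t. mellin_kernel a q (real n + 1 + t))) a q) has_sum D2 mellin_tail a q) UNIV"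
    unfolding mellin_tail_def[abs_def] by (rule H(3)) (use q in auto)
  hence "((\<lambda>n. - integral (cbox 0 1) (\<lambda>t. mellin_kernel (a + 1) q (real n + 1 + t))) has_sum D2 mellin_tail a q) UNIV"
    unfolding mellin_tail_piece_D2 .
  moreover have "((\<lambda>n. - integral (cbox 0 1) (\<lambda>t. mellin_kernel (a + 1) q (real n + 1 + t))) has_sum - mellin_tail (a + 1) q) UNIV"
    by (subst has_sum_uminus) (simp only: minus_minus hs)
  ultimately show "D2 mellin_tail a q = - mellin_tail (a + 1) q" by (rule has_sum_unique)
qed

lemma mellin_tail_partial_sum:
  "(\<Sum>n<N. integral (cbox 0 1) (\<lambda>t. mellin_kernel a q (real n + 1 + t))) = integral {1..real N + 1} (mellin_kernel a q)"
proof (induction N)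
  case (Suc N)
  have c: "continuous_on {u..v} (mellin_kernel a q)" if "u > 0" for u v
    unfolding mellin_kernel_def using that by (intro continuous_intros) auto
  have int: "mellin_kernel a q integrable_on {u..v}" if "u > 0" for u v
    by (rule integrable_continuous_real[OF c[OF that]])
  have "(mellin_kernel a q has_integral integral {real N + 1..real N + 1 + 1} (mellin_kernel a q)) {real N + 1..real N + 1 + 1}"
    by (intro integrable_integral int) simp
  from has_integral_shift_real_ivl[OF this, of "real N + 1"]
  have "integral (cbox 0 1) (\<lambda>t. mellin_kernel a q (real N + 1 + t)) = integral {real N + 1..real N + 1 + 1} (mellin_kernel a q)"
    by (simp add: integral_unique add.commute)
  hence "(\<Sum>n<Suc N. integral (cbox 0 1) (\<lambda>t. mellin_kernel a q (real n + 1 + t))) = integral {1..real N + 1} (mellin_kernel a q) + integral {real N + 1..real N + 1 + 1} (mellin_kernel a q)"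
    using Suc by simp
  also have "\<dots> = integral {1..real N + 1 + 1} (mellin_kernel a q)"
    by (rule Henstock_Kurzweil_Integration.integral_combine) (auto intro: int)
  finally show ?case by (simp add: add.commute)
qed simp

lemma mellin_tail_limit: "q \<in> RHP \<Longrightarrow> (\<lambda>N. integral {1..real N + 1} (mellin_kernel a q)) \<longlonglongrightarrow> mellin_tail a q"
  using has_sum_imp_sums[OF mellin_tail_has_sum, of q a] unfolding sums_def mellin_tail_partial_sum .

text \<open>Integration by parts for the incomplete Gamma function: the boundary term at t = 1 is
  exp(-q), the one at infinity vanishes.\<close>

lemma mellin_tail_recursion:
  assumes q: "q \<in> RHP"
  shows "q * mellin_tail (a + 1) q = exp (- q) + (a + 1) * mellin_tail a q"
proof -
  have q0: "Re q > 0" using q by (simp add: RHP_def)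
  have d: "((\<lambda>t. mellin_kernel (a + 1) q t) has_vector_derivative ((a + 1) * mellin_kernel a q t - q * mellin_kernel (a + 1) q t)) (at t within S)" if t: "t > 0" for t S
  proof -
    have "exp (complex_of_real (ln t)) = of_real t" using t by (simp add: exp_of_real)
    hence e: "exp ((a + 1) * of_real (ln t)) = of_real t * exp (a * of_real (ln t))" by (simp add: distrib_right exp_add mult.commute)
    have 1: "((\<lambda>t. complex_of_real (ln t)) has_vector_derivative of_real (1 / t)) (at t)"
      using t by (intro has_vector_derivative_of_real) (auto intro!: derivative_eq_intros simp: field_simps)
    have 2: "((\<lambda>t. complex_of_real t) has_vector_derivative of_real 1) (at t)"
      by (intro has_vector_derivative_of_real) (auto intro!: derivative_eq_intros)
    have f1: "((\<lambda>z. exp ((a + 1) * z)) has_field_derivative exp ((a + 1) * of_real (ln t)) * (a + 1)) (at (of_real (ln t)))"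
      by (auto intro!: derivative_eq_intros)
    have f2: "((\<lambda>z. exp (- q * z)) has_field_derivative exp (- q * of_real t) * (- q)) (at (of_real t))"
      by (auto intro!: derivative_eq_intros)
    have "(((\<lambda>z. exp ((a + 1) * z)) \<circ> (\<lambda>t. of_real (ln t))) has_vector_derivative of_real (1 / t) * (exp ((a + 1) * of_real (ln t)) * (a + 1))) (at t)"
      by (rule field_vector_diff_chain_at[OF 1 f1])
    moreover have "(((\<lambda>z. exp (- q * z)) \<circ> (\<lambda>t. of_real t)) has_vector_derivative of_real 1 * (exp (- q * of_real t) * (- q))) (at t)"
      by (rule field_vector_diff_chain_at[OF 2 f2])
    ultimately have "((\<lambda>t. exp ((a + 1) * of_real (ln t)) * exp (- q * of_real t)) has_vector_derivative
       exp ((a + 1) * of_real (ln t)) * (of_real 1 * (exp (- q * of_real t) * (- q))) + of_real (1 / t) * (exp ((a + 1) * of_real (ln t)) * (a + 1)) * exp (- q * of_real t)) (at t)"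
      unfolding o_def by (rule has_vector_derivative_mult)
    moreover have "exp ((a + 1) * of_real (ln t)) * (of_real 1 * (exp (- q * of_real t) * (- q))) + of_real (1 / t) * (exp ((a + 1) * of_real (ln t)) * (a + 1)) * exp (- q * of_real t)
       = (a + 1) * mellin_kernel a q t - q * mellin_kernel (a + 1) q t"
      unfolding mellin_kernel_def e using t by (simp add: field_simps)
    ultimately have "((\<lambda>t. mellin_kernel (a + 1) q t) has_vector_derivative ((a + 1) * mellin_kernel a q t - q * mellin_kernel (a + 1) q t)) (at t)"
      unfolding mellin_kernel_def by (simp only:)
    thus ?thesis by (rule has_vector_derivative_at_within)
  qed
  have c: "continuous_on {1..v} (mellin_kernel b q)" for v b
    unfolding mellin_kernel_def by (intro continuous_intros) auto
  have int: "mellin_kernel b q integrable_on {1..v}" for v b by (rule integrable_continuous_real[OF c])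
  have ftc: "(a + 1) * integral {1..real N + 1} (mellin_kernel a q) - q * integral {1..real N + 1} (mellin_kernel (a + 1) q) = mellin_kernel (a + 1) q (real N + 1) - mellin_kernel (a + 1) q 1" for N
  proof -
    have "((\<lambda>t. (a + 1) * mellin_kernel a q t - q * mellin_kernel (a + 1) q t) has_integral (mellin_kernel (a + 1) q (real N + 1) - mellin_kernel (a + 1) q 1)) {1..real N + 1}"
      by (rule fundamental_theorem_of_calculus) (auto intro: d)
    moreover have "((\<lambda>t. (a + 1) * mellin_kernel a q t - q * mellin_kernel (a + 1) q t) has_integral ((a + 1) * integral {1..real N + 1} (mellin_kernel a q) - q * integral {1..real N + 1} (mellin_kernel (a + 1) q))) {1..real N + 1}"
      by (intro has_integral_diff has_integral_mult_right integrable_integral int)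
    ultimately show ?thesis by (rule has_integral_unique[symmetric])
  qed
  have L: "(\<lambda>N. (a + 1) * integral {1..real N + 1} (mellin_kernel a q) - q * integral {1..real N + 1} (mellin_kernel (a + 1) q)) \<longlonglongrightarrow> (a + 1) * mellin_tail a q - q * mellin_tail (a + 1) q"
    by (intro tendsto_intros mellin_tail_limit q)
  have "(\<lambda>N. mellin_kernel (a + 1) q (real N + 1)) \<longlonglongrightarrow> 0"
  proof (rule Lim_null_comparison)
    define M where "M = nat \<lceil>Re (a + 1)\<rceil> + 1"
    have M: "Re (a + 1) - real M \<le> -1" unfolding M_def by linarith
    show "\<forall>\<^sub>F N in sequentially. norm (mellin_kernel (a + 1) q (real N + 1)) \<le> fact M / Re q ^ M * inverse (real (Suc N))"
    proof (intro always_eventually allI)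
      fix N
      have "norm (mellin_kernel (a + 1) q (real N + 1)) \<le> fact M / Re q ^ M * (real N + 1) powr (Re (a + 1) - real M)"
        by (rule norm_mellin_kernel_le) (use q0 in auto)
      also have "\<dots> \<le> fact M / Re q ^ M * (real N + 1) powr (-1)"
        using M q0 by (intro mult_left_mono powr_mono) auto
      finally show "norm (mellin_kernel (a + 1) q (real N + 1)) \<le> fact M / Re q ^ M * inverse (real (Suc N))"
        by (simp add: powr_minus add.commute)
    qed
    show "(\<lambda>N. fact M / Re q ^ M * inverse (real (Suc N))) \<longlonglongrightarrow> 0"
      by (rule tendsto_mult_right_zero[OF LIMSEQ_inverse_real_of_nat])
  qed
  hence "(\<lambda>N. mellin_kernel (a + 1) q (real N + 1) - mellin_kernel (a + 1) q 1) \<longlonglongrightarrow> 0 - exp (- q)"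
    by (intro tendsto_diff) (auto simp: mellin_kernel_def)
  hence "(a + 1) * mellin_tail a q - q * mellin_tail (a + 1) q = 0 - exp (- q)"
    using LIMSEQ_unique[OF L[unfolded ftc]] by blast
  thus ?thesis by (simp add: algebra_simps)
qed

text \<open>The recursion at a = -1, where the factor a + 1 removes the unknown tail.\<close>

lemma mellin_tail_0: "q \<in> RHP \<Longrightarrow> mellin_tail 0 q = exp (- q) / q"
proof -
  assume q: "q \<in> RHP"
  hence "q \<noteq> 0" by (auto simp: RHP_def)
  thus ?thesis using mellin_tail_recursion[OF q, of "-1"] by (simp add: field_simps)
qed

text \<open>One constant for a whole half-plane of a. The margin 3/2 leaves the exponent -3/2 for
  the sum over the pieces.\<close>

lemma mellin_tail_bound:
  "\<exists>C\<ge>0. \<forall>a q. Re a \<le> real N - 3/2 \<longrightarrow> q \<in> RHP \<longrightarrow> norm (mellin_tail a q) \<le> C / Re q ^ N"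
proof -
  define S where "S = (\<Sum>\<^sub>\<infinity>n::nat. fact N * (real n + 1) powr (-(3/2)))"
  have s: "(\<lambda>n::nat. fact N * (real n + 1) powr (-(3/2))) summable_on UNIV" by (rule summable_Suc_powr) simp
  have "S \<ge> 0" unfolding S_def by (rule infsum_nonneg) auto
  moreover have "norm (mellin_tail a q) \<le> S / Re q ^ N" if a: "Re a \<le> real N - 3/2" and q: "q \<in> RHP" for a q
  proof (rule norm_infsum_le[OF mellin_tail_has_sum[OF q]])
    have "((\<lambda>n::nat. (fact N * (real n + 1) powr (-(3/2))) * (1 / Re q ^ N)) has_sum S * (1 / Re q ^ N)) UNIV"
      unfolding S_def by (intro has_sum_cmult_left has_sum_infsum s)
    thus "((\<lambda>n::nat. (fact N * (real n + 1) powr (-(3/2))) * (1 / Re q ^ N)) has_sum S / Re q ^ N) UNIV" by simp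
    fix n
    have "norm (integral (cbox 0 1) (\<lambda>t. mellin_kernel a q (real n + 1 + t))) \<le> fact N / Re q ^ N * (real n + 1) powr ((real N - 3/2) - real N)"
      by (rule mellin_tail_piece_bound[OF a]) (use q in \<open>auto simp: RHP_def\<close>)
    thus "norm (integral (cbox 0 1) (\<lambda>t. mellin_kernel a q (real n + 1 + t))) \<le> fact N * (real n + 1) powr (-(3/2)) * (1 / Re q ^ N)"
      by simp
  qed
  ultimately show ?thesis by blast
qed

section \<open>The kernel, its flux and their differential equations\<close>

text \<open>On the diagonal this is pi |mz+n|^2 / y, the exponent of the theta series.\<close>

definition pi_over :: "complex \<Rightarrow> complex" where "pi_over v = of_real pi / v"

lemma RHP_nonzero: "v \<in> RHP \<Longrightarrow> v \<noteq> 0"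
  by (auto simp: RHP_def)

lemma Re_pi_over: "v \<in> RHP \<Longrightarrow> Re (pi_over v) = pi * Re v / (norm v)\<^sup>2"
  by (simp add: pi_over_def Re_divide cmod_power2)

lemma pi_over_RHP: "v \<in> RHP \<Longrightarrow> pi_over v \<in> RHP"
  using RHP_nonzero[of v] by (simp add: RHP_def Re_pi_over)

lemma pi_over_deriv: "v \<in> RHP \<Longrightarrow> (pi_over has_field_derivative - pi_over v / v) (at v)"
  unfolding pi_over_def[abs_def] using RHP_nonzero[of v]
  by (auto intro!: derivative_eq_intros simp: power2_eq_square)

lemma pi_over_holomorphic: "pi_over holomorphic_on RHP"
  using pi_over_deriv by (auto simp: holomorphic_on_open)

text \<open>The exchange of the two tails under s -> -1 - s is the functional equation of the weight
  2 Eisenstein series.\<close>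

definition eis_kernel :: "complex \<Rightarrow> complex \<Rightarrow> complex" where
  "eis_kernel s v = (1 / v\<^sup>2) * (mellin_tail (s + 1) (pi_over v) + mellin_tail (- s) (pi_over v))"

text \<open>This is \<open>v^2\<close> times the \<open>v\<close>-derivative of \<open>eis_kernel\<close>; \<open>\<psi>0\<close> is its value at \<open>s = 0\<close> and \<open>\<beta>\<close> the derivative
of \<open>\<psi>0\<close>.\<close>
definition eis_flux :: "complex \<Rightarrow> complex \<Rightarrow> complex" where
  "eis_flux s v = (1 / v) * (s * mellin_tail (s + 1) (pi_over v) - (1 + s) * mellin_tail (- s) (pi_over v) + 2 * exp (- pi_over v))"

definition \<psi>0 :: "complex \<Rightarrow> complex" where
  "\<psi>0 v = - (1 / pi) * (exp (- pi_over v) * (1 - 2 * pi_over v))"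

definition \<beta> :: "complex \<Rightarrow> complex" where
  "\<beta> v = (1 / v\<^sup>2) * (exp (- pi_over v) * (2 * pi_over v - 3))"

lemma mellin_tail_pi_over_hol2:
  assumes "f holomorphic_on UNIV"
  shows "hol2 UNIV RHP (\<lambda>s v. mellin_tail (f s) (pi_over v))"
  unfolding hol2_def
proof (intro conjI ballI)
  have cK: "continuous_on (UNIV \<times> RHP) (\<lambda>p. mellin_tail (fst p) (snd p))" using mellin_tail_hol2 by (simp add: hol2_def)
  have cf: "continuous_on UNIV f" and cq: "continuous_on RHP pi_over"
    using assms pi_over_holomorphic holomorphic_on_imp_continuous_on by blast+
  have "continuous_on (UNIV \<times> RHP) (\<lambda>p. (f (fst p), pi_over (snd p)))"
    by (rule continuous_on_Pair; rule continuous_on_compose2[OF cf] continuous_on_compose2[OF cq])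
       (auto intro!: continuous_on_fst continuous_on_snd continuous_on_id)
  moreover have "(\<lambda>p. (f (fst p), pi_over (snd p))) ` (UNIV \<times> RHP) \<subseteq> UNIV \<times> RHP" using pi_over_RHP by auto
  ultimately show "continuous_on (UNIV \<times> RHP) (\<lambda>p. mellin_tail (f (fst p)) (pi_over (snd p)))"
    using continuous_on_compose2[OF cK, of "UNIV \<times> RHP" "\<lambda>p. (f (fst p), pi_over (snd p))"] by simp
  show "(\<lambda>s. mellin_tail (f s) (pi_over v)) holomorphic_on UNIV" if "v \<in> RHP" for v
    using holomorphic_on_compose_gen[OF assms, of "\<lambda>a. mellin_tail a (pi_over v)" UNIV] mellin_tail_hol2 pi_over_RHP[OF that]
    by (auto simp: hol2_def o_def)
  show "(\<lambda>v. mellin_tail (f s) (pi_over v)) holomorphic_on RHP" for s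
    using holomorphic_on_compose_gen[OF pi_over_holomorphic, of "mellin_tail (f s)" RHP] mellin_tail_hol2 pi_over_RHP
    by (auto simp: hol2_def o_def image_subset_iff)
qed

lemma hol2_right:
  assumes g: "g holomorphic_on T" shows "hol2 S T (\<lambda>s v. g v)"
proof -
  have "continuous_on (S \<times> T) (\<lambda>p. g (snd p))"
    by (rule continuous_on_compose2[OF holomorphic_on_imp_continuous_on[OF g] continuous_on_snd[OF continuous_on_id]]) auto
  thus ?thesis using g by (simp add: hol2_def)
qed

lemma hol2_left:
  assumes g: "g holomorphic_on S" shows "hol2 S T (\<lambda>s v. g s)"
proof -
  have "continuous_on (S \<times> T) (\<lambda>p. g (fst p))"
    by (rule continuous_on_compose2[OF holomorphic_on_imp_continuous_on[OF g] continuous_on_fst[OF continuous_on_id]]) auto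
  thus ?thesis using g by (simp add: hol2_def)
qed

lemma inv_holomorphic: "(\<lambda>v. 1 / v) holomorphic_on RHP" "(\<lambda>v. 1 / v\<^sup>2) holomorphic_on RHP"
  using RHP_nonzero by (auto intro!: holomorphic_intros)

lemma exp_pi_over_holomorphic: "(\<lambda>v. exp (- pi_over v)) holomorphic_on RHP"
  by (intro holomorphic_intros pi_over_holomorphic)

lemma eis_kernel_hol2: "hol2 UNIV RHP eis_kernel"
  unfolding eis_kernel_def[abs_def]
  by (intro hol2_mult hol2_add hol2_right inv_holomorphic mellin_tail_pi_over_hol2) (auto intro!: holomorphic_intros)

lemma eis_flux_hol2: "hol2 UNIV RHP eis_flux"
proof -
  have "eis_flux = (\<lambda>s v. (1 / v) * ((s * mellin_tail (s + 1) (pi_over v) + (- (1 + s)) * mellin_tail (- s) (pi_over v)) + 2 * exp (- pi_over v)))"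
    by (intro ext) (simp add: eis_flux_def algebra_simps)
  moreover have "hol2 UNIV RHP (\<lambda>s v. (1 / v) * ((s * mellin_tail (s + 1) (pi_over v) + (- (1 + s)) * mellin_tail (- s) (pi_over v)) + 2 * exp (- pi_over v)))"
    by (intro hol2_mult[where F = "\<lambda>s v. 1 / v"] hol2_add hol2_right[where g = "\<lambda>v. 2 * exp (- pi_over v)"]
          hol2_mult[where F = "\<lambda>s v. s"] hol2_mult[where F = "\<lambda>s v. - (1 + s)"] mellin_tail_pi_over_hol2 hol2_left[where g = "\<lambda>s. s"]
          hol2_left[where g = "\<lambda>s. - (1 + s)"] hol2_right[where g = "\<lambda>v. 1 / v"] inv_holomorphic)
       (auto intro!: holomorphic_intros exp_pi_over_holomorphic)
  ultimately show ?thesis by simp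
qed

text \<open>The recursion trades the index a + 1 produced by d/dq for a again, so derivatives in v
  involve only the two tails of the kernel and an exponential.\<close>

lemma mellin_tail_pi_over_deriv:
  assumes v: "v \<in> RHP"
  shows "((\<lambda>v. mellin_tail a (pi_over v)) has_field_derivative (exp (- pi_over v) + (a + 1) * mellin_tail a (pi_over v)) / v) (at v)"
proof -
  have "(mellin_tail a has_field_derivative D2 mellin_tail a (pi_over v)) (at (pi_over v))"
    by (rule hol2_derivs(2)[OF mellin_tail_hol2 open_UNIV open_RHP UNIV_I pi_over_RHP[OF v]])
  from DERIV_chain2[OF this pi_over_deriv[OF v]]
  have "((\<lambda>v. mellin_tail a (pi_over v)) has_field_derivative - mellin_tail (a + 1) (pi_over v) * (- pi_over v / v)) (at v)"
    by (simp only: mellin_tail_D2[OF pi_over_RHP[OF v]])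
  moreover have "- mellin_tail (a + 1) (pi_over v) * (- pi_over v / v) = (pi_over v * mellin_tail (a + 1) (pi_over v)) / v" by simp
  ultimately show ?thesis by (simp only: mellin_tail_recursion[OF pi_over_RHP[OF v]])
qed

lemma exp_pi_over_deriv:
  assumes v: "v \<in> RHP"
  shows "((\<lambda>v. exp (- pi_over v)) has_field_derivative exp (- pi_over v) * (pi_over v / v)) (at v)"
  by (auto intro!: derivative_eq_intros pi_over_deriv v)

lemma eis_kernel_D2:
  assumes v: "v \<in> RHP" shows "v\<^sup>2 * D2 eis_kernel s v = eis_flux s v"
proof -
  note nz = RHP_nonzero[OF v]
  have "((\<lambda>v. 1 / v\<^sup>2) has_field_derivative - 2 / v ^ 3) (at v)"
    using nz by (auto intro!: derivative_eq_intros simp: power2_eq_square power3_eq_cube)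
  from DERIV_mult[OF this DERIV_add[OF mellin_tail_pi_over_deriv[OF v, of "s + 1"] mellin_tail_pi_over_deriv[OF v, of "- s"]]]
  have e: "D2 eis_kernel s v = - 2 / v ^ 3 * (mellin_tail (s + 1) (pi_over v) + mellin_tail (- s) (pi_over v)) +
      ((exp (- pi_over v) + (s + 1 + 1) * mellin_tail (s + 1) (pi_over v)) / v + (exp (- pi_over v) + (- s + 1) * mellin_tail (- s) (pi_over v)) / v) * (1 / v\<^sup>2)"
    unfolding D2_def eis_kernel_def[abs_def] by (rule DERIV_imp_deriv)
  show ?thesis unfolding e eis_flux_def using nz by (simp add: field_simps power2_eq_square power3_eq_cube)
qed

text \<open>Both tails get the same coefficient: s (s + 2) - s and (1 + s) - (1 + s)(1 - s) are
  equal to s (s + 1). The exponentials from the boundary t = 1 no longer contain s and collect in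
  \<beta>.\<close>

lemma eis_flux_D2:
  assumes v: "v \<in> RHP" shows "D2 eis_flux s v = s * (s + 1) * eis_kernel s v + \<beta> v"
proof -
  note nz = RHP_nonzero[OF v]
  have 1: "((\<lambda>v. 1 / v) has_field_derivative - 1 / v\<^sup>2) (at v)"
    using nz by (auto intro!: derivative_eq_intros simp: power2_eq_square)
  have "((\<lambda>v. s * mellin_tail (s + 1) (pi_over v) - (1 + s) * mellin_tail (- s) (pi_over v) + 2 * exp (- pi_over v)) has_field_derivative
      (s * ((exp (- pi_over v) + (s + 1 + 1) * mellin_tail (s + 1) (pi_over v)) / v) - (1 + s) * ((exp (- pi_over v) + (- s + 1) * mellin_tail (- s) (pi_over v)) / v)
       + 2 * (exp (- pi_over v) * (pi_over v / v)))) (at v)"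
    by (intro DERIV_add DERIV_diff DERIV_cmult mellin_tail_pi_over_deriv exp_pi_over_deriv v)
  from DERIV_mult[OF 1 this]
  have "D2 eis_flux s v = - 1 / v\<^sup>2 * (s * mellin_tail (s + 1) (pi_over v) - (1 + s) * mellin_tail (- s) (pi_over v) + 2 * exp (- pi_over v)) +
      (s * ((exp (- pi_over v) + (s + 1 + 1) * mellin_tail (s + 1) (pi_over v)) / v) - (1 + s) * ((exp (- pi_over v) + (- s + 1) * mellin_tail (- s) (pi_over v)) / v)
       + 2 * (exp (- pi_over v) * (pi_over v / v))) * (1 / v)"
    unfolding D2_def eis_flux_def[abs_def] by (rule DERIV_imp_deriv)
  also have "\<dots> = (1 / v\<^sup>2) * (- (s * mellin_tail (s + 1) (pi_over v) - (1 + s) * mellin_tail (- s) (pi_over v) + 2 * exp (- pi_over v)) +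
      (s * (exp (- pi_over v) + (s + 1 + 1) * mellin_tail (s + 1) (pi_over v)) - (1 + s) * (exp (- pi_over v) + (- s + 1) * mellin_tail (- s) (pi_over v))
       + 2 * (exp (- pi_over v) * pi_over v)))"
    using nz by (simp add: field_simps power2_eq_square)
  also have "\<dots> = s * (s + 1) * eis_kernel s v + \<beta> v"
  proof -
    define c where "c = 1 / v\<^sup>2"
    show ?thesis unfolding eis_kernel_def \<beta>_def c_def[symmetric] by (simp add: algebra_simps)
  qed
  finally show ?thesis .
qed

text \<open>This makes the lattice sum of \<beta> a z-derivative of the lattice sum of \<psi>0, up
  to a constant factor.\<close>

lemma \<psi>0_deriv: "v \<in> RHP \<Longrightarrow> deriv \<psi>0 v = \<beta> v"
proof -
  assume v: "v \<in> RHP"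
  note nz = RHP_nonzero[OF v]
  have "(\<psi>0 has_field_derivative - (1 / pi) * (exp (- pi_over v) * (pi_over v / v) * (1 - 2 * pi_over v) + (0 - 2 * (- pi_over v / v)) * exp (- pi_over v))) (at v)"
    unfolding \<psi>0_def[abs_def]
    by (intro DERIV_cmult DERIV_mult DERIV_diff DERIV_const exp_pi_over_deriv pi_over_deriv v)
  hence "deriv \<psi>0 v = - (1 / pi) * (exp (- pi_over v) * (pi_over v / v) * (1 - 2 * pi_over v) + (0 - 2 * (- pi_over v / v)) * exp (- pi_over v))"
    by (rule DERIV_imp_deriv)
  also have "\<dots> = (pi_over v / (pi * v)) * (exp (- pi_over v) * (2 * pi_over v - 3))"
    using nz by (simp add: field_simps)
  also have "pi_over v / (pi * v) = 1 / v\<^sup>2" using nz by (simp add: pi_over_def power2_eq_square)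
  finally show ?thesis by (simp add: \<beta>_def)
qed

lemma eis_flux_0: "v \<in> RHP \<Longrightarrow> eis_flux 0 v = \<psi>0 v"
proof -
  assume v: "v \<in> RHP"
  have nz: "v \<noteq> 0" "pi_over v \<noteq> 0" using RHP_nonzero[OF v] RHP_nonzero[OF pi_over_RHP[OF v]] by auto
  have "eis_flux 0 v = (1 / v) * (- (exp (- pi_over v) / pi_over v) + 2 * exp (- pi_over v))"
    by (simp add: eis_flux_def mellin_tail_0[OF pi_over_RHP[OF v]])
  also have "\<dots> = \<psi>0 v" using nz by (simp add: \<psi>0_def pi_over_def field_simps)
  finally show ?thesis .
qed

text \<open>Inversion preserves sectors around the positive axis, so within one of them Re (pi / v)
  is at least of order 1 / |v|.\<close>

lemma Re_pi_over_sector: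
  assumes "v \<in> RHP" "\<kappa> * norm v \<le> Re v" "\<kappa> > 0"
  shows "1 / Re (pi_over v) \<le> norm v / (pi * \<kappa>)"
proof -
  have n: "norm v > 0" using RHP_nonzero[OF assms(1)] by simp
  have "pi * \<kappa> / norm v = pi * (\<kappa> * norm v) / (norm v)\<^sup>2" using n by (simp add: power2_eq_square)
  also have "\<dots> \<le> Re (pi_over v)" unfolding Re_pi_over[OF assms(1)] using assms by (intro divide_right_mono mult_left_mono) auto
  finally have "pi * \<kappa> / norm v \<le> Re (pi_over v)" .
  moreover have "pi * \<kappa> / norm v > 0" using n assms by simp
  ultimately have "1 / Re (pi_over v) \<le> 1 / (pi * \<kappa> / norm v)" by (intro divide_left_mono mult_pos_pos) auto
  thus ?thesis by simp
qed

text \<open>Flatness uniform on a disc in s, so that Cauchy's inequality passes it on to every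
  Taylor coefficient at 0. The radius 1/4 keeps Re (s + 1) and Re (-s) below the limits of
  \<open>mellin_tail_bound\<close> for N = 3 and N = 4.\<close>

definition unif_flat :: "(complex \<Rightarrow> complex \<Rightarrow> complex) \<Rightarrow> bool" where
  "unif_flat F \<longleftrightarrow> hol2 UNIV RHP F \<and>
     (\<forall>\<kappa>>0. \<exists>C. \<forall>s v. norm s \<le> 1/4 \<longrightarrow> v \<in> RHP \<longrightarrow> \<kappa> * norm v \<le> Re v \<longrightarrow> norm (F s v) \<le> C * (norm v)\<^sup>2)"

lemma eis_kernel_bound:
  assumes k: "\<kappa> > 0"
  shows "\<exists>C. \<forall>s v. norm s \<le> 1/4 \<longrightarrow> v \<in> RHP \<longrightarrow> \<kappa> * norm v \<le> Re v \<longrightarrow> norm (eis_kernel s v) \<le> C * (norm v)\<^sup>2"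
proof -
  \<comment> \<open>The power 4 leaves |v|^2 after the factor 1 / v^2 of the kernel.\<close>
  obtain C where C: "C \<ge> 0" "\<And>a q. Re a \<le> real 4 - 3/2 \<Longrightarrow> q \<in> RHP \<Longrightarrow> norm (mellin_tail a q) \<le> C / Re q ^ 4"
    using mellin_tail_bound[of 4] by blast
  have "norm (eis_kernel s v) \<le> (2 * C / (pi * \<kappa>) ^ 4) * (norm v)\<^sup>2" if s: "norm s \<le> 1/4" and v: "v \<in> RHP" "\<kappa> * norm v \<le> Re v" for s v
  proof -
    have n: "norm v > 0" using RHP_nonzero[OF v(1)] by simp
    have q: "pi_over v \<in> RHP" by (rule pi_over_RHP[OF v(1)])
    have rs: "\<bar>Re s\<bar> \<le> 1/4" using abs_Re_le_cmod[of s] s by linarith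
    have "norm (mellin_tail (s + 1) (pi_over v) + mellin_tail (- s) (pi_over v)) \<le> C / Re (pi_over v) ^ 4 + C / Re (pi_over v) ^ 4"
      by (intro order_trans[OF norm_triangle_ineq] add_mono C(2) q) (use rs in auto)
    also have "\<dots> = 2 * C * (1 / Re (pi_over v)) ^ 4" by (simp add: power_divide)
    also have "\<dots> \<le> 2 * C * (norm v / (pi * \<kappa>)) ^ 4"
      using Re_pi_over_sector[OF v k] q C(1) by (intro mult_left_mono power_mono) (auto simp: RHP_def)
    finally have "norm (eis_kernel s v) \<le> 1 / (norm v)\<^sup>2 * (2 * C * (norm v / (pi * \<kappa>)) ^ 4)"
      unfolding eis_kernel_def norm_mult by (intro mult_mono) (auto simp: norm_divide norm_power)
    also have "\<dots> = (2 * C / (pi * \<kappa>) ^ 4) * (norm v)\<^sup>2" using n k by (simp add: field_simps eval_nat_numeral)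
    finally show ?thesis .
  qed
  thus ?thesis by blast
qed

lemma exp_pi_over_bound: "v \<in> RHP \<Longrightarrow> norm (exp (- pi_over v)) \<le> fact N / Re (pi_over v) ^ N"
  using exp_minus_le[of "Re (pi_over v)" N] pi_over_RHP[of v] by (simp add: RHP_def)

lemma eis_flux_bound:
  assumes k: "\<kappa> > 0"
  shows "\<exists>C. \<forall>s v. norm s \<le> 1/4 \<longrightarrow> v \<in> RHP \<longrightarrow> \<kappa> * norm v \<le> Re v \<longrightarrow> norm (eis_flux s v) \<le> C * (norm v)\<^sup>2"
proof -
  \<comment> \<open>The power 3 suffices here, since the flux carries only the factor 1 / v.\<close>
  obtain C where C: "C \<ge> 0" "\<And>a q. Re a \<le> real 3 - 3/2 \<Longrightarrow> q \<in> RHP \<Longrightarrow> norm (mellin_tail a q) \<le> C / Re q ^ 3"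
    using mellin_tail_bound[of 3] by blast
  have "norm (eis_flux s v) \<le> ((3 * C + 12) / (pi * \<kappa>) ^ 3) * (norm v)\<^sup>2" if s: "norm s \<le> 1/4" and v: "v \<in> RHP" "\<kappa> * norm v \<le> Re v" for s v
  proof -
    have n: "norm v > 0" using RHP_nonzero[OF v(1)] by simp
    have q: "pi_over v \<in> RHP" by (rule pi_over_RHP[OF v(1)])
    have q0: "Re (pi_over v) > 0" using q by (simp add: RHP_def)
    have rs: "\<bar>Re s\<bar> \<le> 1/4" using abs_Re_le_cmod[of s] s by linarith
    have K1: "norm (mellin_tail (s + 1) (pi_over v)) \<le> C / Re (pi_over v) ^ 3" and K2: "norm (mellin_tail (- s) (pi_over v)) \<le> C / Re (pi_over v) ^ 3"
      by (intro C(2) q; use rs in simp)+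
    have s1: "norm (1 + s) \<le> 2" using norm_triangle_ineq[of 1 s] s by simp
    have "norm (s * mellin_tail (s + 1) (pi_over v) - (1 + s) * mellin_tail (- s) (pi_over v) + 2 * exp (- pi_over v))
       \<le> norm s * norm (mellin_tail (s + 1) (pi_over v)) + norm (1 + s) * norm (mellin_tail (- s) (pi_over v)) + 2 * norm (exp (- pi_over v))"
      by (intro order_trans[OF norm_triangle_ineq] add_mono order_trans[OF norm_triangle_ineq4]) (auto simp: norm_mult)
    also have "\<dots> \<le> 1 * (C / Re (pi_over v) ^ 3) + 2 * (C / Re (pi_over v) ^ 3) + 2 * (fact 3 / Re (pi_over v) ^ 3)"
      using s s1 K1 K2 exp_pi_over_bound[OF v(1), of 3] by (intro add_mono mult_mono) auto
    also have "\<dots> = (3 * C + 12) * (1 / Re (pi_over v)) ^ 3" using q0 by (simp add: power_divide fact_numeral field_simps)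
    also have "\<dots> \<le> (3 * C + 12) * (norm v / (pi * \<kappa>)) ^ 3"
      using Re_pi_over_sector[OF v k] q0 C(1) by (intro mult_left_mono power_mono) auto
    finally have "norm (eis_flux s v) \<le> 1 / norm v * ((3 * C + 12) * (norm v / (pi * \<kappa>)) ^ 3)"
      unfolding eis_flux_def norm_mult by (intro mult_mono) (auto simp: norm_divide)
    also have "\<dots> = ((3 * C + 12) / (pi * \<kappa>) ^ 3) * (norm v)\<^sup>2" using n k by (simp add: field_simps eval_nat_numeral)
    finally show ?thesis .
  qed
  thus ?thesis by blast
qed

lemma unif_flat_eis_kernel: "unif_flat eis_kernel" and unif_flat_eis_flux: "unif_flat eis_flux"
  using eis_kernel_hol2 eis_flux_hol2 eis_kernel_bound eis_flux_bound by (auto simp: unif_flat_def)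

lemma unif_flat_mult:
  assumes F: "unif_flat F" and g: "g holomorphic_on UNIV"
  shows "unif_flat (\<lambda>s v. g s * F s v)"
proof -
  have "continuous_on (cball 0 (1/4)) (\<lambda>s. norm (g s))"
    using holomorphic_on_imp_continuous_on[OF g] by (intro continuous_on_norm) (rule continuous_on_subset, auto)
  hence "bounded ((\<lambda>s. norm (g s)) ` cball 0 (1/4))"
    by (intro compact_imp_bounded compact_continuous_image compact_cball)
  then obtain B where B: "B > 0" "\<And>s. norm s \<le> 1/4 \<Longrightarrow> norm (g s) \<le> B"
    unfolding bounded_pos by auto
  have "\<exists>C. \<forall>s v. norm s \<le> 1/4 \<longrightarrow> v \<in> RHP \<longrightarrow> \<kappa> * norm v \<le> Re v \<longrightarrow> norm (g s * F s v) \<le> C * (norm v)\<^sup>2" if kpos: "\<kappa> > 0" for \<kappa>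
  proof -
    obtain C where C: "\<And>s v. norm s \<le> 1/4 \<Longrightarrow> v \<in> RHP \<Longrightarrow> \<kappa> * norm v \<le> Re v \<Longrightarrow> norm (F s v) \<le> C * (norm v)\<^sup>2"
      using F kpos unfolding unif_flat_def by blast
    have "norm (g s * F s v) \<le> (B * C) * (norm v)\<^sup>2" if "norm s \<le> 1/4" "v \<in> RHP" "\<kappa> * norm v \<le> Re v" for s v
      using mult_mono[OF B(2)[OF that(1)] C[OF that]] B(1) by (simp add: norm_mult mult.assoc)
    thus ?thesis by blast
  qed
  thus ?thesis using F hol2_mult[OF hol2_left[OF g]] by (auto simp: unif_flat_def)
qed

section \<open>Taylor coefficients in s as profiles\<close>

definition taylor0 :: "(complex \<Rightarrow> complex \<Rightarrow> complex) \<Rightarrow> nat \<Rightarrow> complex \<Rightarrow> complex" where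
  "taylor0 F n v = (deriv ^^ n) (\<lambda>s. F s v) 0 / fact n"

lemma iterated_D1:
  assumes F: "hol2 UNIV RHP F"
  shows "hol2 UNIV RHP ((D1 ^^ n) F)" "(D1 ^^ n) F s v = (deriv ^^ n) (\<lambda>s. F s v) s"
    "v \<in> RHP \<Longrightarrow> D2 ((D1 ^^ n) F) s v = (D1 ^^ n) (D2 F) s v"
proof -
  show h: "hol2 UNIV RHP ((D1 ^^ n) F)" for n
    by (induction n) (auto intro: F hol2_D1)
  show "(D1 ^^ n) F s v = (deriv ^^ n) (\<lambda>s. F s v) s"
  proof (induction n arbitrary: s)
    case (Suc n)
    have "(\<lambda>\<zeta>. (D1 ^^ n) F \<zeta> v) = (deriv ^^ n) (\<lambda>s. F s v)" by (rule ext) (rule Suc.IH)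
    moreover have "(D1 ^^ Suc n) F s v = deriv (\<lambda>\<zeta>. (D1 ^^ n) F \<zeta> v) s"
      using D1_def[of "(D1 ^^ n) F" s v] by simp
    ultimately show ?case by simp
  qed simp
  assume v: "v \<in> RHP"
  show "D2 ((D1 ^^ n) F) s v = (D1 ^^ n) (D2 F) s v"
  proof (induction n arbitrary: s)
    case (Suc n)
    have "D2 (D1 ((D1 ^^ n) F)) s v = D1 (D2 ((D1 ^^ n) F)) s v"
      by (rule D1_D2_commute[OF h open_UNIV open_RHP UNIV_I v])
    also have "\<dots> = D1 ((D1 ^^ n) (D2 F)) s v" unfolding D1_def[of "D2 _"] D1_def[of "(D1 ^^ n) (D2 F)"] Suc.IH ..
    finally show ?case by simp
  qed simp
qed

lemma taylor0_flat:
  assumes F: "unif_flat F"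
  shows "flat (taylor0 F n)"
  unfolding flat_def
proof (intro conjI allI impI)
  have h: "hol2 UNIV RHP F" using F by (simp add: unif_flat_def)
  have "(\<lambda>v. (D1 ^^ n) F 0 v / fact n) holomorphic_on RHP"
    using iterated_D1(1)[OF h, of n] by (intro holomorphic_on_divide holomorphic_on_const) (auto simp: hol2_def)
  thus "taylor0 F n holomorphic_on RHP" unfolding iterated_D1(2)[OF h] taylor0_def[abs_def] .
  fix \<kappa> :: real assume "\<kappa> > 0"
  then obtain C where C: "\<And>s v. norm s \<le> 1/4 \<Longrightarrow> v \<in> RHP \<Longrightarrow> \<kappa> * norm v \<le> Re v \<Longrightarrow> norm (F s v) \<le> C * (norm v)\<^sup>2"
    using F unfolding unif_flat_def by blast
  have "norm (taylor0 F n v) \<le> (C / (1/4) ^ n) * (norm v)\<^sup>2" if v: "v \<in> RHP" "\<kappa> * norm v \<le> Re v" for v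
  proof -
    have hol: "(\<lambda>s. F s v) holomorphic_on UNIV" using h v by (simp add: hol2_def)
    have "norm ((deriv ^^ n) (\<lambda>s. F s v) 0) \<le> fact n * (C * (norm v)\<^sup>2) / (1/4) ^ n"
    proof (rule Cauchy_inequality)
      show "(\<lambda>s. F s v) holomorphic_on ball 0 (1/4)" by (rule holomorphic_on_subset[OF hol]) auto
      show "continuous_on (cball 0 (1/4)) (\<lambda>s. F s v)"
        by (rule continuous_on_subset[OF holomorphic_on_imp_continuous_on[OF hol]]) auto
    qed (auto intro: C v)
    thus ?thesis by (simp add: taylor0_def norm_divide field_simps)
  qed
  thus "\<exists>C. \<forall>v\<in>RHP. \<kappa> * norm v \<le> Re v \<longrightarrow> norm (taylor0 F n v) \<le> C * (norm v)\<^sup>2" by blast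
qed

lemma taylor0_deriv:
  assumes F: "hol2 UNIV RHP F" and v: "v \<in> RHP"
  shows "deriv (taylor0 F n) v = taylor0 (D2 F) n v"
proof -
  have D2F: "hol2 UNIV RHP (D2 F)" by (rule hol2_D2[OF F open_UNIV open_RHP])
  have "((D1 ^^ n) F 0 has_field_derivative (D1 ^^ n) (D2 F) 0 v) (at v)"
    using hol2_derivs(2)[OF iterated_D1(1)[OF F] open_UNIV open_RHP UNIV_I v, of n 0] iterated_D1(3)[OF F v, of n 0] by simp
  from DERIV_cdivide[OF this, of "fact n"]
  have "(taylor0 F n has_field_derivative taylor0 (D2 F) n v) (at v)"
    unfolding iterated_D1(2)[OF F] iterated_D1(2)[OF D2F] taylor0_def[abs_def] .
  thus ?thesis by (rule DERIV_imp_deriv)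
qed

lemma taylor0_eq_fps: "taylor0 F n v = fps_nth (fps_expansion (\<lambda>s. F s v) 0) n"
  by (simp add: taylor0_def fps_expansion_def)

text \<open>Multiplication by s + s^2 adds the power series shifted by one and by two. This is the
  source of the recursion with two terms.\<close>

lemma taylor0_quadratic:
  assumes F: "(\<lambda>s. F s v) holomorphic_on UNIV"
  shows "taylor0 (\<lambda>s v. s * (s + 1) * F s v) n v = (if n \<ge> 1 then taylor0 F (n - 1) v else 0) + (if n \<ge> 2 then taylor0 F (n - 2) v else 0)"
proof -
  have "(\<lambda>s. F s v) has_fps_expansion fps_expansion (\<lambda>s. F s v) 0"
    by (rule has_fps_expansion_fps_expansion[OF open_UNIV _ F]) simp
  hence "(\<lambda>s. s * (s + 1) * F s v) has_fps_expansion fps_X * (fps_X + 1) * fps_expansion (\<lambda>s. F s v) 0"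
    by (intro fps_expansion_intros)
  hence e: "fps_expansion (\<lambda>s. s * (s + 1) * F s v) 0 = fps_X * (fps_X + 1) * fps_expansion (\<lambda>s. F s v) 0"
    by (rule fps_expansion_eqI)
  also have "\<dots> = fps_X * fps_expansion (\<lambda>s. F s v) 0 + fps_X * (fps_X * fps_expansion (\<lambda>s. F s v) 0)"
    by (simp add: algebra_simps)
  finally show ?thesis unfolding taylor0_eq_fps by (cases n) (auto simp: Suc_le_eq numeral_2_eq_2)
qed

lemma taylor0_cmult_right:
  assumes "(\<lambda>s. F s v) holomorphic_on UNIV"
  shows "taylor0 (\<lambda>s v. c v * F s v) n v = c v * taylor0 F n v"
  using higher_deriv_cmult[of "\<lambda>s. F s v" UNIV 0 n "c v"] assms by (simp add: taylor0_def)

lemma taylor0_add: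
  assumes "(\<lambda>s. F s v) holomorphic_on UNIV" "(\<lambda>s. G s v) holomorphic_on UNIV"
  shows "taylor0 (\<lambda>s v. F s v + G s v) n v = taylor0 F n v + taylor0 G n v"
  using higher_deriv_add[OF assms, of 0 n] by (simp add: taylor0_def add_divide_distrib)

lemma taylor0_const: "taylor0 (\<lambda>s v. c v) n v = (if n = 0 then c v else 0)"
  by (simp add: taylor0_def higher_deriv_const)

section \<open>Theta functional equations\<close>

definition lat_height :: "complex \<Rightarrow> int \<times> int \<Rightarrow> real" where
  "lat_height z p = Im z / (norm (lin p z))\<^sup>2"

lemma polar_height_lat_height: "polar_height p z (cnj z) = of_real (lat_height z p)"
  by (simp add: polar_height_diagonal lat_height_def)

lemma lat_height_pos: "z \<in> UHP \<Longrightarrow> p \<in> lat \<Longrightarrow> lat_height z p > 0"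
  using lin_nonzero[of p z] by (auto simp: lat_height_def UHP_def)

lemma pi_over_of_real: "pi_over (of_real r) = of_real (pi / r)"
  by (simp add: pi_over_def)

lemma lat_height_bound:
  assumes z: "z \<in> UHP"
  shows "\<exists>B>0. \<forall>p\<in>lat. lat_height z p \<le> B * latnorm p powr (-2) \<and> norm (1 / (lin p z)\<^sup>2) \<le> B * latnorm p powr (-2) \<and> (norm (lin p z))\<^sup>2 = Im z / lat_height z p"
proof -
  have y: "Im z > 0" using z by (simp add: UHP_def)
  define \<delta> where "\<delta> = Im z / (1 + 2 * norm z)"
  have d: "\<delta> > 0" using y by (simp add: \<delta>_def add_pos_nonneg)
  define B where "B = max (Im z) 1 / \<delta>\<^sup>2"
  have "lat_height z p \<le> B * latnorm p powr (-2) \<and> norm (1 / (lin p z)\<^sup>2) \<le> B * latnorm p powr (-2) \<and> (norm (lin p z))\<^sup>2 = Im z / lat_height z p" if p: "p \<in> lat" for p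
  proof -
    define N where "N = latnorm p"
    have N: "N \<ge> 1" using latnorm_ge_1[OF p] by (simp add: N_def)
    have l: "\<delta> * N \<le> norm (lin p z)" unfolding \<delta>_def N_def by (rule lin_lower) (use y in auto)
    have dN: "\<delta> * N > 0" using d N by simp
    have sq: "(\<delta> * N)\<^sup>2 \<le> (norm (lin p z))\<^sup>2" using l dN by (intro power_mono) auto
    have sq0: "(\<delta> * N)\<^sup>2 > 0" using dN by (rule zero_less_power)
    have ln: "norm (lin p z) > 0" using l dN by linarith
    have e: "c / (\<delta> * N)\<^sup>2 = c / \<delta>\<^sup>2 * N powr (-2)" for c
      using N by (simp add: power_mult_distrib powr_minus_divide)
    have "c / (norm (lin p z))\<^sup>2 \<le> B * N powr (-2)" if c: "0 \<le> c" "c \<le> max (Im z) 1" for c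
    proof -
      have "c / (norm (lin p z))\<^sup>2 \<le> max (Im z) 1 / (\<delta> * N)\<^sup>2" using sq sq0 c by (intro frac_le) auto
      thus ?thesis by (simp only: e B_def)
    qed
    from this[of "Im z"] this[of 1] y have "lat_height z p \<le> B * N powr (-2)" "1 / (norm (lin p z))\<^sup>2 \<le> B * N powr (-2)"
      by (auto simp: lat_height_def)
    moreover have "(norm (lin p z))\<^sup>2 = Im z / lat_height z p" using ln y by (simp add: lat_height_def)
    ultimately show ?thesis by (simp add: norm_divide norm_power N_def)
  qed
  moreover have "B > 0" using d by (simp add: B_def)
  ultimately show ?thesis by blast
qed

lemma lat_height_power_summable:
  assumes z: "z \<in> UHP" and k: "k > (1::real)"
  shows "(\<lambda>p. lat_height z p powr k) summable_on lat"
proof -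
  obtain B where B: "B > 0" "\<And>p. p \<in> lat \<Longrightarrow> lat_height z p \<le> B * latnorm p powr (-2)" using lat_height_bound[OF z] by blast
  show ?thesis
  proof (rule summable_on_comparison_test)
    show "(\<lambda>p. B powr k * latnorm p powr (- (2 * k))) summable_on lat"
      by (intro summable_on_cmult_right summable_latnorm) (use k in simp)
    fix p assume p: "p \<in> lat"
    have "lat_height z p powr k \<le> (B * latnorm p powr (-2)) powr k"
      using B p lat_height_pos[OF z p] k by (intro powr_mono2) auto
    also have "\<dots> = B powr k * latnorm p powr (- (2 * k))"
      using B latnorm_ge_1[OF p] by (simp add: powr_mult powr_powr)
    finally show "lat_height z p powr k \<le> B powr k * latnorm p powr (- (2 * k))" .
  qed auto
qed

lemma exp_lat_height_bound:
  assumes "z \<in> UHP" "p \<in> lat" "c > 0"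
  shows "exp (- (c * (pi / lat_height z p))) \<le> fact N / (c * pi) ^ N * lat_height z p powr (real N)"
proof -
  have r: "lat_height z p > 0" by (rule lat_height_pos[OF assms(1,2)])
  have "exp (- (c * (pi / lat_height z p))) \<le> fact N / (c * (pi / lat_height z p)) ^ N"
    by (rule exp_minus_le) (use r assms in auto)
  also have "\<dots> = fact N / (c * pi) ^ N * lat_height z p powr (real N)"
    using r by (simp add: powr_realpow power_mult_distrib power_divide)
  finally show ?thesis .
qed

lemma flat_exp:
  assumes t: "t > 0"
  shows "flat (\<lambda>v. exp (- of_real t * pi_over v))"
  unfolding flat_def
proof (intro conjI allI impI)
  show "(\<lambda>v. exp (- of_real t * pi_over v)) holomorphic_on RHP" by (intro holomorphic_intros pi_over_holomorphic)
  fix \<kappa> :: real assume k: "\<kappa> > 0"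
  have "norm (exp (- of_real t * pi_over v)) \<le> (fact 2 / (t * (pi * \<kappa>))\<^sup>2) * (norm v)\<^sup>2" if v: "v \<in> RHP" "\<kappa> * norm v \<le> Re v" for v
  proof -
    have q0: "Re (pi_over v) > 0" using pi_over_RHP[OF v(1)] by (simp add: RHP_def)
    have "norm (exp (- of_real t * pi_over v)) = exp (- (t * Re (pi_over v)))" by simp
    also have "\<dots> \<le> fact 2 / (t * Re (pi_over v)) ^ 2" by (rule exp_minus_le) (use t q0 in simp)
    also have "\<dots> = fact 2 / t\<^sup>2 * (1 / Re (pi_over v))\<^sup>2" by (simp add: power_mult_distrib power_divide)
    also have "\<dots> \<le> fact 2 / t\<^sup>2 * (norm v / (pi * \<kappa>))\<^sup>2"
      using Re_pi_over_sector[OF v k] q0 by (intro mult_left_mono power_mono) auto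
    also have "\<dots> = (fact 2 / (t * (pi * \<kappa>))\<^sup>2) * (norm v)\<^sup>2" by (simp add: power_mult_distrib power_divide)
    finally show ?thesis .
  qed
  thus "\<exists>C. \<forall>v\<in>RHP. \<kappa> * norm v \<le> Re v \<longrightarrow> norm (exp (- of_real t * pi_over v)) \<le> C * (norm v)\<^sup>2" by blast
qed

text \<open>The theta series of the quadratic form |mz+n|^2 / y without its term at (0,0), which is
  the 1 in the functional equation.\<close>

definition theta0 :: "complex \<Rightarrow> real \<Rightarrow> complex" where
  "theta0 z t = LS0 (\<lambda>v. exp (- of_real t * pi_over v)) z (cnj z)"

lemma lin_norm_Complex: "(norm (lin (m, n) z))\<^sup>2 = (of_int n + of_int m * Re z)\<^sup>2 + (of_int m * Im z)\<^sup>2"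
  by (simp add: lin_def cmod_power2 add.commute)

text \<open>Poisson summation in n alone, for each fixed m, with c = t / y and shift m x. The
  transformed double series is symmetric under exchanging m with n and t with 1/t; the factor
  \<open>sqrt (y / t)\<close> accounts for the t on the right.\<close>

lemma theta0_functional:
  assumes z: "z \<in> UHP" and t: "t > 0"
  shows "1 + theta0 z (1 / t) = of_real t * (1 + theta0 z t)"
proof -
  define x y where "x = Re z" and "y = Im z"
  have y: "y > 0" using z by (simp add: UHP_def y_def)
  define f where "f t p = complex_of_real (exp (- (t * pi * (norm (lin p z))\<^sup>2 / y)))" for t p
  define g where "g t m n = complex_of_real (exp (-(pi * y * (of_int n)\<^sup>2 / t)) * exp (-(pi * y * t * (of_int m)\<^sup>2))) * cis (2 * pi * of_int n * (of_int m * x))" for t and m n :: int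
  have theta0: "1 + theta0 z t = (\<Sum>\<^sub>\<infinity>p. f t p)" and fs: "f t summable_on UNIV" if t: "t > 0" for t
  proof -
    have "(\<lambda>p. exp (- of_real t * pi_over (polar_height p z (cnj z)))) summable_on lat"
      using LS_hol2(6)[OF flat_exp[OF t] z, of "cnj z"] z by (auto simp: summable_on_def)
    moreover have fe: "exp (- of_real t * pi_over (polar_height p z (cnj z))) = f t p" for p
      unfolding polar_height_lat_height pi_over_of_real by (simp add: f_def exp_of_real[symmetric] lat_height_def y_def mult.assoc)
    ultimately have s: "f t summable_on lat" by simp
    hence "((f t) has_sum (infsum (f t) lat)) lat" by simp
    moreover have "((f t) has_sum 1) {(0,0)}" by (rule has_sum_finiteI) (auto simp: f_def lin_def)
    ultimately have "((f t) has_sum (infsum (f t) lat + 1)) (lat \<union> {(0,0)})" by (intro has_sum_Un_disjoint) auto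
    moreover have "lat \<union> {(0,0)} = UNIV" by auto
    ultimately have h: "((f t) has_sum (infsum (f t) lat + 1)) UNIV" by simp
    thus "f t summable_on UNIV" by (auto simp: summable_on_def)
    have "theta0 z t = infsum (f t) lat" unfolding theta0_def LS0_def by (rule infsum_cong) (rule fe)
    thus "1 + theta0 z t = (\<Sum>\<^sub>\<infinity>p. f t p)" using infsumI[OF h] by (simp add: add.commute)
  qed
  define S where "S t = (\<Sum>\<^sub>\<infinity>m. \<Sum>\<^sub>\<infinity>n. g t m n)" for t
  have poisson: "(\<Sum>\<^sub>\<infinity>n. f t (m, n)) = of_real (sqrt (y / t)) * (\<Sum>\<^sub>\<infinity>n. g t m n)" if t: "t > 0" for t m
  proof -
    define c where "c = t / y"
    have c: "c > 0" using t y by (simp add: c_def)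
    have "f t (m, n) = of_real (exp (-(pi * y * t * (of_int m)\<^sup>2))) * of_real (exp (-(pi * c * (of_int n + of_int m * x)\<^sup>2)))" for n
    proof -
      have "- (t * pi * (norm (lin (m, n) z))\<^sup>2 / y) = -(pi * y * t * (of_int m)\<^sup>2) + -(pi * c * (of_int n + of_int m * x)\<^sup>2)"
        unfolding lin_norm_Complex x_def[symmetric] y_def[symmetric] c_def using y by (simp add: field_simps power2_eq_square)
      thus ?thesis unfolding f_def by (simp only: exp_add of_real_mult)
    qed
    hence "(\<Sum>\<^sub>\<infinity>n. f t (m, n)) = of_real (exp (-(pi * y * t * (of_int m)\<^sup>2))) * (\<Sum>\<^sub>\<infinity>n. of_real (exp (-(pi * c * (of_int n + of_int m * x)\<^sup>2))))"
      by (simp only: infsum_cmult_right')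
    also have "(\<Sum>\<^sub>\<infinity>n. complex_of_real (exp (-(pi * c * (of_int n + of_int m * x)\<^sup>2))))
        = (\<Sum>\<^sub>\<infinity>n::int. complex_of_real (exp (-(pi * (of_int n)\<^sup>2 / c)) / sqrt c) * cis (2 * pi * of_int n * (of_int m * x)))"
      by (rule poisson_gaussian[OF c])
    also have "of_real (exp (-(pi * y * t * (of_int m)\<^sup>2))) * \<dots> = (\<Sum>\<^sub>\<infinity>n::int. of_real (exp (-(pi * y * t * (of_int m)\<^sup>2))) * (complex_of_real (exp (-(pi * (of_int n)\<^sup>2 / c)) / sqrt c) * cis (2 * pi * of_int n * (of_int m * x))))"
      by (rule infsum_cmult_right'[symmetric])
    also have "\<dots> = (\<Sum>\<^sub>\<infinity>n. of_real (sqrt (y / t)) * g t m n)"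
    proof (rule infsum_cong)
      fix n :: int
      have "1 / sqrt c = sqrt (y / t)" by (simp add: c_def real_sqrt_divide)
      hence "complex_of_real (exp (-(pi * (of_int n)\<^sup>2 / c)) / sqrt c) = of_real (exp (-(pi * y * (of_int n)\<^sup>2 / t))) * of_real (sqrt (y / t))"
        by (simp add: c_def divide_inverse flip: of_real_mult)
      thus "of_real (exp (-(pi * y * t * (of_int m)\<^sup>2))) * (complex_of_real (exp (-(pi * (of_int n)\<^sup>2 / c)) / sqrt c) * cis (2 * pi * of_int n * (of_int m * x))) = of_real (sqrt (y / t)) * g t m n"
        unfolding g_def of_real_mult by (simp only: mult_ac)
    qed
    also have "\<dots> = of_real (sqrt (y / t)) * (\<Sum>\<^sub>\<infinity>n. g t m n)" by (rule infsum_cmult_right')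
    finally show ?thesis .
  qed
  have ThS: "1 + theta0 z t = of_real (sqrt (y / t)) * S t" if t: "t > 0" for t
  proof -
    have "1 + theta0 z t = (\<Sum>\<^sub>\<infinity>p\<in>UNIV \<times> UNIV. f t p)" using theta0[OF t] by simp
    also have "\<dots> = (\<Sum>\<^sub>\<infinity>m. \<Sum>\<^sub>\<infinity>n. f t (m, n))"
      by (rule infsum_Sigma'_banach[symmetric, where f = "\<lambda>m n. f t (m, n)", simplified]) (use fs[OF t] in simp)
    also have "\<dots> = of_real (sqrt (y / t)) * S t" unfolding poisson[OF t] S_def by (rule infsum_cmult_right')
    finally show ?thesis .
  qed
  have gs: "(\<lambda>(m, n). g t m n) summable_on (UNIV \<times> UNIV)" if t: "t > 0" for t
  proof -
    define a where "a n = exp (-((pi * y / t) * (real_of_int n)\<^sup>2))" for n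
    define b where "b m = exp (-((pi * y * t) * (real_of_int m)\<^sup>2))" for m
    have ab: "a summable_on UNIV" "b summable_on UNIV" unfolding a_def b_def using t y
      by (intro gaussian_summable_on_int; simp)+
    have "(\<lambda>p. norm ((\<lambda>(m, n). g t m n) p)) summable_on (UNIV \<times> UNIV)"
    proof (rule Infinite_Sum.abs_summable_on_Sigma_iff[THEN iffD2], rule conjI)
      have gn: "norm ((\<lambda>(m, n). g t m n) (m, n)) = b m * a n" for m n
        by (simp add: g_def norm_mult a_def b_def)
      show "\<forall>m\<in>UNIV. (\<lambda>n. norm ((\<lambda>(m, n). g t m n) (m, n))) summable_on UNIV"
        unfolding gn using ab by (auto intro!: summable_on_cmult_right)
      have "(\<Sum>\<^sub>\<infinity>n. b m * a n) = b m * infsum a UNIV" for m by (rule infsum_cmult_right')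
      moreover have "infsum a UNIV \<ge> 0" by (rule infsum_nonneg) (simp add: a_def)
      ultimately show "(\<lambda>m. norm (\<Sum>\<^sub>\<infinity>n\<in>UNIV. norm ((\<lambda>(m, n). g t m n) (m, n)))) summable_on UNIV"
        unfolding gn using summable_on_cmult_left[OF ab(2), of "infsum a UNIV"] by (simp add: abs_mult b_def)
    qed
    thus ?thesis by (rule abs_summable_summable)
  qed
  \<comment> \<open>Replacing t by 1/t interchanges the two Gaussians of \<open>g\<close>, and the
    phase 2 pi m n x is symmetric in m and n.\<close>
  have "S (1 / t) = (\<Sum>\<^sub>\<infinity>m. \<Sum>\<^sub>\<infinity>n. g t n m)"
    unfolding S_def g_def using t by (intro infsum_cong) (simp add: mult_ac)
  also have "\<dots> = S t" unfolding S_def by (rule infsum_swap_banach[symmetric]) (rule gs[OF t])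
  finally have SS: "S (1 / t) = S t" .
  have "1 + theta0 z (1 / t) = of_real (sqrt (y * t)) * S t" using ThS[of "1 / t"] t SS by simp
  also have "sqrt (y * t) = t * sqrt (y / t)"
  proof -
    have "sqrt (y * t) = sqrt (t\<^sup>2 * (y / t))" using t by (simp add: power2_eq_square)
    also have "\<dots> = sqrt (t\<^sup>2) * sqrt (y / t)" by (rule real_sqrt_mult)
    also have "sqrt (t\<^sup>2) = t" using t by simp
    finally show ?thesis .
  qed
  also have "of_real (t * sqrt (y / t)) * S t = of_real t * (1 + theta0 z t)" using ThS[OF t] by (simp add: mult.assoc)
  finally show ?thesis .
qed

text \<open>The same series for complex t, so that it can be differentiated term by term.\<close>

definition theta0_hol :: "complex \<Rightarrow> complex \<Rightarrow> complex" where
  "theta0_hol z t = (\<Sum>\<^sub>\<infinity>p\<in>lat. exp (- t * of_real (pi / lat_height z p)))"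

lemma exp_sum_local_bound:
  assumes z: "z \<in> UHP" and c: "\<And>p. p \<in> lat \<Longrightarrow> norm (c p) \<le> C * lat_height z p powr (- real k)" and t: "t \<in> RHP" and C: "C \<ge> 0"
  shows "\<exists>U M. open U \<and> t \<in> U \<and> M summable_on lat \<and> (\<forall>p\<in>lat. \<forall>u\<in>U \<inter> RHP. norm (c p * exp (- u * of_real (pi / lat_height z p))) \<le> M p)"
proof -
  define e where "e = Re t / 2"
  have e: "e > 0" using t by (simp add: e_def RHP_def)
  \<comment> \<open>The power k compensates the growth of the coefficients, and the remaining square
    of \<open>lat_height\<close> is summable over the lattice.\<close>
  define N where "N = k + 2"
  define M where "M = (\<lambda>p. C * (fact N / (e * pi) ^ N) * lat_height z p powr 2)"
  have "open {u. Re u > e}" by (rule open_halfspace_Re_gt)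
  moreover have "t \<in> {u. Re u > e}" using e by (simp add: e_def)
  moreover have "M summable_on lat" unfolding M_def by (intro summable_on_cmult_right lat_height_power_summable z) simp
  moreover have "norm (c p * exp (- u * of_real (pi / lat_height z p))) \<le> M p" if p: "p \<in> lat" and u: "Re u > e" for p u
  proof -
    have r: "lat_height z p > 0" by (rule lat_height_pos[OF z p])
    have "norm (exp (- u * of_real (pi / lat_height z p))) = exp (- (Re u * (pi / lat_height z p)))" by simp
    also have "\<dots> \<le> exp (- (e * (pi / lat_height z p)))" using u r by (simp add: divide_right_mono)
    also have "\<dots> \<le> fact N / (e * pi) ^ N * lat_height z p powr (real N)" by (rule exp_lat_height_bound[OF z p e])
    finally have "norm (c p * exp (- u * of_real (pi / lat_height z p))) \<le> (C * lat_height z p powr (- real k)) * (fact N / (e * pi) ^ N * lat_height z p powr (real N))"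
      unfolding norm_mult using c[OF p] C by (intro mult_mono) auto
    also have "\<dots> = C * (fact N / (e * pi) ^ N) * (lat_height z p powr (- real k) * lat_height z p powr (real N))" by simp
    also have "lat_height z p powr (- real k) * lat_height z p powr (real N) = lat_height z p powr 2"
      unfolding powr_add[symmetric] by (simp add: N_def)
    finally show ?thesis by (simp add: M_def)
  qed
  ultimately show ?thesis by (intro exI[of _ "{u. Re u > e}"] exI[of _ M]) auto
qed

text \<open>Differentiate the functional equation of \<open>theta0\<close> at its fixed point \<open>t = 1\<close>.\<close>
lemma LS0_psi0:
  assumes z: "z \<in> UHP"
  shows "LS0 \<psi>0 z (cnj z) = 1 / pi"
proof -
  have w: "cnj z \<in> LHP" using z by simp
  have hol: "(\<lambda>t. exp (- t * of_real (pi / lat_height z p))) holomorphic_on RHP" for p by (intro holomorphic_intros)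
  have bd: "\<exists>U M. open U \<and> t \<in> U \<and> M summable_on lat \<and> (\<forall>p\<in>lat. \<forall>u\<in>U \<inter> RHP. norm (exp (- u * of_real (pi / lat_height z p))) \<le> M p)" if "t \<in> RHP" for t
  proof -
    have "norm (1::complex) \<le> 1 * lat_height z p powr (- real 0)" if "p \<in> lat" for p
      using lat_height_pos[OF z that] by simp
    from exp_sum_local_bound[where c = "\<lambda>_. 1", OF z this \<open>t \<in> RHP\<close>] show ?thesis by simp
  qed
  have GtTh: "theta0_hol z (of_real t) = theta0 z t" if "t > 0" for t
    unfolding theta0_hol_def theta0_def LS0_def polar_height_lat_height pi_over_of_real by simp
  have one: "1 \<in> RHP" by (simp add: RHP_def)
  have hG: "theta0_hol z holomorphic_on RHP" unfolding theta0_hol_def[abs_def] by (rule holomorphic_infsum_local(1)[OF hol open_RHP bd])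
  have s1: "((\<lambda>p. (deriv ^^ 1) (\<lambda>t. exp (- t * of_real (pi / lat_height z p))) 1) has_sum (deriv ^^ 1) (theta0_hol z) 1) lat"
    unfolding theta0_hol_def[abs_def] by (rule holomorphic_infsum_local(2)[OF hol open_RHP bd one])
  have "deriv (\<lambda>t::complex. exp (- t * of_real (pi / lat_height z p))) 1 = - of_real (pi / lat_height z p) * exp (- of_real (pi / lat_height z p))" for p
  proof -
    have "deriv (\<lambda>t. exp (- t * c)) 1 = - c * exp (- c)" for c :: complex
      by (rule DERIV_imp_deriv) (auto intro!: derivative_eq_intros)
    thus ?thesis .
  qed
  with s1 have s1: "((\<lambda>p. - of_real (pi / lat_height z p) * exp (- of_real (pi / lat_height z p))) has_sum deriv (theta0_hol z) 1) lat" by simp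
  have dG: "(theta0_hol z has_field_derivative deriv (theta0_hol z) 1) (at 1)" by (rule holomorphic_derivI[OF hG open_RHP one])
  have "((\<lambda>u. 1 + theta0_hol z (1 / u)) has_field_derivative 0 + deriv (theta0_hol z) 1 * (- 1)) (at (of_real 1))"
    by (rule DERIV_add[OF DERIV_const], rule DERIV_chain2[where g = "\<lambda>u. 1 / u"]) (use dG in \<open>auto intro!: derivative_eq_intros\<close>)
  from has_vector_derivative_real_field[OF this]
  have d1: "((\<lambda>x. 1 + theta0_hol z (1 / of_real x)) has_vector_derivative 0 + deriv (theta0_hol z) 1 * (- 1)) (at 1)" .
  have "((\<lambda>u. u * (1 + theta0_hol z u)) has_field_derivative 1 * (1 + theta0_hol z 1) + (0 + deriv (theta0_hol z) 1) * 1) (at (of_real 1))"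
    using DERIV_mult[OF DERIV_ident DERIV_add[OF DERIV_const dG], of 1] by simp
  from has_vector_derivative_real_field[OF this]
  have d2: "((\<lambda>x. of_real x * (1 + theta0_hol z (of_real x))) has_vector_derivative 1 * (1 + theta0_hol z 1) + (0 + deriv (theta0_hol z) 1) * 1) (at 1)" .
  have "((\<lambda>x. of_real x * (1 + theta0_hol z (of_real x))) has_vector_derivative 0 + deriv (theta0_hol z) 1 * (- 1)) (at 1)"
  proof (rule has_vector_derivative_transform_within_open[OF d1])
    show "open {0::real<..}" by simp
    fix x :: real assume "x \<in> {0<..}"
    hence x: "x > 0" by simp
    have "1 + theta0_hol z (of_real (1 / x)) = of_real x * (1 + theta0_hol z (of_real x))"
      using theta0_functional[OF z x] GtTh[of x] GtTh[of "1 / x"] x by simp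
    thus "1 + theta0_hol z (1 / of_real x) = of_real x * (1 + theta0_hol z (of_real x))" by simp
  qed simp
  from vector_derivative_unique_at[OF this d2]
  \<comment> \<open>The derivatives at 1 of 1 + \<theta>(1/t) and of t (1 + \<theta>(t)) are
    -\<theta>' and 1 + \<theta> + \<theta>'.\<close>
  have key: "1 + theta0_hol z 1 + 2 * deriv (theta0_hol z) 1 = 0" by (simp add: algebra_simps add_eq_0_iff)
  have s0: "((\<lambda>p. exp (- of_real (pi / lat_height z p))) has_sum theta0_hol z 1) lat"
    using holomorphic_infsum_local(2)[where m = 0, OF hol open_RHP bd one] by (simp add: theta0_hol_def)
  \<comment> \<open>With q = pi / \<open>lat_height\<close>, \<psi>0 is -1/pi times exp(-q) - 2 q
    exp(-q), so its sum is -1/pi times the combination \<theta> + 2 \<theta>' = -1.\<close>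
  have "((\<lambda>p. - (1 / of_real pi :: complex) * (exp (- of_real (pi / lat_height z p)) + 2 * (- of_real (pi / lat_height z p) * exp (- of_real (pi / lat_height z p))))) has_sum
      - (1 / of_real pi :: complex) * (theta0_hol z 1 + 2 * deriv (theta0_hol z) 1)) lat"
    by (intro has_sum_cmult_right has_sum_add s0 s1)
  moreover have "- (1 / of_real pi :: complex) * (exp (- of_real (pi / lat_height z p)) + 2 * (- of_real (pi / lat_height z p) * exp (- of_real (pi / lat_height z p)))) = \<psi>0 (polar_height p z (cnj z))" for p
    unfolding \<psi>0_def polar_height_lat_height pi_over_of_real by (simp add: algebra_simps)
  ultimately have "((\<lambda>p. \<psi>0 (polar_height p z (cnj z))) has_sum - (1 / of_real pi :: complex) * (theta0_hol z 1 + 2 * deriv (theta0_hol z) 1)) lat" by simp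
  moreover have "theta0_hol z 1 + 2 * deriv (theta0_hol z) 1 = -1" using key by (simp add: algebra_simps add_eq_0_iff)
  ultimately show ?thesis unfolding LS0_def by (simp add: infsumI)
qed

text \<open>The coefficients equal conj(mz+n)^2 / y^2. Up to the factor computed in
  \<open>LS2_exp_deriv\<close> this is the z-derivative of \<open>theta0\<close>.\<close>

definition \<theta>2 :: "complex \<Rightarrow> complex \<Rightarrow> complex" where
  "\<theta>2 z t = (\<Sum>\<^sub>\<infinity>p\<in>lat. (1 / (of_real (lat_height z p))\<^sup>2) * (1 / (lin p z)\<^sup>2) * exp (- t * of_real (pi / lat_height z p)))"

lemma LS2_exp_deriv:
  assumes z: "z \<in> UHP" and t: "t > 0"
  shows "LS2 (deriv (\<lambda>v. exp (- of_real t * pi_over v))) z (cnj z) = of_real (t * pi) * \<theta>2 z (of_real t)"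
proof -
  have "deriv (\<lambda>v. exp (- of_real t * pi_over v)) (polar_height p z (cnj z)) * (1 / (lin p z)\<^sup>2)
     = of_real (t * pi) * ((1 / (of_real (lat_height z p))\<^sup>2) * (1 / (lin p z)\<^sup>2) * exp (- of_real t * of_real (pi / lat_height z p)))" if p: "p \<in> lat" for p
  proof -
    define v where "v = polar_height p z (cnj z)"
    have v: "v \<in> RHP" unfolding v_def by (rule polar_height_RHP) (use z p in auto)
    have "((\<lambda>v. exp (- of_real t * pi_over v)) has_field_derivative exp (- of_real t * pi_over v) * (- of_real t * (- pi_over v / v))) (at v)"
      by (auto intro!: derivative_eq_intros pi_over_deriv v)
    hence "deriv (\<lambda>v. exp (- of_real t * pi_over v)) v = exp (- of_real t * pi_over v) * (- of_real t * (- pi_over v / v))"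
      by (rule DERIV_imp_deriv)
    also have "\<dots> = of_real (t * pi) * ((1 / v\<^sup>2) * exp (- of_real t * pi_over v))"
      by (simp add: pi_over_def power2_eq_square)
    finally show ?thesis unfolding v_def polar_height_lat_height pi_over_of_real by (simp add: mult_ac)
  qed
  thus ?thesis unfolding LS2_def \<theta>2_def by (subst infsum_cmult_right'[symmetric]) (rule infsum_cong)
qed

lemma LS2_deriv_eq_dz:
  assumes \<phi>: "flat \<phi>" and z: "z \<in> UHP"
  shows "dz (\<lambda>z. LS0 \<phi> z (cnj z)) z = 1 / (2 * \<i>) * LS2 (deriv \<phi>) z (cnj z)"
    and "(\<lambda>z. LS0 \<phi> z (cnj z)) differentiable (at z)"
    and "(\<lambda>p. deriv \<phi> (polar_height p z (cnj z)) * (1 / (lin p z)\<^sup>2)) summable_on lat"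
proof -
  have w: "cnj z \<in> LHP" using z by simp
  note W = has_wirtinger_imp[OF diagonal_wirtinger[OF LS_hol2(2)[OF \<phi>] refl z]]
  note S = LS_hol2(4)[OF \<phi> z w]
  have "dz (\<lambda>z. LS0 \<phi> z (cnj z)) z = D1 (LS0 \<phi>) z (cnj z)" by (rule W(2))
  also have "\<dots> = (\<Sum>\<^sub>\<infinity>p\<in>lat. 1 / (2 * \<i>) * (deriv \<phi> (polar_height p z (cnj z)) * (1 / (lin p z)\<^sup>2)))"
    by (rule infsumI[symmetric, OF S])
  finally show "dz (\<lambda>z. LS0 \<phi> z (cnj z)) z = 1 / (2 * \<i>) * LS2 (deriv \<phi>) z (cnj z)"
    unfolding LS2_def by (simp only: infsum_cmult_right')
  show "(\<lambda>z. LS0 \<phi> z (cnj z)) differentiable (at z)" by (rule W(1))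
  have "((\<lambda>p. 2 * \<i> * (1 / (2 * \<i>) * (deriv \<phi> (polar_height p z (cnj z)) * (1 / (lin p z)\<^sup>2)))) has_sum 2 * \<i> * D1 (LS0 \<phi>) z (cnj z)) lat"
    by (rule has_sum_cmult_right[OF S])
  thus "(\<lambda>p. deriv \<phi> (polar_height p z (cnj z)) * (1 / (lin p z)\<^sup>2)) summable_on lat" by (auto simp: summable_on_def)
qed

text \<open>The z-derivative of \<open>theta0_functional\<close>: the constants disappear and the
  factor t remains. The factors t pi and pi / t from \<open>LS2_exp_deriv\<close> supply the other
  two powers of t.\<close>

lemma theta2_functional:
  assumes z: "z \<in> UHP" and t: "t > 0"
  shows "\<theta>2 z (of_real (1 / t)) = of_real (t ^ 3) * \<theta>2 z (of_real t)"
proof -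
  have t': "1 / t > 0" using t by simp
  define f where "f s z = LS0 (\<lambda>v. exp (- of_real s * pi_over v)) z (cnj z)" for s z
  have fTh: "f s z = theta0 z s" for s z by (simp add: f_def theta0_def)
  note F = LS2_deriv_eq_dz[OF flat_exp[OF t] z, folded f_def]
  note F' = LS2_deriv_eq_dz[OF flat_exp[OF t'] z, folded f_def]
  have "has_wirtinger (\<lambda>z. of_real t * f t z + (of_real t - 1)) (of_real t * dz (f t) z + 0) (of_real t * dzb (f t) z + 0) z"
    by (intro has_wirtinger_add has_wirtinger_cmult differentiable_wirtinger has_wirtinger_field F(2)) simp
  hence "has_wirtinger (f (1 / t)) (of_real t * dz (f t) z + 0) (of_real t * dzb (f t) z + 0) z"
  proof (rule has_wirtinger_transform[OF _ open_UHP z])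
    fix z assume "z \<in> UHP"
    from theta0_functional[OF this t] show "of_real t * f t z + (of_real t - 1) = f (1 / t) z"
      unfolding fTh by (simp add: algebra_simps)
  qed
  from has_wirtinger_imp(2)[OF this] have "dz (f (1 / t)) z = of_real t * dz (f t) z" by simp
  hence "LS2 (deriv (\<lambda>v. exp (- of_real (1 / t) * pi_over v))) z (cnj z) = of_real t * LS2 (deriv (\<lambda>v. exp (- of_real t * pi_over v))) z (cnj z)"
    unfolding F(1) F'(1) by simp
  hence "of_real (1 / t * pi) * \<theta>2 z (of_real (1 / t)) = of_real t * (of_real (t * pi) * \<theta>2 z (of_real t))"
    unfolding LS2_exp_deriv[OF z t] LS2_exp_deriv[OF z t'] .
  thus ?thesis using t by (simp add: field_simps power3_eq_cube)
qed

lemma flat_psi0: "flat \<psi>0"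
proof -
  have "flat (taylor0 eis_flux 0)" by (rule taylor0_flat[OF unif_flat_eis_flux])
  hence h: "\<psi>0 holomorphic_on RHP" and b: "\<forall>\<kappa>>0. \<exists>C. \<forall>v\<in>RHP. \<kappa> * norm v \<le> Re v \<longrightarrow> norm (\<psi>0 v) \<le> C * (norm v)\<^sup>2"
    unfolding flat_def by (auto simp: taylor0_def eis_flux_0 cong: holomorphic_cong)
  thus ?thesis by (simp add: flat_def)
qed

text \<open>\<beta> is the derivative of \<psi>0, so this sum is a multiple of d/dz of the constant
  1 / pi. It disposes of the boundary terms left over from the split at t = 1.\<close>

lemma LS2_beta: 
  assumes z: "z \<in> UHP"
  shows "((\<lambda>p. \<beta> (polar_height p z (cnj z)) * (1 / (lin p z)\<^sup>2)) has_sum 0) lat"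
proof -
  note F = LS2_deriv_eq_dz[OF flat_psi0 z]
  have "has_wirtinger (\<lambda>z. 1 / pi) 0 0 z" by (intro has_wirtinger_field) simp
  hence "has_wirtinger (\<lambda>z. LS0 \<psi>0 z (cnj z)) 0 0 z"
    by (rule has_wirtinger_transform[OF _ open_UHP z]) (simp add: LS0_psi0)
  from has_wirtinger_imp(2)[OF this] F(1) have "LS2 (deriv \<psi>0) z (cnj z) = 0" by simp
  hence "((\<lambda>p. deriv \<psi>0 (polar_height p z (cnj z)) * (1 / (lin p z)\<^sup>2)) has_sum 0) lat"
    using has_sum_infsum[OF F(3)] by (simp add: LS2_def)
  moreover have "deriv \<psi>0 (polar_height p z (cnj z)) = \<beta> (polar_height p z (cnj z))" if "p \<in> lat" for p
    by (rule \<psi>0_deriv, rule polar_height_RHP) (use z that in auto)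
  ultimately show ?thesis by (subst has_sum_cong[where g = "\<lambda>p. deriv \<psi>0 (polar_height p z (cnj z)) * (1 / (lin p z)\<^sup>2)"]) auto
qed

section \<open>Analytic continuation of the Eisenstein series\<close>

lemma integrable_on_ray:
  fixes f :: "real \<Rightarrow> complex"
  assumes f: "continuous_on {1..} f" and g: "g integrable_on {1..}" and le: "\<And>t. t \<ge> 1 \<Longrightarrow> norm (f t) \<le> g t"
  shows "f integrable_on {1..}"
proof (rule measurable_bounded_by_integrable_imp_integrable[OF _ g])
  show "f \<in> borel_measurable (lebesgue_on {1..})" by (rule continuous_imp_measurable_on_sets_lebesgue[OF f]) simp
  show "norm (f t) \<le> g t" if "t \<in> {1..}" for t using that le by simp
qed simp

lemma integral_ray_limit:
  fixes f :: "real \<Rightarrow> complex"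
  assumes f: "continuous_on {1..} f" and g: "g integrable_on {1..}" and le: "\<And>t. t \<ge> 1 \<Longrightarrow> norm (f t) \<le> g t"
  shows "(\<lambda>N. integral {1..real N + 1} f) \<longlonglongrightarrow> integral {1..} f"
proof -
  have "(\<lambda>N. integral {1..} (\<lambda>t. if t \<in> {1..real N + 1} then f t else 0)) \<longlonglongrightarrow> integral {1..} f"
  proof (rule dominated_convergence(2)[OF _ g])
    fix N :: nat
    have "f integrable_on {1..real N + 1}"
      by (rule integrable_continuous_real) (rule continuous_on_subset[OF f], auto)
    thus "(\<lambda>t. if t \<in> {1..real N + 1} then f t else 0) integrable_on {1..}"
      by (subst integrable_restrict_Int) (simp add: Int_absorb2)
  next
    fix N :: nat and t :: real assume "t \<in> {1..}"
    thus "norm (if t \<in> {1..real N + 1} then f t else 0) \<le> g t"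
      using le[of t] order_trans[OF norm_ge_zero le[of t]] by simp
  next
    fix t :: real assume t: "t \<in> {1..}"
    have "\<forall>\<^sub>F N in sequentially. t \<le> real N" using filterlim_real_sequentially unfolding filterlim_at_top by blast
    hence "\<forall>\<^sub>F N in sequentially. (if t \<in> {1..real N + 1} then f t else 0) = f t"
      by eventually_elim (use t in auto)
    thus "(\<lambda>N. if t \<in> {1..real N + 1} then f t else 0) \<longlonglongrightarrow> f t" by (rule tendsto_eventually)
  qed
  moreover have "integral {1..} (\<lambda>t. if t \<in> {1..real N + 1} then f t else 0) = integral {1..real N + 1} f" for N
    by (subst integral_restrict_Int) (simp add: Int_absorb2)
  ultimately show ?thesis by simp
qed

text \<open>A majorant of product form M_i g(t) bounds the error of a finite partial sum by a tail
  of the sum of the M_i times the integral of g.\<close>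

lemma has_sum_integral_ray:
  fixes f :: "'i \<Rightarrow> real \<Rightarrow> complex"
  assumes f: "\<And>i. i \<in> I \<Longrightarrow> continuous_on {1..} (f i)" and g: "g integrable_on {1..}"
    and le: "\<And>i t. i \<in> I \<Longrightarrow> t \<ge> 1 \<Longrightarrow> norm (f i t) \<le> M i * g t" and M: "M summable_on I"
    and F: "continuous_on {1..} F" and s: "\<And>t. t \<ge> 1 \<Longrightarrow> ((\<lambda>i. f i t) has_sum F t) I"
  shows "((\<lambda>i. integral {1..} (f i)) has_sum integral {1..} F) I"
proof -
  define T where "T = infsum M I"
  have MT: "(M has_sum T) I" unfolding T_def by (rule has_sum_infsum[OF M])
  have d: "norm (F t - (\<Sum>i\<in>X. f i t)) \<le> (T - sum M X) * g t" if X: "finite X" "X \<subseteq> I" and t: "t \<ge> 1" for X t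
  proof (rule norm_infsum_le)
    show "((\<lambda>i. f i t) has_sum (F t - (\<Sum>i\<in>X. f i t))) (I - X)"
      by (rule has_sum_Diff[OF s[OF t] _ X(2)]) (rule has_sum_finite[OF X(1)])
    show "((\<lambda>i. M i * g t) has_sum (T - sum M X) * g t) (I - X)"
      by (rule has_sum_cmult_left, rule has_sum_Diff[OF MT _ X(2)]) (rule has_sum_finite[OF X(1)])
  qed (use le t in auto)
  have fi: "f i integrable_on {1..}" if "i \<in> I" for i
    by (rule integrable_on_ray[OF f[OF that] integrable_on_mult_right[OF g, of "M i"]]) (use le that in simp)
  have Fi: "F integrable_on {1..}"
    by (rule integrable_on_ray[OF F integrable_on_mult_right[OF g, of T]]) (use d[of "{}"] in simp)
  have "norm ((\<Sum>i\<in>X. integral {1..} (f i)) - integral {1..} F) \<le> (T - sum M X) * integral {1..} g"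
    if X: "finite X" "X \<subseteq> I" for X
  proof -
    have sX: "(\<lambda>t. \<Sum>i\<in>X. f i t) integrable_on {1..}" by (rule integrable_sum) (use X fi in auto)
    have "integral {1..} (\<lambda>t. \<Sum>i\<in>X. f i t) = (\<Sum>i\<in>X. integral {1..} (f i))"
      by (rule integral_sum) (use X fi in auto)
    hence "norm ((\<Sum>i\<in>X. integral {1..} (f i)) - integral {1..} F) = norm (integral {1..} (\<lambda>t. F t - (\<Sum>i\<in>X. f i t)))"
      using integral_diff[OF Fi sX] by (simp add: norm_minus_commute)
    also have "\<dots> \<le> integral {1..} (\<lambda>t. (T - sum M X) * g t)"
      by (rule integral_norm_bound_integral)
        (use integrable_diff[OF Fi sX] integrable_on_mult_right[OF g] d[OF X] in auto)
    finally show ?thesis by simp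
  qed
  hence b: "\<forall>\<^sub>F X in finite_subsets_at_top I. norm ((\<Sum>i\<in>X. integral {1..} (f i)) - integral {1..} F) \<le> (T - sum M X) * integral {1..} g"
    unfolding eventually_finite_subsets_at_top by (intro exI[of _ "{}"]) auto
  have "((\<lambda>X. (T - sum M X) * integral {1..} g) \<longlongrightarrow> (T - T) * integral {1..} g) (finite_subsets_at_top I)"
    using MT unfolding has_sum_def by (intro tendsto_mult tendsto_diff tendsto_const)
  hence "((\<lambda>X. (\<Sum>i\<in>X. integral {1..} (f i)) - integral {1..} F) \<longlongrightarrow> 0) (finite_subsets_at_top I)"
    by (intro Lim_null_comparison[OF b]) simp
  thus ?thesis unfolding has_sum_def by (simp add: LIM_zero_iff)
qed

lemma powr_integrable_ray: "e < -1 \<Longrightarrow> (\<lambda>t::real. t powr e) integrable_on {1..}"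
  using has_integral_powr_to_inf[of e 1] by (auto simp: integrable_on_def)

text \<open>A version with real exponent, valid down to x = 0: for x \<ge> 1 the exponent is rounded
  up, for x < 1 both factors on the right are at least 1.\<close>

lemma exp_minus_le_powr:
  assumes x: "x > 0" and k: "(k::real) \<ge> 0"
  shows "exp (- x) \<le> fact (nat \<lceil>k\<rceil>) * x powr (- k)"
proof (cases "x \<ge> 1")
  case True
  have "exp (- x) \<le> fact (nat \<lceil>k\<rceil>) / x ^ nat \<lceil>k\<rceil>" by (rule exp_minus_le[OF x])
  also have "\<dots> = fact (nat \<lceil>k\<rceil>) * x powr (- real (nat \<lceil>k\<rceil>))" using x by (simp add: powr_minus_divide powr_realpow)
  also have "\<dots> \<le> fact (nat \<lceil>k\<rceil>) * x powr (- k)" 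
  proof (rule mult_left_mono)
    have "- real (nat \<lceil>k\<rceil>) \<le> - k" by linarith
    thus "x powr (- real (nat \<lceil>k\<rceil>)) \<le> x powr (- k)" using True by (intro powr_mono) auto
  qed simp
  finally show ?thesis .
next
  case False
  have "exp (- x) \<le> 1 * 1" using x by simp
  also have "\<dots> \<le> fact (nat \<lceil>k\<rceil>) * x powr (- k)"
  proof (rule mult_mono)
    have "1 powr (-k) \<le> x powr (- k)" using False x k by (intro powr_mono2') auto
    thus "1 \<le> x powr (- k)" by simp
  qed auto
  finally show ?thesis .
qed

section \<open>Mellin integrals and the theta functional equation\<close>

text \<open>The transform of t^(s+1) exp(-Qt) under t = 1/u; the exponent s + 3 includes the u^(-2)
  of dt.\<close>

definition mellin_kernel_inv :: "complex \<Rightarrow> real \<Rightarrow> real \<Rightarrow> complex" where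
  "mellin_kernel_inv s Q u = exp (- (s + 3) * of_real (ln u)) * exp (- of_real (Q / u))"

lemma mellin_kernel_continuous_ray: "continuous_on {1..} (mellin_kernel a q)"
  unfolding mellin_kernel_def[abs_def] by (intro continuous_intros) auto

lemma mellin_kernel_inv_continuous: "continuous_on {1..} (mellin_kernel_inv s Q)"
  unfolding mellin_kernel_inv_def[abs_def] by (intro continuous_intros) auto

text \<open>The available decay Re s is shared equally: one half makes the integral in u converge,
  the other gives the exponent of Q that the sum over the lattice requires.\<close>

lemma norm_mellin_kernel_inv_le:
  assumes s: "Re s > 0" and Q: "Q > 0" and u: "u \<ge> 1"
  shows "norm (mellin_kernel_inv s Q u) \<le> (fact (nat \<lceil>2 + Re s / 2\<rceil>) * Q powr (- (2 + Re s / 2))) * u powr (-1 - Re s / 2)"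
proof -
  define k where "k = 2 + Re s / 2"
  have "norm (mellin_kernel_inv s Q u) = u powr (- (Re s + 3)) * exp (- (Q / u))"
    using u by (simp add: mellin_kernel_inv_def norm_mult powr_def)
  also have "\<dots> \<le> u powr (- (Re s + 3)) * (fact (nat \<lceil>k\<rceil>) * (Q / u) powr (- k))"
    by (intro mult_left_mono exp_minus_le_powr) (use s Q u in \<open>auto simp: k_def\<close>)
  also have "(Q / u) powr (- k) = Q powr (- k) * u powr k"
    using Q u by (simp add: powr_divide powr_minus_divide)
  also have "u powr (- (Re s + 3)) * (fact (nat \<lceil>k\<rceil>) * (Q powr (- k) * u powr k))
     = (fact (nat \<lceil>k\<rceil>) * Q powr (- k)) * (u powr (- (Re s + 3)) * u powr k)" by (simp only: mult_ac)
  also have "u powr (- (Re s + 3)) * u powr k = u powr (-1 - Re s / 2)"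
    unfolding powr_add[symmetric] by (simp add: k_def)
  finally show ?thesis unfolding k_def .
qed

lemma mellin_tail_eq_integral:
  assumes Q: "Q > 0"
  shows "mellin_tail a (of_real Q) = integral {1..} (mellin_kernel a (of_real Q))"
proof (rule LIMSEQ_unique)
  show "(\<lambda>N. integral {1..real N + 1} (mellin_kernel a (of_real Q))) \<longlonglongrightarrow> mellin_tail a (of_real Q)"
    by (rule mellin_tail_limit) (use Q in \<open>simp add: RHP_def\<close>)
  define N where "N = nat \<lceil>Re a + 2\<rceil>"
  have N: "Re a - real N \<le> -2" unfolding N_def by linarith
  show "(\<lambda>N. integral {1..real N + 1} (mellin_kernel a (of_real Q))) \<longlonglongrightarrow> integral {1..} (mellin_kernel a (of_real Q))"
  proof (rule integral_ray_limit[OF mellin_kernel_continuous_ray])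
    show "(\<lambda>t. fact N / Q ^ N * t powr (Re a - real N)) integrable_on {1..}"
      by (intro integrable_on_mult_right powr_integrable_ray) (use N in simp)
    show "norm (mellin_kernel a (of_real Q) t) \<le> fact N / Q ^ N * t powr (Re a - real N)" if "t \<ge> 1" for t
      by (rule norm_mellin_kernel_le[OF that]) (use Q in auto)
  qed
qed

text \<open>The part of the Gamma integral over \<open>{0..1}\<close> is moved to \<open>{1..}\<close> by \<open>t = 1/u\<close>.\<close>
lemma gamma_split:
  assumes s: "Re s > 0" and Q: "Q > 0"
  shows "Gamma (s + 2) = exp ((s + 2) * of_real (ln Q)) * (mellin_tail (s + 1) (of_real Q) + integral {1..} (mellin_kernel_inv s Q))"
proof -
  define \<phi> where "\<phi> x = exp ((s + 1) * of_real (ln x)) * exp (- complex_of_real x)" for x :: real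
  define c where "c = exp ((s + 2) * of_real (ln Q))"
  have phi: "of_real t powr (s + 2 - 1) / of_real (exp t) = \<phi> t" if "t \<in> {0<..}" for t
    using that by (simp add: \<phi>_def powr_def Ln_of_real exp_minus divide_inverse exp_of_real add.commute)
  have s2: "Re (s + 2) > 0" using s by simp
  have ai: "\<phi> absolutely_integrable_on {0<..}"
  proof (rule absolutely_integrable_spike[OF absolutely_integrable_Gamma_integral'[OF s2], of "{}"])
    show "\<phi> t = of_real t powr (s + 2 - 1) / of_real (exp t)" if "t \<in> {0<..} - {}" for t
      using phi[of t] that by simp
  qed simp
  have Gi: "integral {0<..} \<phi> = Gamma (s + 2)"
    by (rule integral_unique, rule has_integral_eq[OF phi Gamma_integral_complex'[OF s2]])
  have cont: "continuous_on {a..b} \<phi>" if "a > 0" for a b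
    unfolding \<phi>_def using that by (intro continuous_intros) auto
  \<comment> \<open>The truncation is symmetric about Q, so its halves become [1, N+1] under t = Q u
    and t = Q / u.\<close>
  define I where "I N = {Q / (real N + 1)..Q * (real N + 1)}" for N
  have I0: "I N \<subseteq> {0<..}" for N
  proof -
    have "Q / (real N + 1) > 0" using Q by simp
    thus ?thesis unfolding I_def by force
  qed
  have "(\<lambda>N. integral {0<..} (\<lambda>t. if t \<in> I N then \<phi> t else 0)) \<longlonglongrightarrow> integral {0<..} \<phi>"
  proof (rule dominated_convergence(2))
    show "(\<lambda>t. norm (\<phi> t)) integrable_on {0<..}" using ai by (simp add: absolutely_integrable_on_def)
    fix N :: nat
    have "\<phi> integrable_on I N" unfolding I_def by (intro integrable_continuous_real cont) (use Q in simp)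
    thus "(\<lambda>t. if t \<in> I N then \<phi> t else 0) integrable_on {0<..}"
      using I0[of N] by (subst integrable_restrict_Int) (simp add: Int_absorb2)
    show "norm (if t \<in> I N then \<phi> t else 0) \<le> norm (\<phi> t)" for t by simp
  next
    fix t :: real assume t: "t \<in> {0<..}"
    have "\<forall>\<^sub>F N in sequentially. max (t / Q) (Q / t) \<le> real N" using filterlim_real_sequentially unfolding filterlim_at_top by blast
    hence "\<forall>\<^sub>F N in sequentially. (if t \<in> I N then \<phi> t else 0) = \<phi> t"
    proof eventually_elim
      case (elim N)
      hence "t / Q \<le> real N + 1" "Q / t \<le> real N + 1" by auto
      hence "t \<in> I N" using t Q by (simp add: I_def field_simps)
      thus ?case by simp
    qed
    thus "(\<lambda>N. if t \<in> I N then \<phi> t else 0) \<longlonglongrightarrow> \<phi> t" by (rule tendsto_eventually)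
  qed
  moreover have "integral {0<..} (\<lambda>t. if t \<in> I N then \<phi> t else 0) = integral (I N) \<phi>" for N
    by (subst integral_restrict_Int) (use I0[of N] in \<open>simp add: Int_absorb2\<close>)
  ultimately have L1: "(\<lambda>N. integral (I N) \<phi>) \<longlonglongrightarrow> Gamma (s + 2)" by (simp add: Gi)
  have "integral (I N) \<phi> = c * (integral {1..real N + 1} (mellin_kernel (s + 1) (of_real Q)) + integral {1..real N + 1} (mellin_kernel_inv s Q))" for N
  proof -
    let ?n = "real N + 1"
    have n: "?n \<ge> 1" by simp
    have Qn: "Q / ?n \<le> Q" "Q \<le> Q * ?n" "Q / ?n > 0" using Q by (auto simp: field_simps)
    have lnQ: "c = exp (s * of_real (ln Q)) * of_real Q * of_real Q"
    proof -
      have "c = exp (s * of_real (ln Q) + of_real (ln Q) + of_real (ln Q))" by (simp add: c_def algebra_simps)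
      also have "\<dots> = exp (s * of_real (ln Q)) * of_real Q * of_real Q"
        unfolding exp_add exp_of_real using Q by simp
      finally show ?thesis .
    qed
    have phQ: "of_real Q * \<phi> (Q * t) = c * mellin_kernel (s + 1) (of_real Q) t" if t: "t \<ge> 1" for t
    proof -
      have "ln (Q * t) = ln Q + ln t" using Q t by (simp add: ln_mult)
      hence "of_real Q * \<phi> (Q * t) = of_real Q * exp ((s + 1) * of_real (ln Q)) * mellin_kernel (s + 1) (of_real Q) t"
        by (simp add: \<phi>_def mellin_kernel_def ring_distribs exp_add mult_ac)
      also have "of_real Q * exp ((s + 1) * of_real (ln Q)) = c"
        using Q by (simp add: lnQ ring_distribs exp_add exp_of_real mult_ac)
      finally show ?thesis .
    qed
    have phi2: "of_real (Q / u\<^sup>2) * \<phi> (Q / u) = c * mellin_kernel_inv s Q u" if u: "u \<ge> 1" for u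
    proof -
      have "ln (Q / u) = ln Q - ln u" using Q u by (simp add: ln_div)
      hence "\<phi> (Q / u) = exp ((s + 1) * of_real (ln Q) - (s + 1) * of_real (ln u)) * exp (- of_real (Q / u))"
        by (simp add: \<phi>_def right_diff_distrib)
      also have "\<dots> = exp ((s + 1) * of_real (ln Q)) * exp (- (s + 1) * of_real (ln u)) * exp (- of_real (Q / u))"
        by (simp only: diff_conv_add_uminus exp_add minus_mult_left)
      finally have "of_real (Q / u\<^sup>2) * \<phi> (Q / u) = (of_real Q * exp ((s + 1) * of_real (ln Q))) * ((1 / (of_real u)\<^sup>2) * exp (- (s + 1) * of_real (ln u))) * exp (- of_real (Q / u))"
        by simp
      also have "of_real Q * exp ((s + 1) * of_real (ln Q)) = c"
        using Q by (simp add: lnQ ring_distribs exp_add exp_of_real mult_ac)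
      also have "(1 / (of_real u)\<^sup>2) * exp (- (s + 1) * of_real (ln u)) = exp (- (s + 3) * of_real (ln u))"
      proof -
        have "exp (- (s + 3) * of_real (ln u)) = exp (- (s + 1) * of_real (ln u) + (- of_real (ln u) + - of_real (ln u)))"
          by (rule arg_cong[where f = exp]) (simp add: algebra_simps)
        also have "\<dots> = exp (- (s + 1) * of_real (ln u)) * (exp (- of_real (ln u)) * exp (- of_real (ln u)))"
          by (simp only: exp_add)
        also have "exp (- complex_of_real (ln u)) = 1 / of_real u"
          using u by (simp add: exp_minus exp_of_real divide_inverse)
        finally show ?thesis by (simp add: power2_eq_square)
      qed
      finally show ?thesis by (simp add: mellin_kernel_inv_def mult.assoc)
    qed
    have "((\<lambda>t. Q *\<^sub>R \<phi> (Q * t)) has_integral integral {Q * 1..Q * ?n} \<phi>) {1..?n}"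
    proof (rule has_integral_substitution[where c = Q and d = "Q * ?n"])
      show "continuous_on {Q..Q * ?n} \<phi>" by (rule cont[OF Q])
      show "(*) Q ` {1..?n} \<subseteq> {Q..Q * ?n}" using Q by (auto simp: mult_left_mono)
      show "((*) Q has_field_derivative Q) (at x within {1..?n})" for x by (auto intro!: derivative_eq_intros)
    qed (use Qn in auto)
    hence "((\<lambda>t. c * mellin_kernel (s + 1) (of_real Q) t) has_integral integral {Q..Q * ?n} \<phi>) {1..?n}"
      using phQ by (subst has_integral_cong[where g = "\<lambda>t. Q *\<^sub>R \<phi> (Q * t)"]) (auto simp: scaleR_conv_of_real)
    from integral_unique[OF this] have A: "integral {Q..Q * ?n} \<phi> = c * integral {1..?n} (mellin_kernel (s + 1) (of_real Q))"
      by simp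
    have sub: "((\<lambda>u. (- Q / u\<^sup>2) *\<^sub>R \<phi> (Q / u)) has_integral (integral {Q / 1..Q / ?n} \<phi> - integral {Q / ?n..Q / 1} \<phi>)) {1..?n}"
    proof (rule has_integral_substitution_general[where c = "Q / ?n" and d = Q and s = "{}"])
      show "continuous_on {Q / ?n..Q} \<phi>" by (rule cont[OF Qn(3)])
      show "(/) Q ` {1..?n} \<subseteq> {Q / ?n..Q}"
      proof
        fix y assume "y \<in> (/) Q ` {1..?n}"
        then obtain x where x: "1 \<le> x" "x \<le> ?n" "y = Q / x" by auto
        have "Q / ?n \<le> Q / x" "Q / x \<le> Q / 1" using x Q by (intro divide_left_mono; simp)+
        thus "y \<in> {Q / ?n..Q}" using x by simp
      qed
      show "continuous_on {1..?n} ((/) Q)" by (intro continuous_intros) auto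
      show "((/) Q has_field_derivative - Q / x\<^sup>2) (at x within {1..?n})" if "x \<in> {1..?n} - {}" for x
        using that by (auto intro!: derivative_eq_intros simp: power2_eq_square)
    qed auto
    \<comment> \<open>The substitution formula covers both orders of the end points; the reversed
      interval is empty, or a single point when N = 0.\<close>
    have "integral {Q / 1..Q / ?n} \<phi> = 0"
    proof (cases "N = 0")
      case False
      hence "Q / ?n < Q" using Q by (simp add: field_simps)
      thus ?thesis by simp
    qed simp
    with has_integral_neg[OF sub] have "((\<lambda>u. - ((- Q / u\<^sup>2) *\<^sub>R \<phi> (Q / u))) has_integral integral {Q / ?n..Q} \<phi>) {1..?n}"
      by (simp only: div_by_1 diff_0 minus_minus)
    moreover have "- ((- Q / u\<^sup>2) *\<^sub>R \<phi> (Q / u)) = c * mellin_kernel_inv s Q u" if "u \<in> {1..?n}" for u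
      using phi2[of u] that by (simp add: scaleR_conv_of_real)
    ultimately have "((\<lambda>u. c * mellin_kernel_inv s Q u) has_integral integral {Q / ?n..Q} \<phi>) {1..?n}"
      by (rule has_integral_eq[rotated])
    from integral_unique[OF this] have B: "integral {Q / ?n..Q} \<phi> = c * integral {1..?n} (mellin_kernel_inv s Q)"
      by simp
    have "integral (I N) \<phi> = integral {Q / ?n..Q} \<phi> + integral {Q..Q * ?n} \<phi>"
      unfolding I_def
      by (rule Henstock_Kurzweil_Integration.integral_combine[symmetric, OF Qn(1,2)])
        (intro integrable_continuous_real cont Qn)
    thus ?thesis unfolding A B by (simp add: distrib_left)
  qed
  hence "(\<lambda>N. c * (integral {1..real N + 1} (mellin_kernel (s + 1) (of_real Q)) + integral {1..real N + 1} (mellin_kernel_inv s Q))) \<longlonglongrightarrow> Gamma (s + 2)"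
    using L1 by simp
  moreover have "(\<lambda>N. c * (integral {1..real N + 1} (mellin_kernel (s + 1) (of_real Q)) + integral {1..real N + 1} (mellin_kernel_inv s Q)))
     \<longlonglongrightarrow> c * (mellin_tail (s + 1) (of_real Q) + integral {1..} (mellin_kernel_inv s Q))"
  proof (intro tendsto_intros mellin_tail_limit)
    show "of_real Q \<in> RHP" using Q by (simp add: RHP_def)
    show "(\<lambda>N. integral {1..real N + 1} (mellin_kernel_inv s Q)) \<longlonglongrightarrow> integral {1..} (mellin_kernel_inv s Q)"
      by (rule integral_ray_limit[OF mellin_kernel_inv_continuous _ norm_mellin_kernel_inv_le[OF s Q]])
        (intro integrable_on_mult_right powr_integrable_ray, use s in simp)
  qed
  ultimately show ?thesis unfolding c_def by (rule LIMSEQ_unique)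
qed

lemma inverse_lin_sq_norm: "z \<in> UHP \<Longrightarrow> p \<in> lat \<Longrightarrow> norm (1 / (lin p z)\<^sup>2) = lat_height z p / Im z"
  using lin_nonzero[of p z] by (auto simp: lat_height_def UHP_def norm_divide norm_power)

lemma theta2_coeff_norm:
  assumes "z \<in> UHP" "p \<in> lat"
  shows "norm ((1 / (of_real (lat_height z p))\<^sup>2) * (1 / (lin p z)\<^sup>2)) = 1 / Im z * lat_height z p powr (-1)"
proof -
  have "norm (1 / (complex_of_real (lat_height z p))\<^sup>2) = 1 / (lat_height z p * lat_height z p)"
    by (simp add: norm_divide norm_power flip: power2_eq_square)
  thus ?thesis unfolding norm_mult inverse_lin_sq_norm[OF assms]
    using lat_height_pos[OF assms] by (simp add: powr_minus_divide)
qed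

lemma theta2_bound:
  assumes z: "z \<in> UHP" and t: "t \<in> RHP"
  shows "\<exists>U M. open U \<and> t \<in> U \<and> M summable_on lat \<and>
    (\<forall>p\<in>lat. \<forall>u\<in>U \<inter> RHP. norm ((1 / (of_real (lat_height z p))\<^sup>2) * (1 / (lin p z)\<^sup>2) * exp (- u * of_real (pi / lat_height z p))) \<le> M p)"
  by (rule exp_sum_local_bound[OF z, where k = 1 and C = "1 / Im z"])
    (use theta2_coeff_norm[OF z] z t in \<open>auto simp: UHP_def\<close>)

lemma theta2_term_holomorphic: "(\<lambda>t. c * exp (- t * d)) holomorphic_on S"
  by (intro holomorphic_intros)

lemma theta2_continuous:
  assumes "z \<in> UHP"
  shows "continuous_on RHP (\<theta>2 z)"
  unfolding \<theta>2_def[abs_def]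
  by (rule holomorphic_on_imp_continuous_on, rule holomorphic_infsum_local(1)[OF theta2_term_holomorphic open_RHP theta2_bound[OF assms]])

lemma theta2_has_sum:
  assumes z: "z \<in> UHP" and t: "t > 0"
  shows "((\<lambda>p. (1 / (of_real (lat_height z p))\<^sup>2) * (1 / (lin p z)\<^sup>2) * exp (- of_real (t * (pi / lat_height z p)))) has_sum \<theta>2 z (of_real t)) lat"
proof -
  have "of_real t \<in> RHP" using t by (simp add: RHP_def)
  from holomorphic_infsum_local(2)[where m = 0, OF theta2_term_holomorphic open_RHP theta2_bound[OF z] this]
  show ?thesis by (simp add: \<theta>2_def)
qed

text \<open>Equality holds after summation over the lattice: both sums move inside their integrals,
  and the summed integrands \<open>F\<close> and \<open>G\<close> agree because \<theta>2(1/u) = u^3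
  \<theta>2(u).\<close>

lemma theta_mellin_swap:
  assumes z: "z \<in> UHP" and s: "Re s > 0"
  shows "((\<lambda>p. (1 / (of_real (lat_height z p))\<^sup>2) * (1 / (lin p z)\<^sup>2) * integral {1..} (mellin_kernel_inv s (pi / lat_height z p)))
    has_sum (\<Sum>\<^sub>\<infinity>p\<in>lat. (1 / (of_real (lat_height z p))\<^sup>2) * (1 / (lin p z)\<^sup>2) * mellin_tail (- s) (of_real (pi / lat_height z p)))) lat"
    and "(\<lambda>p. (1 / (of_real (lat_height z p))\<^sup>2) * (1 / (lin p z)\<^sup>2) * mellin_tail (- s) (of_real (pi / lat_height z p))) summable_on lat"
proof -
  define d where "d p = (1 / (of_real (lat_height z p))\<^sup>2) * (1 / (lin p z)\<^sup>2)" for p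
  define Q where "Q p = pi / lat_height z p" for p
  have y: "Im z > 0" using z by (simp add: UHP_def)
  have Q: "Q p > 0" if "p \<in> lat" for p using lat_height_pos[OF z that] by (simp add: Q_def)
  have dn: "norm (d p) = 1 / Im z * lat_height z p powr (-1)" if "p \<in> lat" for p unfolding d_def by (rule theta2_coeff_norm[OF z that])
  have th: "((\<lambda>p. d p * exp (- of_real (t * Q p))) has_sum \<theta>2 z (of_real t)) lat" if "t > 0" for t
    unfolding d_def Q_def by (rule theta2_has_sum[OF z that])
  \<comment> \<open>The share of Re s left to the lattice sum by
    \<open>norm_mellin_kernel_inv_le\<close>: the coefficients contribute the power -1 of
    \<open>lat_height\<close>, the kernel 2 + \<epsilon>.\<close>
  define \<epsilon> where "\<epsilon> = Re s / 2"
  have e: "\<epsilon> > 0" using s by (simp add: \<epsilon>_def)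
  define C where "C = fact (nat \<lceil>2 + \<epsilon>\<rceil>) * pi powr (- (2 + \<epsilon>)) / Im z"
  define F where "F u = exp (- (s + 3) * of_real (ln u)) * \<theta>2 z (of_real (1 / u))" for u :: real
  define G where "G u = exp (- s * of_real (ln u)) * \<theta>2 z (of_real u)" for u :: real
  have FG: "F u = G u" if u: "u \<in> {1..}" for u
  proof -
    have "F u = exp (- s * of_real (ln u) - (of_real (ln u) + of_real (ln u) + of_real (ln u))) * (of_real (u ^ 3) * \<theta>2 z (of_real u))"
      unfolding F_def using theta2_functional[OF z, of u] u by (simp add: algebra_simps)
    also have "exp (- s * of_real (ln u) - (of_real (ln u) + of_real (ln u) + of_real (ln u))) = exp (- s * of_real (ln u)) / of_real (u ^ 3)"
      unfolding exp_diff exp_add exp_of_real using u by (simp add: power3_eq_cube)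
    finally show ?thesis using u by (simp add: G_def)
  qed
  have cont\<theta>: "continuous_on {1..} (\<lambda>u. \<theta>2 z (of_real u))"
    by (rule continuous_on_compose2[OF theta2_continuous[OF z]]) (auto simp: RHP_def intro: continuous_on_of_real continuous_on_id)
  have cG: "continuous_on {1..} G" unfolding G_def[abs_def]
    by (rule continuous_on_mult[OF _ cont\<theta>]) (intro continuous_intros, auto)
  have cF: "continuous_on {1..} F" by (rule continuous_on_eq[OF cG]) (use FG in simp)
  have h1: "((\<lambda>p. integral {1..} (\<lambda>u. d p * mellin_kernel_inv s (Q p) u)) has_sum integral {1..} F) lat"
  proof (rule has_sum_integral_ray[OF _ _ _ _ cF])
    show "(\<lambda>u::real. u powr (-1 - \<epsilon>)) integrable_on {1..}" by (rule powr_integrable_ray) (use e in simp)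
    show "(\<lambda>p. C * lat_height z p powr (1 + \<epsilon>)) summable_on lat"
      by (intro summable_on_cmult_right lat_height_power_summable[OF z]) (use e in simp)
    show "continuous_on {1..} (\<lambda>u. d p * mellin_kernel_inv s (Q p) u)" for p
      by (rule continuous_on_mult_left[OF mellin_kernel_inv_continuous])
    show "norm (d p * mellin_kernel_inv s (Q p) u) \<le> C * lat_height z p powr (1 + \<epsilon>) * u powr (-1 - \<epsilon>)" if p: "p \<in> lat" and u: "u \<ge> 1" for p u
    proof -
      have r: "lat_height z p > 0" by (rule lat_height_pos[OF z p])
      have "norm (d p * mellin_kernel_inv s (Q p) u) \<le> (1 / Im z * lat_height z p powr (-1)) * ((fact (nat \<lceil>2 + \<epsilon>\<rceil>) * Q p powr (- (2 + \<epsilon>))) * u powr (-1 - \<epsilon>))"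
        unfolding norm_mult dn[OF p] \<epsilon>_def using y by (intro mult_left_mono norm_mellin_kernel_inv_le[OF s Q[OF p] u]) auto
      also have "Q p powr (- (2 + \<epsilon>)) = pi powr (- (2 + \<epsilon>)) * lat_height z p powr (2 + \<epsilon>)"
        using r unfolding Q_def powr_minus_divide by (simp add: powr_divide)
      also have "(1 / Im z * lat_height z p powr (-1)) * ((fact (nat \<lceil>2 + \<epsilon>\<rceil>) * (pi powr (- (2 + \<epsilon>)) * lat_height z p powr (2 + \<epsilon>))) * u powr (-1 - \<epsilon>))
         = C * (lat_height z p powr (-1) * lat_height z p powr (2 + \<epsilon>)) * u powr (-1 - \<epsilon>)" unfolding C_def by (simp add: mult_ac)
      also have "lat_height z p powr (-1) * lat_height z p powr (2 + \<epsilon>) = lat_height z p powr (1 + \<epsilon>)"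
        unfolding powr_add[symmetric] by (simp add: add.commute)
      finally show ?thesis .
    qed
    show "((\<lambda>p. d p * mellin_kernel_inv s (Q p) u) has_sum F u) lat" if u: "u \<ge> 1" for u
    proof -
      have "((\<lambda>p. exp (- (s + 3) * of_real (ln u)) * (d p * exp (- of_real (1 / u * Q p)))) has_sum F u) lat"
        unfolding F_def by (rule has_sum_cmult_right[OF th]) (use u in simp)
      thus ?thesis by (simp add: mellin_kernel_inv_def mult_ac)
    qed
  qed
  have h2: "((\<lambda>p. integral {1..} (\<lambda>u. d p * mellin_kernel (- s) (of_real (Q p)) u)) has_sum integral {1..} G) lat"
  proof (rule has_sum_integral_ray[OF _ _ _ _ cG])
    show "(\<lambda>u::real. u powr (- Re s - 3)) integrable_on {1..}" by (rule powr_integrable_ray) (use s in simp)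
    show "(\<lambda>p. (fact 3 / pi ^ 3 / Im z) * lat_height z p powr 2) summable_on lat"
      by (intro summable_on_cmult_right lat_height_power_summable[OF z]) simp
    show "continuous_on {1..} (\<lambda>u. d p * mellin_kernel (- s) (of_real (Q p)) u)" for p
      by (rule continuous_on_mult_left[OF mellin_kernel_continuous_ray])
    show "norm (d p * mellin_kernel (- s) (of_real (Q p)) u) \<le> (fact 3 / pi ^ 3 / Im z) * lat_height z p powr 2 * u powr (- Re s - 3)" if p: "p \<in> lat" and u: "u \<ge> 1" for p u
    proof -
      have r: "lat_height z p > 0" by (rule lat_height_pos[OF z p])
      have "norm (mellin_kernel (- s) (of_real (Q p)) u) \<le> fact 3 / Q p ^ 3 * u powr (- Re s - real 3)"
        by (rule norm_mellin_kernel_le[OF u]) (use Q[OF p] in auto)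
      hence "norm (d p * mellin_kernel (- s) (of_real (Q p)) u) \<le> (1 / Im z * lat_height z p powr (-1)) * (fact 3 / Q p ^ 3 * u powr (- Re s - 3))"
        unfolding norm_mult dn[OF p] using y by (intro mult_left_mono) auto
      also have "\<dots> = (fact 3 / pi ^ 3 / Im z) * lat_height z p powr 2 * u powr (- Re s - 3)"
        using r by (simp add: Q_def powr_minus_divide power_divide power3_eq_cube power2_eq_square mult_ac)
      finally show ?thesis .
    qed
    show "((\<lambda>p. d p * mellin_kernel (- s) (of_real (Q p)) u) has_sum G u) lat" if u: "u \<ge> 1" for u
    proof -
      have "((\<lambda>p. exp (- s * of_real (ln u)) * (d p * exp (- of_real (u * Q p)))) has_sum G u) lat"
        unfolding G_def by (rule has_sum_cmult_right[OF th]) (use u in simp)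
      thus ?thesis by (simp add: mellin_kernel_def mult_ac)
    qed
  qed
  have "integral {1..} F = integral {1..} G" by (rule integral_cong) (rule FG)
  with h1 have h1: "((\<lambda>p. d p * integral {1..} (mellin_kernel_inv s (Q p))) has_sum integral {1..} G) lat" by simp
  have "((\<lambda>p. d p * integral {1..} (mellin_kernel (- s) (of_real (Q p)))) has_sum integral {1..} G) lat" using h2 by simp
  hence h2: "((\<lambda>p. d p * mellin_tail (- s) (of_real (Q p))) has_sum integral {1..} G) lat"
    by (subst has_sum_cong[where g = "\<lambda>p. d p * integral {1..} (mellin_kernel (- s) (of_real (Q p)))"]) (use mellin_tail_eq_integral[OF Q] in auto)
  thus "(\<lambda>p. (1 / (of_real (lat_height z p))\<^sup>2) * (1 / (lin p z)\<^sup>2) * mellin_tail (- s) (of_real (pi / lat_height z p))) summable_on lat"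
    unfolding d_def Q_def by (auto simp: summable_on_def)
  show "((\<lambda>p. (1 / (of_real (lat_height z p))\<^sup>2) * (1 / (lin p z)\<^sup>2) * integral {1..} (mellin_kernel_inv s (pi / lat_height z p)))
    has_sum (\<Sum>\<^sub>\<infinity>p\<in>lat. (1 / (of_real (lat_height z p))\<^sup>2) * (1 / (lin p z)\<^sup>2) * mellin_tail (- s) (of_real (pi / lat_height z p)))) lat"
    using h1 infsumI[OF h2] unfolding d_def Q_def by simp
qed

section \<open>The completed series, its continuation and its Taylor coefficients\<close>

definition eis_kernel_hat :: "complex \<Rightarrow> complex \<Rightarrow> complex" where
  "eis_kernel_hat s v = s * (s + 1) * eis_kernel s v"

text \<open>Locally uniform around an arbitrary s0, whereas \<open>unif_flat\<close> stays near 0.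
  The power N in the tail bound is adapted to |s0|.\<close>

lemma eis_kernel_hat_term_bound:
  assumes z: "z \<in> UHP"
  shows "\<exists>U M. open U \<and> s0 \<in> U \<and> M summable_on lat \<and> (\<forall>p\<in>lat. \<forall>s\<in>U \<inter> UNIV. norm (eis_kernel s (polar_height p z (cnj z)) * (1 / (lin p z)\<^sup>2)) \<le> M p)"
proof -
  define R where "R = norm s0 + 1"
  define N where "N = nat \<lceil>R + 4\<rceil>"
  have N: "real N \<ge> R + 4" unfolding N_def by linarith
  have R: "R \<ge> 1" by (simp add: R_def)
  obtain C where C: "C \<ge> 0" "\<And>a q. Re a \<le> real N - 3/2 \<Longrightarrow> q \<in> RHP \<Longrightarrow> norm (mellin_tail a q) \<le> C / Re q ^ N"
    using mellin_tail_bound[of N] by blast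
  define M where "M p = (2 * C / pi ^ N / Im z) * lat_height z p powr (real N - 1)" for p
  have "M summable_on lat" unfolding M_def
    by (intro summable_on_cmult_right lat_height_power_summable[OF z]) (use N R in simp)
  moreover have "norm (eis_kernel s (polar_height p z (cnj z)) * (1 / (lin p z)\<^sup>2)) \<le> M p" if p: "p \<in> lat" and s: "s \<in> ball s0 1" for p s
  proof -
    have r: "lat_height z p > 0" by (rule lat_height_pos[OF z p])
    have y: "Im z > 0" using z by (simp add: UHP_def)
    have "norm s \<le> norm s0 + dist s0 s" by (metis dist_norm norm_triangle_sub add.commute dist_commute)
    hence sR: "norm s \<le> R" using s by (simp add: R_def)
    have a: "Re (s + 1) \<le> real N - 3/2" "Re (- s) \<le> real N - 3/2"
      using sR abs_Re_le_cmod[of s] N by auto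
    have q: "of_real (pi / lat_height z p) \<in> RHP" using r by (simp add: RHP_def)
    have Kb: "norm (mellin_tail a (of_real (pi / lat_height z p))) \<le> C * lat_height z p ^ N / pi ^ N" if "Re a \<le> real N - 3/2" for a
      using C(2)[OF that q] by (simp add: power_divide)
    have "norm (mellin_tail (s + 1) (of_real (pi / lat_height z p)) + mellin_tail (- s) (of_real (pi / lat_height z p))) \<le> 2 * (C * lat_height z p ^ N / pi ^ N)"
      using norm_triangle_ineq[of "mellin_tail (s + 1) (of_real (pi / lat_height z p))" "mellin_tail (- s) (of_real (pi / lat_height z p))"] Kb[OF a(1)] Kb[OF a(2)] by linarith
    hence "norm (eis_kernel s (polar_height p z (cnj z)) * (1 / (lin p z)\<^sup>2)) \<le> (1 / (lat_height z p)\<^sup>2 * (2 * (C * lat_height z p ^ N / pi ^ N))) * (lat_height z p / Im z)"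
      unfolding norm_mult inverse_lin_sq_norm[OF z p] eis_kernel_def polar_height_lat_height pi_over_of_real
      using r y by (intro mult_right_mono mult_mono) (auto simp: norm_divide norm_power)
    also have "\<dots> = M p"
    proof -
      have "lat_height z p powr (real N - 1) = lat_height z p ^ N / lat_height z p" using r by (simp add: powr_diff powr_realpow)
      thus ?thesis using r by (simp add: M_def power2_eq_square mult_ac)
    qed
    finally show ?thesis .
  qed
  ultimately show ?thesis by (intro exI[of _ "ball s0 1"] exI[of _ M]) auto
qed

text \<open>The Gamma factor is distributed over the lattice by \<open>gamma_split\<close> with Q =
  pi / \<open>lat_height\<close>; there pi^(-(s+1)) Q^(s+2) times the s-th power of
  \<open>lat_height\<close> collapses to pi over its square. After summation the inverted integrals
  are replaced by tails through \<open>theta_mellin_swap\<close>.\<close>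

lemma eis_hat_2:
  assumes z: "z \<in> UHP" and s: "Re s > 0"
  shows "eis_hat 2 z s = pi / 2 * (\<Sum>\<^sub>\<infinity>p\<in>lat. eis_kernel s (polar_height p z (cnj z)) * (1 / (lin p z)\<^sup>2))"
proof -
  have y: "Im z > 0" using z by (simp add: UHP_def)
  define d where "d p = (1 / (of_real (lat_height z p))\<^sup>2) * (1 / (lin p z)\<^sup>2)" for p
  define Q where "Q p = pi / lat_height z p" for p
  have Q: "Q p > 0" if "p \<in> lat" for p using lat_height_pos[OF z that] by (simp add: Q_def)
  have hhK: "eis_kernel s (polar_height p z (cnj z)) * (1 / (lin p z)\<^sup>2) = d p * mellin_tail (s + 1) (of_real (Q p)) + d p * mellin_tail (- s) (of_real (Q p))" for p
    unfolding eis_kernel_def polar_height_lat_height pi_over_of_real d_def Q_def by (simp add: ring_distribs mult_ac add_divide_distrib)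
  note sw = theta_mellin_swap[OF z s, folded d_def Q_def]
  have hs: "(\<lambda>p. eis_kernel s (polar_height p z (cnj z)) * (1 / (lin p z)\<^sup>2)) summable_on lat"
  proof -
    obtain M U where "M summable_on lat" "s \<in> U" "\<forall>p\<in>lat. \<forall>s\<in>U \<inter> UNIV. norm (eis_kernel s (polar_height p z (cnj z)) * (1 / (lin p z)\<^sup>2)) \<le> M p"
      using eis_kernel_hat_term_bound[OF z, of s] by blast
    hence "(\<lambda>p. norm (eis_kernel s (polar_height p z (cnj z)) * (1 / (lin p z)\<^sup>2))) summable_on lat"
      by (intro Infinite_Sum.abs_summable_on_comparison_test'[of M]) auto
    thus ?thesis by (rule abs_summable_summable)
  qed
  \<comment> \<open>The first tail is summable as the difference of the whole kernel and the second
    tail.\<close>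
  from summable_on_add[OF this summable_on_cmult_right[OF sw(2), of "-1"]] have K1: "(\<lambda>p. d p * mellin_tail (s + 1) (of_real (Q p))) summable_on lat"
    unfolding hhK by simp
  have eq: "(\<Sum>\<^sub>\<infinity>p\<in>lat. eis_kernel s (polar_height p z (cnj z)) * (1 / (lin p z)\<^sup>2)) = (\<Sum>\<^sub>\<infinity>p\<in>lat. d p * (mellin_tail (s + 1) (of_real (Q p)) + integral {1..} (mellin_kernel_inv s (Q p))))"
  proof -
    have "(\<Sum>\<^sub>\<infinity>p\<in>lat. eis_kernel s (polar_height p z (cnj z)) * (1 / (lin p z)\<^sup>2)) = (\<Sum>\<^sub>\<infinity>p\<in>lat. d p * mellin_tail (s + 1) (of_real (Q p))) + (\<Sum>\<^sub>\<infinity>p\<in>lat. d p * mellin_tail (- s) (of_real (Q p)))"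
      unfolding hhK by (rule infsum_add[OF K1 sw(2)])
    also have "\<dots> = (\<Sum>\<^sub>\<infinity>p\<in>lat. d p * mellin_tail (s + 1) (of_real (Q p))) + (\<Sum>\<^sub>\<infinity>p\<in>lat. d p * integral {1..} (mellin_kernel_inv s (Q p)))"
      using infsumI[OF sw(1)] by simp
    also have "\<dots> = (\<Sum>\<^sub>\<infinity>p\<in>lat. d p * (mellin_tail (s + 1) (of_real (Q p)) + integral {1..} (mellin_kernel_inv s (Q p))))"
      unfolding distrib_left by (rule infsum_add[symmetric, OF K1 has_sum_imp_summable[OF sw(1)]])
    finally show ?thesis .
  qed
  have "of_real pi powr (- (s + 1)) * Gamma (s + 2) * (of_real (Im z) powr s / ((lin p z)\<^sup>2 * of_real (norm (lin p z)) powr (2 * s)))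
      = pi * (d p * (mellin_tail (s + 1) (of_real (Q p)) + integral {1..} (mellin_kernel_inv s (Q p))))" if p: "p \<in> lat" for p
  proof -
    have r: "lat_height z p > 0" by (rule lat_height_pos[OF z p])
    have l0: "norm (lin p z) > 0" using lin_nonzero[of p z] p y by auto
    have lnr: "ln (lat_height z p) = ln (Im z) - 2 * ln (norm (lin p z))"
      using l0 y by (simp add: lat_height_def ln_div ln_realpow)
    have lnQ: "ln (Q p) = ln pi - ln (lat_height z p)" using r by (simp add: Q_def ln_div)
    have "of_real (Im z) powr s / of_real (norm (lin p z)) powr (2 * s) = exp (s * of_real (ln (lat_height z p)))"
      using y l0 unfolding lnr by (simp add: powr_def Ln_of_real exp_diff[symmetric] algebra_simps)
    then have e1: "of_real (Im z) powr s / ((lin p z)\<^sup>2 * of_real (norm (lin p z)) powr (2 * s)) = exp (s * of_real (ln (lat_height z p))) * (1 / (lin p z)\<^sup>2)"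
    proof -
      assume e: "of_real (Im z) powr s / of_real (norm (lin p z)) powr (2 * s) = exp (s * of_real (ln (lat_height z p)))"
      have "A / (L * W) = A / W * (1 / L)" for A L W :: complex by simp
      thus ?thesis by (simp only: e)
    qed
      have "of_real pi powr (- (s + 1)) = exp (- (s + 1) * of_real (ln pi))" by (simp add: powr_def Ln_of_real)
      hence "of_real pi powr (- (s + 1)) * exp ((s + 2) * of_real (ln (Q p))) * exp (s * of_real (ln (lat_height z p)))
         = exp (- (s + 1) * of_real (ln pi) + (s + 2) * of_real (ln (Q p)) + s * of_real (ln (lat_height z p)))"
        by (simp only: exp_add)
      also have "- (s + 1) * of_real (ln pi) + (s + 2) * of_real (ln (Q p)) + s * of_real (ln (lat_height z p)) = of_real (ln pi) - (of_real (ln (lat_height z p)) + of_real (ln (lat_height z p)))"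
        unfolding lnQ by (simp add: algebra_simps)
      also have "exp \<dots> = of_real pi * (1 / (of_real (lat_height z p))\<^sup>2)"
        unfolding exp_diff exp_add exp_of_real using r by (simp add: power2_eq_square)
    finally have e2: "of_real pi powr (- (s + 1)) * exp ((s + 2) * of_real (ln (Q p))) * exp (s * of_real (ln (lat_height z p))) = of_real pi * (1 / (of_real (lat_height z p))\<^sup>2)" .
    have "P * (X * W) * (E * Y) = (P * X * E) * W * Y" for P X W E Y :: complex by (simp only: mult_ac)
    thus ?thesis unfolding gamma_split[OF s Q[OF p]] e1 d_def by (simp only: e2) (simp only: mult_ac)
  qed
  note summand = this
  have "eis_hat 2 z s = of_real pi powr (- (s + 1)) * Gamma (s + 2) * (1 / 2 * (\<Sum>\<^sub>\<infinity>p\<in>lat. of_real (Im z) powr s / ((lin p z)\<^sup>2 * of_real (norm (lin p z)) powr (2 * s))))"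
    unfolding eis_hat_def eis_def lin_def by (simp add: case_prod_unfold add.assoc)
  also have "\<dots> = 1 / 2 * (\<Sum>\<^sub>\<infinity>p\<in>lat. of_real pi powr (- (s + 1)) * Gamma (s + 2) * (of_real (Im z) powr s / ((lin p z)\<^sup>2 * of_real (norm (lin p z)) powr (2 * s))))"
    unfolding infsum_cmult_right' by simp
  also have "\<dots> = 1 / 2 * (\<Sum>\<^sub>\<infinity>p\<in>lat. pi * (d p * (mellin_tail (s + 1) (of_real (Q p)) + integral {1..} (mellin_kernel_inv s (Q p)))))"
    by (rule arg_cong[where f = "\<lambda>x. 1 / 2 * x"], rule infsum_cong, rule summand)
  also have "\<dots> = 1 / 2 * (pi * (\<Sum>\<^sub>\<infinity>p\<in>lat. eis_kernel s (polar_height p z (cnj z)) * (1 / (lin p z)\<^sup>2)))"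
    unfolding infsum_cmult_right' eq ..
  finally show ?thesis by simp
qed

text \<open>The kernel sum is entire in s and has the right values for Re s > 0, and the identity
  theorem makes it the unique function meant by the description in \<open>eis_hh\<close>.\<close>

lemma eis_hh_2:
  assumes z: "z \<in> UHP"
  shows "eis_hh 2 z = (\<lambda>s. pi / 2 * (s * (s + 1) * (\<Sum>\<^sub>\<infinity>p\<in>lat. eis_kernel s (polar_height p z (cnj z)) * (1 / (lin p z)\<^sup>2))))"
proof -
  define H where "H s = pi / 2 * (s * (s + 1) * (\<Sum>\<^sub>\<infinity>p\<in>lat. eis_kernel s (polar_height p z (cnj z)) * (1 / (lin p z)\<^sup>2)))" for s
  have "(\<lambda>s. eis_kernel s (polar_height p z (cnj z)) * (1 / (lin p z)\<^sup>2)) holomorphic_on UNIV" if p: "p \<in> lat" for p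
  proof -
    have "polar_height p z (cnj z) \<in> RHP" by (rule polar_height_RHP) (use z p in auto)
    hence "(\<lambda>s. eis_kernel s (polar_height p z (cnj z))) holomorphic_on UNIV" using eis_kernel_hol2 by (auto simp: hol2_def)
    thus ?thesis by (rule holomorphic_on_mult[OF _ holomorphic_on_const])
  qed
  hence "(\<lambda>s. \<Sum>\<^sub>\<infinity>p\<in>lat. eis_kernel s (polar_height p z (cnj z)) * (1 / (lin p z)\<^sup>2)) holomorphic_on UNIV"
    by (rule holomorphic_infsum_local(1)[OF _ open_UNIV eis_kernel_hat_term_bound[OF z]])
  hence hol: "H holomorphic_on UNIV" unfolding H_def[abs_def] by (intro holomorphic_intros)
  have eq: "H s = eis_hh_conv 2 z s" if "Re (2 * s + of_int 2) > 2" for s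
  proof -
    have "Re s > 0" using that by simp
    thus ?thesis by (simp add: H_def eis_hh_conv_def eis_hat_2[OF z] mult_ac)
  qed
  have "eis_hh 2 z = H" unfolding eis_hh_def
  proof (rule the_equality)
    show "H holomorphic_on UNIV \<and> (\<forall>s. Re (2 * s + of_int 2) > 2 \<longrightarrow> H s = eis_hh_conv 2 z s)" using hol eq by blast
    fix F assume F: "F holomorphic_on UNIV \<and> (\<forall>s. Re (2 * s + of_int 2) > 2 \<longrightarrow> F s = eis_hh_conv 2 z s)"
    show "F = H"
    proof
      fix s
      show "F s = H s"
      proof (rule analytic_continuation_open[where s = "{s. Re s > 0}" and s' = UNIV and f = F and g = H and z = s])
        show "open {s. Re s > 0}" by (rule open_halfspace_Re_gt)
        have "1 \<in> {s. Re s > 0}" by simp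
        thus "{s. Re s > 0} \<noteq> {}" by blast
        show "\<And>x. x \<in> {s. Re s > 0} \<Longrightarrow> F x = H x" using F eq by simp
      qed (use F hol in auto)
    qed
  qed
  thus ?thesis unfolding H_def[abs_def] .
qed

lemma G2_eq: "G2 n = (\<lambda>z. pi / 2 * latform (taylor0 eis_kernel_hat n) z)"
proof
  fix z
  show "G2 n z = pi / 2 * latform (taylor0 eis_kernel_hat n) z"
  proof (cases "z \<in> UHP")
    case False
    thus ?thesis by (simp add: G2_def taylor_coeff_eis_def latform_def)
  next
    case z: True
    define f where "f p s = eis_kernel s (polar_height p z (cnj z)) * (1 / (lin p z)\<^sup>2)" for p s
    have b: "\<exists>U M. open U \<and> s0 \<in> U \<and> M summable_on lat \<and> (\<forall>p\<in>lat. \<forall>s\<in>U \<inter> UNIV. norm (f p s) \<le> M p)" for s0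
      unfolding f_def by (rule eis_kernel_hat_term_bound[OF z])
    have b2: "\<exists>U M. open U \<and> s0 \<in> U \<and> M summable_on lat \<and> (\<forall>p\<in>lat. \<forall>s\<in>U \<inter> UNIV. norm (s * (s + 1) * f p s) \<le> M p)" for s0
    proof -
      obtain U M where UM: "open U" "s0 \<in> U" "M summable_on lat" "\<And>p s. p \<in> lat \<Longrightarrow> s \<in> U \<Longrightarrow> norm (f p s) \<le> M p"
        using b[of s0] by blast
      define B where "B = (norm s0 + 1) * (norm s0 + 2)"
      have "norm (s * (s + 1) * f p s) \<le> B * M p" if "p \<in> lat" "s \<in> U \<inter> ball s0 1" for p s
      proof -
        have "norm s \<le> norm s0 + dist s0 s" by (metis dist_norm norm_triangle_sub add.commute dist_commute)
        hence "norm s \<le> norm s0 + 1" using that by simp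
        moreover from this have "norm (s + 1) \<le> norm s0 + 2" using norm_triangle_ineq[of s 1] by simp
        ultimately have "norm (s * (s + 1)) \<le> B" unfolding norm_mult B_def by (intro mult_mono) auto
        thus ?thesis unfolding norm_mult[of "s * (s + 1)"] using UM(4) that
          by (intro mult_mono) (auto simp: B_def)
      qed
      moreover have "(\<lambda>p. B * M p) summable_on lat" by (intro summable_on_cmult_right UM)
      ultimately show ?thesis
        by (intro exI[of _ "U \<inter> ball s0 1"] exI[of _ "\<lambda>p. B * M p"]) (use UM in auto)
    qed
    have hol: "(\<lambda>s. eis_kernel_hat s (polar_height p z (cnj z))) holomorphic_on UNIV" if p: "p \<in> lat" for p
    proof -
      have "polar_height p z (cnj z) \<in> RHP" by (rule polar_height_RHP) (use z p in auto)
      hence "(\<lambda>s. eis_kernel s (polar_height p z (cnj z))) holomorphic_on UNIV" using eis_kernel_hol2 by (auto simp: hol2_def)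
      thus ?thesis unfolding eis_kernel_hat_def by (intro holomorphic_intros)
    qed
    have fe: "s * (s + 1) * f p s = eis_kernel_hat s (polar_height p z (cnj z)) * (1 / (lin p z)\<^sup>2)" for p s
      by (simp add: f_def eis_kernel_hat_def)
    have "((\<lambda>p. (deriv ^^ n) (\<lambda>s. s * (s + 1) * f p s) 0) has_sum (deriv ^^ n) (\<lambda>s. \<Sum>\<^sub>\<infinity>p\<in>lat. s * (s + 1) * f p s) 0) lat"
    proof (rule holomorphic_infsum_local(2)[OF _ open_UNIV b2 UNIV_I])
      show "(\<lambda>s. s * (s + 1) * f p s) holomorphic_on UNIV" if "p \<in> lat" for p
        unfolding fe by (rule holomorphic_on_mult[OF hol[OF that] holomorphic_on_const])
    qed
    also have "(\<lambda>s. \<Sum>\<^sub>\<infinity>p\<in>lat. s * (s + 1) * f p s) = (\<lambda>s. s * (s + 1) * (\<Sum>\<^sub>\<infinity>p\<in>lat. f p s))"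
      by (rule ext) (rule infsum_cmult_right')
    finally have hs: "((\<lambda>p. (deriv ^^ n) (\<lambda>s. s * (s + 1) * f p s) 0) has_sum (deriv ^^ n) (\<lambda>s. s * (s + 1) * (\<Sum>\<^sub>\<infinity>p\<in>lat. f p s)) 0) lat" .
    have "(deriv ^^ n) (\<lambda>s. s * (s + 1) * f p s) 0 = fact n * (taylor0 eis_kernel_hat n (polar_height p z (cnj z)) * (1 / (lin p z)\<^sup>2))" if p: "p \<in> lat" for p
    proof -
      have "(deriv ^^ n) (\<lambda>s. s * (s + 1) * f p s) 0 = (deriv ^^ n) (\<lambda>s. (1 / (lin p z)\<^sup>2) * eis_kernel_hat s (polar_height p z (cnj z))) 0"
        unfolding fe by (simp only: mult.commute)
      also have "\<dots> = (1 / (lin p z)\<^sup>2) * (deriv ^^ n) (\<lambda>s. eis_kernel_hat s (polar_height p z (cnj z))) 0"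
        by (rule higher_deriv_cmult[OF hol[OF p] UNIV_I open_UNIV])
      finally show ?thesis by (simp add: taylor0_def)
    qed
    with hs have "((\<lambda>p. fact n * (taylor0 eis_kernel_hat n (polar_height p z (cnj z)) * (1 / (lin p z)\<^sup>2))) has_sum (deriv ^^ n) (\<lambda>s. s * (s + 1) * (\<Sum>\<^sub>\<infinity>p\<in>lat. f p s)) 0) lat"
      using has_sum_cong[of lat "\<lambda>p. (deriv ^^ n) (\<lambda>s. s * (s + 1) * f p s) 0" "\<lambda>p. fact n * (taylor0 eis_kernel_hat n (polar_height p z (cnj z)) * (1 / (lin p z)\<^sup>2))"] by blast
    from infsumI[OF this] have LS: "(deriv ^^ n) (\<lambda>s. s * (s + 1) * (\<Sum>\<^sub>\<infinity>p\<in>lat. f p s)) 0 = fact n * LS2 (taylor0 eis_kernel_hat n) z (cnj z)"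
      unfolding infsum_cmult_right' LS2_def by simp
    have "(\<lambda>s. \<Sum>\<^sub>\<infinity>p\<in>lat. f p s) holomorphic_on UNIV"
    proof (rule holomorphic_infsum_local(1)[OF _ open_UNIV b])
      fix p assume "p \<in> lat"
      hence "polar_height p z (cnj z) \<in> RHP" by (intro polar_height_RHP) (use z in auto)
      hence "(\<lambda>s. eis_kernel s (polar_height p z (cnj z))) holomorphic_on UNIV" using eis_kernel_hol2 by (auto simp: hol2_def)
      thus "f p holomorphic_on UNIV" unfolding f_def[abs_def] by (rule holomorphic_on_mult[OF _ holomorphic_on_const])
    qed
    hence holS: "(\<lambda>s. s * (s + 1) * (\<Sum>\<^sub>\<infinity>p\<in>lat. f p s)) holomorphic_on UNIV" by (intro holomorphic_intros)
    have "(deriv ^^ n) (eis_hh 2 z) 0 = pi / 2 * (fact n * LS2 (taylor0 eis_kernel_hat n) z (cnj z))"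
      unfolding eis_hh_2[OF z] f_def[symmetric] LS[symmetric]
      by (rule higher_deriv_cmult[OF holS UNIV_I open_UNIV])
    thus ?thesis using z by (simp add: G2_def taylor_coeff_eis_def latform_def)
  qed
qed

section \<open>The action of the Laplacian and the basis\<close>

lemma flat_cong: "(\<And>v. v \<in> RHP \<Longrightarrow> f v = g v) \<Longrightarrow> flat f \<Longrightarrow> flat g"
  unfolding flat_def using holomorphic_cong[of RHP RHP f g] by auto

lemma taylor0_cong: "(\<And>s. F s v = G s v) \<Longrightarrow> taylor0 F n v = taylor0 G n v"
  by (simp add: taylor0_def)

definition eis_flux_hat :: "complex \<Rightarrow> complex \<Rightarrow> complex" where
  "eis_flux_hat s v = s * (s + 1) * eis_flux s v"

lemma unif_flat_eis_kernel_hat: "unif_flat eis_kernel_hat"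
  unfolding eis_kernel_hat_def[abs_def] by (rule unif_flat_mult[OF unif_flat_eis_kernel]) (intro holomorphic_intros)

lemma unif_flat_eis_flux_hat: "unif_flat eis_flux_hat"
  unfolding eis_flux_hat_def[abs_def] by (rule unif_flat_mult[OF unif_flat_eis_flux]) (intro holomorphic_intros)

lemma D2_scale:
  assumes F: "hol2 UNIV RHP F" and v: "v \<in> RHP"
  shows "D2 (\<lambda>s v. g s * F s v) s v = g s * D2 F s v"
proof -
  have "(F s has_field_derivative D2 F s v) (at v)"
    by (rule hol2_derivs(2)[OF F open_UNIV open_RHP UNIV_I v])
  from DERIV_cmult[OF this, of "g s"] show ?thesis
    unfolding D2_def[of "\<lambda>s v. g s * F s v"] by (rule DERIV_imp_deriv)
qed

lemma taylor0_eis_kernel_hat_deriv: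
  assumes v: "v \<in> RHP"
  shows "v\<^sup>2 * deriv (taylor0 eis_kernel_hat n) v = taylor0 eis_flux_hat n v"
proof -
  have h: "hol2 UNIV RHP eis_kernel_hat" using unif_flat_eis_kernel_hat by (simp add: unif_flat_def)
  have "(\<lambda>s. D2 eis_kernel_hat s v) holomorphic_on UNIV"
    using hol2_D2[OF h open_UNIV open_RHP] v by (auto simp: hol2_def)
  from taylor0_cmult_right[where F = "D2 eis_kernel_hat" and v = v and c = "\<lambda>v. v\<^sup>2" and n = n, OF this] have "v\<^sup>2 * deriv (taylor0 eis_kernel_hat n) v = taylor0 (\<lambda>s v. v\<^sup>2 * D2 eis_kernel_hat s v) n v"
    unfolding taylor0_deriv[OF h v] by simp
  also have "\<dots> = taylor0 eis_flux_hat n v"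
  proof (rule taylor0_cong)
    fix s
    have "D2 eis_kernel_hat s v = s * (s + 1) * D2 eis_kernel s v" unfolding eis_kernel_hat_def[abs_def] by (rule D2_scale[OF eis_kernel_hol2 v])
    thus "v\<^sup>2 * D2 eis_kernel_hat s v = eis_flux_hat s v" using eis_kernel_D2[OF v, of s] by (simp add: eis_flux_hat_def mult_ac)
  qed
  finally show ?thesis .
qed

text \<open>These are Taylor coefficients of s (s + 1) times \<open>eis_kernel_hat\<close> +
  \<beta>. As \<beta> does not depend on s, it shows up only for n = 1 and n = 2. The truncated
  indices are harmless because the coefficient of index 0 vanishes.\<close>

lemma taylor0_eis_flux_hat_deriv:
  assumes v: "v \<in> RHP"
  shows "deriv (\<lambda>v. v\<^sup>2 * deriv (taylor0 eis_kernel_hat n) v) v = taylor0 eis_kernel_hat (n - 1) v + taylor0 eis_kernel_hat (n - 2) v + (if n = 1 \<or> n = 2 then 1 else 0) * \<beta> v"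
proof -
  have h: "hol2 UNIV RHP eis_flux_hat" using unif_flat_eis_flux_hat by (simp add: unif_flat_def)
  have H: "(\<lambda>s. eis_kernel_hat s v) holomorphic_on UNIV" using unif_flat_eis_kernel_hat v by (auto simp: unif_flat_def hol2_def)
  have "\<forall>\<^sub>F v in nhds v. v \<in> RHP" by (rule eventually_nhds_in_open[OF open_RHP v])
  hence "\<forall>\<^sub>F v in nhds v. v\<^sup>2 * deriv (taylor0 eis_kernel_hat n) v = taylor0 eis_flux_hat n v" by eventually_elim (rule taylor0_eis_kernel_hat_deriv)
  hence "deriv (\<lambda>v. v\<^sup>2 * deriv (taylor0 eis_kernel_hat n) v) v = deriv (taylor0 eis_flux_hat n) v" by (rule deriv_cong_ev) simp
  also have "\<dots> = taylor0 (D2 eis_flux_hat) n v" by (rule taylor0_deriv[OF h v])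
  also have "\<dots> = taylor0 (\<lambda>s v. s * (s + 1) * (eis_kernel_hat s v + \<beta> v)) n v"
  proof (rule taylor0_cong)
    fix s
    have "D2 eis_flux_hat s v = s * (s + 1) * D2 eis_flux s v" unfolding eis_flux_hat_def[abs_def] by (rule D2_scale[OF eis_flux_hol2 v])
    thus "D2 eis_flux_hat s v = s * (s + 1) * (eis_kernel_hat s v + \<beta> v)" by (simp only: eis_flux_D2[OF v] eis_kernel_hat_def)
  qed
  also have "\<dots> = (if n \<ge> 1 then taylor0 (\<lambda>s v. eis_kernel_hat s v + \<beta> v) (n - 1) v else 0) + (if n \<ge> 2 then taylor0 (\<lambda>s v. eis_kernel_hat s v + \<beta> v) (n - 2) v else 0)"
    by (rule taylor0_quadratic) (intro holomorphic_on_add H holomorphic_on_const)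
  also have "taylor0 (\<lambda>s v. eis_kernel_hat s v + \<beta> v) k v = taylor0 eis_kernel_hat k v + (if k = 0 then \<beta> v else 0)" for k
    using taylor0_add[where F = eis_kernel_hat and v = v and G = "\<lambda>s v. \<beta> v" and n = k, OF H holomorphic_on_const] by (simp add: taylor0_const)
  moreover have "taylor0 eis_kernel_hat 0 v = 0" by (simp add: taylor0_def eis_kernel_hat_def)
  ultimately show ?thesis by (cases "n = 0"; cases "n = 1"; cases "n = 2") auto
qed

lemma flat_taylor0_eis_kernel_hat: "flat (taylor0 eis_kernel_hat n)" by (rule taylor0_flat[OF unif_flat_eis_kernel_hat])

lemma flat_taylor0_eis_kernel_hat_deriv: "flat (\<lambda>v. v\<^sup>2 * deriv (taylor0 eis_kernel_hat n) v)"
  by (rule flat_cong[OF _ taylor0_flat[OF unif_flat_eis_flux_hat, of n]]) (simp add: taylor0_eis_kernel_hat_deriv)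

lemma base_forms_linear:
  assumes f: "f \<in> base_forms 2" and g: "g \<in> base_forms 2"
  shows "(\<lambda>z. a * f z + b * g z) \<in> base_forms 2"
proof -
  have "moderate_growth (\<lambda>z. a * f z + b * g z)"
  proof -
    obtain \<alpha> C Y where F: "\<And>x y. y \<ge> Y \<Longrightarrow> y > 0 \<Longrightarrow> norm (f (Complex x y)) \<le> C * y powr \<alpha>"
      using f unfolding base_forms_def moderate_growth_def by blast
    obtain \<alpha>' C' Y' where G: "\<And>x y. y \<ge> Y' \<Longrightarrow> y > 0 \<Longrightarrow> norm (g (Complex x y)) \<le> C' * y powr \<alpha>'"
      using g unfolding base_forms_def moderate_growth_def by blast
    define \<gamma> where "\<gamma> = max \<alpha> \<alpha>'"
    have "norm (a * f (Complex x y) + b * g (Complex x y)) \<le> (norm a * \<bar>C\<bar> + norm b * \<bar>C'\<bar>) * y powr \<gamma>"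
      if y: "y \<ge> max 1 (max Y Y')" for x y
    proof -
      have p: "y powr \<alpha> \<le> y powr \<gamma>" "y powr \<alpha>' \<le> y powr \<gamma>" using y by (auto simp: \<gamma>_def intro!: powr_mono)
      have "norm (f (Complex x y)) \<le> \<bar>C\<bar> * y powr \<gamma>"
        by (rule order_trans[OF F]) (use y p in \<open>auto intro!: mult_mono\<close>)
      moreover have "norm (g (Complex x y)) \<le> \<bar>C'\<bar> * y powr \<gamma>"
        by (rule order_trans[OF G]) (use y p in \<open>auto intro!: mult_mono\<close>)
      ultimately have "norm a * norm (f (Complex x y)) + norm b * norm (g (Complex x y)) \<le> norm a * (\<bar>C\<bar> * y powr \<gamma>) + norm b * (\<bar>C'\<bar> * y powr \<gamma>)"
        by (intro add_mono mult_left_mono) auto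
      thus ?thesis using norm_triangle_ineq[of "a * f (Complex x y)" "b * g (Complex x y)"]
        by (simp add: norm_mult distrib_right mult.assoc)
    qed
    thus ?thesis unfolding moderate_growth_def by blast
  qed
  moreover have "modular_weight 2 (\<lambda>z. a * f z + b * g z)"
    using f g unfolding base_forms_def modular_weight_def by (auto simp: algebra_simps)
  ultimately show ?thesis using f g smooth_const_mult_add[of f g a b] by (auto simp: base_forms_def)
qed

lemma G2_base: "G2 n \<in> base_forms 2"
  using base_forms_linear[OF latform_base[OF flat_taylor0_eis_kernel_hat[of n]] latform_base[OF flat_taylor0_eis_kernel_hat[of n]], of "pi / 2" 0]
  by (simp add: G2_eq)

lemma G2_0: "G2 0 = (\<lambda>z. 0)"
  by (simp add: G2_eq latform_def LS2_def taylor0_def eis_kernel_hat_def fun_eq_iff)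

text \<open>The truncated indices for \<open>n < 2\<close> do no harm, because \<open>G2 0\<close> vanishes.\<close>
lemma hyp_lap_G2:
  assumes z: "z \<in> UHP"
  shows "hyp_lap 2 (G2 n) z = G2 (n - 1) z + G2 (n - 2) z"
proof -
  let ?c = "if n = 1 \<or> n = 2 then 1 else (0::complex)"
  have w: "cnj z \<in> LHP" using z by simp
  have S: "((\<lambda>p. taylor0 eis_kernel_hat k (polar_height p z (cnj z)) * (1 / (lin p z)\<^sup>2)) has_sum LS2 (taylor0 eis_kernel_hat k) z (cnj z)) lat" for k
    by (rule LS_hol2(5)[OF flat_taylor0_eis_kernel_hat z w])
  have "((\<lambda>p. taylor0 eis_kernel_hat (n - 1) (polar_height p z (cnj z)) * (1 / (lin p z)\<^sup>2) + taylor0 eis_kernel_hat (n - 2) (polar_height p z (cnj z)) * (1 / (lin p z)\<^sup>2)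
      + ?c * (\<beta> (polar_height p z (cnj z)) * (1 / (lin p z)\<^sup>2))) has_sum LS2 (taylor0 eis_kernel_hat (n - 1)) z (cnj z) + LS2 (taylor0 eis_kernel_hat (n - 2)) z (cnj z) + ?c * 0) lat"
    by (intro has_sum_add has_sum_cmult_right S LS2_beta[OF z])
  from infsumI[OF this] have "(\<Sum>\<^sub>\<infinity>p\<in>lat. taylor0 eis_kernel_hat (n - 1) (polar_height p z (cnj z)) * (1 / (lin p z)\<^sup>2) + taylor0 eis_kernel_hat (n - 2) (polar_height p z (cnj z)) * (1 / (lin p z)\<^sup>2)
      + ?c * (\<beta> (polar_height p z (cnj z)) * (1 / (lin p z)\<^sup>2))) = LS2 (taylor0 eis_kernel_hat (n - 1)) z (cnj z) + LS2 (taylor0 eis_kernel_hat (n - 2)) z (cnj z)" by simp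
  moreover have "LS2 (deriv (\<lambda>v. v\<^sup>2 * deriv (taylor0 eis_kernel_hat n) v)) z (cnj z) = (\<Sum>\<^sub>\<infinity>p\<in>lat. taylor0 eis_kernel_hat (n - 1) (polar_height p z (cnj z)) * (1 / (lin p z)\<^sup>2) + taylor0 eis_kernel_hat (n - 2) (polar_height p z (cnj z)) * (1 / (lin p z)\<^sup>2)
      + ?c * (\<beta> (polar_height p z (cnj z)) * (1 / (lin p z)\<^sup>2)))"
    unfolding LS2_def
  proof (rule infsum_cong)
    fix p assume p: "p \<in> lat"
    have "polar_height p z (cnj z) \<in> RHP" by (rule polar_height_RHP) (use z p in auto)
    from taylor0_eis_flux_hat_deriv[OF this] show "deriv (\<lambda>v. v\<^sup>2 * deriv (taylor0 eis_kernel_hat n) v) (polar_height p z (cnj z)) * (1 / (lin p z)\<^sup>2) =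
      taylor0 eis_kernel_hat (n - 1) (polar_height p z (cnj z)) * (1 / (lin p z)\<^sup>2) + taylor0 eis_kernel_hat (n - 2) (polar_height p z (cnj z)) * (1 / (lin p z)\<^sup>2) + ?c * (\<beta> (polar_height p z (cnj z)) * (1 / (lin p z)\<^sup>2))"
      by (simp only: distrib_right mult.assoc)
  qed
  ultimately have "hyp_lap 2 (latform (taylor0 eis_kernel_hat n)) z = latform (taylor0 eis_kernel_hat (n - 1)) z + latform (taylor0 eis_kernel_hat (n - 2)) z"
    unfolding hyp_lap_latform[OF flat_taylor0_eis_kernel_hat flat_taylor0_eis_kernel_hat_deriv z] using z by (simp add: latform_def)
  moreover have sm: "smooth_UHP (latform (taylor0 eis_kernel_hat n))" by (rule latform_smooth[OF flat_taylor0_eis_kernel_hat])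
  have "hyp_lap 2 (G2 n) z = pi / 2 * hyp_lap 2 (latform (taylor0 eis_kernel_hat n)) z"
    using hyp_lap_linear[OF sm sm z, of "pi / 2" 0] by (simp add: G2_eq)
  ultimately show ?thesis by (simp add: G2_eq distrib_left)
qed

text \<open>The linear coefficient of s (s + 1) times the flux is the flux at 0, which is \<psi>0.
  The constant is pi/2 from \<open>G2_eq\<close> times i/2 from the lowering times the sum 1/pi of
  \<open>LS0_psi0\<close>.\<close>

lemma lowering_G2_1:
  assumes z: "z \<in> UHP"
  shows "lowering (G2 1) z = \<i> / 4"
proof -
  have "LS0 (\<lambda>v. v\<^sup>2 * deriv (taylor0 eis_kernel_hat 1) v) z (cnj z) = LS0 \<psi>0 z (cnj z)"
    unfolding LS0_def
  proof (rule infsum_cong)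
    fix p assume p: "p \<in> lat"
    define v where "v = polar_height p z (cnj z)"
    have v: "v \<in> RHP" unfolding v_def by (rule polar_height_RHP) (use z p in auto)
    have "(\<lambda>s. eis_flux s v) holomorphic_on UNIV" using eis_flux_hol2 v by (auto simp: hol2_def)
    from taylor0_quadratic[where F = eis_flux and v = v and n = 1, OF this] have "taylor0 eis_flux_hat 1 v = eis_flux 0 v" unfolding eis_flux_hat_def[abs_def] by (simp add: taylor0_def)
    thus "(polar_height p z (cnj z))\<^sup>2 * deriv (taylor0 eis_kernel_hat 1) (polar_height p z (cnj z)) = \<psi>0 (polar_height p z (cnj z))"
      unfolding v_def[symmetric] taylor0_eis_kernel_hat_deriv[OF v] by (simp add: eis_flux_0[OF v])
  qed
  hence "lowering (latform (taylor0 eis_kernel_hat 1)) z = \<i> / 2 * (1 / pi)"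
    unfolding lowering_latform[OF flat_taylor0_eis_kernel_hat z] LS0_psi0[OF z] by simp
  moreover have sm: "smooth_UHP (latform (taylor0 eis_kernel_hat 1))" by (rule latform_smooth[OF flat_taylor0_eis_kernel_hat])
  have "lowering (G2 1) z = pi / 2 * lowering (latform (taylor0 eis_kernel_hat 1)) z"
    using lowering_linear[OF sm sm z, of "pi / 2" 0] by (simp add: G2_eq)
  ultimately show ?thesis by simp
qed

section \<open>Iterated Laplacians and the induction on m\<close>

abbreviation Lap :: "nat \<Rightarrow> (complex \<Rightarrow> complex) \<Rightarrow> complex \<Rightarrow> complex" where
  "Lap m \<equiv> hyp_lap 2 ^^ m"

lemma Lap_smooth: "smooth_UHP f \<Longrightarrow> smooth_UHP (Lap m f)"
  by (induction m) (auto intro: smooth_hyp_lap)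

lemma Lap_cong: "(\<And>z. z \<in> UHP \<Longrightarrow> f z = g z) \<Longrightarrow> z \<in> UHP \<Longrightarrow> Lap m f z = Lap m g z"
proof (induction m arbitrary: z)
  case (Suc m)
  have "hyp_lap 2 (Lap m f) z = hyp_lap 2 (Lap m g) z" by (rule hyp_lap_cong) (use Suc in auto)
  thus ?case by simp
qed simp

lemma Lap_linear:
  assumes "smooth_UHP f" "smooth_UHP g" "z \<in> UHP"
  shows "Lap m (\<lambda>z. a * f z + b * g z) z = a * Lap m f z + b * Lap m g z"
  using assms(3)
proof (induction m arbitrary: z)
  case (Suc m)
  have "hyp_lap 2 (Lap m (\<lambda>z. a * f z + b * g z)) z = hyp_lap 2 (\<lambda>z. a * Lap m f z + b * Lap m g z) z"
    by (rule hyp_lap_cong[OF Suc.IH Suc.prems])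
  also have "\<dots> = a * hyp_lap 2 (Lap m f) z + b * hyp_lap 2 (Lap m g) z"
    by (rule hyp_lap_linear[OF Lap_smooth Lap_smooth]) (use assms Suc.prems in auto)
  finally show ?case by simp
qed simp

lemma base_forms_smooth: "f \<in> base_forms 2 \<Longrightarrow> smooth_UHP f"
  by (simp add: base_forms_def)

lemma Lap_Suc_G2:
  assumes "z \<in> UHP"
  shows "Lap (Suc m) (G2 n) z = Lap m (G2 (n - 1)) z + Lap m (G2 (n - 2)) z"
proof -
  have "Lap (Suc m) (G2 n) z = Lap m (\<lambda>z. 1 * G2 (n - 1) z + 1 * G2 (n - 2) z) z"
    unfolding funpow_Suc_right comp_def by (rule Lap_cong) (auto simp: hyp_lap_G2 assms)
  thus ?thesis unfolding Lap_linear[OF base_forms_smooth[OF G2_base] base_forms_smooth[OF G2_base] assms] by simp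
qed

text \<open>Each Laplacian lowers the index by at least one, and truncated subtraction ends at
  \<open>G2 0\<close>, which is zero.\<close>

lemma Lap_G2_vanish: "n \<le> m \<Longrightarrow> z \<in> UHP \<Longrightarrow> Lap m (G2 n) z = 0"
proof (induction m arbitrary: n)
  case (Suc m)
  thus ?case unfolding Lap_Suc_G2[OF Suc.prems(2)] by simp
qed (simp add: G2_0)

text \<open>Of the two terms in the recursion only the one of higher index survives; the other is
  killed by \<open>Lap_G2_vanish\<close>.\<close>

lemma Lap_G2_top: "z \<in> UHP \<Longrightarrow> Lap m (G2 (Suc m)) z = G2 1 z"
proof (induction m)
  case (Suc m)
  have "Lap (Suc m) (G2 (Suc (Suc m))) z = Lap m (G2 (Suc m)) z + Lap m (G2 m) z"
    using Lap_Suc_G2[OF Suc.prems, of m "Suc (Suc m)"] by (simp del: funpow.simps)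
  thus ?case using Suc Lap_G2_vanish[of m m z] by (simp del: funpow.simps)
qed simp

lemma lowering_zero_holomorphic:
  assumes h: "smooth_UHP h" and lowering: "\<And>z. z \<in> UHP \<Longrightarrow> lowering h z = 0"
  shows "h holomorphic_on UHP"
  unfolding holomorphic_iff_dzb[OF h] using lowering by (auto simp: lowering_def UHP_def)

text \<open>If \<open>Lap m f\<close> is holomorphic, it is a holomorphic weak form of weight 2 and
  hence zero, so the half-integral step adds nothing.\<close>

lemma V_int_eq_V_half: "V_int 2 m = V_half 2 m"
proof (intro Set.equalityI subsetI)
  fix f assume f: "f \<in> V_int 2 m"
  have "(\<lambda>z. 0) holomorphic_on UHP" by (rule holomorphic_on_const)
  hence "Lap m f holomorphic_on UHP" by (rule holomorphic_transform) (use f in \<open>simp add: V_int_def\<close>)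
  thus "f \<in> V_half 2 m" using f by (simp add: V_int_def V_half_def)
next
  fix f assume f: "f \<in> V_half 2 m"
  hence "weak_form (Lap m f)" "Lap m f holomorphic_on UHP"
    by (auto simp: V_half_def intro: weak_form_iterate weak_form_base)
  thus "f \<in> V_int 2 m" using f weak_form_holomorphic_zero by (simp add: V_int_def V_half_def)
qed

text \<open>Stated in the shape of \<open>fs.span_insert\<close>, so that the induction for the
  basis is immediate.\<close>

lemma V_int_Suc:
  "f \<in> V_int 2 (Suc m) \<longleftrightarrow> (\<exists>c. (\<lambda>z. f z - c * G2 (Suc m) z) \<in> V_int 2 m)"
proof
  assume f: "f \<in> V_int 2 (Suc m)"
  define h where "h = Lap m f"
  have fb: "f \<in> base_forms 2" using f by (simp add: V_int_def)
  have wh: "weak_form h" unfolding h_def by (intro weak_form_iterate weak_form_base fb)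
  obtain c where c: "\<And>z. z \<in> UHP \<Longrightarrow> lowering h z = c"
    using weak_form_harmonic_lowering_constant[OF wh] f by (auto simp: h_def V_int_def)
  \<comment> \<open>\<open>G2 1\<close> has the constant lowering i/4, so subtracting d times it
    from h leaves lowering 0.\<close>
  define d where "d = c / (\<i> / 4)"
  have sh: "smooth_UHP h" using wh by (simp add: weak_form_def)
  have sg: "smooth_UHP (G2 n)" for n by (rule base_forms_smooth[OF G2_base])
  define h' where "h' = (\<lambda>z. 1 * h z + (- d) * G2 1 z)"
  have d: "d * (\<i> / 4) = c" by (rule nonzero_eq_divide_eq[THEN iffD1, OF _ d_def]) simp
  have "lowering h' z = 0" if z: "z \<in> UHP" for z
    unfolding h'_def lowering_linear[OF sh sg z] lowering_G2_1[OF z] c[OF z] d[symmetric] by simp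
  hence "h' holomorphic_on UHP" unfolding h'_def by (intro lowering_zero_holomorphic smooth_const_mult_add sh sg) 
  moreover have "weak_form h'" unfolding h'_def by (intro weak_form_linear wh weak_form_base G2_base)
  ultimately have h0: "h' z = 0" if "z \<in> UHP" for z using weak_form_holomorphic_zero that by blast
  have "(\<lambda>z. 1 * f z + (- d) * G2 (Suc m) z) \<in> V_int 2 m"
  proof -
    have "Lap m (\<lambda>z. 1 * f z + (- d) * G2 (Suc m) z) z = 0" if z: "z \<in> UHP" for z
      unfolding Lap_linear[OF base_forms_smooth[OF fb] sg z] Lap_G2_top[OF z] using h0[OF z] by (simp add: h'_def h_def)
    thus ?thesis using base_forms_linear[OF fb G2_base, of 1 "- d"] by (simp add: V_int_def)
  qed
  thus "\<exists>c. (\<lambda>z. f z - c * G2 (Suc m) z) \<in> V_int 2 m" by (intro exI[of _ d]) simp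
next
  assume "\<exists>c. (\<lambda>z. f z - c * G2 (Suc m) z) \<in> V_int 2 m"
  then obtain c where c: "(\<lambda>z. f z - c * G2 (Suc m) z) \<in> V_int 2 m" by blast
  define g where "g = (\<lambda>z. f z - c * G2 (Suc m) z)"
  have g: "g \<in> base_forms 2" "\<And>z. z \<in> UHP \<Longrightarrow> Lap m g z = 0" using c by (auto simp: V_int_def g_def)
  have f: "f = (\<lambda>z. 1 * g z + c * G2 (Suc m) z)" by (simp add: g_def)
  have "hyp_lap 2 (Lap m g) z = 0" if z: "z \<in> UHP" for z
    using hyp_lap_cong[of "Lap m g" "\<lambda>z. 0 * g z + 0 * g z" z] g(2) z
      hyp_lap_linear[OF base_forms_smooth[OF g(1)] base_forms_smooth[OF g(1)] z, of 0 0] by simp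
  then have "Lap (Suc m) f z = 0" if z: "z \<in> UHP" for z
    unfolding f Lap_linear[OF base_forms_smooth[OF g(1)] base_forms_smooth[OF G2_base] z] Lap_G2_vanish[OF order_refl z]
    using z by simp
  moreover have "f \<in> base_forms 2" unfolding f by (rule base_forms_linear[OF g(1) G2_base])
  ultimately show "f \<in> V_int 2 (Suc m)" by (simp add: V_int_def)
qed

lemma V_int_0: "V_int 2 0 = {\<lambda>z. 0}"
proof -
  have "(\<lambda>z. 0) \<in> base_forms 2" using G2_base[of 0] by (simp add: G2_0)
  thus ?thesis by (auto simp: V_int_def base_forms_def fun_eq_iff)
qed

text \<open>Otherwise \<open>G2 1\<close> would vanish on the half-plane by
  \<open>Lap_G2_top\<close>, but its lowering is i/4.\<close>

lemma G2_not_in_V_int: "G2 (Suc m) \<notin> V_int 2 m"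
proof
  assume "G2 (Suc m) \<in> V_int 2 m"
  hence "\<And>z. z \<in> UHP \<Longrightarrow> G2 1 z = 0" using Lap_G2_top[of _ m] by (simp add: V_int_def)
  hence "G2 1 holomorphic_on UHP" by (intro holomorphic_transform[OF holomorphic_on_const[of 0]]) simp
  moreover have i: "\<i> \<in> UHP" by (simp add: UHP_def)
  ultimately have "lowering (G2 1) \<i> = 0"
    using holomorphic_iff_dzb[OF base_forms_smooth[OF G2_base[of 1]]] by (simp add: lowering_def)
  thus False using lowering_G2_1[OF i] by simp
qed

interpretation fs: vector_space fscale
  by unfold_locales (auto simp: fun_eq_iff algebra_simps)

text \<open>The cardinality belongs to the induction: independence of the image as a set would not
  exclude coinciding G_n, and the dimension is read off the cardinality.\<close>

lemma V_int_basis: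
  "fs.span (G2 ` {1..m}) = V_int 2 m \<and> fs.independent (G2 ` {1..m}) \<and> card (G2 ` {1..m}) = m"
proof (induction m)
  case 0
  show ?case using fs.independent_empty by (auto simp: V_int_0 zero_fun_def)
next
  case (Suc m)
  have ins: "G2 ` {1..Suc m} = insert (G2 (Suc m)) (G2 ` {1..m})" by (simp add: atLeastAtMostSuc_conv)
  have new: "G2 (Suc m) \<notin> fs.span (G2 ` {1..m})" using Suc G2_not_in_V_int by simp
  hence new': "G2 (Suc m) \<notin> G2 ` {1..m}" using fs.span_base by blast
  have "fs.span (G2 ` {1..Suc m}) = V_int 2 (Suc m)"
    unfolding ins fs.span_insert using Suc by (auto simp: V_int_Suc fun_diff_def)
  moreover have "fs.independent (G2 ` {1..Suc m})"
    unfolding ins using Suc new new' by (simp add: fs.independent_insert)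
  moreover have "card (G2 ` {1..Suc m}) = Suc m" unfolding ins using Suc new' by simp
  ultimately show ?case by blast
qed

theorem theorem1p2:
  shows "G2 0 = (\<lambda>z. 0) \<and>
    (\<forall>m::nat.
       V_int 2 m = V_half 2 m \<and>
       vector_space.dim fscale (V_int 2 m) = m \<and>
       (m \<ge> 1 \<longrightarrow>
          \<not> module.dependent fscale (G2 ` {1..m}) \<and>
          module.span fscale (G2 ` {1..m}) = V_int 2 m))"
proof (intro conjI allI impI)
  fix m
  have "fs.dim (fs.span (G2 ` {1..m})) = card (G2 ` {1..m})"
    using V_int_basis[of m] by (intro fs.dim_span_eq_card_independent) blast
  thus "fs.dim (V_int 2 m) = m" using V_int_basis[of m] by metis
  show "fs.independent (G2 ` {1..m})" "fs.span (G2 ` {1..m}) = V_int 2 m" using V_int_basis[of m] by blast+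
qed (rule G2_0 V_int_eq_V_half)+

end
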